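(* Let $m,n$ be coprime positive integers, $r>0$ and $C=\{x^m=y^n\}$. There is an isomorphism $$\mathrm{Spr}(b_1,\mathrm{Id},\mathrm{Id},\dots,Y)\cong\mathrm{CPHilb}^{r,y}(C).$$
   Context: $\mathbb K=\mathbb C((\epsilon))$, $\mathbb O=\mathbb C[[\epsilon]]$. $G=GL_n^{\times r}$ acts on $N=\mathbb C^n\oplus\mathfrak{gl}_n^{\oplus r}$ by $$(g_0,\dots,g_{r-1})\cdot(v,X_0,\dots,X_{r-1})=(g_0v,\,g_1X_0g_0^{-1},\dots,g_{r-1}X_{r-2}g_{r-2}^{-1},\,g_0X_{r-1}g_{r-1}^{-1}).$$ $\mathrm{Gr}_G=G_{\mathbb K}/G_{\mathbb O}=(GL_n(\mathbb K)/GL_n(\mathbb O))^{\times r}$. $b_1,\dots,b_n$ is the standard basis of $\mathbb O^n$, and $Y\in\mathfrak{gl}_n(\mathbb O)$ is given by $Yb_i=b_{i+1}$ for $i<n$, $Yb_n=\epsilon^mb_1$. With $r-1$ copies of $\mathrm{Id}$, $$\mathrm{Spr}(b_1,\mathrm{Id},\dots,\mathrm{Id},Y)=\{[g]\in\mathrm{Gr}_G:(g_0^{-1}b_1,\,g_1^{-1}g_0,\dots,g_{r-1}^{-1}g_{r-2},\,g_0^{-1}Yg_{r-1})\in N_{\mathbb O}=N\otimes\mathbb O\}.$$ $\mathcal O_C=\mathbb C[[x,y]]/(x^m-y^n)$, and $\mathrm{CPHilb}^{r,y}(C)$ is the moduli space of chains $\mathcal O_C\supseteq J^0\supseteq J^1\supseteq\cdots\supseteq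 J^{r-1}\supseteq J^r=yJ^0$ of ideals of finite codimension. *)

theory Defs
  imports "HOL-Algebra.Algebra" "HOL-Algebra.Algebraic_Closure_Type"
begin

text \<open>
  Moduli spaces over the complex numbers are given by their functors of points on commutative
  \<open>\<complex>\<close>-algebras. Test algebras have their carrier in an arbitrary type \<open>'u\<close>, which plays
  the role of a universe.
\<close>

section \<open>Test algebras and the Zariski topology\<close>

abbreviation complex_algebra :: "(complex, 'u) module \<Rightarrow> bool" where
  "complex_algebra R \<equiv> algebra (ring_of_type_algebra :: complex ring) R"

definition algebra_hom ::
    "(complex, 'u) module \<Rightarrow> (complex, 'u) module \<Rightarrow> ('u \<Rightarrow> 'u) set" where
  "algebra_hom R S = {\<phi> \<in> ring_hom R S.
     \<forall>c. \<forall>a\<in>carrier R. \<phi> (c \<odot>\<^bsub>R\<^esub> a) = c \<odot>\<^bsub>S\<^esub> \<phi> a}"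

text \<open>\<open>\<phi> : R \<rightarrow> S\<close> exhibits \<open>S\<close> as the localization of \<open>R\<close> at the powers of \<open>f\<close>.\<close>

definition is_localization ::
    "(complex, 'u) module \<Rightarrow> 'u \<Rightarrow> (complex, 'u) module \<Rightarrow> ('u \<Rightarrow> 'u) \<Rightarrow> bool" where
  "is_localization R f S \<phi> \<longleftrightarrow>
     complex_algebra S \<and> \<phi> \<in> algebra_hom R S \<and> f \<in> carrier R \<and> \<phi> f \<in> Units S \<and>
     (\<forall>s\<in>carrier S. \<exists>a\<in>carrier R. \<exists>k::nat. s \<otimes>\<^bsub>S\<^esub> (\<phi> f [^]\<^bsub>S\<^esub> k) = \<phi> a) \<and>
     (\<forall>a\<in>carrier R. \<phi> a = \<zero>\<^bsub>S\<^esub> \<longrightarrow> (\<exists>k::nat. (f [^]\<^bsub>R\<^esub> k) \<otimes>\<^bsub>R\<^esub> a = \<zero>\<^bsub>R\<^esub>))"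

text \<open>
  The property holds on every member of some cover of \<open>Spec R\<close> by principal open subsets.
  A localization of \<open>R\<close> never has larger cardinality than \<open>R\<close>, so it is available in the
  universe \<open>'u\<close> and the inner universal quantifier is not vacuous.
\<close>

definition zariski_locally ::
    "(complex, 'u) module \<Rightarrow> ((complex, 'u) module \<Rightarrow> ('u \<Rightarrow> 'u) \<Rightarrow> bool) \<Rightarrow> bool" where
  "zariski_locally R P \<longleftrightarrow>
     (\<exists>F. finite F \<and> F \<subseteq> carrier R \<and> Idl\<^bsub>R\<^esub> F = carrier R \<and>
        (\<forall>f\<in>F. \<forall>S \<phi>. is_localization R f S \<phi> \<longrightarrow> P S \<phi>))"

record ('u, 'x) points_functor =
  pts :: "(complex, 'u) module \<Rightarrow> 'x set"
  pts_map :: "(complex, 'u) module \<Rightarrow> (complex, 'u) module \<Rightarrow> ('u \<Rightarrow> 'u) \<Rightarrow> 'x \<Rightarrow> 'x"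

definition natural_transformation ::
    "('u, 'x) points_functor \<Rightarrow> ('u, 'y) points_functor \<Rightarrow>
     ((complex, 'u) module \<Rightarrow> 'x \<Rightarrow> 'y) \<Rightarrow> bool" where
  "natural_transformation F G \<Phi> \<longleftrightarrow>
     (\<forall>R. complex_algebra R \<longrightarrow> \<Phi> R \<in> pts F R \<rightarrow> pts G R) \<and>
     (\<forall>R S \<phi>. complex_algebra R \<and> complex_algebra S \<and> \<phi> \<in> algebra_hom R S \<longrightarrow>
        (\<forall>x\<in>pts F R. \<Phi> S (pts_map F R S \<phi> x) = pts_map G R S \<phi> (\<Phi> R x)))"

definition locally_injective ::
    "('u, 'x) points_functor \<Rightarrow> ((complex, 'u) module \<Rightarrow> 'x \<Rightarrow> 'y) \<Rightarrow> bool" where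
  "locally_injective F \<Phi> \<longleftrightarrow>
     (\<forall>R. complex_algebra R \<longrightarrow> (\<forall>x\<in>pts F R. \<forall>y\<in>pts F R. \<Phi> R x = \<Phi> R y \<longrightarrow>
        zariski_locally R (\<lambda>S \<phi>. pts_map F R S \<phi> x = pts_map F R S \<phi> y)))"

definition locally_surjective ::
    "('u, 'x) points_functor \<Rightarrow> ('u, 'y) points_functor \<Rightarrow>
     ((complex, 'u) module \<Rightarrow> 'x \<Rightarrow> 'y) \<Rightarrow> bool" where
  "locally_surjective F G \<Phi> \<longleftrightarrow>
     (\<forall>R. complex_algebra R \<longrightarrow> (\<forall>y\<in>pts G R.
        zariski_locally R (\<lambda>S \<phi>. pts_map G R S \<phi> y \<in> \<Phi> S ` pts F S)))"

text \<open>
  The space attached to a functor of points is its associated Zariski sheaf. A morphism of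
  presheaves induces an isomorphism of associated sheaves iff it is locally injective and locally
  surjective, and if \<open>G\<close> is a sheaf, then every isomorphism from the sheaf associated to \<open>F\<close>
  to \<open>G\<close> arises from such a morphism. On an algebra over which every principal cover contains a
  unit (such as \<open>\<complex>\<close> itself), the induced map on points is a bijection.
\<close>

definition isomorphic_spaces ::
    "('u, 'x) points_functor \<Rightarrow> ('u, 'y) points_functor \<Rightarrow> bool" where
  "isomorphic_spaces F G \<longleftrightarrow>
     (\<exists>\<Phi>. natural_transformation F G \<Phi> \<and> locally_injective F \<Phi> \<and> locally_surjective F G \<Phi>)"

section \<open>Laurent series and matrices\<close>

definition laurent_ring :: "('a, 'b) ring_scheme \<Rightarrow> (int \<Rightarrow> 'a) ring" where
  "laurent_ring R = \<lparr>
     carrier = {f. range f \<subseteq> carrier R \<and> (\<exists>N. \<forall>k<N. f k = \<zero>\<^bsub>R\<^esub>)},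
     monoid.mult = (\<lambda>f g k. \<Oplus>\<^bsub>R\<^esub>i\<in>{i. f i \<noteq> \<zero>\<^bsub>R\<^esub> \<and> g (k - i) \<noteq> \<zero>\<^bsub>R\<^esub>}. f i \<otimes>\<^bsub>R\<^esub> g (k - i)),
     one = (\<lambda>k. if k = 0 then \<one>\<^bsub>R\<^esub> else \<zero>\<^bsub>R\<^esub>),
     ring.zero = (\<lambda>k. \<zero>\<^bsub>R\<^esub>),
     add = (\<lambda>f g k. f k \<oplus>\<^bsub>R\<^esub> g k)\<rparr>"

definition integral_ring :: "('a, 'b) ring_scheme \<Rightarrow> (int \<Rightarrow> 'a) ring" where
  "integral_ring R = (laurent_ring R)
     \<lparr>carrier := {f \<in> carrier (laurent_ring R). \<forall>k<0. f k = \<zero>\<^bsub>R\<^esub>}\<rparr>"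

definition eps :: "('a, 'b) ring_scheme \<Rightarrow> int \<Rightarrow> 'a" where
  "eps R = (\<lambda>k. if k = 1 then \<one>\<^bsub>R\<^esub> else \<zero>\<^bsub>R\<^esub>)"

definition mat_monoid :: "nat \<Rightarrow> ('a, 'b) ring_scheme \<Rightarrow> (nat \<times> nat \<Rightarrow> 'a) monoid" where
  "mat_monoid n A = \<lparr>
     carrier = {1..n} \<times> {1..n} \<rightarrow>\<^sub>E carrier A,
     monoid.mult = (\<lambda>M L. \<lambda>(i, j)\<in>{1..n} \<times> {1..n}. \<Oplus>\<^bsub>A\<^esub>k\<in>{1..n}. M (i, k) \<otimes>\<^bsub>A\<^esub> L (k, j)),
     one = (\<lambda>(i, j)\<in>{1..n} \<times> {1..n}. if i = j then \<one>\<^bsub>A\<^esub> else \<zero>\<^bsub>A\<^esub>)\<rparr>"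

definition mat_vec :: "nat \<Rightarrow> ('a, 'b) ring_scheme \<Rightarrow> (nat \<times> nat \<Rightarrow> 'a) \<Rightarrow> (nat \<Rightarrow> 'a) \<Rightarrow> nat \<Rightarrow> 'a" where
  "mat_vec n A M v = (\<lambda>i\<in>{1..n}. \<Oplus>\<^bsub>A\<^esub>k\<in>{1..n}. M (i, k) \<otimes>\<^bsub>A\<^esub> v k)"

section \<open>The generalized affine Springer fibre\<close>

definition gauge_group :: "nat \<Rightarrow> nat \<Rightarrow> ('a, 'b) ring_scheme \<Rightarrow> (nat \<Rightarrow> nat \<times> nat \<Rightarrow> 'a) monoid" where
  "gauge_group n r A = product_group {..<r} (\<lambda>_. units_of (mat_monoid n A))"

definition rep_space ::
    "nat \<Rightarrow> nat \<Rightarrow> ('a, 'b) ring_scheme \<Rightarrow> ((nat \<Rightarrow> 'a) \<times> (nat \<Rightarrow> nat \<times> nat \<Rightarrow> 'a)) set" where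
  "rep_space n r A =
     ({1..n} \<rightarrow>\<^sub>E carrier A) \<times> ({..<r} \<rightarrow>\<^sub>E carrier (mat_monoid n A))"

definition rep_action ::
    "nat \<Rightarrow> nat \<Rightarrow> ('a, 'b) ring_scheme \<Rightarrow> (nat \<Rightarrow> nat \<times> nat \<Rightarrow> 'a) \<Rightarrow>
     (nat \<Rightarrow> 'a) \<times> (nat \<Rightarrow> nat \<times> nat \<Rightarrow> 'a) \<Rightarrow> (nat \<Rightarrow> 'a) \<times> (nat \<Rightarrow> nat \<times> nat \<Rightarrow> 'a)" where
  "rep_action n r A g = (\<lambda>(v, M).
     (mat_vec n A (g 0) v,
      \<lambda>i\<in>{..<r}. g (Suc i mod r) \<otimes>\<^bsub>mat_monoid n A\<^esub> M i
         \<otimes>\<^bsub>mat_monoid n A\<^esub> inv\<^bsub>mat_monoid n A\<^esub> (g i)))"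

definition basis_vec :: "nat \<Rightarrow> ('a, 'b) ring_scheme \<Rightarrow> nat \<Rightarrow> nat \<Rightarrow> 'a" where
  "basis_vec n A i = (\<lambda>k\<in>{1..n}. if k = i then \<one>\<^bsub>A\<^esub> else \<zero>\<^bsub>A\<^esub>)"

text \<open>Matrix entries are indexed by (row, column), so column \<open>i\<close> is the image of \<open>b\<^sub>i\<close>.\<close>

definition Y_matrix :: "nat \<Rightarrow> nat \<Rightarrow> ('a, 'b) ring_scheme \<Rightarrow> nat \<times> nat \<Rightarrow> int \<Rightarrow> 'a" where
  "Y_matrix m n R = (\<lambda>(j, i)\<in>{1..n} \<times> {1..n}.
     if i < n \<and> j = i + 1 then \<one>\<^bsub>laurent_ring R\<^esub>
     else if i = n \<and> j = 1 then eps R [^]\<^bsub>laurent_ring R\<^esub> m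
     else \<zero>\<^bsub>laurent_ring R\<^esub>)"

definition spr_vector ::
    "nat \<Rightarrow> nat \<Rightarrow> nat \<Rightarrow> ('a, 'b) ring_scheme \<Rightarrow>
     (nat \<Rightarrow> int \<Rightarrow> 'a) \<times> (nat \<Rightarrow> nat \<times> nat \<Rightarrow> int \<Rightarrow> 'a)" where
  "spr_vector m n r R =
     (basis_vec n (laurent_ring R) 1,
      \<lambda>i\<in>{..<r}. if i = r - 1 then Y_matrix m n R else \<one>\<^bsub>mat_monoid n (laurent_ring R)\<^esub>)"

definition gr_class ::
    "nat \<Rightarrow> nat \<Rightarrow> ('a, 'b) ring_scheme \<Rightarrow> (nat \<Rightarrow> nat \<times> nat \<Rightarrow> int \<Rightarrow> 'a) \<Rightarrow>
     (nat \<Rightarrow> nat \<times> nat \<Rightarrow> int \<Rightarrow> 'a) set" where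
  "gr_class n r R g =
     g <#\<^bsub>gauge_group n r (laurent_ring R)\<^esub> carrier (gauge_group n r (integral_ring R))"

definition spr_points ::
    "nat \<Rightarrow> nat \<Rightarrow> nat \<Rightarrow> ('a, 'b) ring_scheme \<Rightarrow> (nat \<Rightarrow> nat \<times> nat \<Rightarrow> int \<Rightarrow> 'a) set set" where
  "spr_points m n r R =
     {gr_class n r R g | g. g \<in> carrier (gauge_group n r (laurent_ring R)) \<and>
        rep_action n r (laurent_ring R)
          (inv\<^bsub>gauge_group n r (laurent_ring R)\<^esub> g) (spr_vector m n r R)
        \<in> rep_space n r (integral_ring R)}"

text \<open>All members of the union over representatives \<open>g\<close> of the class are equal.\<close>

definition gr_map ::
    "nat \<Rightarrow> nat \<Rightarrow> ('a, 'b) ring_scheme \<Rightarrow> ('a \<Rightarrow> 'a) \<Rightarrow>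
     (nat \<Rightarrow> nat \<times> nat \<Rightarrow> int \<Rightarrow> 'a) set \<Rightarrow> (nat \<Rightarrow> nat \<times> nat \<Rightarrow> int \<Rightarrow> 'a) set" where
  "gr_map n r S \<phi> c =
     (\<Union>g\<in>c. gr_class n r S (\<lambda>i\<in>{..<r}. \<lambda>p\<in>{1..n} \<times> {1..n}. \<phi> \<circ> g i p))"

definition Spr ::
    "nat \<Rightarrow> nat \<Rightarrow> nat \<Rightarrow> ('u, (nat \<Rightarrow> nat \<times> nat \<Rightarrow> int \<Rightarrow> 'u) set) points_functor" where
  "Spr m n r = \<lparr>pts = spr_points m n r, pts_map = (\<lambda>R S \<phi>. gr_map n r S \<phi>)\<rparr>"

section \<open>The parabolic flag Hilbert scheme\<close>

definition power_series2 :: "('a, 'b) ring_scheme \<Rightarrow> (nat \<times> nat \<Rightarrow> 'a) ring" where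
  "power_series2 R = \<lparr>
     carrier = {f. range f \<subseteq> carrier R},
     monoid.mult = (\<lambda>f g (a, b). \<Oplus>\<^bsub>R\<^esub>i\<in>{..a}. \<Oplus>\<^bsub>R\<^esub>j\<in>{..b}. f (i, j) \<otimes>\<^bsub>R\<^esub> g (a - i, b - j)),
     one = (\<lambda>p. if p = (0, 0) then \<one>\<^bsub>R\<^esub> else \<zero>\<^bsub>R\<^esub>),
     ring.zero = (\<lambda>p. \<zero>\<^bsub>R\<^esub>),
     add = (\<lambda>f g p. f p \<oplus>\<^bsub>R\<^esub> g p)\<rparr>"

definition var_x :: "('a, 'b) ring_scheme \<Rightarrow> nat \<times> nat \<Rightarrow> 'a" where
  "var_x R = (\<lambda>p. if p = (1, 0) then \<one>\<^bsub>R\<^esub> else \<zero>\<^bsub>R\<^esub>)"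

definition var_y :: "('a, 'b) ring_scheme \<Rightarrow> nat \<times> nat \<Rightarrow> 'a" where
  "var_y R = (\<lambda>p. if p = (0, 1) then \<one>\<^bsub>R\<^esub> else \<zero>\<^bsub>R\<^esub>)"

definition curve_ideal :: "nat \<Rightarrow> nat \<Rightarrow> ('a, 'b) ring_scheme \<Rightarrow> (nat \<times> nat \<Rightarrow> 'a) set" where
  "curve_ideal m n R = PIdl\<^bsub>power_series2 R\<^esub>
     (var_x R [^]\<^bsub>power_series2 R\<^esub> m \<ominus>\<^bsub>power_series2 R\<^esub> var_y R [^]\<^bsub>power_series2 R\<^esub> n)"

text \<open>
  For \<open>R = \<complex>\<close> this is \<open>O\<^sub>C\<close>; in general it is the completed base change of \<open>O\<^sub>C\<close> to \<open>R\<close>.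
\<close>

definition curve_ring :: "nat \<Rightarrow> nat \<Rightarrow> ('a, 'b) ring_scheme \<Rightarrow> (nat \<times> nat \<Rightarrow> 'a) set ring" where
  "curve_ring m n R = power_series2 R Quot curve_ideal m n R"

definition curve_class ::
    "nat \<Rightarrow> nat \<Rightarrow> ('a, 'b) ring_scheme \<Rightarrow> (nat \<times> nat \<Rightarrow> 'a) \<Rightarrow> (nat \<times> nat \<Rightarrow> 'a) set" where
  "curve_class m n R f = curve_ideal m n R +>\<^bsub>power_series2 R\<^esub> f"

definition const_series :: "('a, 'b) ring_scheme \<Rightarrow> 'a \<Rightarrow> nat \<times> nat \<Rightarrow> 'a" where
  "const_series R c = (\<lambda>p. if p = (0, 0) then c else \<zero>\<^bsub>R\<^esub>)"

definition curve_quotient_module ::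
    "nat \<Rightarrow> nat \<Rightarrow> ('a, 'b) ring_scheme \<Rightarrow> (nat \<times> nat \<Rightarrow> 'a) set set \<Rightarrow>
     ('a, (nat \<times> nat \<Rightarrow> 'a) set set) module" where
  "curve_quotient_module m n R J = (let Q = curve_ring m n R Quot J in \<lparr>
     carrier = carrier Q, monoid.mult = monoid.mult Q, one = one Q, ring.zero = ring.zero Q, add = add Q,
     module.smult = (\<lambda>c q. (J +>\<^bsub>curve_ring m n R\<^esub> curve_class m n R (const_series R c)) \<otimes>\<^bsub>Q\<^esub> q)\<rparr>)"

definition free_module :: "('a, 'b) ring_scheme \<Rightarrow> nat \<Rightarrow> ('a, nat \<Rightarrow> 'a) module" where
  "free_module R N = \<lparr>
     carrier = {..<N} \<rightarrow>\<^sub>E carrier R,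
     monoid.mult = (\<lambda>u v. \<lambda>i\<in>{..<N}. u i \<otimes>\<^bsub>R\<^esub> v i),
     one = (\<lambda>i\<in>{..<N}. \<one>\<^bsub>R\<^esub>),
     ring.zero = (\<lambda>i\<in>{..<N}. \<zero>\<^bsub>R\<^esub>),
     add = (\<lambda>u v. \<lambda>i\<in>{..<N}. u i \<oplus>\<^bsub>R\<^esub> v i),
     module.smult = (\<lambda>c v. \<lambda>i\<in>{..<N}. c \<otimes>\<^bsub>R\<^esub> v i)\<rparr>"

definition linear_maps ::
    "('a, 'b) ring_scheme \<Rightarrow> ('a, 'c, 'd) module_scheme \<Rightarrow> ('a, 'e, 'f) module_scheme \<Rightarrow> ('c \<Rightarrow> 'e) set" where
  "linear_maps R M L = {h \<in> carrier M \<rightarrow> carrier L.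
     (\<forall>u\<in>carrier M. \<forall>v\<in>carrier M. h (u \<oplus>\<^bsub>M\<^esub> v) = h u \<oplus>\<^bsub>L\<^esub> h v) \<and>
     (\<forall>c\<in>carrier R. \<forall>u\<in>carrier M. h (c \<odot>\<^bsub>M\<^esub> u) = c \<odot>\<^bsub>L\<^esub> h u)}"

text \<open>Finitely generated projective: a direct summand of a free module of finite rank.\<close>

definition finite_projective :: "('a, 'b) ring_scheme \<Rightarrow> ('a, 'c, 'd) module_scheme \<Rightarrow> bool" where
  "finite_projective R M \<longleftrightarrow> module R M \<and>
     (\<exists>N. \<exists>p\<in>linear_maps R (free_module R N) M. \<exists>s\<in>linear_maps R M (free_module R N).
        \<forall>q\<in>carrier M. p (s q) = q)"

text \<open>
  Families over \<open>R\<close> of ideals of finite codimension in \<open>O\<^sub>C\<close>: the quotient is locally free of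
  finite rank, and it is supported on the closed point, that is, a power of the maximal ideal of
  \<open>O\<^sub>C\<close> lies in the ideal. Over \<open>\<complex>\<close> the second condition follows from the first and the first
  one says that the codimension is finite.
\<close>

definition finite_codim_ideal ::
    "nat \<Rightarrow> nat \<Rightarrow> ('a, 'b) ring_scheme \<Rightarrow> (nat \<times> nat \<Rightarrow> 'a) set set \<Rightarrow> bool" where
  "finite_codim_ideal m n R J \<longleftrightarrow>
     ideal J (curve_ring m n R) \<and>
     finite_projective R (curve_quotient_module m n R J) \<and>
     (\<exists>k::nat. curve_class m n R (var_x R) [^]\<^bsub>curve_ring m n R\<^esub> k \<in> J \<and>
               curve_class m n R (var_y R) [^]\<^bsub>curve_ring m n R\<^esub> k \<in> J)"

text \<open>Here \<open><#\<close> is the multiplicative coset operation, so the last clause says \<open>J\<^sup>r = y J\<^sup>0\<close>.\<close>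

definition cphilb_points ::
    "nat \<Rightarrow> nat \<Rightarrow> nat \<Rightarrow> ('a, 'b) ring_scheme \<Rightarrow> (nat \<Rightarrow> (nat \<times> nat \<Rightarrow> 'a) set set) set" where
  "cphilb_points m n r R =
     {J \<in> extensional {..r}.
        (\<forall>i\<le>r. finite_codim_ideal m n R (J i)) \<and>
        (\<forall>i<r. J (Suc i) \<subseteq> J i) \<and>
        J r = curve_class m n R (var_y R) <#\<^bsub>curve_ring m n R\<^esub> J 0}"

definition curve_ring_map ::
    "nat \<Rightarrow> nat \<Rightarrow> ('a, 'b) ring_scheme \<Rightarrow> ('a \<Rightarrow> 'a) \<Rightarrow> (nat \<times> nat \<Rightarrow> 'a) set \<Rightarrow> (nat \<times> nat \<Rightarrow> 'a) set" where
  "curve_ring_map m n S \<phi> c = (\<Union>f\<in>c. curve_class m n S (\<phi> \<circ> f))"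

text \<open>Pulling back a family of ideals along \<open>\<phi>\<close> gives the ideals generated by their images.\<close>

definition cphilb_map ::
    "nat \<Rightarrow> nat \<Rightarrow> nat \<Rightarrow> ('a, 'b) ring_scheme \<Rightarrow> ('a \<Rightarrow> 'a) \<Rightarrow>
     (nat \<Rightarrow> (nat \<times> nat \<Rightarrow> 'a) set set) \<Rightarrow> nat \<Rightarrow> (nat \<times> nat \<Rightarrow> 'a) set set" where
  "cphilb_map m n r S \<phi> J =
     (\<lambda>i\<in>{..r}. Idl\<^bsub>curve_ring m n S\<^esub> (curve_ring_map m n S \<phi> ` J i))"

definition CPHilb ::
    "nat \<Rightarrow> nat \<Rightarrow> nat \<Rightarrow> ('u, nat \<Rightarrow> (nat \<times> nat \<Rightarrow> 'u) set set) points_functor" where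
  "CPHilb m n r = \<lparr>pts = cphilb_points m n r, pts_map = (\<lambda>R S \<phi>. cphilb_map m n r S \<phi>)\<rparr>"

end

theory Submission
  imports Defs
begin

text \<open>
  Replacing \<open>y\<^sup>n\<close> by \<open>x\<^sup>m\<close> identifies \<open>R[[x,y]]/(x\<^sup>m - y\<^sup>n)\<close> with the row vectors \<open>R[[\<epsilon>]]\<^sup>n\<close>, where
  \<open>x = \<epsilon>\<close> and \<open>y\<close> acts by right multiplication by \<open>Y\<close>; ideals become \<open>Y\<close>-stable sublattices. The class of
  \<open>g = (g\<^sub>0, \<dots>, g\<^bsub>r-1\<^esub>)\<close> is sent to the chain of the lattices \<open>{w. w g\<^sub>i integral}\<close>. The Springer
  conditions on \<open>Id\<close> and \<open>Y\<close> become the inclusions of the chain, and the one on \<open>b\<^sub>1\<close> puts the first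
  lattice inside \<open>R[[\<epsilon>]]\<^sup>n\<close>. The lattice determines \<open>g\<^sub>i\<close> up to \<open>GL\<^sub>n(R[[\<epsilon>]])\<close>, since the rows of
  \<open>g\<^sub>i\<^sup>-\<^sup>1\<close> form a basis of it. Conversely, let \<open>W\<close> be a lattice with projective quotient. Then \<open>\<epsilon>W\<close> has an
  \<open>R\<close>-linear complement in \<open>W\<close>, given by a projector \<open>E\<close> on finitely many coefficients. Near every prime
  of \<open>R\<close> some of the rows of \<open>E\<close> together with some of the rows of \<open>1 - E\<close> form an invertible
  matrix, so that the complement is free; its basis is a basis of \<open>W\<close> over \<open>R[[\<epsilon>]]\<close> by
  \<open>\<epsilon>\<close>-adic approximation. It has \<open>n\<close> elements, by comparing traces.
\<close>

section \<open>Finite sums and maximal ideals\<close>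

text \<open>A lattice with projective quotient is shown to have a basis only Zariski-locally, and a
  pivot becomes invertible only over a localization S of R. Since S[[\<epsilon>]] is in general
  larger than the localization of R[[\<epsilon>]], no basis is sought over R. Only finite data
  travel along R \<rightarrow> S: the matrix E, a choice of rows, and an inverse of the chosen rows
  up to a scalar. The conditions in \<open>split_lattice\<close> survive base change and still
  suffice for the \<epsilon>-adic approximation, which takes place over S.

  Projectivity of the quotient enters through an R-linear retraction P of R[[\<epsilon>]]^n onto W.
  With D the division by \<epsilon> that forgets the constant term, F = P - \<epsilon> P D P is
  idempotent, vanishes on \<epsilon>W and moves vectors of W only by elements of \<epsilon>W. As W
  contains \<epsilon>^k R[[\<epsilon>]]^n, F ignores multiples of \<epsilon>^(k+1), and E is its
  matrix on the remaining coefficients.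

  Pulled back ideals are generated by images, without completion; as W contains \<epsilon>^k
  R[[\<epsilon>]]^n, S-linear combinations of images and multiples of \<epsilon>^(k+1)
  suffice.\<close>

context abelian_monoid
begin

lemma finsum_swap:
  assumes "finite A" "finite B" "\<And>i j. i \<in> A \<Longrightarrow> j \<in> B \<Longrightarrow> f i j \<in> carrier G"
  shows "(\<Oplus>i\<in>A. \<Oplus>j\<in>B. f i j) = (\<Oplus>j\<in>B. \<Oplus>i\<in>A. f i j)"
  using assms(1,3)
proof (induction A rule: finite_induct)
  case empty
  then show ?case by simp
next
  case (insert a A)
  have "(\<Oplus>i\<in>insert a A. \<Oplus>j\<in>B. f i j) = (\<Oplus>j\<in>B. f a j) \<oplus> (\<Oplus>j\<in>B. \<Oplus>i\<in>A. f i j)"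
    using insert by (simp add: Pi_def)
  also have "\<dots> = (\<Oplus>j\<in>B. f a j \<oplus> (\<Oplus>i\<in>A. f i j))"
    using insert by (subst finsum_addf) (auto simp: Pi_def)
  also have "\<dots> = (\<Oplus>j\<in>B. \<Oplus>i\<in>insert a A. f i j)"
    using insert by (intro finsum_cong') (auto simp: Pi_def)
  finally show ?case .
qed

lemma finsum_mono_neutral:
  assumes "finite B" "A \<subseteq> B" "\<And>i. i \<in> A \<Longrightarrow> f i \<in> carrier G" "\<And>i. i \<in> B - A \<Longrightarrow> f i = \<zero>"
  shows "(\<Oplus>i\<in>A. f i) = (\<Oplus>i\<in>B. f i)"
proof -
  have "f i \<in> carrier G" if "i \<in> B" for i using assms that by (cases "i \<in> A") auto
  then show ?thesis using assms by (intro add.finprod_mono_neutral_cong_left) auto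
qed

lemma finsum_single:
  assumes "finite A" "a \<in> A" "f a \<in> carrier G" "\<And>i. i \<in> A \<Longrightarrow> i \<noteq> a \<Longrightarrow> f i = \<zero>"
  shows "(\<Oplus>i\<in>A. f i) = f a"
proof -
  have "(\<Oplus>i\<in>{a}. f i) = (\<Oplus>i\<in>A. f i)"
    using assms by (intro finsum_mono_neutral) auto
  then show ?thesis using assms by simp
qed

end

text \<open>The common core of associativity for Laurent series, of associativity for matrices, and
  of the comparison of coordinates when basis vectors are counted: distribute, exchange the sums,
  and collect again.\<close>

lemma (in cring) finsum_assoc:
  assumes "finite A" "finite B"
    and "\<And>i. i \<in> A \<Longrightarrow> x i \<in> carrier R" "\<And>i k. i \<in> A \<Longrightarrow> k \<in> B \<Longrightarrow> M i k \<in> carrier R"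
    and "\<And>k. k \<in> B \<Longrightarrow> L k \<in> carrier R"
  shows "(\<Oplus>k\<in>B. (\<Oplus>i\<in>A. x i \<otimes> M i k) \<otimes> L k) = (\<Oplus>i\<in>A. x i \<otimes> (\<Oplus>k\<in>B. M i k \<otimes> L k))"
proof -
  have "(\<Oplus>k\<in>B. (\<Oplus>i\<in>A. x i \<otimes> M i k) \<otimes> L k) = (\<Oplus>k\<in>B. \<Oplus>i\<in>A. x i \<otimes> M i k \<otimes> L k)"
    using assms by (intro finsum_cong') (auto simp: finsum_ldistr Pi_def)
  also have "\<dots> = (\<Oplus>i\<in>A. \<Oplus>k\<in>B. x i \<otimes> M i k \<otimes> L k)"
    using assms by (intro finsum_swap) auto
  also have "\<dots> = (\<Oplus>i\<in>A. x i \<otimes> (\<Oplus>k\<in>B. M i k \<otimes> L k))"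
    using assms by (intro finsum_cong') (auto simp: finsum_rdistr m_assoc Pi_def intro!: finsum_cong')
  finally show ?thesis .
qed

text \<open>Zorn's lemma applied to the ideals that contain \<open>I\<close> and avoid
  \<open>\<one>\<close>; unions of chains stay proper because \<open>\<one>\<close> would already
  lie in one member. It turns a statement near every prime into a statement about the unit
  ideal.\<close>

lemma (in ring) exists_maximal_ideal:
  assumes "ideal I R" "\<one> \<notin> I"
  obtains p where "maximalideal p R" "I \<subseteq> p"
proof -
  define S where "S = {J. ideal J R \<and> I \<subseteq> J \<and> \<one> \<notin> J}"
  have "\<exists>M\<in>S. \<forall>J\<in>S. M \<subseteq> J \<longrightarrow> J = M"
  proof (rule subset_Zorn_nonempty)
    show "S \<noteq> {}" using assms by (auto simp: S_def)
  next
    fix C assume C: "C \<noteq> {}" "subset.chain S C"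
    then have CS: "C \<subseteq> S" by (auto simp: subset.chain_def)
    have id: "ideal J R" if "J \<in> C" for J using that CS by (auto simp: S_def)
    have lin: "\<exists>J\<in>C. x \<in> J \<and> y \<in> J" if xy: "x \<in> \<Union>C" "y \<in> \<Union>C" for x y
    proof -
      obtain J J' where J: "J \<in> C" "x \<in> J" "J' \<in> C" "y \<in> J'" using xy by blast
      then have "J \<subseteq> J' \<or> J' \<subseteq> J" using C unfolding subset.chain_def by blast
      then show ?thesis using J by blast
    qed
    have "ideal (\<Union>C) R"
    proof (rule idealI)
      show "ring R" by (rule ring_axioms)
      show "subgroup (\<Union>C) (add_monoid R)"
      proof (rule add.subgroupI)
        show "\<Union>C \<subseteq> carrier R" using id ideal.Icarr by fastforce
        obtain J where "J \<in> C" using C by blast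
        moreover have "\<zero> \<in> J" if "J \<in> C" for J
          using id[OF that] by (rule additive_subgroup.zero_closed[OF ideal.axioms(1)])
        ultimately show "\<Union>C \<noteq> {}" by blast
        show "\<ominus> x \<in> \<Union>C" if "x \<in> \<Union>C" for x
          using that id by (auto intro: additive_subgroup.a_inv_closed ideal.axioms(1))
        show "x \<oplus> y \<in> \<Union>C" if "x \<in> \<Union>C" "y \<in> \<Union>C" for x y
          using lin[OF that] id by (meson UnionI additive_subgroup.a_closed ideal.axioms(1))
      qed
      show "x \<otimes> a \<in> \<Union>C" "a \<otimes> x \<in> \<Union>C" if "a \<in> \<Union>C" "x \<in> carrier R" for a x
        using that id by (auto intro: ideal.I_l_closed ideal.I_r_closed)
    qed
    moreover have "I \<subseteq> \<Union>C" "\<one> \<notin> \<Union>C" using C CS by (auto simp: S_def)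
    ultimately show "\<Union>C \<in> S" by (simp add: S_def)
  qed
  then obtain p where p: "p \<in> S" "\<And>J. J \<in> S \<Longrightarrow> p \<subseteq> J \<Longrightarrow> J = p" by blast
  interpret p: ideal p R using p by (simp add: S_def)
  have "maximalideal p R"
  proof (rule maximalidealI)
    show "ideal p R" by (rule p.is_ideal)
    show "carrier R \<noteq> p" using p by (auto simp: S_def)
    fix J assume J: "ideal J R" "p \<subseteq> J" "J \<subseteq> carrier R"
    show "J = p \<or> J = carrier R"
    proof (cases "\<one> \<in> J")
      case True
      then show ?thesis using ideal.one_imp_carrier[OF J(1)] by simp
    next
      case False
      then have "J \<in> S" using J p(1) by (auto simp: S_def)
      then show ?thesis using p(2) J by simp
    qed
  qed
  then show ?thesis using that p by (auto simp: S_def)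
qed

text \<open>Quasi-compactness of the spectrum in algebraic form: the elements that lie in the ideal
  of some finite subset of \<open>T\<close> form an ideal containing \<open>T\<close>. It extracts a
  finite cover from the family of all good principal open sets.\<close>

lemma (in ring) finite_subset_genideal:
  assumes "T \<subseteq> carrier R" "x \<in> Idl T"
  obtains F where "finite F" "F \<subseteq> T" "x \<in> Idl F"
proof -
  define I where "I = {x. \<exists>F. finite F \<and> F \<subseteq> T \<and> x \<in> Idl F}"
  have mono: "Idl F \<subseteq> Idl G" if "F \<subseteq> G" "G \<subseteq> T" for F G
    using that assms by (intro subset_Idl_subset) auto
  have id: "ideal (Idl F) R" if "F \<subseteq> T" for F
    using that assms by (intro genideal_ideal) auto
  have "ideal I R"
  proof (rule idealI)
    show "ring R" by (rule ring_axioms)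
    show "subgroup I (add_monoid R)"
    proof (rule add.subgroupI)
      show "I \<subseteq> carrier R" unfolding I_def by (auto dest: ideal.Icarr[OF id])
      have "\<zero> \<in> Idl {}" using id[of "{}"] by (auto intro: additive_subgroup.zero_closed ideal.axioms(1))
      then show "I \<noteq> {}" by (auto simp: I_def)
      show "\<ominus> x \<in> I" if "x \<in> I" for x
        using that id unfolding I_def by (auto intro: additive_subgroup.a_inv_closed ideal.axioms(1))
      show "x \<oplus> y \<in> I" if xy: "x \<in> I" "y \<in> I" for x y
      proof -
        obtain F G where FG: "finite F" "F \<subseteq> T" "x \<in> Idl F" "finite G" "G \<subseteq> T" "y \<in> Idl G"
          using xy by (auto simp: I_def)
        then have "x \<in> Idl (F \<union> G)" "y \<in> Idl (F \<union> G)" using mono[of F "F \<union> G"] mono[of G "F \<union> G"] by auto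
        then have "x \<oplus> y \<in> Idl (F \<union> G)"
          using id[of "F \<union> G"] FG by (auto intro: additive_subgroup.a_closed ideal.axioms(1))
        then show ?thesis using FG unfolding I_def by blast
      qed
    qed
    show "x \<otimes> a \<in> I" "a \<otimes> x \<in> I" if "a \<in> I" "x \<in> carrier R" for a x
      using that id unfolding I_def by (auto intro: ideal.I_l_closed ideal.I_r_closed)
  qed
  moreover have "T \<subseteq> I"
  proof
    fix x assume "x \<in> T"
    then have "finite {x}" "{x} \<subseteq> T" "x \<in> Idl {x}" using assms genideal_self' by auto
    then show "x \<in> I" unfolding I_def by blast
  qed
  ultimately have "Idl T \<subseteq> I" by (rule genideal_minimal)
  then show ?thesis using assms that by (auto simp: I_def)
qed

section \<open>Laurent series\<close>

locale coeff_ring = cring R for R (structure)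
begin

abbreviation K where "K \<equiv> laurent_ring R"
abbreviation K0 where "K0 \<equiv> integral_ring R"

text \<open>The monomial c \<epsilon>^k. Multiplying by it scales and shifts coefficients, so powers
  of \<epsilon>, their inverses and the constants of \<open>R\<close> are all handled by this one
  family.\<close>

definition lmon :: "'a \<Rightarrow> int \<Rightarrow> int \<Rightarrow> 'a" where
  "lmon c k = (\<lambda>j. if j = k then c else \<zero>)"

lemma laurent_carrierI:
  assumes "\<And>k. f k \<in> carrier R" "\<And>k. k < N \<Longrightarrow> f k = \<zero>"
  shows "f \<in> carrier K"
  using assms by (auto simp: laurent_ring_def)

lemma laurent_coeff_closed [simp]: "f \<in> carrier K \<Longrightarrow> f k \<in> carrier R"
  by (auto simp: laurent_ring_def)

lemma laurent_bound:
  assumes "f \<in> carrier K"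
  obtains N where "\<And>k. k < N \<Longrightarrow> f k = \<zero>"
  using assms by (auto simp: laurent_ring_def)

lemma laurent_common_bound:
  assumes "f \<in> carrier K" "g \<in> carrier K"
  obtains N where "\<And>k. k < N \<Longrightarrow> f k = \<zero>" "\<And>k. k < N \<Longrightarrow> g k = \<zero>"
proof -
  obtain N M where "\<And>k. k < N \<Longrightarrow> f k = \<zero>" "\<And>k. k < M \<Longrightarrow> g k = \<zero>"
    using assms laurent_bound by metis
  then show ?thesis using that[of "min N M"] by auto
qed

lemma laurent_zero [simp]: "\<zero>\<^bsub>K\<^esub> k = \<zero>"
  and laurent_add [simp]: "(f \<oplus>\<^bsub>K\<^esub> g) k = f k \<oplus> g k"
  and laurent_one: "\<one>\<^bsub>K\<^esub> = lmon \<one> 0"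
  by (auto simp: laurent_ring_def lmon_def)

text \<open>The product is defined by a sum over the indices where both factors are nonzero, a set
  that changes with the factors and with the degree. Any finite set containing these indices gives
  the same value, and only then can sums be exchanged or reindexed.\<close>

lemma laurent_mult_eq:
  assumes "f \<in> carrier K" "g \<in> carrier K" "finite B" "\<And>i. f i \<noteq> \<zero> \<Longrightarrow> g (k - i) \<noteq> \<zero> \<Longrightarrow> i \<in> B"
  shows "(f \<otimes>\<^bsub>K\<^esub> g) k = (\<Oplus>i\<in>B. f i \<otimes> g (k - i))"
proof -
  have "(f \<otimes>\<^bsub>K\<^esub> g) k = (\<Oplus>i\<in>{i. f i \<noteq> \<zero> \<and> g (k - i) \<noteq> \<zero>}. f i \<otimes> g (k - i))"
    by (simp add: laurent_ring_def)
  also have "\<dots> = (\<Oplus>i\<in>B. f i \<otimes> g (k - i))"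
    using assms by (intro finsum_mono_neutral) auto
  finally show ?thesis .
qed

text \<open>The bound on \<open>g\<close> is stated relative to the degree \<open>k\<close>, so that
  one interval can serve several degrees at once.\<close>

lemma laurent_mult_box:
  assumes "f \<in> carrier K" "g \<in> carrier K"
    and "\<And>i. i < a \<Longrightarrow> f i = \<zero>" "\<And>i. i < k - b \<Longrightarrow> g i = \<zero>"
  shows "(f \<otimes>\<^bsub>K\<^esub> g) k = (\<Oplus>i\<in>{a..b}. f i \<otimes> g (k - i))"
proof (rule laurent_mult_eq)
  fix i assume *: "f i \<noteq> \<zero>" "g (k - i) \<noteq> \<zero>"
  then have "\<not> i < a" "\<not> k - i < k - b" using assms by metis+
  then show "i \<in> {a..b}" by auto
qed (use assms in auto)

lemma laurent_mult_closed [simp, intro]: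
  assumes "f \<in> carrier K" "g \<in> carrier K"
  shows "f \<otimes>\<^bsub>K\<^esub> g \<in> carrier K"
proof -
  obtain N where N: "\<And>k. k < N \<Longrightarrow> f k = \<zero>" "\<And>k. k < N \<Longrightarrow> g k = \<zero>"
    using assms laurent_common_bound by blast
  have eq: "(f \<otimes>\<^bsub>K\<^esub> g) k = (\<Oplus>i\<in>{N..k-N}. f i \<otimes> g (k - i))" for k
    using assms N by (intro laurent_mult_box) auto
  show ?thesis
    by (rule laurent_carrierI[where N = "2 * N"]) (use assms in \<open>auto simp: eq intro!: finsum_closed\<close>)
qed

lemma laurent_mult_comm:
  assumes "f \<in> carrier K" "g \<in> carrier K"
  shows "f \<otimes>\<^bsub>K\<^esub> g = g \<otimes>\<^bsub>K\<^esub> f"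
proof
  fix k
  obtain N where N: "\<And>k. k < N \<Longrightarrow> f k = \<zero>" "\<And>k. k < N \<Longrightarrow> g k = \<zero>"
    using assms laurent_common_bound by blast
  have "(f \<otimes>\<^bsub>K\<^esub> g) k = (\<Oplus>i\<in>{N..k-N}. f i \<otimes> g (k - i))"
    using assms N by (intro laurent_mult_box) auto
  also have "{N..k-N} = (\<lambda>i. k - i) ` {N..k-N}"
    by (auto simp: image_iff intro!: bexI[of _ "k - _"])
  also have "(\<Oplus>i\<in>(\<lambda>i. k - i) ` {N..k-N}. f i \<otimes> g (k - i)) = (\<Oplus>i\<in>{N..k-N}. f (k - i) \<otimes> g i)"
    using assms by (subst finsum_reindex) (auto simp: inj_on_def)
  also have "\<dots> = (\<Oplus>i\<in>{N..k-N}. g i \<otimes> f (k - i))"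
    using assms by (intro finsum_cong') (auto simp: m_comm)
  also have "\<dots> = (g \<otimes>\<^bsub>K\<^esub> f) k"
    using assms N by (intro laurent_mult_box[symmetric]) auto
  finally show "(f \<otimes>\<^bsub>K\<^esub> g) k = (g \<otimes>\<^bsub>K\<^esub> f) k" .
qed

lemma laurent_mult_assoc:
  assumes "f \<in> carrier K" "g \<in> carrier K" "h \<in> carrier K"
  shows "(f \<otimes>\<^bsub>K\<^esub> g) \<otimes>\<^bsub>K\<^esub> h = f \<otimes>\<^bsub>K\<^esub> (g \<otimes>\<^bsub>K\<^esub> h)"
proof
  fix k
  obtain N1 where N1: "\<And>k. k < N1 \<Longrightarrow> f k = \<zero>" "\<And>k. k < N1 \<Longrightarrow> g k = \<zero>"
    using assms laurent_common_bound by blast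
  obtain N2 where N2: "\<And>k. k < N2 \<Longrightarrow> h k = \<zero>" using assms laurent_bound by blast
  define N where "N = min N1 N2"
  have N: "k < N \<Longrightarrow> f k = \<zero>" "k < N \<Longrightarrow> g k = \<zero>" "k < N \<Longrightarrow> h k = \<zero>" for k
    using N1 N2 by (auto simp: N_def)
  \<comment> \<open>If three indices add up to \<open>k\<close> and each is at least
    \<open>N\<close>, then each is at most \<open>k - 2 * N\<close>, and the sum of the first two
    lies between \<open>2 * N\<close> and \<open>k - N\<close>. So \<open>B\<close> holds the index
    of \<open>f\<close>, and \<open>C\<close> the degree of the product of \<open>f\<close> and
    \<open>g\<close>, whichever way the brackets are set.\<close>
  define B where "B = {N..k - 2 * N}"
  define C where "C = {2 * N..k - N}"
  have fg: "(f \<otimes>\<^bsub>K\<^esub> g) s = (\<Oplus>i\<in>B. f i \<otimes> g (s - i))" if "s \<in> C" for s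
    unfolding B_def using assms N that by (intro laurent_mult_box) (auto simp: C_def)
  have fg0: "(f \<otimes>\<^bsub>K\<^esub> g) s = \<zero>" if "s < 2 * N" for s
  proof -
    have "(f \<otimes>\<^bsub>K\<^esub> g) s = (\<Oplus>i\<in>{N..s-N}. f i \<otimes> g (s - i))"
      using assms N by (intro laurent_mult_box) auto
    then show ?thesis using that by simp
  qed
  have gh: "(g \<otimes>\<^bsub>K\<^esub> h) (k - i) = (\<Oplus>s\<in>C. g (s - i) \<otimes> h (k - s))" if "i \<in> B" for i
  proof -
    have "(g \<otimes>\<^bsub>K\<^esub> h) (k - i) = (\<Oplus>j\<in>(\<lambda>s. s - i) ` C. g j \<otimes> h (k - i - j))"
    proof (rule laurent_mult_eq)
      fix j assume "g j \<noteq> \<zero>" "h (k - i - j) \<noteq> \<zero>"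
      then have "\<not> j < N" "\<not> k - i - j < N" using N by metis+
      then have "j + i \<in> C" using that by (auto simp: C_def B_def)
      then show "j \<in> (\<lambda>s. s - i) ` C" by (metis add_diff_cancel_right' image_eqI)
    qed (use assms in \<open>auto simp: C_def\<close>)
    also have "\<dots> = (\<Oplus>s\<in>C. g (s - i) \<otimes> h (k - i - (s - i)))"
      using assms by (subst finsum_reindex) (auto simp: inj_on_def)
    finally show ?thesis by simp
  qed
  have "((f \<otimes>\<^bsub>K\<^esub> g) \<otimes>\<^bsub>K\<^esub> h) k = (\<Oplus>s\<in>C. (f \<otimes>\<^bsub>K\<^esub> g) s \<otimes> h (k - s))"
    unfolding C_def using assms N fg0 by (intro laurent_mult_box) auto
  also have "\<dots> = (\<Oplus>s\<in>C. (\<Oplus>i\<in>B. f i \<otimes> g (s - i)) \<otimes> h (k - s))"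
    using assms by (intro finsum_cong') (auto simp: fg[symmetric])
  also have "\<dots> = (\<Oplus>i\<in>B. f i \<otimes> (\<Oplus>s\<in>C. g (s - i) \<otimes> h (k - s)))"
    using assms by (intro finsum_assoc) (auto simp: B_def C_def)
  also have "\<dots> = (\<Oplus>i\<in>B. f i \<otimes> (g \<otimes>\<^bsub>K\<^esub> h) (k - i))"
    using assms by (intro finsum_cong') (auto simp: gh[symmetric])
  also have "\<dots> = (f \<otimes>\<^bsub>K\<^esub> (g \<otimes>\<^bsub>K\<^esub> h)) k"
  proof (unfold B_def, rule laurent_mult_box[symmetric])
    fix i assume "i < k - (k - 2 * N)"
    then have i: "i < 2 * N" by simp
    have "(g \<otimes>\<^bsub>K\<^esub> h) i = (\<Oplus>j\<in>{N..i-N}. g j \<otimes> h (i - j))"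
      using assms N by (intro laurent_mult_box) auto
    then show "(g \<otimes>\<^bsub>K\<^esub> h) i = \<zero>" using i by simp
  qed (use assms N in auto)
  finally show "((f \<otimes>\<^bsub>K\<^esub> g) \<otimes>\<^bsub>K\<^esub> h) k = (f \<otimes>\<^bsub>K\<^esub> (g \<otimes>\<^bsub>K\<^esub> h)) k" .
qed

lemma lmon_closed [simp, intro]: "c \<in> carrier R \<Longrightarrow> lmon c k \<in> carrier K"
  by (rule laurent_carrierI[where N = k]) (auto simp: lmon_def)

lemma lmon_mult:
  assumes "c \<in> carrier R" "f \<in> carrier K"
  shows "lmon c k \<otimes>\<^bsub>K\<^esub> f = (\<lambda>j. c \<otimes> f (j - k))"
proof
  fix j
  have "(lmon c k \<otimes>\<^bsub>K\<^esub> f) j = (\<Oplus>i\<in>{k}. lmon c k i \<otimes> f (j - i))"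
    proof (rule laurent_mult_eq)
    show "i \<in> {k}" if "lmon c k i \<noteq> \<zero>" for i using that by (auto simp: lmon_def split: if_splits)
  qed (use assms in auto)
  then show "(lmon c k \<otimes>\<^bsub>K\<^esub> f) j = c \<otimes> f (j - k)" using assms by (simp add: lmon_def)
qed

lemma laurent_add_closed:
  assumes "f \<in> carrier K" "g \<in> carrier K"
  shows "f \<oplus>\<^bsub>K\<^esub> g \<in> carrier K"
proof -
  obtain N where "\<And>k. k < N \<Longrightarrow> f k = \<zero>" "\<And>k. k < N \<Longrightarrow> g k = \<zero>"
    using assms laurent_common_bound by blast
  then show ?thesis using assms by (intro laurent_carrierI[where N = N]) (auto simp: laurent_add)
qed

lemma laurent_l_distr:
  assumes "f \<in> carrier K" "g \<in> carrier K" "h \<in> carrier K"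
  shows "(f \<oplus>\<^bsub>K\<^esub> g) \<otimes>\<^bsub>K\<^esub> h = f \<otimes>\<^bsub>K\<^esub> h \<oplus>\<^bsub>K\<^esub> g \<otimes>\<^bsub>K\<^esub> h"
proof
  fix k
  obtain N where N: "\<And>k. k < N \<Longrightarrow> f k = \<zero>" "\<And>k. k < N \<Longrightarrow> g k = \<zero>"
    using assms laurent_common_bound by blast
  obtain M where M: "\<And>k. k < M \<Longrightarrow> h k = \<zero>" using assms laurent_bound by blast
  have fg: "f \<oplus>\<^bsub>K\<^esub> g \<in> carrier K" using assms laurent_add_closed by blast
  have 1: "((f \<oplus>\<^bsub>K\<^esub> g) \<otimes>\<^bsub>K\<^esub> h) k = (\<Oplus>i\<in>{N..k-M}. (f \<oplus>\<^bsub>K\<^esub> g) i \<otimes> h (k - i))"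
    using assms fg N M by (intro laurent_mult_box) auto
  have 2: "(f \<otimes>\<^bsub>K\<^esub> h) k = (\<Oplus>i\<in>{N..k-M}. f i \<otimes> h (k - i))"
    using assms N M by (intro laurent_mult_box) auto
  have 3: "(g \<otimes>\<^bsub>K\<^esub> h) k = (\<Oplus>i\<in>{N..k-M}. g i \<otimes> h (k - i))"
    using assms N M by (intro laurent_mult_box) auto
  have 4: "(\<Oplus>i\<in>{N..k-M}. (f \<oplus>\<^bsub>K\<^esub> g) i \<otimes> h (k - i)) = (\<Oplus>i\<in>{N..k-M}. f i \<otimes> h (k - i) \<oplus> g i \<otimes> h (k - i))"
    using assms by (intro finsum_cong') (auto simp: l_distr)
  have 5: "(\<Oplus>i\<in>{N..k-M}. f i \<otimes> h (k - i) \<oplus> g i \<otimes> h (k - i)) =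
      (\<Oplus>i\<in>{N..k-M}. f i \<otimes> h (k - i)) \<oplus> (\<Oplus>i\<in>{N..k-M}. g i \<otimes> h (k - i))"
    using assms by (intro finsum_addf) auto
  show "((f \<oplus>\<^bsub>K\<^esub> g) \<otimes>\<^bsub>K\<^esub> h) k = (f \<otimes>\<^bsub>K\<^esub> h \<oplus>\<^bsub>K\<^esub> g \<otimes>\<^bsub>K\<^esub> h) k"
    by (subst laurent_add) (simp only: 1 2 3 4 5)
qed

lemma laurent_cring: "cring K"
proof (rule cringI)
  show "abelian_group K"
  proof (rule abelian_groupI)
    show "\<exists>g\<in>carrier K. g \<oplus>\<^bsub>K\<^esub> f = \<zero>\<^bsub>K\<^esub>" if "f \<in> carrier K" for f
    proof
      show "(\<lambda>k. \<ominus> f k) \<oplus>\<^bsub>K\<^esub> f = \<zero>\<^bsub>K\<^esub>" by (rule ext) (use that in \<open>simp add: l_neg\<close>)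
      from that obtain N where "\<And>k. k < N \<Longrightarrow> f k = \<zero>" by (rule laurent_bound) blast
      then show "(\<lambda>k. \<ominus> f k) \<in> carrier K"
        using that by (intro laurent_carrierI[where N = N]) auto
    qed
    show "\<zero>\<^bsub>K\<^esub> \<in> carrier K" by (auto intro: laurent_carrierI)
    show "f \<oplus>\<^bsub>K\<^esub> g \<oplus>\<^bsub>K\<^esub> h = f \<oplus>\<^bsub>K\<^esub> (g \<oplus>\<^bsub>K\<^esub> h)" if "f \<in> carrier K" "g \<in> carrier K" "h \<in> carrier K" for f g h
      by (rule ext) (use that in \<open>simp add: a_assoc\<close>)
    show "f \<oplus>\<^bsub>K\<^esub> g = g \<oplus>\<^bsub>K\<^esub> f" if "f \<in> carrier K" "g \<in> carrier K" for f g
      by (rule ext) (use that in \<open>simp add: a_comm\<close>)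
    show "\<zero>\<^bsub>K\<^esub> \<oplus>\<^bsub>K\<^esub> f = f" if "f \<in> carrier K" for f
      by (rule ext) (use that in simp)
  qed (use laurent_add_closed in auto)
  show "Group.comm_monoid K"
  proof (rule comm_monoidI)
    show "\<one>\<^bsub>K\<^esub> \<otimes>\<^bsub>K\<^esub> f = f" if "f \<in> carrier K" for f
      using that by (simp add: laurent_one lmon_mult)
  qed (use laurent_mult_assoc laurent_mult_comm in \<open>auto simp: laurent_one\<close>)
qed (use laurent_l_distr in auto)

sublocale K: cring K by (rule laurent_cring)

declare laurent_add [simp del] laurent_zero [simp del]

lemma laurent_minus: "f \<in> carrier K \<Longrightarrow> \<ominus>\<^bsub>K\<^esub> f = (\<lambda>k. \<ominus> f k)"
proof (rule K.minus_equality)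
  assume f: "f \<in> carrier K"
  show "(\<lambda>k. \<ominus> f k) \<oplus>\<^bsub>K\<^esub> f = \<zero>\<^bsub>K\<^esub>" by (rule ext) (use f in \<open>simp add: l_neg laurent_add laurent_zero\<close>)
  from f obtain N where "\<And>k. k < N \<Longrightarrow> f k = \<zero>" by (rule laurent_bound) blast
  then show "(\<lambda>k. \<ominus> f k) \<in> carrier K"
    using f by (intro laurent_carrierI[where N = N]) auto
qed

lemma laurent_finsum_coeff:
  assumes "\<And>i. i \<in> B \<Longrightarrow> f i \<in> carrier K"
  shows "(\<Oplus>\<^bsub>K\<^esub>i\<in>B. f i) k = (\<Oplus>i\<in>B. f i k)"
  using assms
proof (induction B rule: infinite_finite_induct)
  case (insert x F)
  then have "(\<Oplus>\<^bsub>K\<^esub>i\<in>insert x F. f i) = f x \<oplus>\<^bsub>K\<^esub> (\<Oplus>\<^bsub>K\<^esub>i\<in>F. f i)"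
    by (intro K.finsum_insert) auto
  then show ?case using insert by (simp add: Pi_def laurent_add)
qed (auto simp: laurent_zero)

lemma K0_carrier: "f \<in> carrier K0 \<longleftrightarrow> f \<in> carrier K \<and> (\<forall>k<0. f k = \<zero>)"
  by (simp add: integral_ring_def)

lemma K0_carrier_iff: "f \<in> carrier K0 \<longleftrightarrow> (\<forall>k. f k \<in> carrier R) \<and> (\<forall>k<0. f k = \<zero>)"
  by (auto simp: integral_ring_def laurent_ring_def)

lemma K0_closed: "f \<in> carrier K0 \<Longrightarrow> f \<in> carrier K"
  by (simp add: K0_carrier)

lemma K0_ops [simp]:
  "\<zero>\<^bsub>K0\<^esub> = \<zero>\<^bsub>K\<^esub>" "\<one>\<^bsub>K0\<^esub> = \<one>\<^bsub>K\<^esub>" "f \<oplus>\<^bsub>K0\<^esub> g = f \<oplus>\<^bsub>K\<^esub> g" "f \<otimes>\<^bsub>K0\<^esub> g = f \<otimes>\<^bsub>K\<^esub> g"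
  by (simp_all add: integral_ring_def)

lemma K0_subcring: "subcring (carrier K0) K"
proof (rule K.subcringI', rule K.subringI)
  show "h1 \<otimes>\<^bsub>K\<^esub> h2 \<in> carrier K0" if "h1 \<in> carrier K0" "h2 \<in> carrier K0" for h1 h2
  proof -
    have "(h1 \<otimes>\<^bsub>K\<^esub> h2) k = \<zero>" if "k < 0" for k
    proof -
      have "(h1 \<otimes>\<^bsub>K\<^esub> h2) k = (\<Oplus>i\<in>{0..k}. h1 i \<otimes> h2 (k - i))"
        using \<open>h1 \<in> carrier K0\<close> \<open>h2 \<in> carrier K0\<close> by (intro laurent_mult_box) (auto simp: K0_carrier)
      then show ?thesis using that by simp
    qed
    then show ?thesis using that by (auto simp: K0_carrier)
  qed
  show "\<ominus>\<^bsub>K\<^esub> h \<in> carrier K0" if "h \<in> carrier K0" for h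
    using that K.a_inv_closed[of h] by (auto simp: K0_carrier laurent_minus)
  show "\<one>\<^bsub>K\<^esub> \<in> carrier K0" 
    unfolding K0_carrier using K.one_closed by (simp add: laurent_one) (simp add: lmon_def)
  show "h1 \<oplus>\<^bsub>K\<^esub> h2 \<in> carrier K0" if "h1 \<in> carrier K0" "h2 \<in> carrier K0" for h1 h2
    using that K.a_closed[of h1 h2] by (simp add: K0_carrier laurent_add)
qed (auto simp: K0_carrier)

lemma K0_cring: "cring K0"
proof -
  have "cring (K\<lparr>carrier := carrier K0\<rparr>)"
    using K.subcring_iff[of "carrier K0"] K0_subcring K0_closed by (simp add: subset_iff)
  moreover have "K\<lparr>carrier := carrier K0\<rparr> = K0" by (simp add: integral_ring_def)
  ultimately show ?thesis by metis
qed

sublocale K0: cring K0 by (rule K0_cring)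

declare K0_closed [simp]

lemma K0_mult_closed [simp, intro]:
  "f \<in> carrier K0 \<Longrightarrow> g \<in> carrier K0 \<Longrightarrow> f \<otimes>\<^bsub>K\<^esub> g \<in> carrier K0"
  using K0.m_closed by simp

lemma K0_add_closed [simp, intro]:
  "f \<in> carrier K0 \<Longrightarrow> g \<in> carrier K0 \<Longrightarrow> f \<oplus>\<^bsub>K\<^esub> g \<in> carrier K0"
  using K0.a_closed by simp

lemma lmon_K0 [simp, intro]: "c \<in> carrier R \<Longrightarrow> k \<ge> 0 \<Longrightarrow> lmon c k \<in> carrier K0"
  unfolding K0_carrier using lmon_closed[of c k] by (auto simp: lmon_def)

text \<open>\<open>finsum\<close> refers to the carrier of its ring, so sums over the subring and
  over the big ring are compared by induction on the index set.\<close>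

lemma K0_finsum:
  assumes "\<And>i. i \<in> B \<Longrightarrow> f i \<in> carrier K0"
  shows "(\<Oplus>\<^bsub>K0\<^esub>i\<in>B. f i) = (\<Oplus>\<^bsub>K\<^esub>i\<in>B. f i)"
  using assms
proof (induction B rule: infinite_finite_induct)
  case (insert x F)
  then have "(\<Oplus>\<^bsub>K\<^esub>i\<in>insert x F. f i) = f x \<oplus>\<^bsub>K\<^esub> (\<Oplus>\<^bsub>K\<^esub>i\<in>F. f i)"
    by (intro K.finsum_insert) auto
  moreover have "(\<Oplus>\<^bsub>K0\<^esub>i\<in>insert x F. f i) = f x \<oplus>\<^bsub>K0\<^esub> (\<Oplus>\<^bsub>K0\<^esub>i\<in>F. f i)"
    using insert by (intro K0.finsum_insert) auto
  ultimately show ?case using insert by simp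
qed auto

lemma K0_finsum_closed [intro]:
  assumes "\<And>i. i \<in> B \<Longrightarrow> f i \<in> carrier K0"
  shows "(\<Oplus>\<^bsub>K\<^esub>i\<in>B. f i) \<in> carrier K0"
  using K0_finsum[of B f] K0.finsum_closed[of f B] assms by auto

lemma lmon_mult_lmon:
  assumes "a \<in> carrier R" "b \<in> carrier R"
  shows "lmon a k \<otimes>\<^bsub>K\<^esub> lmon b l = lmon (a \<otimes> b) (k + l)"
  using assms by (simp add: lmon_mult) (auto simp: lmon_def)

lemma eps_pow: "eps R [^]\<^bsub>K\<^esub> (k::nat) = lmon \<one> (int k)"
proof (induction k)
  case 0
  then show ?case by (simp add: laurent_one)
next
  case (Suc k)
  have "eps R = lmon \<one> 1" by (simp add: eps_def lmon_def)
  then show ?case using Suc lmon_mult_lmon[of \<one> \<one> "int k" 1] by (simp add: algebra_simps)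
qed

end

section \<open>Row vectors and matrices\<close>

text \<open>Index sets are arbitrary because two kinds of vectors occur: Laurent vectors indexed by
  \<open>{1..n}\<close>, and vectors of finitely many coefficients indexed by pairs of position and
  degree. For \<open>{..<N}\<close> it is exactly \<open>free_module\<close>.\<close>

definition vec_mod :: "'i set \<Rightarrow> ('a, 'b) ring_scheme \<Rightarrow> ('a, 'i \<Rightarrow> 'a) module" where
  "vec_mod I B = \<lparr>
     carrier = I \<rightarrow>\<^sub>E carrier B,
     monoid.mult = (\<lambda>u v. \<lambda>i\<in>I. u i \<otimes>\<^bsub>B\<^esub> v i),
     one = (\<lambda>i\<in>I. \<one>\<^bsub>B\<^esub>),
     ring.zero = (\<lambda>i\<in>I. \<zero>\<^bsub>B\<^esub>),
     add = (\<lambda>u v. \<lambda>i\<in>I. u i \<oplus>\<^bsub>B\<^esub> v i),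
     module.smult = (\<lambda>c v. \<lambda>i\<in>I. c \<otimes>\<^bsub>B\<^esub> v i)\<rparr>"

definition rowmul :: "'i set \<Rightarrow> ('a, 'b) ring_scheme \<Rightarrow> ('i \<Rightarrow> 'a) \<Rightarrow> ('i \<times> 'i \<Rightarrow> 'a) \<Rightarrow> 'i \<Rightarrow> 'a" where
  "rowmul I B w M = (\<lambda>j\<in>I. \<Oplus>\<^bsub>B\<^esub>i\<in>I. w i \<otimes>\<^bsub>B\<^esub> M (i, j))"

definition mat_mult :: "'i set \<Rightarrow> ('a, 'b) ring_scheme \<Rightarrow> ('i \<times> 'i \<Rightarrow> 'a) \<Rightarrow> ('i \<times> 'i \<Rightarrow> 'a) \<Rightarrow> 'i \<times> 'i \<Rightarrow> 'a" where
  "mat_mult I B M L = (\<lambda>(i, j)\<in>I \<times> I. \<Oplus>\<^bsub>B\<^esub>k\<in>I. M (i, k) \<otimes>\<^bsub>B\<^esub> L (k, j))"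

definition scalar_mat :: "'i set \<Rightarrow> ('a, 'b) ring_scheme \<Rightarrow> 'a \<Rightarrow> 'i \<times> 'i \<Rightarrow> 'a" where
  "scalar_mat I B c = (\<lambda>(i, j)\<in>I \<times> I. if i = j then c else \<zero>\<^bsub>B\<^esub>)"

definition unit_row :: "'i set \<Rightarrow> ('a, 'b) ring_scheme \<Rightarrow> 'i \<Rightarrow> 'i \<Rightarrow> 'a" where
  "unit_row I B i = (\<lambda>j\<in>I. if j = i then \<one>\<^bsub>B\<^esub> else \<zero>\<^bsub>B\<^esub>)"

definition mat_row :: "'i set \<Rightarrow> ('i \<times> 'i \<Rightarrow> 'a) \<Rightarrow> 'i \<Rightarrow> 'i \<Rightarrow> 'a" where
  "mat_row I M i = (\<lambda>j\<in>I. M (i, j))"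

lemma vec_carrier [simp]: "carrier (vec_mod I B) = I \<rightarrow>\<^sub>E carrier B"
  by (simp add: vec_mod_def)

lemma vec_add [simp]: "i \<in> I \<Longrightarrow> (u \<oplus>\<^bsub>vec_mod I B\<^esub> v) i = u i \<oplus>\<^bsub>B\<^esub> v i"
  and vec_zero [simp]: "i \<in> I \<Longrightarrow> \<zero>\<^bsub>vec_mod I B\<^esub> i = \<zero>\<^bsub>B\<^esub>"
  and vec_smult [simp]: "i \<in> I \<Longrightarrow> (c \<odot>\<^bsub>vec_mod I B\<^esub> v) i = c \<otimes>\<^bsub>B\<^esub> v i"
  and vec_add_ext [simp]: "u \<oplus>\<^bsub>vec_mod I B\<^esub> v \<in> extensional I"
  and vec_zero_ext [simp]: "\<zero>\<^bsub>vec_mod I B\<^esub> \<in> extensional I"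
  and vec_smult_ext [simp]: "c \<odot>\<^bsub>vec_mod I B\<^esub> v \<in> extensional I"
  by (auto simp: vec_mod_def)

lemma rowmul_ext [simp]: "rowmul I B w M \<in> extensional I"
  and unit_row_ext [simp]: "unit_row I B i \<in> extensional I"
  and mat_row_ext [simp]: "mat_row I M i \<in> extensional I"
  and mat_mult_ext [simp]: "mat_mult I B M L \<in> extensional (I \<times> I)"
  and scalar_mat_ext [simp]: "scalar_mat I B c \<in> extensional (I \<times> I)"
  by (auto simp: rowmul_def mat_mult_def unit_row_def mat_row_def scalar_mat_def extensional_def)

lemma vec_eqI:
  assumes "u \<in> extensional I" "v \<in> extensional I" "\<And>i. i \<in> I \<Longrightarrow> u i = v i"
  shows "u = v"
  using assms by (rule extensionalityI)

lemma mat_monoid_simps: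
  "carrier (mat_monoid n B) = {1..n} \<times> {1..n} \<rightarrow>\<^sub>E carrier B"
  "M \<otimes>\<^bsub>mat_monoid n B\<^esub> L = mat_mult {1..n} B M L"
  "\<one>\<^bsub>mat_monoid n B\<^esub> = scalar_mat {1..n} B \<one>\<^bsub>B\<^esub>"
  by (auto simp: mat_monoid_def mat_mult_def scalar_mat_def)

lemma mat_row_apply [simp]: "j \<in> I \<Longrightarrow> mat_row I M i j = M (i, j)"
  by (simp add: mat_row_def)

context cring
begin

lemma vec_abelian_group: "abelian_group (vec_mod I R)"
proof (rule abelian_groupI)
  fix x assume x: "x \<in> carrier (vec_mod I R)"
  show "\<exists>y\<in>carrier (vec_mod I R). y \<oplus>\<^bsub>vec_mod I R\<^esub> x = \<zero>\<^bsub>vec_mod I R\<^esub>"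
  proof (rule bexI[of _ "\<lambda>i\<in>I. \<ominus> x i"])
    have "x i \<in> carrier R" if "i \<in> I" for i using x that by auto
    then show "(\<lambda>i\<in>I. \<ominus> x i) \<oplus>\<^bsub>vec_mod I R\<^esub> x = \<zero>\<^bsub>vec_mod I R\<^esub>"
      by (auto simp: vec_mod_def l_neg intro!: restrict_ext)
  qed (use x in auto)
  show "x \<oplus>\<^bsub>vec_mod I R\<^esub> y = y \<oplus>\<^bsub>vec_mod I R\<^esub> x" if "y \<in> carrier (vec_mod I R)" for y
    by (rule vec_eqI[where I = I]) (use x that in \<open>auto simp: a_comm PiE_iff\<close>)
qed (auto simp: vec_mod_def PiE_iff a_assoc extensional_def intro!: restrict_ext)

lemma vec_module: "module R (vec_mod I R)"
  by (rule moduleI, rule is_cring, rule vec_abelian_group)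
    (auto simp: vec_mod_def PiE_mem PiE_iff l_distr r_distr m_assoc extensional_def intro!: restrict_ext)

lemma rowmul_closed [simp, intro]:
  assumes "w \<in> I \<rightarrow>\<^sub>E carrier R" "M \<in> I \<times> I \<rightarrow>\<^sub>E carrier R"
  shows "rowmul I R w M \<in> I \<rightarrow>\<^sub>E carrier R"
  using assms by (auto simp: rowmul_def PiE_mem intro!: finsum_closed)

lemma mat_row_closed [simp, intro]: "M \<in> I \<times> I \<rightarrow>\<^sub>E carrier R \<Longrightarrow> i \<in> I \<Longrightarrow> mat_row I M i \<in> I \<rightarrow>\<^sub>E carrier R"
  by (auto simp: mat_row_def)

lemma unit_row_closed [simp, intro]: "unit_row I R i \<in> I \<rightarrow>\<^sub>E carrier R"
  by (auto simp: unit_row_def)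

lemma vec_mem: "w \<in> I \<rightarrow>\<^sub>E carrier R \<Longrightarrow> i \<in> I \<Longrightarrow> w i \<in> carrier R"
  and mat_mem: "M \<in> I \<times> I \<rightarrow>\<^sub>E carrier R \<Longrightarrow> i \<in> I \<Longrightarrow> j \<in> I \<Longrightarrow> M (i, j) \<in> carrier R"
  by auto

lemma mat_mult_row:
  assumes "i \<in> I" "M \<in> I \<times> I \<rightarrow>\<^sub>E carrier R" "L \<in> I \<times> I \<rightarrow>\<^sub>E carrier R"
  shows "mat_row I (mat_mult I R M L) i = rowmul I R (mat_row I M i) L"
  unfolding mat_row_def mat_mult_def rowmul_def
  by (rule restrict_ext) (use assms mat_mem[OF assms(2)] mat_mem[OF assms(3)] in \<open>auto intro!: finsum_cong'\<close>)

lemma mat_mult_closed [simp, intro]: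
  assumes "L \<in> I \<times> I \<rightarrow>\<^sub>E carrier R" "M \<in> I \<times> I \<rightarrow>\<^sub>E carrier R"
  shows "mat_mult I R L M \<in> I \<times> I \<rightarrow>\<^sub>E carrier R"
  using assms by (auto simp: mat_mult_def PiE_mem intro!: finsum_closed)

lemma scalar_mat_closed [simp, intro]: "c \<in> carrier R \<Longrightarrow> scalar_mat I R c \<in> I \<times> I \<rightarrow>\<^sub>E carrier R"
  by (auto simp: scalar_mat_def)

text \<open>Row by row, matrix identities become identities for \<open>rowmul\<close>; associativity
  and the laws for scalars are proved only there.\<close>

lemma mat_eqI:
  assumes "L \<in> extensional (I \<times> I)" "M \<in> extensional (I \<times> I)" "\<And>i. i \<in> I \<Longrightarrow> mat_row I L i = mat_row I M i"
  shows "L = M"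
proof (rule vec_eqI[OF assms(1,2)])
  fix p assume "p \<in> I \<times> I"
  then obtain i j where p: "p = (i, j)" "i \<in> I" "j \<in> I" by auto
  then show "L p = M p" using assms(3)[of i] by (metis mat_row_apply)
qed

lemma rowmul_assoc:
  assumes "finite I" "w \<in> I \<rightarrow>\<^sub>E carrier R" "L \<in> I \<times> I \<rightarrow>\<^sub>E carrier R" "M \<in> I \<times> I \<rightarrow>\<^sub>E carrier R"
  shows "rowmul I R (rowmul I R w L) M = rowmul I R w (mat_mult I R L M)"
proof (rule vec_eqI)
  fix j assume j: "j \<in> I"
  note mem = vec_mem[OF assms(2)] mat_mem[OF assms(3)] mat_mem[OF assms(4)]
  have "rowmul I R (rowmul I R w L) M j = (\<Oplus>k\<in>I. (\<Oplus>i\<in>I. w i \<otimes> L (i, k)) \<otimes> M (k, j))"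
    using j mem by (auto simp: rowmul_def intro!: finsum_cong' finsum_closed)
  also have "\<dots> = (\<Oplus>i\<in>I. w i \<otimes> (\<Oplus>k\<in>I. L (i, k) \<otimes> M (k, j)))"
    using assms(1) j mem by (intro finsum_assoc) auto
  also have "\<dots> = rowmul I R w (mat_mult I R L M) j"
    using j mem by (auto simp: rowmul_def mat_mult_def intro!: finsum_cong' finsum_closed)
  finally show "rowmul I R (rowmul I R w L) M j = rowmul I R w (mat_mult I R L M) j" .
qed simp_all

lemma rowmul_unit_row:
  assumes "finite I" "i \<in> I" "M \<in> I \<times> I \<rightarrow>\<^sub>E carrier R"
  shows "rowmul I R (unit_row I R i) M = mat_row I M i"
proof (rule vec_eqI)
  fix j assume j: "j \<in> I"
  have "(\<Oplus>k\<in>I. unit_row I R i k \<otimes> M (k, j)) = unit_row I R i i \<otimes> M (i, j)"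
    using assms(1,2) j mat_mem[OF assms(3)] by (intro finsum_single) (auto simp: unit_row_def)
  then show "rowmul I R (unit_row I R i) M j = mat_row I M i j"
    using assms(2) j mat_mem[OF assms(3)] by (simp add: rowmul_def unit_row_def)
qed simp_all

lemma rowmul_scalar:
  assumes "finite I" "w \<in> I \<rightarrow>\<^sub>E carrier R" "c \<in> carrier R"
  shows "rowmul I R w (scalar_mat I R c) = c \<odot>\<^bsub>vec_mod I R\<^esub> w"
proof (rule vec_eqI)
  fix j assume j: "j \<in> I"
  have "(\<Oplus>k\<in>I. w k \<otimes> scalar_mat I R c (k, j)) = w j \<otimes> scalar_mat I R c (j, j)"
    using assms(1,3) j vec_mem[OF assms(2)] by (intro finsum_single) (auto simp: scalar_mat_def)
  then show "rowmul I R w (scalar_mat I R c) j = (c \<odot>\<^bsub>vec_mod I R\<^esub> w) j"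
    using assms(3) j vec_mem[OF assms(2)] by (simp add: rowmul_def scalar_mat_def m_comm)
qed simp_all

lemma rowmul_one [simp]:
  assumes "finite I" "w \<in> I \<rightarrow>\<^sub>E carrier R"
  shows "rowmul I R w (scalar_mat I R \<one>) = w"
  using rowmul_scalar[OF assms one_closed] module.smult_one[OF vec_module] assms by simp

lemma rowmul_add:
  assumes "v \<in> I \<rightarrow>\<^sub>E carrier R" "w \<in> I \<rightarrow>\<^sub>E carrier R" "M \<in> I \<times> I \<rightarrow>\<^sub>E carrier R"
  shows "rowmul I R (v \<oplus>\<^bsub>vec_mod I R\<^esub> w) M = rowmul I R v M \<oplus>\<^bsub>vec_mod I R\<^esub> rowmul I R w M"
proof (rule vec_eqI)
  fix j assume j: "j \<in> I"
  have "(\<Oplus>i\<in>I. (v \<oplus>\<^bsub>vec_mod I R\<^esub> w) i \<otimes> M (i, j)) = (\<Oplus>i\<in>I. v i \<otimes> M (i, j) \<oplus> w i \<otimes> M (i, j))"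
    using j vec_mem[OF assms(1)] vec_mem[OF assms(2)] mat_mem[OF assms(3)] by (intro finsum_cong') (auto simp: l_distr)
  also have "\<dots> = (\<Oplus>i\<in>I. v i \<otimes> M (i, j)) \<oplus> (\<Oplus>i\<in>I. w i \<otimes> M (i, j))"
    using j vec_mem[OF assms(1)] vec_mem[OF assms(2)] mat_mem[OF assms(3)] by (intro finsum_addf) auto
  finally show "rowmul I R (v \<oplus>\<^bsub>vec_mod I R\<^esub> w) M j = (rowmul I R v M \<oplus>\<^bsub>vec_mod I R\<^esub> rowmul I R w M) j"
    using j by (simp add: rowmul_def)
qed simp_all

lemma rowmul_smult:
  assumes "finite I" "c \<in> carrier R" "w \<in> I \<rightarrow>\<^sub>E carrier R" "M \<in> I \<times> I \<rightarrow>\<^sub>E carrier R"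
  shows "rowmul I R (c \<odot>\<^bsub>vec_mod I R\<^esub> w) M = c \<odot>\<^bsub>vec_mod I R\<^esub> rowmul I R w M"
proof (rule vec_eqI)
  fix j assume j: "j \<in> I"
  have "(\<Oplus>i\<in>I. (c \<odot>\<^bsub>vec_mod I R\<^esub> w) i \<otimes> M (i, j)) = (\<Oplus>i\<in>I. c \<otimes> (w i \<otimes> M (i, j)))"
    using assms(2) j vec_mem[OF assms(3)] mat_mem[OF assms(4)] by (intro finsum_cong') (auto simp: m_assoc)
  also have "\<dots> = c \<otimes> (\<Oplus>i\<in>I. w i \<otimes> M (i, j))"
    using assms(1,2) j vec_mem[OF assms(3)] mat_mem[OF assms(4)] by (intro finsum_rdistr[symmetric]) auto
  finally show "rowmul I R (c \<odot>\<^bsub>vec_mod I R\<^esub> w) M j = (c \<odot>\<^bsub>vec_mod I R\<^esub> rowmul I R w M) j"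
    using j by (simp add: rowmul_def)
qed simp_all

lemma mat_row_scalar:
  assumes "i \<in> I" "c \<in> carrier R"
  shows "mat_row I (scalar_mat I R c) i = c \<odot>\<^bsub>vec_mod I R\<^esub> unit_row I R i"
  using assms by (auto simp: mat_row_def scalar_mat_def vec_mod_def unit_row_def intro!: restrict_ext)

lemma mat_mult_assoc:
  assumes "finite I" "L \<in> I \<times> I \<rightarrow>\<^sub>E carrier R" "M \<in> I \<times> I \<rightarrow>\<^sub>E carrier R" "N \<in> I \<times> I \<rightarrow>\<^sub>E carrier R"
  shows "mat_mult I R (mat_mult I R L M) N = mat_mult I R L (mat_mult I R M N)"
  by (rule mat_eqI[where I = I]) (use assms in \<open>simp_all add: mat_mult_row rowmul_assoc\<close>)

lemma mat_mult_one:
  assumes "finite I" "M \<in> I \<times> I \<rightarrow>\<^sub>E carrier R"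
  shows "mat_mult I R M (scalar_mat I R \<one>) = M" "mat_mult I R (scalar_mat I R \<one>) M = M"
proof -
  show "mat_mult I R M (scalar_mat I R \<one>) = M"
    by (rule mat_eqI[where I = I]) (use assms in \<open>simp_all add: mat_mult_row PiE_iff[of M]\<close>)
  have "mat_row I (scalar_mat I R \<one>) i = unit_row I R i" if "i \<in> I" for i
    using that by (auto simp: mat_row_def scalar_mat_def unit_row_def intro!: restrict_ext)
  then show "mat_mult I R (scalar_mat I R \<one>) M = M"
    by (intro mat_eqI[where I = I]) (use assms in \<open>simp_all add: mat_mult_row rowmul_unit_row PiE_iff[of M]\<close>)
qed

lemma mat_monoid_monoid: "Group.monoid (mat_monoid n R)"
  by (rule monoidI) (simp_all add: mat_monoid_simps mat_mult_assoc mat_mult_one)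

end

section \<open>Simultaneous bases for the image and the kernel of a projector\<close>

context cring
begin

text \<open>An exchange lemma without determinants or division. The vector c = uZ satisfies f u = c
  M, so an elementary matrix \<open>Y\<close> with pivot a = c_t reduces the new matrix back to a
  multiple of the old one. Then Z Y inverts the new matrix up to the scalar a f.\<close>

lemma replace_row_invertible:
  assumes I: "finite I" "t \<in> I" and M: "M \<in> I \<times> I \<rightarrow>\<^sub>E carrier R" and Z: "Z \<in> I \<times> I \<rightarrow>\<^sub>E carrier R"
    and MZ: "mat_mult I R M Z = scalar_mat I R f" and ZM: "mat_mult I R Z M = scalar_mat I R f"
    and f: "f \<in> carrier R" and u: "u \<in> I \<rightarrow>\<^sub>E carrier R"
    and M': "M' = (\<lambda>(i, j)\<in>I \<times> I. if i = t then u j else M (i, j))"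
    and a: "a = rowmul I R u Z t"
  shows "\<exists>Z'\<in>I \<times> I \<rightarrow>\<^sub>E carrier R. mat_mult I R M' Z' = scalar_mat I R (a \<otimes> f) \<and>
           mat_mult I R Z' M' = scalar_mat I R (a \<otimes> f)"
proof -
  interpret V: module R "vec_mod I R" by (rule vec_module)
  define c where "c = rowmul I R u Z"
  have c: "c \<in> I \<rightarrow>\<^sub>E carrier R" using u Z by (simp add: c_def)
  note cm = vec_mem[OF c] and um = vec_mem[OF u] and Mm = mat_mem[OF M]
  have ac: "a = c t" by (simp add: a c_def)
  have aR: "a \<in> carrier R" using cm I ac by simp
  have M'c: "M' \<in> I \<times> I \<rightarrow>\<^sub>E carrier R" using M' um Mm by auto
  \<comment> \<open>Row t encodes f u minus the sum of the c_j M_j over j \<noteq> t, which equals a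
    M_t; the other rows are multiplied by a. Thus \<open>Y\<close> times \<open>M'\<close> is a M,
    while c times \<open>Y\<close> is a f in position t and cancels elsewhere.\<close>
  define Y where "Y = (\<lambda>(i, j)\<in>I \<times> I. if i = t then (if j = t then f else \<ominus> c j)
     else if i = j then a else \<zero>)"
  have Y: "Y \<in> I \<times> I \<rightarrow>\<^sub>E carrier R" using f aR cm by (auto simp: Y_def)
  have rM't: "mat_row I M' t = u"
    by (rule vec_eqI[where I = I]) (use I u in \<open>auto simp: M' PiE_iff\<close>)
  have rM'i: "mat_row I M' i = mat_row I M i" if "i \<in> I" "i \<noteq> t" for i
    by (rule vec_eqI[where I = I]) (use that in \<open>auto simp: M'\<close>)
  have rYi: "mat_row I Y i = a \<odot>\<^bsub>vec_mod I R\<^esub> unit_row I R i" if "i \<in> I" "i \<noteq> t" for i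
    by (rule vec_eqI[where I = I]) (use that aR in \<open>auto simp: Y_def unit_row_def\<close>)
  have rMZ: "rowmul I R (mat_row I M i) Z = f \<odot>\<^bsub>vec_mod I R\<^esub> unit_row I R i" if "i \<in> I" for i
    using mat_mult_row[OF that M Z] that f by (simp add: MZ mat_row_scalar)
  have rZM: "rowmul I R (mat_row I Z i) M = f \<odot>\<^bsub>vec_mod I R\<^esub> unit_row I R i" if "i \<in> I" for i
    using mat_mult_row[OF that Z M] that f by (simp add: ZM mat_row_scalar)
  have sm: "b \<odot>\<^bsub>vec_mod I R\<^esub> v \<in> I \<rightarrow>\<^sub>E carrier R" if "b \<in> carrier R" "v \<in> I \<rightarrow>\<^sub>E carrier R" for b v
    using V.smult_closed that by simp
  have cY: "rowmul I R c Y = (a \<otimes> f) \<odot>\<^bsub>vec_mod I R\<^esub> unit_row I R t"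
  proof (rule vec_eqI[where I = I])
    fix j assume j: "j \<in> I"
    show "rowmul I R c Y j = ((a \<otimes> f) \<odot>\<^bsub>vec_mod I R\<^esub> unit_row I R t) j"
    proof (cases "j = t")
      case True
      have "(\<Oplus>k\<in>I. c k \<otimes> Y (k, t)) = c t \<otimes> Y (t, t)"
        using I cm f aR by (intro finsum_single) (auto simp: Y_def)
      then show ?thesis using True j I f aR by (simp add: rowmul_def unit_row_def Y_def ac)
    next
      case False
      have "(\<Oplus>k\<in>{t, j}. c k \<otimes> Y (k, j)) = (\<Oplus>k\<in>I. c k \<otimes> Y (k, j))"
        using I cm f aR j by (intro finsum_mono_neutral) (auto simp: Y_def)
      moreover have "(\<Oplus>k\<in>{t, j}. c k \<otimes> Y (k, j)) = c t \<otimes> (\<ominus> c j) \<oplus> c j \<otimes> a"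
        using False I j cm aR by (simp add: Y_def)
      moreover have "c t \<otimes> (\<ominus> c j) \<oplus> c j \<otimes> a = \<zero>" using cm[OF I(2)] cm[OF j] unfolding ac by algebra
      ultimately have "(\<Oplus>k\<in>I. c k \<otimes> Y (k, j)) = \<zero>" by metis
      then show ?thesis using False j I f aR by (simp add: rowmul_def unit_row_def)
    qed
  qed simp_all
  have Yt: "rowmul I R (mat_row I Y t) M' = a \<odot>\<^bsub>vec_mod I R\<^esub> mat_row I M t"
  proof (rule vec_eqI[where I = I])
    fix j assume j: "j \<in> I"
    have cA: "rowmul I R c M = f \<odot>\<^bsub>vec_mod I R\<^esub> u"
      unfolding c_def using rowmul_assoc[OF I(1) u Z M] rowmul_scalar[OF I(1) u f] by (simp add: ZM)
    define s where "s = (\<Oplus>k\<in>I - {t}. c k \<otimes> M (k, j))"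
    define s' where "s' = (\<Oplus>k\<in>I - {t}. (\<ominus> c k) \<otimes> M (k, j))"
    have sR: "s \<in> carrier R" "s' \<in> carrier R" unfolding s_def s'_def using cm Mm j by (auto intro!: finsum_closed)
    have ins: "I = insert t (I - {t})" using I by auto
    have "(\<Oplus>k\<in>I. c k \<otimes> M (k, j)) = c t \<otimes> M (t, j) \<oplus> s"
      unfolding s_def using I cm Mm j by (subst ins, subst finsum_insert) auto
    then have 1: "a \<otimes> M (t, j) \<oplus> s = f \<otimes> u j"
      using arg_cong[OF cA, of "\<lambda>v. v j"] j by (simp add: rowmul_def ac)
    have "s' \<oplus> s = (\<Oplus>k\<in>I - {t}. (\<ominus> c k) \<otimes> M (k, j) \<oplus> c k \<otimes> M (k, j))"
      unfolding s_def s'_def using cm Mm j by (intro finsum_addf[symmetric]) auto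
    also have "\<dots> = (\<Oplus>k\<in>I - {t}. \<zero>)"
      using cm Mm j by (intro finsum_cong') (auto simp: l_minus l_neg)
    finally have 2: "s' \<oplus> s = \<zero>" by simp
    have "(\<Oplus>k\<in>I. Y (t, k) \<otimes> M' (k, j)) = Y (t, t) \<otimes> M' (t, j) \<oplus> (\<Oplus>k\<in>I - {t}. Y (t, k) \<otimes> M' (k, j))"
      using I mat_mem[OF Y] mat_mem[OF M'c] j by (subst ins, subst finsum_insert) auto
    also have "(\<Oplus>k\<in>I - {t}. Y (t, k) \<otimes> M' (k, j)) = s'"
      unfolding s'_def using I cm Mm j by (intro finsum_cong') (auto simp: Y_def M')
    also have "Y (t, t) \<otimes> M' (t, j) = f \<otimes> u j" using I j by (simp add: Y_def M')
    also have "f \<otimes> u j \<oplus> s' = a \<otimes> M (t, j) \<oplus> (s' \<oplus> s)"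
      unfolding 1[symmetric] using sR aR Mm[OF I(2) j] by algebra
    finally have "(\<Oplus>k\<in>I. Y (t, k) \<otimes> M' (k, j)) = a \<otimes> M (t, j)"
      using 2 aR Mm[OF I(2) j] by simp
    moreover have "(\<Oplus>k\<in>I. mat_row I Y t k \<otimes> M' (k, j)) = (\<Oplus>k\<in>I. Y (t, k) \<otimes> M' (k, j))"
      using I mat_mem[OF Y] mat_mem[OF M'c] j by (intro finsum_cong') auto
    ultimately show "rowmul I R (mat_row I Y t) M' j = (a \<odot>\<^bsub>vec_mod I R\<^esub> mat_row I M t) j"
      using j by (simp add: rowmul_def)
  qed simp_all
  have YM': "mat_mult I R Y M' = mat_mult I R (scalar_mat I R a) M"
  proof (rule mat_eqI[where I = I])
    fix i assume i: "i \<in> I"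
    have "rowmul I R (mat_row I Y i) M' = a \<odot>\<^bsub>vec_mod I R\<^esub> mat_row I M i"
      using Yt rYi[OF i] rM'i[OF i] rowmul_smult[OF I(1) aR _ M'c] rowmul_unit_row[OF I(1) i M'c]
      by (cases "i = t") auto
    moreover have "rowmul I R (mat_row I (scalar_mat I R a) i) M = a \<odot>\<^bsub>vec_mod I R\<^esub> mat_row I M i"
      using i aR rowmul_smult[OF I(1) aR _ M] rowmul_unit_row[OF I(1) i M] by (simp add: mat_row_scalar)
    ultimately show "mat_row I (mat_mult I R Y M') i = mat_row I (mat_mult I R (scalar_mat I R a) M) i"
      using i Y M'c M aR by (simp add: mat_mult_row)
  qed simp_all
  have "mat_mult I R (mat_mult I R M' Z) Y = scalar_mat I R (a \<otimes> f)"
  proof (rule mat_eqI[where I = I])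
    fix i assume i: "i \<in> I"
    have "rowmul I R (rowmul I R (mat_row I M' i) Z) Y = (a \<otimes> f) \<odot>\<^bsub>vec_mod I R\<^esub> unit_row I R i"
    proof (cases "i = t")
      case True
      then show ?thesis using cY rM't by (simp add: c_def)
    next
      case False
      then have "rowmul I R (rowmul I R (mat_row I M' i) Z) Y = f \<odot>\<^bsub>vec_mod I R\<^esub> (a \<odot>\<^bsub>vec_mod I R\<^esub> unit_row I R i)"
        using rM'i[OF i] rMZ[OF i] rYi[OF i] rowmul_smult[OF I(1) f _ Y] rowmul_unit_row[OF I(1) i Y] by simp
      also have "\<dots> = (f \<otimes> a) \<odot>\<^bsub>vec_mod I R\<^esub> unit_row I R i" using f aR V.smult_assoc1 by simp
      finally show ?thesis using f aR by (simp add: m_comm)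
    qed
    then show "mat_row I (mat_mult I R (mat_mult I R M' Z) Y) i = mat_row I (scalar_mat I R (a \<otimes> f)) i"
      using i Y M'c Z aR f by (simp add: mat_mult_row mat_row_scalar)
  qed simp_all
  moreover have "mat_mult I R Z (mat_mult I R (scalar_mat I R a) M) = scalar_mat I R (a \<otimes> f)"
  proof (rule mat_eqI[where I = I])
    fix i assume i: "i \<in> I"
    have "rowmul I R (mat_row I Z i) (mat_mult I R (scalar_mat I R a) M)
        = rowmul I R (rowmul I R (mat_row I Z i) (scalar_mat I R a)) M"
      using i Z M aR I by (simp add: rowmul_assoc)
    also have "\<dots> = a \<odot>\<^bsub>vec_mod I R\<^esub> (f \<odot>\<^bsub>vec_mod I R\<^esub> unit_row I R i)"
      using i Z M aR I rZM[OF i] by (simp add: rowmul_scalar rowmul_smult)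
    also have "\<dots> = (a \<otimes> f) \<odot>\<^bsub>vec_mod I R\<^esub> unit_row I R i" using f aR V.smult_assoc1 by simp
    finally show "mat_row I (mat_mult I R Z (mat_mult I R (scalar_mat I R a) M)) i = mat_row I (scalar_mat I R (a \<otimes> f)) i"
      using i Z M aR f by (simp add: mat_mult_row mat_row_scalar)
  qed simp_all
  ultimately show ?thesis
    using Y Z M'c I YM' by (intro bexI[of _ "mat_mult I R Z Y"]) (simp_all add: mat_mult_assoc)
qed

text \<open>\<open>T\<close> is the set of rows already decided: those in \<open>J\<close> come from
  E, the others in \<open>T\<close> from 1 - E. Rows outside \<open>T\<close> are still those of the
  identity, so that the selection can proceed by induction on \<open>T\<close>.\<close>

definition split_rows :: "'i set \<Rightarrow> ('i \<times> 'i \<Rightarrow> 'a) \<Rightarrow> 'i set \<Rightarrow> 'i set \<Rightarrow> 'i \<times> 'i \<Rightarrow> 'a" where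
  "split_rows I E T J = (\<lambda>(i, j)\<in>I \<times> I. if i \<in> J then E (i, j)
     else if i \<in> T then unit_row I R i j \<ominus> E (i, j) else unit_row I R i j)"

lemma split_rows_closed:
  assumes "E \<in> I \<times> I \<rightarrow>\<^sub>E carrier R"
  shows "split_rows I E T J \<in> I \<times> I \<rightarrow>\<^sub>E carrier R"
  using mat_mem[OF assms] vec_mem[OF unit_row_closed, of _ I] by (auto simp: split_rows_def)

text \<open>Writing the unit row as the sum of a row of \<^term>\<open>E\<close> and a row of \<open>1 - E\<close>, one of the two
  can replace it without the pivot falling into the prime ideal.\<close>

lemma split_rows_invertible:
  assumes I: "finite I" and E: "E \<in> I \<times> I \<rightarrow>\<^sub>E carrier R" and p: "primeideal p R"
  shows "\<exists>J\<subseteq>I. \<exists>Z\<in>I \<times> I \<rightarrow>\<^sub>E carrier R. \<exists>f\<in>carrier R - p.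
    mat_mult I R (split_rows I E I J) Z = scalar_mat I R f \<and>
    mat_mult I R Z (split_rows I E I J) = scalar_mat I R f"
proof -
  interpret p: primeideal p R by (rule p)
  interpret V: module R "vec_mod I R" by (rule vec_module)
  have "\<exists>J\<subseteq>T. \<exists>Z\<in>I \<times> I \<rightarrow>\<^sub>E carrier R. \<exists>f\<in>carrier R - p.
    mat_mult I R (split_rows I E T J) Z = scalar_mat I R f \<and>
    mat_mult I R Z (split_rows I E T J) = scalar_mat I R f" if "finite T" "T \<subseteq> I" for T
    using that
  proof (induction T rule: finite_induct)
    case empty
    have "split_rows I E {} {} = scalar_mat I R \<one>"
      by (auto simp: split_rows_def scalar_mat_def unit_row_def intro!: restrict_ext)
    moreover have "\<one> \<notin> p" using p.I_notcarr p.one_imp_carrier by blast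
    ultimately show ?case using I by (intro exI[of _ "{}"] conjI bexI[of _ "scalar_mat I R \<one>"] bexI[of _ \<one>])
        (auto simp: mat_mult_one simp del: PiE_iff)
  next
    case (insert t T)
    then obtain J Z f where J: "J \<subseteq> T" and Z: "Z \<in> I \<times> I \<rightarrow>\<^sub>E carrier R" and f: "f \<in> carrier R" "f \<notin> p"
      and MZ: "mat_mult I R (split_rows I E T J) Z = scalar_mat I R f"
      and ZM: "mat_mult I R Z (split_rows I E T J) = scalar_mat I R f" by auto
    have t: "t \<in> I" "t \<notin> T" "t \<notin> J" using insert J by auto
    define u where "u = mat_row I E t"
    define u' where "u' = (\<lambda>j\<in>I. unit_row I R t j \<ominus> E (t, j))"
    have uc: "u \<in> I \<rightarrow>\<^sub>E carrier R" "u' \<in> I \<rightarrow>\<^sub>E carrier R"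
      using t E mat_mem[OF E] vec_mem[OF unit_row_closed, of _ I] by (auto simp: u_def u'_def)
    let ?M = "split_rows I E T J"
    have M: "?M \<in> I \<times> I \<rightarrow>\<^sub>E carrier R" by (rule split_rows_closed[OF E])
    have "u \<oplus>\<^bsub>vec_mod I R\<^esub> u' = mat_row I ?M t"
    proof (rule vec_eqI[where I = I])
      fix j assume j: "j \<in> I"
      have "E (t, j) \<oplus> (unit_row I R t j \<ominus> E (t, j)) = unit_row I R t j"
        using mat_mem[OF E t(1) j] vec_mem[OF unit_row_closed j, of t] by algebra
      then show "(u \<oplus>\<^bsub>vec_mod I R\<^esub> u') j = mat_row I ?M t j"
        using j t by (simp add: u_def u'_def split_rows_def)
    qed simp_all
    then have "rowmul I R u Z \<oplus>\<^bsub>vec_mod I R\<^esub> rowmul I R u' Z = f \<odot>\<^bsub>vec_mod I R\<^esub> unit_row I R t"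
      using rowmul_add[OF uc Z] mat_mult_row[OF t(1) M Z] t f by (simp add: MZ mat_row_scalar)
    from arg_cong[OF this, of "\<lambda>v. v t"]
    have sum: "rowmul I R u Z t \<oplus> rowmul I R u' Z t = f" using t f by (simp add: unit_row_def)
    have cl: "rowmul I R u Z t \<in> carrier R" "rowmul I R u' Z t \<in> carrier R"
      using vec_mem[OF rowmul_closed[OF _ Z] t(1)] uc by auto
    \<comment> \<open>The two pivots add up to \<open>f\<close>, which lies outside
      \<open>p\<close>; hence at least one of them does, and primality keeps its product with
      \<open>f\<close> outside \<open>p\<close>.\<close>
    consider "rowmul I R u Z t \<notin> p" | "rowmul I R u' Z t \<notin> p"
      using sum f p.a_closed by metis
    then show ?case
    proof cases
      case 1
      have eq: "split_rows I E (insert t T) (insert t J) = (\<lambda>(i, j)\<in>I \<times> I. if i = t then u j else ?M (i, j))"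
        using t by (auto simp: split_rows_def u_def intro!: restrict_ext)
      obtain Z' where "Z' \<in> I \<times> I \<rightarrow>\<^sub>E carrier R"
          "mat_mult I R (split_rows I E (insert t T) (insert t J)) Z' = scalar_mat I R (rowmul I R u Z t \<otimes> f)"
          "mat_mult I R Z' (split_rows I E (insert t T) (insert t J)) = scalar_mat I R (rowmul I R u Z t \<otimes> f)"
        using replace_row_invertible[OF I t(1) M Z MZ ZM f(1) uc(1) eq refl] by blast
      moreover have "rowmul I R u Z t \<otimes> f \<in> carrier R - p" using 1 f cl p.I_prime by blast
      moreover have "insert t J \<subseteq> insert t T" using J by auto
      ultimately show ?thesis by blast
    next
      case 2
      have eq: "split_rows I E (insert t T) J = (\<lambda>(i, j)\<in>I \<times> I. if i = t then u' j else ?M (i, j))"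
        using t by (auto simp: split_rows_def u'_def intro!: restrict_ext)
      obtain Z' where "Z' \<in> I \<times> I \<rightarrow>\<^sub>E carrier R"
          "mat_mult I R (split_rows I E (insert t T) J) Z' = scalar_mat I R (rowmul I R u' Z t \<otimes> f)"
          "mat_mult I R Z' (split_rows I E (insert t T) J) = scalar_mat I R (rowmul I R u' Z t \<otimes> f)"
        using replace_row_invertible[OF I t(1) M Z MZ ZM f(1) uc(2) eq refl] by blast
      moreover have "rowmul I R u' Z t \<otimes> f \<in> carrier R - p" using 2 f cl p.I_prime by blast
      moreover have "J \<subseteq> insert t T" using J by auto
      ultimately show ?thesis by blast
    qed
  qed
  from this[OF I order.refl] show ?thesis .
qed

end

section \<open>Lattices in Laurent row vectors\<close>

locale row_lattices = coeff_ring R for R (structure) + fixes n :: nat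
begin

declare One_nat_def [simp del] atLeastAtMost_iff [simp del]

abbreviation V where "V \<equiv> vec_mod {1..n} K"
abbreviation VK where "VK \<equiv> {1..n} \<rightarrow>\<^sub>E carrier K"
abbreviation Lam where "Lam \<equiv> {1..n} \<rightarrow>\<^sub>E carrier K0"
abbreviation "GL \<equiv> Units (mat_monoid n K)"

definition rowlat :: "(nat \<times> nat \<Rightarrow> int \<Rightarrow> 'a) \<Rightarrow> (nat \<Rightarrow> int \<Rightarrow> 'a) set" where
  "rowlat g = {w \<in> VK. rowmul {1..n} K w g \<in> Lam}"

definition K0_submodule :: "(nat \<Rightarrow> int \<Rightarrow> 'a) set \<Rightarrow> bool" where
  "K0_submodule W \<longleftrightarrow> W \<subseteq> Lam \<and> \<zero>\<^bsub>V\<^esub> \<in> W \<and> (\<forall>v\<in>W. \<forall>w\<in>W. v \<oplus>\<^bsub>V\<^esub> w \<in> W) \<and> (\<forall>a\<in>carrier K0. \<forall>w\<in>W. a \<odot>\<^bsub>V\<^esub> w \<in> W)"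

definition lincomb :: "'s set \<Rightarrow> ('s \<Rightarrow> int \<Rightarrow> 'a) \<Rightarrow> ('s \<Rightarrow> nat \<Rightarrow> int \<Rightarrow> 'a) \<Rightarrow> nat \<Rightarrow> int \<Rightarrow> 'a" where
  "lincomb S a u = (\<lambda>i\<in>{1..n}. \<Oplus>\<^bsub>K\<^esub>s\<in>S. a s \<otimes>\<^bsub>K\<^esub> u s i)"

sublocale V: module K V by (rule K.vec_module)

lemma Lam_VK: "w \<in> Lam \<Longrightarrow> w \<in> VK"
  by (auto simp: PiE_iff)

lemma VK_coeff: "w \<in> VK \<Longrightarrow> i \<in> {1..n} \<Longrightarrow> w i k \<in> carrier R"
  by (rule laurent_coeff_closed[OF K.vec_mem])

lemma Lam_coeff: "w \<in> Lam \<Longrightarrow> i \<in> {1..n} \<Longrightarrow> w i k \<in> carrier R"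
  by (rule VK_coeff[OF Lam_VK])

lemma Lam_neg: "w \<in> Lam \<Longrightarrow> i \<in> {1..n} \<Longrightarrow> k < 0 \<Longrightarrow> w i k = \<zero>"
  by (auto simp: PiE_iff K0_carrier)

lemma V_eqI:
  assumes "v \<in> extensional {1..n}" "w \<in> extensional {1..n}" "\<And>i k. i \<in> {1..n} \<Longrightarrow> v i k = w i k"
  shows "v = w"
  using assms by (intro vec_eqI[where I = "{1..n}"]) auto

lemma V_smult_lmon:
  assumes "w \<in> VK" "c \<in> carrier R" "i \<in> {1..n}"
  shows "(lmon c k \<odot>\<^bsub>V\<^esub> w) i j = c \<otimes> w i (j - k)"
  using assms lmon_mult[OF assms(2) K.vec_mem[OF assms(1,3)]] by simp

lemma Lam_submodule: "K0_submodule Lam"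
  unfolding K0_submodule_def
proof (intro conjI ballI)
  show "a \<odot>\<^bsub>V\<^esub> w \<in> Lam" if "a \<in> carrier K0" "w \<in> Lam" for a w
    using that K0.vec_mem[OF that(2)] by (intro PiE_I) (auto simp: vec_mod_def)
  show "v \<oplus>\<^bsub>V\<^esub> w \<in> Lam" if "v \<in> Lam" "w \<in> Lam" for v w
    using K0.vec_mem[OF that(1)] K0.vec_mem[OF that(2)] by (intro PiE_I) (auto simp: vec_mod_def)
  show "\<zero>\<^bsub>V\<^esub> \<in> Lam" using K0.zero_closed by (auto simp: vec_mod_def)
qed simp

lemma lincomb_closed:
  assumes "\<And>s. s \<in> S \<Longrightarrow> a s \<in> carrier K" "\<And>s. s \<in> S \<Longrightarrow> u s \<in> VK"
  shows "lincomb S a u \<in> VK"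
proof -
  have "a s \<otimes>\<^bsub>K\<^esub> u s i \<in> carrier K" if "s \<in> S" "i \<in> {1..n}" for s i
    using assms(1)[OF that(1)] K.vec_mem[OF assms(2)[OF that(1)] that(2)] by simp
  then show ?thesis by (auto simp: lincomb_def intro!: K.finsum_closed)
qed

lemma lincomb_coeff:
  assumes "\<And>s. s \<in> S \<Longrightarrow> a s \<in> carrier K" "\<And>s. s \<in> S \<Longrightarrow> u s \<in> VK" "i \<in> {1..n}"
  shows "lincomb S a u i k = (\<Oplus>s\<in>S. (a s \<otimes>\<^bsub>K\<^esub> u s i) k)"
proof -
  have "a s \<otimes>\<^bsub>K\<^esub> u s i \<in> carrier K" if "s \<in> S" for s
    using assms(1)[OF that] K.vec_mem[OF assms(2)[OF that] assms(3)] by simp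
  then show ?thesis using assms(3) by (simp add: lincomb_def laurent_finsum_coeff)
qed

lemma lincomb_insert:
  assumes "finite S" "s \<notin> S" "\<And>t. t \<in> insert s S \<Longrightarrow> a t \<in> carrier K" "\<And>t. t \<in> insert s S \<Longrightarrow> u t \<in> VK"
  shows "lincomb (insert s S) a u = (a s \<odot>\<^bsub>V\<^esub> u s) \<oplus>\<^bsub>V\<^esub> lincomb S a u"
proof (rule vec_eqI[where I = "{1..n}"])
  fix i assume i: "i \<in> {1..n}"
  have "(\<Oplus>\<^bsub>K\<^esub>t\<in>insert s S. a t \<otimes>\<^bsub>K\<^esub> u t i) = a s \<otimes>\<^bsub>K\<^esub> u s i \<oplus>\<^bsub>K\<^esub> (\<Oplus>\<^bsub>K\<^esub>t\<in>S. a t \<otimes>\<^bsub>K\<^esub> u t i)"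
    using assms(1-3) K.vec_mem[OF assms(4) i] by (intro K.finsum_insert) auto
  then show "lincomb (insert s S) a u i = ((a s \<odot>\<^bsub>V\<^esub> u s) \<oplus>\<^bsub>V\<^esub> lincomb S a u) i"
    using i by (simp add: lincomb_def)
qed (auto simp: lincomb_def)

lemma lincomb_empty: "lincomb {} a u = \<zero>\<^bsub>V\<^esub>"
  by (auto simp: lincomb_def vec_mod_def)

lemma lincomb_in_submodule:
  assumes W: "K0_submodule W" and "finite S" "\<And>s. s \<in> S \<Longrightarrow> a s \<in> carrier K0" "\<And>s. s \<in> S \<Longrightarrow> u s \<in> W"
  shows "lincomb S a u \<in> W"
  using assms(2-)
proof (induction S rule: finite_induct)
  case empty
  then show ?case using W by (simp add: K0_submodule_def lincomb_empty)
next
  case (insert s S)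
  have uV: "u t \<in> VK" if "t \<in> insert s S" for t
    by (rule Lam_VK) (use W insert.prems(2)[OF that] in \<open>auto simp: K0_submodule_def\<close>)
  have aK: "\<And>t. t \<in> insert s S \<Longrightarrow> a t \<in> carrier K" by (rule K0_closed, rule insert.prems(1))
  have "lincomb (insert s S) a u = (a s \<odot>\<^bsub>V\<^esub> u s) \<oplus>\<^bsub>V\<^esub> lincomb S a u"
    using insert.hyps aK uV by (rule lincomb_insert)
  then show ?case using insert W by (auto simp: K0_submodule_def)
qed

text \<open>Linearity in the single form a + c b: c is a power of \<epsilon> in the adic arguments,
  -1 for differences, and a constant for linearity over \<open>R\<close>.\<close>

lemma lincomb_shift:
  assumes S: "finite S" and a: "\<And>d. d \<in> S \<Longrightarrow> a d \<in> carrier K" and b: "\<And>d. d \<in> S \<Longrightarrow> b d \<in> carrier K"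
    and c: "c \<in> carrier K" and u: "\<And>d. d \<in> S \<Longrightarrow> u d \<in> VK"
  shows "lincomb S (\<lambda>d. a d \<oplus>\<^bsub>K\<^esub> c \<otimes>\<^bsub>K\<^esub> b d) u = lincomb S a u \<oplus>\<^bsub>V\<^esub> c \<odot>\<^bsub>V\<^esub> lincomb S b u"
proof (rule vec_eqI[where I = "{1..n}"])
  fix i assume i: "i \<in> {1..n}"
  note u = K.vec_mem[OF u i]
  have "(\<Oplus>\<^bsub>K\<^esub>d\<in>S. (a d \<oplus>\<^bsub>K\<^esub> c \<otimes>\<^bsub>K\<^esub> b d) \<otimes>\<^bsub>K\<^esub> u d i)
      = (\<Oplus>\<^bsub>K\<^esub>d\<in>S. a d \<otimes>\<^bsub>K\<^esub> u d i \<oplus>\<^bsub>K\<^esub> c \<otimes>\<^bsub>K\<^esub> (b d \<otimes>\<^bsub>K\<^esub> u d i))"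
    using a b c u by (intro K.finsum_cong') (simp_all add: K.l_distr K.m_assoc)
  also have "\<dots> = (\<Oplus>\<^bsub>K\<^esub>d\<in>S. a d \<otimes>\<^bsub>K\<^esub> u d i) \<oplus>\<^bsub>K\<^esub> (\<Oplus>\<^bsub>K\<^esub>d\<in>S. c \<otimes>\<^bsub>K\<^esub> (b d \<otimes>\<^bsub>K\<^esub> u d i))"
    using a b c u by (intro K.finsum_addf) auto
  also have "(\<Oplus>\<^bsub>K\<^esub>d\<in>S. c \<otimes>\<^bsub>K\<^esub> (b d \<otimes>\<^bsub>K\<^esub> u d i)) = c \<otimes>\<^bsub>K\<^esub> (\<Oplus>\<^bsub>K\<^esub>d\<in>S. b d \<otimes>\<^bsub>K\<^esub> u d i)"
    using b c u S by (intro K.finsum_rdistr[symmetric]) auto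
  finally show "lincomb S (\<lambda>d. a d \<oplus>\<^bsub>K\<^esub> c \<otimes>\<^bsub>K\<^esub> b d) u i = (lincomb S a u \<oplus>\<^bsub>V\<^esub> c \<odot>\<^bsub>V\<^esub> lincomb S b u) i"
    using i by (simp add: lincomb_def)
qed (auto simp: lincomb_def)

lemma lincomb_cong:
  assumes "\<And>d. d \<in> S \<Longrightarrow> a d = b d" "\<And>d. d \<in> S \<Longrightarrow> b d \<in> carrier K" "\<And>d. d \<in> S \<Longrightarrow> u d \<in> VK"
  shows "lincomb S a u = lincomb S b u"
  unfolding lincomb_def
  by (rule restrict_ext, rule K.finsum_cong') (use assms(1,2) K.vec_mem[OF assms(3)] in auto)

lemma lincomb_zero:
  assumes "\<And>d. d \<in> S \<Longrightarrow> a d = \<zero>\<^bsub>K\<^esub>" "\<And>d. d \<in> S \<Longrightarrow> u d \<in> VK"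
  shows "lincomb S a u = \<zero>\<^bsub>V\<^esub>"
  by (rule vec_eqI[where I = "{1..n}"])
    (use assms(1) K.vec_mem[OF assms(2)] in \<open>auto simp: lincomb_def intro!: K.add.finprod_one_eqI\<close>)

text \<open>Degrees 0 to \<open>k\<close> inclusive. In the applications \<epsilon>^k times every
  integral vector lies in the lattice W, so multiples of \<epsilon>^(k+1) lie in \<epsilon>W and
  only these coefficients matter modulo \<epsilon>W.\<close>

definition cidx :: "nat \<Rightarrow> (nat \<times> int) set" where
  "cidx k = {1..n} \<times> {0..int k}"

definition coeffs :: "nat \<Rightarrow> (nat \<Rightarrow> int \<Rightarrow> 'a) \<Rightarrow> nat \<times> int \<Rightarrow> 'a" where
  "coeffs k w = (\<lambda>(i, a)\<in>cidx k. w i a)"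

definition from_coeffs :: "nat \<Rightarrow> (nat \<times> int \<Rightarrow> 'a) \<Rightarrow> nat \<Rightarrow> int \<Rightarrow> 'a" where
  "from_coeffs k x = (\<lambda>i\<in>{1..n}. \<lambda>a. if (i, a) \<in> cidx k then x (i, a) else \<zero>)"

lemma finite_cidx [simp]: "finite (cidx k)"
  by (simp add: cidx_def)

lemma cidxD: "(i, a) \<in> cidx k \<Longrightarrow> i \<in> {1..n}" "(i, a) \<in> cidx k \<Longrightarrow> 0 \<le> a \<and> a \<le> int k"
  by (auto simp: cidx_def atLeastAtMost_iff)

lemma coeffs_closed [simp]: "w \<in> VK \<Longrightarrow> coeffs k w \<in> cidx k \<rightarrow>\<^sub>E carrier R"
  using VK_coeff by (auto simp: coeffs_def cidx_def)

lemma from_coeffs_closed [simp]: "x \<in> cidx k \<rightarrow>\<^sub>E carrier R \<Longrightarrow> from_coeffs k x \<in> Lam"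
  using vec_mem[of x "cidx k"] by (fastforce simp: from_coeffs_def K0_carrier_iff dest: cidxD)

lemma coeffs_from_coeffs [simp]: "x \<in> cidx k \<rightarrow>\<^sub>E carrier R \<Longrightarrow> coeffs k (from_coeffs k x) = x"
  by (rule vec_eqI[where I = "cidx k"]) (auto simp: coeffs_def from_coeffs_def PiE_iff dest: cidxD)

end

text \<open>The rows of \<^term>\<open>E\<close> span a complement of \<open>\<epsilon>W\<close> in \<^term>\<open>W\<close>.\<close>

locale split_lattice = row_lattices +
  fixes W :: "(nat \<Rightarrow> int \<Rightarrow> 'a) set" and k :: nat and E :: "(nat \<times> int) \<times> (nat \<times> int) \<Rightarrow> 'a"
  assumes W: "K0_submodule W"
    and W_deep: "\<And>w. w \<in> Lam \<Longrightarrow> lmon \<one> (int k) \<odot>\<^bsub>V\<^esub> w \<in> W"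
    and E: "E \<in> cidx k \<times> cidx k \<rightarrow>\<^sub>E carrier R"
    and E_idem: "mat_mult (cidx k) R E E = E"
    and E_row: "\<And>d. d \<in> cidx k \<Longrightarrow> from_coeffs k (mat_row (cidx k) E d) \<in> W"
    and E_split: "\<And>w. w \<in> W \<Longrightarrow> \<exists>w'\<in>W. w = from_coeffs k (rowmul (cidx k) R (coeffs k w) E) \<oplus>\<^bsub>V\<^esub> lmon \<one> 1 \<odot>\<^bsub>V\<^esub> w'"
    and E_eps: "\<And>w. w \<in> W \<Longrightarrow> rowmul (cidx k) R (coeffs k (lmon \<one> 1 \<odot>\<^bsub>V\<^esub> w)) E = \<zero>\<^bsub>vec_mod (cidx k) R\<^esub>"
begin

definition brow :: "nat \<times> int \<Rightarrow> nat \<Rightarrow> int \<Rightarrow> 'a" where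
  "brow d = from_coeffs k (mat_row (cidx k) E d)"

lemma W_Lam: "w \<in> W \<Longrightarrow> w \<in> Lam" and W_VK: "w \<in> W \<Longrightarrow> w \<in> VK"
  using W Lam_VK by (auto simp: K0_submodule_def)

lemma brow_W: "d \<in> cidx k \<Longrightarrow> brow d \<in> W"
  using E_row by (simp add: brow_def)

lemma brow_VK: "d \<in> cidx k \<Longrightarrow> brow d \<in> VK"
  using brow_W W_VK by blast

lemma lincomb_const_coeff:
  assumes "J \<subseteq> cidx k" "\<And>d. d \<in> J \<Longrightarrow> c d \<in> carrier R" "i \<in> {1..n}"
  shows "lincomb J (\<lambda>d. lmon (c d) 0) brow i a =
    (if (i, a) \<in> cidx k then (\<Oplus>d\<in>J. c d \<otimes> E (d, (i, a))) else \<zero>)"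
proof -
  have JV: "\<And>d. d \<in> J \<Longrightarrow> brow d \<in> VK" using assms(1) brow_VK by blast
  have Em: "\<And>d e. d \<in> J \<Longrightarrow> e \<in> cidx k \<Longrightarrow> E (d, e) \<in> carrier R" using mat_mem[OF E] assms(1) by blast
  have "lincomb J (\<lambda>d. lmon (c d) 0) brow i a = (\<Oplus>d\<in>J. (lmon (c d) 0 \<otimes>\<^bsub>K\<^esub> brow d i) a)"
    using assms(2,3) JV by (intro lincomb_coeff) auto
  also have "\<dots> = (\<Oplus>d\<in>J. if (i, a) \<in> cidx k then c d \<otimes> E (d, (i, a)) else \<zero>)"
  proof (rule finsum_cong')
    fix d assume d: "d \<in> J"
    have "(lmon (c d) 0 \<otimes>\<^bsub>K\<^esub> brow d i) a = c d \<otimes> brow d i a"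
      using lmon_mult[OF assms(2)[OF d] K.vec_mem[OF JV[OF d] assms(3)]] by simp
    then show "(lmon (c d) 0 \<otimes>\<^bsub>K\<^esub> brow d i) a = (if (i, a) \<in> cidx k then c d \<otimes> E (d, (i, a)) else \<zero>)"
      using assms(2)[OF d] assms(3) by (simp add: brow_def from_coeffs_def)
  qed (use assms(2) Em in simp_all)
  finally show ?thesis by simp
qed

text \<open>Write the coefficients x of w as y M, where M is the matrix of selected rows. Applying E
  fixes the rows of M taken from E and kills those taken from 1 - E, because E is idempotent. So xE
  is a combination of the rows in \<open>J\<close> alone, and it represents w modulo
  \<epsilon>W.\<close>

lemma W_generated_step:
  assumes J: "J \<subseteq> cidx k" and Z: "Z \<in> cidx k \<times> cidx k \<rightarrow>\<^sub>E carrier R" and f: "f \<in> Units R"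
    and ZM: "mat_mult (cidx k) R Z (split_rows (cidx k) E (cidx k) J) = scalar_mat (cidx k) R f"
    and w: "w \<in> W"
  shows "\<exists>c\<in>J \<rightarrow> carrier R. \<exists>w'\<in>W. w = lincomb J (\<lambda>d. lmon (c d) 0) brow \<oplus>\<^bsub>V\<^esub> lmon \<one> 1 \<odot>\<^bsub>V\<^esub> w'"
proof -
  let ?D = "cidx k" and ?M = "split_rows (cidx k) E (cidx k) J"
  interpret D: module R "vec_mod ?D R" by (rule vec_module)
  have JD: "d \<in> ?D" if "d \<in> J" for d using J that by blast
  have M: "?M \<in> ?D \<times> ?D \<rightarrow>\<^sub>E carrier R" by (rule split_rows_closed[OF E])
  define x where "x = coeffs k w"
  have x: "x \<in> ?D \<rightarrow>\<^sub>E carrier R" using w W_VK by (simp add: x_def)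
  define y where "y = inv f \<odot>\<^bsub>vec_mod ?D R\<^esub> rowmul ?D R x Z"
  have fR: "f \<in> carrier R" "inv f \<in> carrier R" using f by auto
  have y: "y \<in> ?D \<rightarrow>\<^sub>E carrier R" using D.smult_closed[of "inv f" "rowmul ?D R x Z"] x Z fR by (simp add: y_def)
  have yM: "rowmul ?D R y ?M = x"
  proof -
    have "rowmul ?D R y ?M = inv f \<odot>\<^bsub>vec_mod ?D R\<^esub> (f \<odot>\<^bsub>vec_mod ?D R\<^esub> x)"
      using x Z M fR by (simp add: y_def rowmul_smult rowmul_assoc ZM rowmul_scalar)
    also have "\<dots> = (inv f \<otimes> f) \<odot>\<^bsub>vec_mod ?D R\<^esub> x" using x fR D.smult_assoc1 by simp
    also have "inv f \<otimes> f = \<one>" using f by simp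
    finally show ?thesis using x by simp
  qed
  have ME: "mat_row ?D (mat_mult ?D R ?M E) d = (if d \<in> J then mat_row ?D E d else \<zero>\<^bsub>vec_mod ?D R\<^esub>)"
    if d: "d \<in> ?D" for d
  proof (cases "d \<in> J")
    case True
    have "mat_row ?D ?M d = mat_row ?D E d"
      by (rule vec_eqI[where I = ?D]) (use True d in \<open>auto simp: split_rows_def\<close>)
    then have "mat_row ?D (mat_mult ?D R ?M E) d = mat_row ?D (mat_mult ?D R E E) d"
      using d E M by (simp add: mat_mult_row)
    then show ?thesis using True E_idem by simp
  next
    case False
    have "mat_row ?D ?M d \<oplus>\<^bsub>vec_mod ?D R\<^esub> mat_row ?D E d = unit_row ?D R d"
    proof (rule vec_eqI[where I = ?D])
      fix j assume j: "j \<in> ?D"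
      have "unit_row ?D R d j \<ominus> E (d, j) \<oplus> E (d, j) = unit_row ?D R d j"
        using mat_mem[OF E d j] vec_mem[OF unit_row_closed j, of d] by algebra
      then show "(mat_row ?D ?M d \<oplus>\<^bsub>vec_mod ?D R\<^esub> mat_row ?D E d) j = unit_row ?D R d j"
        using False d j by (simp add: split_rows_def)
    qed simp_all
    then have "rowmul ?D R (mat_row ?D ?M d) E \<oplus>\<^bsub>vec_mod ?D R\<^esub> rowmul ?D R (mat_row ?D E d) E = mat_row ?D E d"
      using rowmul_add[of "mat_row ?D ?M d" ?D "mat_row ?D E d" E] rowmul_unit_row[OF finite_cidx d E] M E d by simp
    moreover have "rowmul ?D R (mat_row ?D E d) E = mat_row ?D E d"
      using mat_mult_row[OF d E E] E_idem by simp
    moreover have "rowmul ?D R (mat_row ?D ?M d) E \<in> ?D \<rightarrow>\<^sub>E carrier R" "mat_row ?D E d \<in> ?D \<rightarrow>\<^sub>E carrier R"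
      using M E d by simp_all
    ultimately have "rowmul ?D R (mat_row ?D ?M d) E = \<zero>\<^bsub>vec_mod ?D R\<^esub>"
      using D.M.add.r_cancel_one[of "mat_row ?D E d" "rowmul ?D R (mat_row ?D ?M d) E"] by simp
    then show ?thesis using False d M E by (simp add: mat_mult_row)
  qed
  have xE: "rowmul ?D R x E e = (\<Oplus>d\<in>J. y d \<otimes> E (d, e))" if e: "e \<in> ?D" for e
  proof -
    have ent: "mat_mult ?D R ?M E (d, e) = (if d \<in> J then E (d, e) else \<zero>)" if "d \<in> ?D" for d
      using arg_cong[OF ME[OF that], of "\<lambda>v. v e"] e by (auto split: if_splits)
    have "rowmul ?D R x E = rowmul ?D R y (mat_mult ?D R ?M E)"
      unfolding yM[symmetric] using y M E by (simp add: rowmul_assoc)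
    then have "rowmul ?D R x E e = (\<Oplus>d\<in>?D. y d \<otimes> mat_mult ?D R ?M E (d, e))"
      using e by (simp add: rowmul_def)
    also have "\<dots> = (\<Oplus>d\<in>?D. if d \<in> J then y d \<otimes> E (d, e) else \<zero>)"
      using vec_mem[OF y] mat_mem[OF E _ e] by (intro finsum_cong') (simp_all add: ent)
    also have "\<dots> = (\<Oplus>d\<in>J. if d \<in> J then y d \<otimes> E (d, e) else \<zero>)"
      using J JD vec_mem[OF y] mat_mem[OF E _ e] by (intro finsum_mono_neutral[symmetric]) simp_all
    also have "\<dots> = (\<Oplus>d\<in>J. y d \<otimes> E (d, e))"
      using JD vec_mem[OF y] mat_mem[OF E _ e] by (intro finsum_cong') simp_all
    finally show ?thesis .
  qed
  have "from_coeffs k (rowmul ?D R x E) = lincomb J (\<lambda>d. lmon (y d) 0) brow"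
  proof (rule V_eqI)
    fix i a assume i: "i \<in> {1..n}"
    show "from_coeffs k (rowmul ?D R x E) i a = lincomb J (\<lambda>d. lmon (y d) 0) brow i a"
      using i J vec_mem[OF y] by (subst lincomb_const_coeff) (auto simp: from_coeffs_def xE)
  qed (auto simp: from_coeffs_def lincomb_def)
  moreover have "y \<in> J \<rightarrow> carrier R" using vec_mem[OF y] J by blast
  ultimately show ?thesis using E_split[OF w] unfolding x_def[symmetric] by auto
qed

text \<open>Apply E to the relation: the left side is fixed by E and the right side is killed. Hence
  y E = 0 for the coefficient vector y. Since y is supported on \<open>J\<close>, it gives the same
  product with E and with the matrix of selected rows, and the latter is invertible.\<close>

lemma brow_independent_mod_eps:
  assumes J: "J \<subseteq> cidx k" and Z: "Z \<in> cidx k \<times> cidx k \<rightarrow>\<^sub>E carrier R" and f: "f \<in> Units R"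
    and MZ: "mat_mult (cidx k) R (split_rows (cidx k) E (cidx k) J) Z = scalar_mat (cidx k) R f"
    and w: "w \<in> W" and c: "c \<in> J \<rightarrow> carrier R"
    and eq: "lincomb J (\<lambda>d. lmon (c d) 0) brow = lmon \<one> 1 \<odot>\<^bsub>V\<^esub> w"
  shows "\<forall>d\<in>J. c d = \<zero>"
proof -
  let ?D = "cidx k" and ?M = "split_rows (cidx k) E (cidx k) J"
  interpret D: module R "vec_mod ?D R" by (rule vec_module)
  have JD: "d \<in> ?D" if "d \<in> J" for d using J that by blast
  have M: "?M \<in> ?D \<times> ?D \<rightarrow>\<^sub>E carrier R" by (rule split_rows_closed[OF E])
  define y where "y = (\<lambda>d\<in>?D. if d \<in> J then c d else \<zero>)"
  have y: "y \<in> ?D \<rightarrow>\<^sub>E carrier R" using c by (auto simp: y_def)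
  have cR: "c d \<in> carrier R" if "d \<in> J" for d using c that by (rule Pi_mem)
  have red: "rowmul ?D R y N e = (\<Oplus>d\<in>J. c d \<otimes> E (d, e))"
    if e: "e \<in> ?D" and N: "\<And>d. d \<in> J \<Longrightarrow> N (d, e) = E (d, e)" "\<And>d. d \<in> ?D \<Longrightarrow> N (d, e) \<in> carrier R" for N e
  proof -
    have "(\<Oplus>d\<in>J. y d \<otimes> N (d, e)) = (\<Oplus>d\<in>?D. y d \<otimes> N (d, e))"
      using J JD N(2) vec_mem[OF y] cR by (intro finsum_mono_neutral) (simp_all add: y_def)
    moreover have "(\<Oplus>d\<in>J. y d \<otimes> N (d, e)) = (\<Oplus>d\<in>J. c d \<otimes> E (d, e))"
      using JD N(1) cR mat_mem[OF E _ e] by (intro finsum_cong') (simp_all add: y_def)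
    ultimately show ?thesis using e by (simp add: rowmul_def)
  qed
  have yE: "rowmul ?D R y E = coeffs k (lmon \<one> 1 \<odot>\<^bsub>V\<^esub> w)"
  proof (rule vec_eqI[where I = ?D])
    fix e assume e: "e \<in> ?D"
    obtain i a where ia: "e = (i, a)" by (cases e)
    then have "lincomb J (\<lambda>d. lmon (c d) 0) brow i a = (\<Oplus>d\<in>J. c d \<otimes> E (d, e))"
      using e J c cidxD(1)[of i a k] by (subst lincomb_const_coeff) auto
    then show "rowmul ?D R y E e = coeffs k (lmon \<one> 1 \<odot>\<^bsub>V\<^esub> w) e"
      using red[OF e, of E] mat_mem[OF E _ e] e ia by (simp add: coeffs_def eq)
  qed (auto simp: coeffs_def)
  have "rowmul ?D R y E = rowmul ?D R (rowmul ?D R y E) E"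
    using y E by (simp add: rowmul_assoc E_idem)
  also have "\<dots> = \<zero>\<^bsub>vec_mod ?D R\<^esub>" unfolding yE using E_eps w by simp
  finally have yE0: "rowmul ?D R y E = \<zero>\<^bsub>vec_mod ?D R\<^esub>" .
  have "rowmul ?D R y ?M = rowmul ?D R y E"
  proof (rule vec_eqI[where I = ?D])
    fix e assume e: "e \<in> ?D"
    show "rowmul ?D R y ?M e = rowmul ?D R y E e"
      using red[OF e, of ?M] red[OF e, of E] mat_mem[OF E _ e] mat_mem[OF M _ e] e JD
      by (simp add: split_rows_def)
  qed simp_all
  then have "rowmul ?D R (rowmul ?D R y ?M) Z = rowmul ?D R \<zero>\<^bsub>vec_mod ?D R\<^esub> Z" using yE0 by simp
  moreover have "rowmul ?D R \<zero>\<^bsub>vec_mod ?D R\<^esub> Z = \<zero>\<^bsub>vec_mod ?D R\<^esub>"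
  proof (rule vec_eqI[where I = ?D])
    fix e assume e: "e \<in> ?D"
    have "(\<Oplus>d\<in>?D. \<zero>\<^bsub>vec_mod ?D R\<^esub> d \<otimes> Z (d, e)) = (\<Oplus>d\<in>?D. \<zero>)"
      using mat_mem[OF Z _ e] by (intro finsum_cong') auto
    then show "rowmul ?D R \<zero>\<^bsub>vec_mod ?D R\<^esub> Z e = \<zero>\<^bsub>vec_mod ?D R\<^esub> e" using e by (simp add: rowmul_def)
  qed simp_all
  moreover have "rowmul ?D R (rowmul ?D R y ?M) Z = f \<odot>\<^bsub>vec_mod ?D R\<^esub> y"
    using y M Z f by (simp add: rowmul_assoc MZ rowmul_scalar Units_closed)
  ultimately have fy: "f \<odot>\<^bsub>vec_mod ?D R\<^esub> y = \<zero>\<^bsub>vec_mod ?D R\<^esub>" by simp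
  show ?thesis
  proof
    fix d assume d: "d \<in> J"
    then have "f \<otimes> c d = \<zero>" using arg_cong[OF fy, of "\<lambda>v. v d"] J by (auto simp: y_def)
    then have "inv f \<otimes> (f \<otimes> c d) = \<zero>" using f by simp
    moreover have "inv f \<otimes> (f \<otimes> c d) = c d" using f cR[OF d] by (simp add: m_assoc[symmetric] Units_closed)
    ultimately show "c d = \<zero>" by simp
  qed
qed

end

text \<open>Separate from \<open>split_lattice\<close> because the scalar \<open>f\<close> need not
  be a unit over the ring where the projector and the selection of rows are found. The locale is
  entered after \<open>f\<close> has been inverted.\<close>

locale split_lattice_basis = split_lattice +
  fixes J Z f
  assumes J: "J \<subseteq> cidx k" and Z: "Z \<in> cidx k \<times> cidx k \<rightarrow>\<^sub>E carrier R" and f: "f \<in> Units R"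
    and MZ: "mat_mult (cidx k) R (split_rows (cidx k) E (cidx k) J) Z = scalar_mat (cidx k) R f"
    and ZM: "mat_mult (cidx k) R Z (split_rows (cidx k) E (cidx k) J) = scalar_mat (cidx k) R f"
begin

lemma finite_J: "finite J" using J finite_cidx finite_subset by blast

lemma J_cidx: "d \<in> J \<Longrightarrow> d \<in> cidx k" using J by blast

lemma J_VK: "d \<in> J \<Longrightarrow> brow d \<in> VK" using J_cidx brow_VK by blast

lemma lincomb_Lam:
  assumes "\<And>d. d \<in> J \<Longrightarrow> a d \<in> carrier K0"
  shows "lincomb J a brow \<in> W"
  by (rule lincomb_in_submodule[OF W finite_J]) (use assms brow_W J_cidx in auto)

lemma W_generated:
  assumes "w \<in> W"
  obtains a where "\<And>d. d \<in> J \<Longrightarrow> a d \<in> carrier K0" "w = lincomb J a brow"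
proof -
  obtain C N where CN: "\<And>w. w \<in> W \<Longrightarrow> C w \<in> J \<rightarrow> carrier R" "\<And>w. w \<in> W \<Longrightarrow> N w \<in> W"
    "\<And>w. w \<in> W \<Longrightarrow> w = lincomb J (\<lambda>d. lmon (C w d) 0) brow \<oplus>\<^bsub>V\<^esub> lmon \<one> 1 \<odot>\<^bsub>V\<^esub> N w"
    using W_generated_step[OF J Z f ZM] by metis
  \<comment> \<open>\<open>N w\<close> is the remainder after one approximation step, and the
    constants extracted from the j-th iterated remainder become the coefficients of \<epsilon>^j. No
    convergence is at stake, since each coefficient is fixed by a single step.\<close>
  define a where "a w d k = (if k < 0 then \<zero> else C ((N ^^ nat k) w) d)" for w d and k :: int
  have NW: "(N ^^ t) w \<in> W" if "w \<in> W" for t w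
    using that by (induction t) (auto intro: CN)
  have aK0: "a w d \<in> carrier K0" if "w \<in> W" "d \<in> J" for w d
    using CN(1)[OF NW[OF that(1)]] that(2) by (auto simp: a_def K0_carrier_iff)
  have aK: "a w d \<in> carrier K" if "w \<in> W" "d \<in> J" for w d
    using aK0[OF that] by simp
  have CR: "C w d \<in> carrier R" if "w \<in> W" "d \<in> J" for w d
    using CN(1)[OF that(1)] that(2) by (rule Pi_mem)
  have a_rec: "a w d = lmon (C w d) 0 \<oplus>\<^bsub>K\<^esub> lmon \<one> 1 \<otimes>\<^bsub>K\<^esub> a (N w) d" if w: "w \<in> W" and d: "d \<in> J" for w d
  proof
    fix j :: int
    have nw: "a (N w) d (j - 1) \<in> carrier R" using aK[OF CN(2)[OF w] d] by simp
    have "(lmon (C w d) 0 \<oplus>\<^bsub>K\<^esub> lmon \<one> 1 \<otimes>\<^bsub>K\<^esub> a (N w) d) j = lmon (C w d) 0 j \<oplus> a (N w) d (j - 1)"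
      using lmon_mult[OF one_closed aK[OF CN(2)[OF w] d], of 1] nw by (simp add: laurent_add)
    also have "\<dots> = a w d j"
    proof (cases "j \<le> 0")
      case True
      then show ?thesis using CR[OF w d] by (auto simp: lmon_def a_def)
    next
      case False
      then have "nat j = Suc (nat (j - 1))" by simp
      then show ?thesis using False CR[OF NW[OF w] d, of "nat j"]
        by (simp add: lmon_def a_def funpow_swap1)
    qed
    finally show "a w d j = (lmon (C w d) 0 \<oplus>\<^bsub>K\<^esub> lmon \<one> 1 \<otimes>\<^bsub>K\<^esub> a (N w) d) j" by simp
  qed
  have rec: "lincomb J (a w) brow = lincomb J (\<lambda>d. lmon (C w d) 0) brow \<oplus>\<^bsub>V\<^esub> lmon \<one> 1 \<odot>\<^bsub>V\<^esub> lincomb J (a (N w)) brow"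
    if w: "w \<in> W" for w
  proof -
    have "lincomb J (a w) brow = lincomb J (\<lambda>d. lmon (C w d) 0 \<oplus>\<^bsub>K\<^esub> lmon \<one> 1 \<otimes>\<^bsub>K\<^esub> a (N w) d) brow"
      unfolding lincomb_def
      by (rule restrict_ext, rule K.finsum_cong')
        (use a_rec[OF w] aK[OF w] K.vec_mem[OF J_VK] in \<open>simp_all add: Pi_def flip: a_rec[OF w]\<close>)
    then show ?thesis
      using lincomb_shift[OF finite_J, of "\<lambda>d. lmon (C w d) 0" "a (N w)" "lmon \<one> 1" brow] CR[OF w] aK[OF CN(2)[OF w]] J_VK by simp
  qed
  have inL: "lincomb J (a w) brow \<in> Lam" if "w \<in> W" for w
    by (rule W_Lam, rule lincomb_Lam) (rule aK0[OF that])
  \<comment> \<open>Agreement is proved degree by degree; the shift by one lets the induction start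
    in degree -1, where both sides vanish.\<close>
  have main: "lincomb J (a w) brow i (int t - 1) = w i (int t - 1)" if "w \<in> W" "i \<in> {1..n}" for w i t
    using that
  proof (induction t arbitrary: w)
    case 0
    then show ?case using Lam_neg[OF inL] Lam_neg[OF W_Lam] by simp
  next
    case (Suc t)
    let ?s = "lincomb J (\<lambda>d. lmon (C w d) 0) brow"
    note i = Suc.prems(2) and nw = CN(2)[OF Suc.prems(1)]
    have 1: "lincomb J (a w) brow i (int t) = ?s i (int t) \<oplus> lincomb J (a (N w)) brow i (int t - 1)"
      using arg_cong[OF rec[OF Suc.prems(1)], of "\<lambda>v. v i (int t)"] i
        lmon_mult[OF one_closed K.vec_mem[OF Lam_VK[OF inL[OF nw]] i], of 1] Lam_coeff[OF inL[OF nw] i] by (simp add: laurent_add)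
    have 2: "w i (int t) = ?s i (int t) \<oplus> N w i (int t - 1)"
      using arg_cong[OF CN(3)[OF Suc.prems(1)], of "\<lambda>v. v i (int t)"] i
        lmon_mult[OF one_closed K.vec_mem[OF W_VK[OF nw] i], of 1] Lam_coeff[OF W_Lam[OF nw] i] by (simp add: laurent_add)
    show ?case using 1 2 Suc.IH[OF nw i] by simp
  qed
  have "w = lincomb J (a w) brow"
  proof (rule V_eqI)
    fix i and j :: int assume i: "i \<in> {1..n}"
    show "w i j = lincomb J (a w) brow i j"
    proof (cases "j < 0")
      case True
      then show ?thesis using Lam_neg[OF inL[OF assms] i] Lam_neg[OF W_Lam[OF assms] i] by simp
    next
      case False
      then show ?thesis using main[OF assms i, of "nat (j + 1)"] by simp
    qed
  qed (use W_VK[OF assms] in \<open>auto simp: lincomb_def PiE_iff\<close>)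
  then show ?thesis using that aK0[OF assms] by blast
qed

text \<open>A relation with Laurent coefficients is cleared from the lowest degree upwards. If all
  coefficients vanish below degree l, dividing by \<epsilon>^l leaves constants plus \<epsilon>
  times integral series, and independence modulo \<epsilon>W makes the constants vanish.\<close>

lemma brow_independent:
  assumes a: "\<And>d. d \<in> J \<Longrightarrow> a d \<in> carrier K" and eq: "lincomb J a brow = \<zero>\<^bsub>V\<^esub>" and "d \<in> J"
  shows "a d = \<zero>\<^bsub>K\<^esub>"
proof -
  have "\<exists>N. \<forall>d\<in>S. \<forall>j<N. a d j = \<zero>" if "finite S" "S \<subseteq> J" for S
    using that
  proof (induction S rule: finite_induct)
    case (insert x S)
    then obtain N where N: "\<forall>d\<in>S. \<forall>j<N. a d j = \<zero>" by auto
    have "a x \<in> carrier K" using insert a by blast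
    then obtain M where M: "\<And>j. j < M \<Longrightarrow> a x j = \<zero>" by (rule laurent_bound) blast
    show ?case by (rule exI[of _ "min N M"]) (use N M in auto)
  qed simp
  from this[OF finite_J order.refl] obtain N where N: "\<forall>d\<in>J. \<forall>j<N. a d j = \<zero>" ..
  have step: "\<forall>d\<in>J. a d l = \<zero>" if l: "\<And>d j. d \<in> J \<Longrightarrow> j < l \<Longrightarrow> a d j = \<zero>" for l
  proof -
    define b where "b d j = (if j < 0 then \<zero> else a d (j + l + 1))" for d j
    have aR: "a d j \<in> carrier R" if "d \<in> J" for d j using a[OF that] by simp
    have b: "b d \<in> carrier K0" if "d \<in> J" for d using aR[OF that] by (auto simp: b_def K0_carrier_iff)
    define a' where "a' d = lmon \<one> (- l) \<otimes>\<^bsub>K\<^esub> a d" for d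
    have a': "a' d = lmon (a d l) 0 \<oplus>\<^bsub>K\<^esub> lmon \<one> 1 \<otimes>\<^bsub>K\<^esub> b d" if d: "d \<in> J" for d
    proof
      fix j
      have "(lmon (a d l) 0 \<oplus>\<^bsub>K\<^esub> lmon \<one> 1 \<otimes>\<^bsub>K\<^esub> b d) j = lmon (a d l) 0 j \<oplus> b d (j - 1)"
        using lmon_mult[OF one_closed K0_closed[OF b[OF d]], of 1] K0_closed[OF b[OF d]] by (simp add: laurent_add)
      also have "\<dots> = a d (j + l)"
        using l[OF d, of "j + l"] aR[OF d] by (cases "j < 0"; cases "j = 0") (auto simp: lmon_def b_def)
      also have "\<dots> = a' d j"
        using lmon_mult[OF one_closed a[OF d], of "- l"] aR[OF d] by (simp add: a'_def)
      finally show "a' d j = (lmon (a d l) 0 \<oplus>\<^bsub>K\<^esub> lmon \<one> 1 \<otimes>\<^bsub>K\<^esub> b d) j" by simp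
    qed
    have a'K: "a' d \<in> carrier K" if "d \<in> J" for d using a[OF that] by (simp add: a'_def)
    have "lincomb J a' brow = \<zero>\<^bsub>V\<^esub> \<oplus>\<^bsub>V\<^esub> lmon \<one> (- l) \<odot>\<^bsub>V\<^esub> lincomb J a brow"
    proof -
      have "lincomb J (\<lambda>d. \<zero>\<^bsub>K\<^esub>) brow = \<zero>\<^bsub>V\<^esub>" by (rule lincomb_zero) (use J_VK in auto)
      moreover have "lincomb J a' brow = lincomb J (\<lambda>d. \<zero>\<^bsub>K\<^esub> \<oplus>\<^bsub>K\<^esub> lmon \<one> (- l) \<otimes>\<^bsub>K\<^esub> a d) brow"
        unfolding lincomb_def a'_def
        by (rule restrict_ext, rule K.finsum_cong') (use a K.vec_mem[OF J_VK] in \<open>simp_all add: Pi_def\<close>)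
      ultimately show ?thesis
        using lincomb_shift[OF finite_J, of "\<lambda>d. \<zero>\<^bsub>K\<^esub>" a "lmon \<one> (- l)" brow] a J_VK by simp
    qed
    then have z: "lincomb J a' brow = \<zero>\<^bsub>V\<^esub>" using eq V.smult_r_null V.M.l_zero[OF V.M.zero_closed] by simp
    define w where "w = lincomb J b brow"
    have wW: "w \<in> W" unfolding w_def using b by (rule lincomb_Lam)
    have m1: "\<ominus>\<^bsub>K\<^esub> \<one>\<^bsub>K\<^esub> \<in> carrier K0"
      using K0.a_inv_closed[OF K0.one_closed] K.minus_equality[of "\<ominus>\<^bsub>K0\<^esub> \<one>\<^bsub>K0\<^esub>" "\<one>\<^bsub>K\<^esub>"] K0.l_neg[OF K0.one_closed] by simp
    define w' where "w' = (\<ominus>\<^bsub>K\<^esub> \<one>\<^bsub>K\<^esub>) \<odot>\<^bsub>V\<^esub> w"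
    have w'W: "w' \<in> W" using W wW m1 by (simp add: w'_def K0_submodule_def)
    have w': "w' = \<ominus>\<^bsub>V\<^esub> w" unfolding w'_def using W_VK[OF wW] V.smult_l_minus by simp
    let ?s = "lincomb J (\<lambda>d. lmon (a d l) 0) brow"
    have "lincomb J a' brow = lincomb J (\<lambda>d. lmon (a d l) 0 \<oplus>\<^bsub>K\<^esub> lmon \<one> 1 \<otimes>\<^bsub>K\<^esub> b d) brow"
      unfolding lincomb_def
      by (rule restrict_ext, rule K.finsum_cong') (use a' a'K K.vec_mem[OF J_VK] in \<open>simp_all add: Pi_def flip: a'\<close>)
    also have "\<dots> = ?s \<oplus>\<^bsub>V\<^esub> lmon \<one> 1 \<odot>\<^bsub>V\<^esub> w"
      unfolding w_def using aR K0_closed[OF b] J_VK finite_J by (intro lincomb_shift) auto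
    finally have sum: "?s \<oplus>\<^bsub>V\<^esub> lmon \<one> 1 \<odot>\<^bsub>V\<^esub> w = \<zero>\<^bsub>V\<^esub>" using z by simp
    have sV: "?s \<in> carrier V" using aR J_VK by (simp add: lincomb_closed)
    have wV: "w \<in> carrier V" using W_VK[OF wW] by simp
    have ewV: "lmon \<one> 1 \<odot>\<^bsub>V\<^esub> w \<in> carrier V" using V.smult_closed[OF _ wV] by blast
    have "?s = \<ominus>\<^bsub>V\<^esub> (lmon \<one> 1 \<odot>\<^bsub>V\<^esub> w)"
      by (rule V.minus_equality[symmetric]) (use sum sV ewV in auto)
    also have "\<dots> = lmon \<one> 1 \<odot>\<^bsub>V\<^esub> w'"
      unfolding w' using V.smult_r_minus[OF _ wV, of "lmon \<one> 1"] by simp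
    finally have "?s = lmon \<one> 1 \<odot>\<^bsub>V\<^esub> w'" .
    from brow_independent_mod_eps[OF J Z f MZ w'W _ this] aR show ?thesis by auto
  qed
  have all: "\<forall>d\<in>J. \<forall>j < N + int t. a d j = \<zero>" for t
  proof (induction t)
    case 0
    then show ?case using N by simp
  next
    case (Suc t)
    have "\<forall>d\<in>J. a d (N + int t) = \<zero>" by (rule step) (use Suc in auto)
    moreover have "j < N + int (Suc t) \<longleftrightarrow> j < N + int t \<or> j = N + int t" for j by auto
    ultimately show ?case using Suc by auto
  qed
  show ?thesis
  proof
    fix j
    have "j < N + int (nat (j - N + 1))" by simp
    then have "a d j = \<zero>" using all \<open>d \<in> J\<close> by blast
    then show "a d j = \<zero>\<^bsub>K\<^esub> j" by (simp add: laurent_zero)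
  qed
qed

end

context split_lattice_basis
begin

text \<open>The number of basis rows is found by comparing traces, which needs invertibility of the positive integers.\<close>

lemma lattice_is_rowlat:
  assumes char0: "\<And>t::nat. t > 0 \<Longrightarrow> add_pow R t \<one> \<in> Units R"
  shows "\<exists>g\<in>GL. W = rowlat g"
proof -
  let ?N = "{1..n}"
  have bK: "brow d i \<in> carrier K" if "d \<in> J" "i \<in> ?N" for d i using K.vec_mem[OF J_VK[OF that(1)] that(2)] .
  have "\<exists>a. (\<forall>d\<in>J. a d \<in> carrier K0) \<and> lmon \<one> (int k) \<odot>\<^bsub>V\<^esub> unit_row ?N K j = lincomb J a brow" for j
  proof -
    have "unit_row ?N K j \<in> Lam"
      using K0.one_closed K0.zero_closed by (auto simp: unit_row_def)
    from W_generated[OF W_deep[OF this]] show ?thesis by metis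
  qed
  then obtain a where aK0: "\<And>j d. d \<in> J \<Longrightarrow> a j d \<in> carrier K0"
    and a: "\<And>j. lmon \<one> (int k) \<odot>\<^bsub>V\<^esub> unit_row ?N K j = lincomb J (a j) brow" by metis
  \<comment> \<open>Every \<epsilon>^k e_j lies in W and is therefore an integral combination of the
    basis rows; dividing by \<epsilon>^k expresses e_j itself over the Laurent ring.
    \<open>B\<close> is the matrix of these coordinates.\<close>
  define B where "B j d = lmon \<one> (- int k) \<otimes>\<^bsub>K\<^esub> a j d" for j d
  have BK: "B j d \<in> carrier K" if "d \<in> J" for j d using aK0[OF that] by (simp add: B_def)
  have B1: "(\<Oplus>\<^bsub>K\<^esub>d\<in>J. B j d \<otimes>\<^bsub>K\<^esub> brow d i) = unit_row ?N K j i" if i: "i \<in> ?N" for i j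
  proof -
    have u: "unit_row ?N K j i \<in> carrier K" using K.vec_mem[OF K.unit_row_closed i] .
    have "(\<Oplus>\<^bsub>K\<^esub>d\<in>J. B j d \<otimes>\<^bsub>K\<^esub> brow d i) = (\<Oplus>\<^bsub>K\<^esub>d\<in>J. lmon \<one> (- int k) \<otimes>\<^bsub>K\<^esub> (a j d \<otimes>\<^bsub>K\<^esub> brow d i))"
      using aK0 bK[OF _ i] by (intro K.finsum_cong') (simp_all add: B_def K.m_assoc)
    also have "\<dots> = lmon \<one> (- int k) \<otimes>\<^bsub>K\<^esub> (\<Oplus>\<^bsub>K\<^esub>d\<in>J. a j d \<otimes>\<^bsub>K\<^esub> brow d i)"
      using aK0 bK[OF _ i] finite_J by (intro K.finsum_rdistr[symmetric]) auto
    also have "(\<Oplus>\<^bsub>K\<^esub>d\<in>J. a j d \<otimes>\<^bsub>K\<^esub> brow d i) = lmon \<one> (int k) \<otimes>\<^bsub>K\<^esub> unit_row ?N K j i"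
      using arg_cong[OF a[of j], of "\<lambda>v. v i"] i by (simp add: lincomb_def)
    also have "lmon \<one> (- int k) \<otimes>\<^bsub>K\<^esub> (lmon \<one> (int k) \<otimes>\<^bsub>K\<^esub> unit_row ?N K j i) = unit_row ?N K j i"
      using u by (subst K.m_assoc[symmetric]) (auto simp: lmon_mult_lmon laurent_one[symmetric])
    finally show ?thesis .
  qed
  define C where "C d e = (\<Oplus>\<^bsub>K\<^esub>j\<in>?N. brow d j \<otimes>\<^bsub>K\<^esub> B j e)" for d e
  have CK: "C d e \<in> carrier K" if "d \<in> J" "e \<in> J" for d e
    unfolding C_def using bK[OF that(1)] BK[OF that(2)] by (intro K.finsum_closed) auto
  \<comment> \<open>Row d of \<open>C\<close> and the d-th unit row both express
    \<open>brow d\<close> in the basis rows, so they agree by independence. Thus \<open>B\<close>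
    and the matrix of basis rows are inverse on both sides, before they are known to be
    square.\<close>
  have C1: "C d e = (if e = d then \<one>\<^bsub>K\<^esub> else \<zero>\<^bsub>K\<^esub>)" if d: "d \<in> J" and e: "e \<in> J" for d e
  proof -
    let ?i = "\<lambda>e. if e = d then \<one>\<^bsub>K\<^esub> else \<zero>\<^bsub>K\<^esub>"
    have 1: "lincomb J (C d) brow = brow d"
    proof (rule vec_eqI[where I = ?N])
      fix i assume i: "i \<in> ?N"
      have "(\<Oplus>\<^bsub>K\<^esub>e\<in>J. C d e \<otimes>\<^bsub>K\<^esub> brow e i) = (\<Oplus>\<^bsub>K\<^esub>j\<in>?N. brow d j \<otimes>\<^bsub>K\<^esub> (\<Oplus>\<^bsub>K\<^esub>e\<in>J. B j e \<otimes>\<^bsub>K\<^esub> brow e i))"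
        unfolding C_def using finite_J bK BK i d by (intro K.finsum_assoc) auto
      also have "\<dots> = (\<Oplus>\<^bsub>K\<^esub>j\<in>?N. brow d j \<otimes>\<^bsub>K\<^esub> unit_row ?N K j i)" using B1[OF i] by simp
      also have "\<dots> = brow d i \<otimes>\<^bsub>K\<^esub> unit_row ?N K i i"
        using bK[OF d] i by (intro K.finsum_single) (auto simp: unit_row_def)
      finally show "lincomb J (C d) brow i = brow d i"
        using i bK[OF d i] by (simp add: lincomb_def unit_row_def)
    qed (use J_VK[OF d] in \<open>auto simp: lincomb_def PiE_iff\<close>)
    have 2: "lincomb J ?i brow = brow d"
    proof (rule vec_eqI[where I = ?N])
      fix i assume i: "i \<in> ?N"
      have "(\<Oplus>\<^bsub>K\<^esub>e\<in>J. ?i e \<otimes>\<^bsub>K\<^esub> brow e i) = ?i d \<otimes>\<^bsub>K\<^esub> brow d i"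
        by (rule K.finsum_single) (use bK[OF _ i] d finite_J in auto)
      then show "lincomb J ?i brow i = brow d i"
        using i bK[OF d i] by (simp add: lincomb_def)
    qed (use J_VK[OF d] in \<open>auto simp: lincomb_def PiE_iff\<close>)
    have bV: "brow d \<in> carrier V" using J_VK[OF d] by simp
    have "lincomb J (\<lambda>e. C d e \<oplus>\<^bsub>K\<^esub> (\<ominus>\<^bsub>K\<^esub> \<one>\<^bsub>K\<^esub>) \<otimes>\<^bsub>K\<^esub> ?i e) brow
        = lincomb J (C d) brow \<oplus>\<^bsub>V\<^esub> (\<ominus>\<^bsub>K\<^esub> \<one>\<^bsub>K\<^esub>) \<odot>\<^bsub>V\<^esub> lincomb J ?i brow"
      using CK[OF d] J_VK finite_J by (intro lincomb_shift) auto
    also have "\<dots> = \<zero>\<^bsub>V\<^esub>"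
      unfolding 1 2 using V.smult_l_minus[OF K.one_closed bV] V.smult_one[OF bV] V.M.r_neg[OF bV] by simp
    finally have "C d e \<oplus>\<^bsub>K\<^esub> (\<ominus>\<^bsub>K\<^esub> \<one>\<^bsub>K\<^esub>) \<otimes>\<^bsub>K\<^esub> ?i e = \<zero>\<^bsub>K\<^esub>"
      by (intro brow_independent[of "\<lambda>e. C d e \<oplus>\<^bsub>K\<^esub> (\<ominus>\<^bsub>K\<^esub> \<one>\<^bsub>K\<^esub>) \<otimes>\<^bsub>K\<^esub> ?i e"]) (use CK[OF d] e in auto)
    moreover have ie: "?i e \<in> carrier K" by simp
    ultimately have "C d e \<oplus>\<^bsub>K\<^esub> \<ominus>\<^bsub>K\<^esub> ?i e = \<zero>\<^bsub>K\<^esub>" using K.l_minus[OF K.one_closed ie] K.l_one[OF ie] by simp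
    then have "\<ominus>\<^bsub>K\<^esub> (\<ominus>\<^bsub>K\<^esub> ?i e) = C d e" by (rule K.minus_equality) (use ie CK[OF d e] in auto)
    then show ?thesis using K.minus_minus[OF ie] by simp
  qed
  \<comment> \<open>The two products of \<open>B\<close> with the matrix of basis rows are identity
    matrices of sizes \<open>n\<close> and \<open>card J\<close>, and products taken in either order
    have the same trace.\<close>
  have tr: "(\<Oplus>\<^bsub>K\<^esub>j\<in>?N. \<one>\<^bsub>K\<^esub>) = (\<Oplus>\<^bsub>K\<^esub>d\<in>J. \<one>\<^bsub>K\<^esub>)"
  proof -
    have "(\<Oplus>\<^bsub>K\<^esub>j\<in>?N. \<one>\<^bsub>K\<^esub>) = (\<Oplus>\<^bsub>K\<^esub>j\<in>?N. \<Oplus>\<^bsub>K\<^esub>d\<in>J. B j d \<otimes>\<^bsub>K\<^esub> brow d j)"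
      by (rule K.finsum_cong') (use B1 in \<open>auto simp: unit_row_def\<close>)
    also have "\<dots> = (\<Oplus>\<^bsub>K\<^esub>d\<in>J. \<Oplus>\<^bsub>K\<^esub>j\<in>?N. B j d \<otimes>\<^bsub>K\<^esub> brow d j)"
      using finite_J BK bK by (intro K.finsum_swap) auto
    also have "\<dots> = (\<Oplus>\<^bsub>K\<^esub>d\<in>J. \<one>\<^bsub>K\<^esub>)"
    proof (rule K.finsum_cong')
      fix d assume d: "d \<in> J"
      have "(\<Oplus>\<^bsub>K\<^esub>j\<in>?N. B j d \<otimes>\<^bsub>K\<^esub> brow d j) = C d d"
        unfolding C_def using BK[OF d] bK[OF d] by (intro K.finsum_cong') (auto simp: K.m_comm)
      then show "(\<Oplus>\<^bsub>K\<^esub>j\<in>?N. B j d \<otimes>\<^bsub>K\<^esub> brow d j) = \<one>\<^bsub>K\<^esub>" using C1[OF d d] by simp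
    qed auto
    finally show ?thesis .
  qed
  have one0: "\<one>\<^bsub>K\<^esub> 0 = \<one>" by (simp add: laurent_one lmon_def)
  have "add_pow R n \<one> = add_pow R (card J) \<one>"
    using arg_cong[OF tr, of "\<lambda>v. v 0"] finite_J by (simp add: laurent_finsum_coeff one0 add.finprod_const)
  \<comment> \<open>If the sizes differ, some positive multiple of \<open>\<one>\<close> vanishes;
    as it is also a unit, the ring is zero.\<close>
  then have "n = card J \<or> \<one> = \<zero>"
  proof -
    have "\<one> = \<zero>" if "add_pow R p \<one> = add_pow R (p + t) \<one>" "t > 0" for p t :: nat
    proof -
      have "add_pow R p \<one> \<oplus> add_pow R t \<one> = add_pow R p \<one>" using that add.nat_pow_mult[of \<one> p t] by simp
      then have "add_pow R t \<one> = \<zero>" by (metis add.l_cancel_one' add.nat_pow_closed one_closed)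
      then have "\<zero> \<in> Units R" using char0[OF that(2)] by simp
      then show ?thesis by (metis Units_r_inv l_null Units_inv_closed)
    qed
    note imp = this
    show ?thesis
    proof (cases n "card J" rule: linorder_cases)
      case less
      then show ?thesis using imp[of n "card J - n"] \<open>add_pow R n \<one> = add_pow R (card J) \<one>\<close> by simp
    next
      case greater
      then show ?thesis using imp[of "card J" "n - card J"] \<open>add_pow R n \<one> = add_pow R (card J) \<one>\<close> by simp
    qed simp
  qed
  then show ?thesis
  proof
    \<comment> \<open>Over the zero ring sizes cannot be compared, but there is only one vector, and
      the identity matrix already describes the lattice.\<close>
    assume "\<one> = \<zero>"
    then have R0: "x = \<zero>" if "x \<in> carrier R" for x using that by (metis l_null l_one)
    then have all: "v = \<zero>\<^bsub>V\<^esub>" if "v \<in> VK" for v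
      using that VK_coeff[OF that] by (intro V_eqI) (auto simp: PiE_iff laurent_zero)
    interpret M: monoid "mat_monoid n K" by (rule K.mat_monoid_monoid)
    have one: "scalar_mat ?N K \<one>\<^bsub>K\<^esub> \<in> GL" using M.Units_one_closed by (simp add: mat_monoid_simps)
    have W0: "W = {\<zero>\<^bsub>V\<^esub>}" using all W_VK W by (auto simp: K0_submodule_def)
    have z: "\<zero>\<^bsub>V\<^esub> \<in> VK" "\<zero>\<^bsub>V\<^esub> \<in> Lam" using V.M.zero_closed Lam_submodule by (auto simp: K0_submodule_def)
    have "rowmul ?N K \<zero>\<^bsub>V\<^esub> (scalar_mat ?N K \<one>\<^bsub>K\<^esub>) = \<zero>\<^bsub>V\<^esub>" using z by (intro K.rowmul_one) auto
    then have "\<zero>\<^bsub>V\<^esub> \<in> rowlat (scalar_mat ?N K \<one>\<^bsub>K\<^esub>)" using z by (simp add: rowlat_def)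
    moreover have "w = \<zero>\<^bsub>V\<^esub>" if "w \<in> rowlat (scalar_mat ?N K \<one>\<^bsub>K\<^esub>)" for w
      using that by (intro all) (simp add: rowlat_def)
    ultimately have "rowlat (scalar_mat ?N K \<one>\<^bsub>K\<^esub>) = {\<zero>\<^bsub>V\<^esub>}" by blast
    then show ?thesis using one W0 by (intro bexI[of _ "scalar_mat ?N K \<one>\<^bsub>K\<^esub>"]) simp_all
  next
    assume "n = card J"
    \<comment> \<open>After renumbering the basis by 1 to n, the relations above say that
      \<open>g\<close> and the matrix \<open>H\<close> of basis rows are inverse to each other, so
      the integral combinations of the rows of \<open>H\<close> are the row lattice of
      \<open>g\<close>.\<close>
    then obtain h where h: "bij_betw h ?N J"
      using finite_same_card_bij[of ?N J] finite_J by auto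
    have hJ: "h i \<in> J" if "i \<in> ?N" for i using h that by (auto simp: bij_betw_def)
    define H where "H = (\<lambda>(i, j)\<in>?N \<times> ?N. brow (h i) j)"
    define g where "g = (\<lambda>(j, i)\<in>?N \<times> ?N. B j (h i))"
    have Hc: "H \<in> ?N \<times> ?N \<rightarrow>\<^sub>E carrier K" unfolding H_def using bK[OF hJ] by auto
    have gc: "g \<in> ?N \<times> ?N \<rightarrow>\<^sub>E carrier K" unfolding g_def using BK[OF hJ] by auto
    have Hg: "mat_mult ?N K H g = scalar_mat ?N K \<one>\<^bsub>K\<^esub>"
    proof -
      have "(\<Oplus>\<^bsub>K\<^esub>j\<in>?N. H (i, j) \<otimes>\<^bsub>K\<^esub> g (j, i')) = (if i = i' then \<one>\<^bsub>K\<^esub> else \<zero>\<^bsub>K\<^esub>)" if i: "i \<in> ?N" "i' \<in> ?N" for i i'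
      proof -
        have "(\<Oplus>\<^bsub>K\<^esub>j\<in>?N. H (i, j) \<otimes>\<^bsub>K\<^esub> g (j, i')) = C (h i) (h i')"
          unfolding C_def using i bK[OF hJ] BK[OF hJ] by (intro K.finsum_cong') (auto simp: H_def g_def)
        moreover have "h i = h i' \<longleftrightarrow> i = i'" using h i by (auto simp: bij_betw_def inj_on_def)
        ultimately show ?thesis using C1[OF hJ hJ] i by auto
      qed
      then show ?thesis unfolding mat_mult_def scalar_mat_def by (auto intro!: restrict_ext)
    qed
    have gH: "mat_mult ?N K g H = scalar_mat ?N K \<one>\<^bsub>K\<^esub>"
    proof -
      have "(\<Oplus>\<^bsub>K\<^esub>i'\<in>?N. g (j, i') \<otimes>\<^bsub>K\<^esub> H (i', i)) = (if j = i then \<one>\<^bsub>K\<^esub> else \<zero>\<^bsub>K\<^esub>)" if i: "j \<in> ?N" "i \<in> ?N" for i j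
      proof -
        have "(\<Oplus>\<^bsub>K\<^esub>i'\<in>?N. g (j, i') \<otimes>\<^bsub>K\<^esub> H (i', i)) = (\<Oplus>\<^bsub>K\<^esub>i'\<in>?N. B j (h i') \<otimes>\<^bsub>K\<^esub> brow (h i') i)"
          using i bK[OF hJ] BK[OF hJ] by (intro K.finsum_cong') (auto simp: H_def g_def)
        also have "\<dots> = (\<Oplus>\<^bsub>K\<^esub>d\<in>h ` ?N. B j d \<otimes>\<^bsub>K\<^esub> brow d i)"
          using h BK[OF hJ] bK[OF hJ] i by (intro K.finsum_reindex[symmetric]) (auto simp: bij_betw_def Pi_def)
        also have "h ` ?N = J" using h by (auto simp: bij_betw_def)
        finally show ?thesis using B1[OF i(2)] i by (auto simp: unit_row_def)
      qed
      then show ?thesis unfolding mat_mult_def scalar_mat_def by (auto intro!: restrict_ext)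
    qed
    have "g \<in> GL" using Hc gc Hg gH unfolding Units_def by (auto simp: mat_monoid_simps)
    moreover have "W = rowlat g"
    proof
      show "W \<subseteq> rowlat g"
      proof
        fix w assume w: "w \<in> W"
        then obtain c where c: "\<And>d. d \<in> J \<Longrightarrow> c d \<in> carrier K0" "w = lincomb J c brow"
          by (rule W_generated) blast
        define y where "y = (\<lambda>i\<in>?N. c (h i))"
        have y: "y \<in> Lam" using c(1) hJ by (auto simp: y_def)
        have "rowmul ?N K y H = w"
        proof (rule vec_eqI[where I = ?N])
          fix i assume i: "i \<in> ?N"
          have "(\<Oplus>\<^bsub>K\<^esub>i'\<in>?N. y i' \<otimes>\<^bsub>K\<^esub> H (i', i)) = (\<Oplus>\<^bsub>K\<^esub>i'\<in>?N. c (h i') \<otimes>\<^bsub>K\<^esub> brow (h i') i)"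
            using i bK[OF hJ] K0_closed[OF c(1)[OF hJ]] by (intro K.finsum_cong') (auto simp: H_def y_def)
          also have "\<dots> = (\<Oplus>\<^bsub>K\<^esub>d\<in>h ` ?N. c d \<otimes>\<^bsub>K\<^esub> brow d i)"
            using h bK[OF hJ i] K0_closed[OF c(1)[OF hJ]] by (intro K.finsum_reindex[symmetric]) (auto simp: bij_betw_def Pi_def)
          also have "h ` ?N = J" using h by (auto simp: bij_betw_def)
          finally show "rowmul ?N K y H i = w i" using i by (simp add: rowmul_def c(2) lincomb_def)
        qed (use W_VK[OF w] in \<open>auto simp: PiE_iff\<close>)
        then have "rowmul ?N K w g = y"
          using K.rowmul_assoc[OF _ Lam_VK[OF y] Hc gc] K.rowmul_one[OF _ Lam_VK[OF y]] by (simp add: Hg)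
        then show "w \<in> rowlat g" using y W_VK[OF w] by (simp add: rowlat_def)
      qed
      show "rowlat g \<subseteq> W"
      proof
        fix w assume "w \<in> rowlat g"
        then have w: "w \<in> VK" "rowmul ?N K w g \<in> Lam" by (simp_all add: rowlat_def)
        have "w = rowmul ?N K (rowmul ?N K w g) H"
          using K.rowmul_assoc[OF _ w(1) gc Hc] K.rowmul_one[OF _ w(1)] by (simp add: gH)
        also have "\<dots> = lincomb ?N (rowmul ?N K w g) (\<lambda>i. brow (h i))"
          unfolding lincomb_def by (subst rowmul_def, rule restrict_ext, rule K.finsum_cong')
            (use K.vec_mem[OF Lam_VK[OF w(2)]] bK[OF hJ] in \<open>auto simp: H_def\<close>)
        also have "\<dots> \<in> W"
          by (rule lincomb_in_submodule[OF W]) (use K0.vec_mem[OF w(2)] brow_W J_cidx hJ in auto)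
        finally show "w \<in> W" .
      qed
    qed
    ultimately show ?thesis by blast
  qed
qed

end

section \<open>Power series in two variables\<close>

context coeff_ring
begin

abbreviation PS where "PS \<equiv> power_series2 R"

lemma PS_carrier: "f \<in> carrier PS \<longleftrightarrow> (\<forall>p. f p \<in> carrier R)"
  and PS_zero: "\<zero>\<^bsub>PS\<^esub> p = \<zero>"
  and PS_add: "(f \<oplus>\<^bsub>PS\<^esub> g) p = f p \<oplus> g p"
  and PS_one: "\<one>\<^bsub>PS\<^esub> = (\<lambda>p. if p = (0, 0) then \<one> else \<zero>)"
  and PS_mult: "(f \<otimes>\<^bsub>PS\<^esub> g) (a, b) = (\<Oplus>i\<in>{..a}. \<Oplus>j\<in>{..b}. f (i, j) \<otimes> g (a - i, b - j))"
  by (auto simp: power_series2_def)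

lemma PS_coeff: "f \<in> carrier PS \<Longrightarrow> f p \<in> carrier R"
  unfolding PS_carrier by blast

lemma finsum_int_nat:
  assumes "\<And>j. 0 \<le> j \<Longrightarrow> j \<le> int b \<Longrightarrow> F j \<in> carrier R"
  shows "(\<Oplus>j\<in>{0..int b}. F j) = (\<Oplus>j\<in>{..b}. F (int j))"
proof -
  have "{0..int b} = int ` {..b}"
    by (auto simp: image_iff intro!: bexI[of _ "nat _"])
  moreover have "(\<Oplus>j\<in>int ` {..b}. F j) = (\<Oplus>j\<in>{..b}. F (int j))"
    using assms by (intro finsum_reindex) auto
  ultimately show ?thesis by simp
qed

text \<open>Series in x and y sit inside the Laurent series in y whose coefficients are Laurent
  series in x; the first argument is the degree in y. The laws that involve multiplication are
  inherited from two applications of \<open>laurent_cring\<close>.\<close>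

definition ps_embed :: "(nat \<times> nat \<Rightarrow> 'a) \<Rightarrow> int \<Rightarrow> int \<Rightarrow> 'a" where
  "ps_embed f = (\<lambda>b a. if 0 \<le> a \<and> 0 \<le> b then f (nat a, nat b) else \<zero>)"

lemma ps_embed_row: "f \<in> carrier PS \<Longrightarrow> ps_embed f b \<in> carrier K"
  by (rule laurent_carrierI[where N = 0]) (auto simp: ps_embed_def PS_coeff)

lemma ps_embed_closed:
  assumes "f \<in> carrier PS"
  shows "ps_embed f \<in> carrier (laurent_ring K)"
proof -
  interpret L: coeff_ring K by unfold_locales
  show ?thesis
    by (rule L.laurent_carrierI[where N = 0])
      (use ps_embed_row[OF assms] in \<open>auto simp: ps_embed_def fun_eq_iff laurent_zero\<close>)
qed

lemma ps_embed_inj: "ps_embed f = ps_embed g \<Longrightarrow> f = g"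
proof
  fix p :: "nat \<times> nat" assume "ps_embed f = ps_embed g"
  then have "ps_embed f (int (snd p)) (int (fst p)) = ps_embed g (int (snd p)) (int (fst p))" by simp
  then show "f p = g p" by (simp add: ps_embed_def)
qed

lemma PS_mult_closed:
  assumes "f \<in> carrier PS" "g \<in> carrier PS"
  shows "f \<otimes>\<^bsub>PS\<^esub> g \<in> carrier PS"
  unfolding PS_carrier
proof
  fix p :: "nat \<times> nat"
  show "(f \<otimes>\<^bsub>PS\<^esub> g) p \<in> carrier R"
    using assms by (cases p) (auto simp: PS_mult PS_coeff intro!: finsum_closed)
qed

lemma ps_embed_mult:
  assumes f: "f \<in> carrier PS" and g: "g \<in> carrier PS"
  shows "ps_embed (f \<otimes>\<^bsub>PS\<^esub> g) = ps_embed f \<otimes>\<^bsub>laurent_ring K\<^esub> ps_embed g"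
proof (intro ext)
  fix b a :: int
  interpret L: coeff_ring K by unfold_locales
  note fr = ps_embed_row[OF f] and gr = ps_embed_row[OF g]
  have neg: "ps_embed h j = \<zero>\<^bsub>K\<^esub>" if "j < 0" for h j
    using that by (auto simp: ps_embed_def fun_eq_iff laurent_zero)
  have "(ps_embed f \<otimes>\<^bsub>laurent_ring K\<^esub> ps_embed g) b = (\<Oplus>\<^bsub>K\<^esub>j\<in>{0..b}. ps_embed f j \<otimes>\<^bsub>K\<^esub> ps_embed g (b - j))"
    using f g neg by (intro L.laurent_mult_box ps_embed_closed) auto
  then have "(ps_embed f \<otimes>\<^bsub>laurent_ring K\<^esub> ps_embed g) b a = (\<Oplus>j\<in>{0..b}. (ps_embed f j \<otimes>\<^bsub>K\<^esub> ps_embed g (b - j)) a)"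
    using fr gr by (simp add: laurent_finsum_coeff)
  also have "\<dots> = (\<Oplus>j\<in>{0..b}. \<Oplus>i\<in>{0..a}. ps_embed f j i \<otimes> ps_embed g (b - j) (a - i))"
  proof (rule finsum_cong')
    fix j assume "j \<in> {0..b}"
    show "(ps_embed f j \<otimes>\<^bsub>K\<^esub> ps_embed g (b - j)) a = (\<Oplus>i\<in>{0..a}. ps_embed f j i \<otimes> ps_embed g (b - j) (a - i))"
      by (rule laurent_mult_box[OF fr gr]) (auto simp: ps_embed_def)
  qed (use fr gr in \<open>auto intro!: finsum_closed\<close>)
  also have "\<dots> = ps_embed (f \<otimes>\<^bsub>PS\<^esub> g) b a"
  proof (cases "0 \<le> a \<and> 0 \<le> b")
    case False
    then show ?thesis by (auto simp: ps_embed_def)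
  next
    case True
    then obtain a' b' where ab: "a = int a'" "b = int b'" using nonneg_int_cases by metis
    have cl: "ps_embed f j i \<otimes> ps_embed g (b - j) (a - i) \<in> carrier R" for i j using fr gr by auto
    have "(\<Oplus>j\<in>{0..b}. \<Oplus>i\<in>{0..a}. ps_embed f j i \<otimes> ps_embed g (b - j) (a - i))
        = (\<Oplus>j\<in>{..b'}. \<Oplus>i\<in>{..a'}. ps_embed f (int j) (int i) \<otimes> ps_embed g (b - int j) (a - int i))"
      using cl unfolding ab by (simp add: finsum_int_nat Pi_def)
    also have "\<dots> = (\<Oplus>i\<in>{..a'}. \<Oplus>j\<in>{..b'}. ps_embed f (int j) (int i) \<otimes> ps_embed g (b - int j) (a - int i))"
      using cl by (intro finsum_swap) auto
    also have "\<dots> = (\<Oplus>i\<in>{..a'}. \<Oplus>j\<in>{..b'}. f (i, j) \<otimes> g (a' - i, b' - j))"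
      using f g by (intro finsum_cong') (auto simp: ps_embed_def PS_coeff ab nat_diff_distrib intro!: finsum_closed finsum_cong')
    also have "\<dots> = ps_embed (f \<otimes>\<^bsub>PS\<^esub> g) b a" by (simp add: ps_embed_def PS_mult ab)
    finally show ?thesis .
  qed
  finally show "ps_embed (f \<otimes>\<^bsub>PS\<^esub> g) b a = (ps_embed f \<otimes>\<^bsub>laurent_ring K\<^esub> ps_embed g) b a" by simp
qed

lemma ps_embed_add: "ps_embed (f \<oplus>\<^bsub>PS\<^esub> g) = ps_embed f \<oplus>\<^bsub>laurent_ring K\<^esub> ps_embed g"
proof -
  interpret L: coeff_ring K by unfold_locales
  show ?thesis by (intro ext) (simp add: ps_embed_def PS_add L.laurent_add laurent_add)
qed

lemma ps_embed_one: "ps_embed \<one>\<^bsub>PS\<^esub> = \<one>\<^bsub>laurent_ring K\<^esub>"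
proof -
  interpret L: coeff_ring K by unfold_locales
  show ?thesis
    by (intro ext) (simp add: ps_embed_def PS_one L.laurent_one L.lmon_def laurent_one lmon_def laurent_zero)
qed

lemma PS_cring: "cring PS"
proof -
  interpret L: coeff_ring K by unfold_locales
  have add_cl: "f \<oplus>\<^bsub>PS\<^esub> g \<in> carrier PS" if "f \<in> carrier PS" "g \<in> carrier PS" for f g
    using that by (auto simp: PS_carrier PS_add)
  show ?thesis
  proof (rule cringI)
    show "abelian_group PS"
    proof (rule abelian_groupI)
      show "\<exists>g\<in>carrier PS. g \<oplus>\<^bsub>PS\<^esub> f = \<zero>\<^bsub>PS\<^esub>" if "f \<in> carrier PS" for f
        by (rule bexI[of _ "\<lambda>p. \<ominus> f p"]) (use that in \<open>auto simp: PS_carrier PS_add PS_zero l_neg fun_eq_iff\<close>)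
      show "\<zero>\<^bsub>PS\<^esub> \<in> carrier PS" by (simp add: PS_carrier PS_zero)
      show "f \<oplus>\<^bsub>PS\<^esub> g \<oplus>\<^bsub>PS\<^esub> h = f \<oplus>\<^bsub>PS\<^esub> (g \<oplus>\<^bsub>PS\<^esub> h)" if "f \<in> carrier PS" "g \<in> carrier PS" "h \<in> carrier PS" for f g h
        by (rule ext) (use that in \<open>simp add: PS_add PS_coeff a_assoc\<close>)
      show "f \<oplus>\<^bsub>PS\<^esub> g = g \<oplus>\<^bsub>PS\<^esub> f" if "f \<in> carrier PS" "g \<in> carrier PS" for f g
        by (rule ext) (use that in \<open>simp add: PS_add PS_coeff a_comm\<close>)
      show "\<zero>\<^bsub>PS\<^esub> \<oplus>\<^bsub>PS\<^esub> f = f" if "f \<in> carrier PS" for f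
        by (rule ext) (use that in \<open>simp add: PS_add PS_coeff PS_zero\<close>)
    qed (rule add_cl)
    show "Group.comm_monoid PS"
    proof (rule comm_monoidI)
      show "\<one>\<^bsub>PS\<^esub> \<in> carrier PS" by (simp add: PS_carrier PS_one)
      show "f \<otimes>\<^bsub>PS\<^esub> g \<otimes>\<^bsub>PS\<^esub> h = f \<otimes>\<^bsub>PS\<^esub> (g \<otimes>\<^bsub>PS\<^esub> h)" if "f \<in> carrier PS" "g \<in> carrier PS" "h \<in> carrier PS" for f g h
        using that by (intro ps_embed_inj) (simp add: ps_embed_mult PS_mult_closed L.K.m_assoc ps_embed_closed)
      show "f \<otimes>\<^bsub>PS\<^esub> g = g \<otimes>\<^bsub>PS\<^esub> f" if "f \<in> carrier PS" "g \<in> carrier PS" for f g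
        using that by (intro ps_embed_inj) (simp add: ps_embed_mult L.K.m_comm ps_embed_closed)
      show "\<one>\<^bsub>PS\<^esub> \<otimes>\<^bsub>PS\<^esub> f = f" if "f \<in> carrier PS" for f
        using that \<open>\<one>\<^bsub>PS\<^esub> \<in> carrier PS\<close>
        by (intro ps_embed_inj) (simp add: ps_embed_mult ps_embed_one ps_embed_closed)
    qed (rule PS_mult_closed)
    show "(f \<oplus>\<^bsub>PS\<^esub> g) \<otimes>\<^bsub>PS\<^esub> h = f \<otimes>\<^bsub>PS\<^esub> h \<oplus>\<^bsub>PS\<^esub> g \<otimes>\<^bsub>PS\<^esub> h" if "f \<in> carrier PS" "g \<in> carrier PS" "h \<in> carrier PS" for f g h
      using that by (intro ps_embed_inj)
        (simp add: ps_embed_mult ps_embed_add add_cl L.K.l_distr ps_embed_closed)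
  qed
qed

sublocale PS: cring PS by (rule PS_cring)

lemma PS_minus: "f \<in> carrier PS \<Longrightarrow> (\<ominus>\<^bsub>PS\<^esub> f) p = \<ominus> f p"
proof -
  assume f: "f \<in> carrier PS"
  have "\<ominus>\<^bsub>PS\<^esub> f = (\<lambda>p. \<ominus> f p)"
    by (rule PS.minus_equality) (use f in \<open>auto simp: PS_carrier PS_add PS_zero l_neg fun_eq_iff\<close>)
  then show ?thesis by simp
qed

text \<open>The monomial c x^a y^b.\<close>

definition pmon :: "'a \<Rightarrow> nat \<Rightarrow> nat \<Rightarrow> nat \<times> nat \<Rightarrow> 'a" where
  "pmon c a b = (\<lambda>p. if p = (a, b) then c else \<zero>)"

lemma pmon_closed [simp]: "c \<in> carrier R \<Longrightarrow> pmon c a b \<in> carrier PS"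
  by (auto simp: PS_carrier pmon_def)

lemma pmon_mult:
  assumes c: "c \<in> carrier R" and f: "f \<in> carrier PS"
  shows "(pmon c a0 b0 \<otimes>\<^bsub>PS\<^esub> f) (a, b) = (if a0 \<le> a \<and> b0 \<le> b then c \<otimes> f (a - a0, b - b0) else \<zero>)"
proof -
  have inner: "(\<Oplus>j\<in>{..b}. pmon c a0 b0 (i, j) \<otimes> f (a - i, b - j))
      = (if i = a0 \<and> b0 \<le> b then c \<otimes> f (a - a0, b - b0) else \<zero>)" for i
  proof (cases "i = a0 \<and> b0 \<le> b")
    case True
    have "(\<Oplus>j\<in>{..b}. pmon c a0 b0 (i, j) \<otimes> f (a - i, b - j)) = pmon c a0 b0 (i, b0) \<otimes> f (a - i, b - b0)"
      using True c PS_coeff[OF f] by (intro finsum_single) (auto simp: pmon_def)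
    then show ?thesis using True by (simp add: pmon_def)
  next
    case False
    then show ?thesis
      using c PS_coeff[OF f] by (auto simp: pmon_def intro!: add.finprod_one_eqI)
  qed
  have "(pmon c a0 b0 \<otimes>\<^bsub>PS\<^esub> f) (a, b) = (\<Oplus>i\<in>{..a}. if i = a0 \<and> b0 \<le> b then c \<otimes> f (a - a0, b - b0) else \<zero>)"
    by (simp add: PS_mult inner)
  also have "\<dots> = (if a0 \<le> a \<and> b0 \<le> b then c \<otimes> f (a - a0, b - b0) else \<zero>)"
  proof (cases "a0 \<le> a \<and> b0 \<le> b")
    case True
    then show ?thesis using c PS_coeff[OF f]
      by (subst finsum_single[of _ a0]) auto
  next
    case False
    then show ?thesis by (auto intro!: add.finprod_one_eqI)
  qed
  finally show ?thesis .
qed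

lemma pmon_mult_pmon:
  assumes "c \<in> carrier R" "d \<in> carrier R"
  shows "pmon c a b \<otimes>\<^bsub>PS\<^esub> pmon d a' b' = pmon (c \<otimes> d) (a + a') (b + b')"
proof
  fix p
  show "(pmon c a b \<otimes>\<^bsub>PS\<^esub> pmon d a' b') p = pmon (c \<otimes> d) (a + a') (b + b') p"
    by (cases p, simp add: pmon_mult assms) (use assms in \<open>auto simp: pmon_def\<close>)
qed

lemma pmon_one: "pmon \<one> 0 0 = \<one>\<^bsub>PS\<^esub>"
  by (simp add: pmon_def PS_one)

lemma var_x_pow: "var_x R [^]\<^bsub>PS\<^esub> (k::nat) = pmon \<one> k 0"
  and var_y_pow: "var_y R [^]\<^bsub>PS\<^esub> (k::nat) = pmon \<one> 0 k"
proof -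
  have "var_x R = pmon \<one> 1 0" "var_y R = pmon \<one> 0 1" by (auto simp: var_x_def var_y_def pmon_def)
  then show "var_x R [^]\<^bsub>PS\<^esub> (k::nat) = pmon \<one> k 0" "var_y R [^]\<^bsub>PS\<^esub> (k::nat) = pmon \<one> 0 k"
    by (induction k) (simp_all add: pmon_mult_pmon pmon_one)
qed

lemma var_y_eq: "var_y R = pmon \<one> 0 1"
  by (auto simp: var_y_def pmon_def)

lemma const_series_eq: "const_series R c = pmon c 0 0"
  by (auto simp: const_series_def pmon_def)

text \<open>The coefficient of \<open>y\<^sup>b\<close>, as a series in \<open>x = \<epsilon>\<close>.\<close>

definition col :: "(nat \<times> nat \<Rightarrow> 'a) \<Rightarrow> nat \<Rightarrow> int \<Rightarrow> 'a" where
  "col f b = (\<lambda>z. if z < 0 then \<zero> else f (nat z, b))"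

text \<open>Reads an integral series in \<epsilon> as a series in x, which makes every ideal of the
  curve ring a module over R[[\<epsilon>]].\<close>

definition xseries :: "(int \<Rightarrow> 'a) \<Rightarrow> nat \<times> nat \<Rightarrow> 'a" where
  "xseries a = (\<lambda>(i, j). if j = 0 then a (int i) else \<zero>)"

lemma col_closed [simp]: "f \<in> carrier PS \<Longrightarrow> col f b \<in> carrier K0"
  by (auto simp: col_def K0_carrier_iff PS_coeff)

lemma col_coeff: "f \<in> carrier PS \<Longrightarrow> col f b z \<in> carrier R"
  by (simp add: col_def PS_coeff)

lemma xseries_closed [simp]: "a \<in> carrier K0 \<Longrightarrow> xseries a \<in> carrier PS"
  by (auto simp: xseries_def PS_carrier K0_carrier_iff)

lemma col_xseries_mult:
  assumes a: "a \<in> carrier K0" and g: "g \<in> carrier PS"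
  shows "col (xseries a \<otimes>\<^bsub>PS\<^esub> g) b = a \<otimes>\<^bsub>K\<^esub> col g b"
proof
  fix z :: int
  have aR: "a i \<in> carrier R" for i using a by (simp add: K0_carrier_iff)
  have box: "(a \<otimes>\<^bsub>K\<^esub> col g b) z = (\<Oplus>i\<in>{0..z}. a i \<otimes> col g b (z - i))"
    by (rule laurent_mult_box[OF K0_closed[OF a] K0_closed[OF col_closed[OF g]]])
      (use a in \<open>auto simp: K0_carrier_iff col_def\<close>)
  show "col (xseries a \<otimes>\<^bsub>PS\<^esub> g) b z = (a \<otimes>\<^bsub>K\<^esub> col g b) z"
  proof (cases "z < 0")
    case True
    then show ?thesis by (simp add: box) (simp add: col_def)
  next
    case False
    then obtain k where k: "z = int k" using nonneg_int_cases by (metis not_less)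
    have "(\<Oplus>j\<in>{..b}. xseries a (i, j) \<otimes> g (k - i, b - j)) = xseries a (i, 0) \<otimes> g (k - i, b - 0)" for i
      using aR PS_coeff[OF g] by (intro finsum_single) (auto simp: xseries_def)
    then have "(xseries a \<otimes>\<^bsub>PS\<^esub> g) (k, b) = (\<Oplus>i\<in>{..k}. a (int i) \<otimes> g (k - i, b))"
      by (simp add: PS_mult xseries_def)
    moreover have "(\<Oplus>i\<in>{0..z}. a i \<otimes> col g b (z - i)) = (\<Oplus>i\<in>{..k}. a (int i) \<otimes> col g b (z - int i))"
      unfolding k by (rule finsum_int_nat) (use aR col_coeff[OF g] in auto)
    moreover have "\<dots> = (\<Oplus>i\<in>{..k}. a (int i) \<otimes> g (k - i, b))"
      using aR PS_coeff[OF g] by (intro finsum_cong') (auto simp: col_def k nat_diff_distrib)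
    ultimately show ?thesis unfolding box by (simp add: col_def k)
  qed
qed

end

section \<open>The curve ring as a module over power series in \<open>x\<close>\<close>

locale curve_setting = row_lattices R n for R (structure) and n :: nat +
  fixes m :: nat
  assumes m_pos: "m > 0" and n_pos: "n > 0"
begin

definition csum :: "(nat \<times> nat \<Rightarrow> 'a) \<Rightarrow> int \<Rightarrow> nat \<Rightarrow> 'a" where
  "csum f z b = (\<Oplus>q\<in>{..nat z}. col f (b + n * q) (z - int (m * q)))"

text \<open>The \<open>i\<close>-th entry of \<open>theta f\<close> is the coefficient of \<open>y\<^bsup>n - i\<^esup>\<close> once \<open>y\<^sup>n\<close> is replaced by \<open>x\<^sup>m\<close>.
  With this order, multiplication by \<open>y\<close> is right multiplication by the matrix \<open>Y\<close>.\<close>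

definition theta :: "(nat \<times> nat \<Rightarrow> 'a) \<Rightarrow> nat \<Rightarrow> int \<Rightarrow> 'a" where
  "theta f = (\<lambda>i\<in>{1..n}. \<lambda>z. csum f z (n - i))"

text \<open>The representative of y-degree below n, read off in the reversed order of
  \<open>theta\<close>.\<close>

definition sect :: "(nat \<Rightarrow> int \<Rightarrow> 'a) \<Rightarrow> nat \<times> nat \<Rightarrow> 'a" where
  "sect w = (\<lambda>(a, b). if b < n then w (n - b) (int a) else \<zero>)"

abbreviation "Y \<equiv> Y_matrix m n R"
abbreviation "shiftY w \<equiv> rowmul {1..n} K w Y"
abbreviation "CR \<equiv> curve_ring m n R"
abbreviation "CI \<equiv> curve_ideal m n R"
abbreviation "cl \<equiv> curve_class m n R"

lemma csum_closed [simp]: "f \<in> carrier PS \<Longrightarrow> csum f z b \<in> carrier R"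
  by (auto simp: csum_def col_coeff intro!: finsum_closed)

lemma csum_ext:
  assumes f: "f \<in> carrier PS" and Q: "nat z \<le> Q"
  shows "csum f z b = (\<Oplus>q\<in>{..Q}. col f (b + n * q) (z - int (m * q)))"
  unfolding csum_def
proof (rule finsum_mono_neutral)
  fix q assume "q \<in> {..Q} - {..nat z}"
  then have "z < int q" by auto
  also have "int q \<le> int (m * q)" using m_pos by (simp only: of_nat_le_iff) simp
  finally show "col f (b + n * q) (z - int (m * q)) = \<zero>" by (simp add: col_def)
qed (use f Q in \<open>auto simp: col_coeff\<close>)

text \<open>Splits off q = 0. This is the relation y^n = x^m in terms of coefficients, and it drives
  both the action of y and the computation of the kernel of \<open>theta\<close>.\<close>

lemma csum_rec:
  assumes f: "f \<in> carrier PS"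
  shows "csum f z b = col f b z \<oplus> csum f (z - int m) (b + n)"
proof -
  have "csum f z b = (\<Oplus>q\<in>{..Suc (nat z)}. col f (b + n * q) (z - int (m * q)))"
    using f by (intro csum_ext) auto
  also have "\<dots> = (\<Oplus>q\<in>{..nat z}. col f (b + n * Suc q) (z - int (m * Suc q))) \<oplus> col f (b + n * 0) (z - int (m * 0))"
    using f by (intro finsum_Suc2) (auto simp: col_coeff)
  also have "(\<Oplus>q\<in>{..nat z}. col f (b + n * Suc q) (z - int (m * Suc q)))
      = (\<Oplus>q\<in>{..nat z}. col f (b + n + n * q) (z - int m - int (m * q)))"
    by (simp add: algebra_simps)
  also have "\<dots> = csum f (z - int m) (b + n)"
    using f by (intro csum_ext[symmetric]) auto
  finally show ?thesis using f by (simp add: a_comm col_coeff)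
qed

lemma csum_neg: "f \<in> carrier PS \<Longrightarrow> z < 0 \<Longrightarrow> csum f z b = \<zero>"
  by (simp add: csum_def col_def)

lemma csum_add:
  assumes "f \<in> carrier PS" "g \<in> carrier PS"
  shows "csum (f \<oplus>\<^bsub>PS\<^esub> g) z b = csum f z b \<oplus> csum g z b"
proof -
  have "csum (f \<oplus>\<^bsub>PS\<^esub> g) z b = (\<Oplus>q\<in>{..nat z}. col f (b + n * q) (z - int (m * q)) \<oplus> col g (b + n * q) (z - int (m * q)))"
    unfolding csum_def using assms
    by (intro finsum_cong') (auto simp: col_coeff, simp add: col_def PS_add)
  also have "\<dots> = csum f z b \<oplus> csum g z b"
    unfolding csum_def using assms by (intro finsum_addf) (auto simp: col_coeff)
  finally show ?thesis .
qed

lemma csum_y_mult: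
  assumes "g \<in> carrier PS"
  shows "csum (pmon \<one> 0 j \<otimes>\<^bsub>PS\<^esub> g) z (b + j) = csum g z b"
  unfolding csum_def
  by (rule finsum_cong') (use assms in \<open>auto simp: col_coeff, simp add: col_def pmon_mult PS_coeff\<close>)

lemma theta_closed [simp]: "f \<in> carrier PS \<Longrightarrow> theta f \<in> Lam"
  by (auto simp: theta_def K0_carrier_iff csum_neg)

lemma theta_VK [simp]: "f \<in> carrier PS \<Longrightarrow> theta f \<in> VK"
  using theta_closed Lam_VK by blast

lemma theta_coeff: "i \<in> {1..n} \<Longrightarrow> theta f i z = csum f z (n - i)"
  by (simp add: theta_def)

lemma theta_ext [simp]: "theta f \<in> extensional {1..n}"
  by (simp add: theta_def)

lemma theta_add:
  assumes "f \<in> carrier PS" "g \<in> carrier PS"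
  shows "theta (f \<oplus>\<^bsub>PS\<^esub> g) = theta f \<oplus>\<^bsub>V\<^esub> theta g"
  by (rule V_eqI) (use assms in \<open>auto simp: theta_coeff laurent_add csum_add\<close>)

lemma theta_xseries:
  assumes a: "a \<in> carrier K0" and g: "g \<in> carrier PS"
  shows "theta (xseries a \<otimes>\<^bsub>PS\<^esub> g) = a \<odot>\<^bsub>V\<^esub> theta g"
proof (rule V_eqI)
  fix i and z :: int assume i: "i \<in> {1..n}"
  let ?b = "\<lambda>q. n - i + n * q"
  have aR: "a i \<in> carrier R" for i using a by (simp add: K0_carrier_iff)
  have cK: "col g b \<in> carrier K" for b using g by simp
  have "csum (xseries a \<otimes>\<^bsub>PS\<^esub> g) z (n - i) = (\<Oplus>q\<in>{..nat z}. (a \<otimes>\<^bsub>K\<^esub> col g (?b q)) (z - int (m * q)))"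
    unfolding csum_def using a g by (simp add: col_xseries_mult)
  also have "\<dots> = (\<Oplus>q\<in>{..nat z}. \<Oplus>j\<in>{0..z}. a j \<otimes> col g (?b q) (z - int (m * q) - j))"
  proof (rule finsum_cong')
    fix q
    have "j < 0" if "j < z - int (m * q) - z" for j using that by (smt (verit) of_nat_0_le_iff)
    then show "(a \<otimes>\<^bsub>K\<^esub> col g (?b q)) (z - int (m * q)) = (\<Oplus>j\<in>{0..z}. a j \<otimes> col g (?b q) (z - int (m * q) - j))"
      by (intro laurent_mult_box[OF K0_closed[OF a] cK]) (use a in \<open>auto simp: K0_carrier_iff col_def\<close>)
  qed (use aR g in \<open>auto simp: col_coeff intro!: finsum_closed\<close>)
  also have "\<dots> = (\<Oplus>j\<in>{0..z}. \<Oplus>q\<in>{..nat z}. a j \<otimes> col g (?b q) (z - int (m * q) - j))"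
    using aR g by (intro finsum_swap) (auto simp: col_coeff)
  also have "\<dots> = (\<Oplus>j\<in>{0..z}. a j \<otimes> csum g (z - j) (n - i))"
  proof (rule finsum_cong')
    fix j assume j: "j \<in> {0..z}"
    have "csum g (z - j) (n - i) = (\<Oplus>q\<in>{..nat z}. col g (?b q) (z - j - int (m * q)))"
      using g j by (intro csum_ext) (auto simp: atLeastAtMost_iff)
    then have "a j \<otimes> csum g (z - j) (n - i) = (\<Oplus>q\<in>{..nat z}. a j \<otimes> col g (?b q) (z - j - int (m * q)))"
      using aR g by (simp add: finsum_rdistr col_coeff Pi_def)
    then show "(\<Oplus>q\<in>{..nat z}. a j \<otimes> col g (?b q) (z - int (m * q) - j)) = a j \<otimes> csum g (z - j) (n - i)"
      by (simp add: algebra_simps)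
  qed (use aR g in auto)
  also have "\<dots> = (\<Oplus>j\<in>{0..z}. a j \<otimes> theta g i (z - j))"
    using i by (simp add: theta_coeff)
  also have "\<dots> = (a \<otimes>\<^bsub>K\<^esub> theta g i) z"
    by (rule laurent_mult_box[symmetric, OF K0_closed[OF a] K.vec_mem[OF theta_VK[OF g] i]])
      (use a i in \<open>auto simp: K0_carrier_iff theta_coeff csum_neg g\<close>)
  finally show "theta (xseries a \<otimes>\<^bsub>PS\<^esub> g) i z = (a \<odot>\<^bsub>V\<^esub> theta g) i z"
    using i by (simp add: theta_coeff)
qed simp_all

lemma Y_closed: "Y \<in> {1..n} \<times> {1..n} \<rightarrow>\<^sub>E carrier K"
  by (auto simp: Y_matrix_def eps_pow)

lemma shiftY:
  assumes w: "w \<in> VK" and i: "i \<in> {1..n}"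
  shows "shiftY w i = (if i < n then w (i + 1) else lmon \<one> (int m) \<otimes>\<^bsub>K\<^esub> w 1)"
proof -
  note wm = K.vec_mem[OF w]
  let ?j = "if i < n then i + 1 else 1"
  have j: "?j \<in> {1..n}" using i n_pos by (auto simp: atLeastAtMost_iff)
  have "(\<Oplus>\<^bsub>K\<^esub>j\<in>{1..n}. w j \<otimes>\<^bsub>K\<^esub> Y (j, i)) = w ?j \<otimes>\<^bsub>K\<^esub> Y (?j, i)"
    by (rule K.finsum_single)
      (use j i wm in \<open>auto simp: Y_matrix_def eps_pow atLeastAtMost_iff\<close>)
  moreover have "Y (?j, i) = (if i < n then \<one>\<^bsub>K\<^esub> else lmon \<one> (int m))"
    using i j by (auto simp: Y_matrix_def eps_pow atLeastAtMost_iff)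
  ultimately show ?thesis
    using i j wm[OF j] by (auto simp: rowmul_def K.m_comm)
qed

lemma shiftY_closed [simp]: "w \<in> VK \<Longrightarrow> shiftY w \<in> VK"
  using Y_closed by simp

text \<open>For i < n the degree in y simply drops by one. In the last entry, which belongs to y^0,
  the product has no term of its own; the recursion moves on to y^n and supplies the factor
  \<epsilon>^m.\<close>

lemma theta_y:
  assumes g: "g \<in> carrier PS"
  shows "theta (var_y R \<otimes>\<^bsub>PS\<^esub> g) = shiftY (theta g)"
proof (rule V_eqI)
  fix i z assume i: "i \<in> {1..n}"
  have yg: "var_y R \<otimes>\<^bsub>PS\<^esub> g \<in> carrier PS" using g by (simp add: var_y_eq)
  show "theta (var_y R \<otimes>\<^bsub>PS\<^esub> g) i z = shiftY (theta g) i z"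
  proof (cases "i < n")
    case True
    then have i1: "i + 1 \<in> {1..n}" "n - i = (n - (i + 1)) + 1" by (auto simp: atLeastAtMost_iff)
    have "csum (var_y R \<otimes>\<^bsub>PS\<^esub> g) z (n - i) = csum g z (n - (i + 1))"
      unfolding var_y_eq i1(2) by (rule csum_y_mult[OF g])
    then show ?thesis using True i i1(1) shiftY[OF theta_VK[OF g] i] by (simp add: theta_coeff)
  next
    case False
    then have ni: "i = n" using i by (auto simp: atLeastAtMost_iff)
    have n1: "1 \<in> {1..n}" "0 + n = (n - 1) + 1" using n_pos by (auto simp: atLeastAtMost_iff)
    have "csum (var_y R \<otimes>\<^bsub>PS\<^esub> g) z 0 = col (var_y R \<otimes>\<^bsub>PS\<^esub> g) 0 z \<oplus> csum (var_y R \<otimes>\<^bsub>PS\<^esub> g) (z - int m) (0 + n)"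
      by (rule csum_rec[OF yg])
    also have "col (var_y R \<otimes>\<^bsub>PS\<^esub> g) 0 z = \<zero>" using g by (simp add: col_def var_y_eq pmon_mult)
    also have "csum (var_y R \<otimes>\<^bsub>PS\<^esub> g) (z - int m) (0 + n) = csum g (z - int m) (n - 1)"
      unfolding n1(2) var_y_eq by (rule csum_y_mult[OF g])
    finally have "csum (var_y R \<otimes>\<^bsub>PS\<^esub> g) z 0 = csum g (z - int m) (n - 1)" using g by simp
    then show ?thesis
      using i n1(1) shiftY[OF theta_VK[OF g] i] g lmon_mult[OF one_closed K.vec_mem[OF theta_VK[OF g] n1(1)]]
      by (simp add: theta_coeff ni)
  qed
qed simp_all

lemma sect_closed [simp]:
  assumes "w \<in> Lam" shows "sect w \<in> carrier PS"
  using Lam_coeff[OF assms] by (auto simp: PS_carrier sect_def atLeastAtMost_iff)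

lemma theta_sect:
  assumes w: "w \<in> Lam" shows "theta (sect w) = w"
proof (rule V_eqI)
  fix i z assume i: "i \<in> {1..n}"
  have lt: "n - i < n" "n - (n - i) = i" using i n_pos by (auto simp: atLeastAtMost_iff)
  have "csum (sect w) (z - int m) (n - i + n) = \<zero>"
    unfolding csum_def by (rule add.finprod_one_eqI) (simp add: col_def sect_def)
  then have "csum (sect w) z (n - i) = col (sect w) (n - i) z \<oplus> \<zero>"
    using csum_rec[OF sect_closed[OF w], of z "n - i"] by simp
  also have "col (sect w) (n - i) z = w i z"
    using lt Lam_neg[OF w i] by (auto simp: col_def sect_def)
  finally show "theta (sect w) i z = w i z" using i Lam_coeff[OF w i] by (simp add: theta_coeff)
qed (use w in \<open>auto simp: PiE_iff\<close>)

lemma CI_eq: "CI = {h \<otimes>\<^bsub>PS\<^esub> (pmon \<one> m 0 \<ominus>\<^bsub>PS\<^esub> pmon \<one> 0 n) |h. h \<in> carrier PS}"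
  by (simp add: curve_ideal_def cgenideal_def var_x_pow var_y_pow)

lemma CI_ideal: "ideal CI PS"
  unfolding curve_ideal_def var_x_pow var_y_pow by (rule PS.cgenideal_ideal) simp

lemma CI_gen_mult:
  assumes h: "h \<in> carrier PS"
  shows "(h \<otimes>\<^bsub>PS\<^esub> (pmon \<one> m 0 \<ominus>\<^bsub>PS\<^esub> pmon \<one> 0 n)) (a, b) =
    (if m \<le> a then h (a - m, b) else \<zero>) \<ominus> (if n \<le> b then h (a, b - n) else \<zero>)"
proof -
  have "h \<otimes>\<^bsub>PS\<^esub> (pmon \<one> m 0 \<ominus>\<^bsub>PS\<^esub> pmon \<one> 0 n) = pmon \<one> m 0 \<otimes>\<^bsub>PS\<^esub> h \<oplus>\<^bsub>PS\<^esub> (\<ominus>\<^bsub>PS\<^esub> (pmon \<one> 0 n \<otimes>\<^bsub>PS\<^esub> h))"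
    using h by (simp add: PS.minus_eq PS.r_distr PS.r_minus PS.m_comm)
  then show ?thesis
    using h by (simp add: PS_add PS_minus pmon_mult PS_coeff minus_eq)
qed

text \<open>A series with vanishing image is divided by x^m - y^n explicitly, the quotient being the
  negative tail of the sums that define \<open>csum\<close>. Conversely x^m h and y^n h have the
  same image, by a shift of the summation index.\<close>

lemma theta_CI:
  assumes f: "f \<in> carrier PS"
  shows "theta f = \<zero>\<^bsub>V\<^esub> \<longleftrightarrow> f \<in> CI"
proof
  assume t0: "theta f = \<zero>\<^bsub>V\<^esub>"
  have T0: "csum f z b = \<zero>" if "b < n" for z b
  proof -
    have i: "n - b \<in> {1..n}" "n - (n - b) = b" using that by (auto simp: atLeastAtMost_iff)
    show ?thesis using arg_cong[OF t0, of "\<lambda>v. v (n - b) z"] i by (simp add: theta_coeff laurent_zero)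
  qed
  \<comment> \<open>By \<open>csum_rec\<close> the two shifted copies of this tail differ by exactly
    f; the vanishing of \<open>csum\<close> for b < n settles the boundary where y^n does not
    divide.\<close>
  define h where "h = (\<lambda>(a, b). \<ominus> csum f (int a) (b + n))"
  have h: "h \<in> carrier PS" using f by (auto simp: h_def PS_carrier)
  have "f = h \<otimes>\<^bsub>PS\<^esub> (pmon \<one> m 0 \<ominus>\<^bsub>PS\<^esub> pmon \<one> 0 n)"
  proof
    fix p :: "nat \<times> nat"
    obtain a b where p: "p = (a, b)" by (cases p)
    have fa: "f (a, b) \<in> carrier R" using f by (rule PS_coeff)
    have rec: "csum f (int a) b = f (a, b) \<oplus> csum f (int a - int m) (b + n)"
      using csum_rec[OF f, of "int a" b] by (simp add: col_def)
    have "(if m \<le> a then h (a - m, b) else \<zero>) = \<ominus> csum f (int a - int m) (b + n)"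
      using f by (auto simp: h_def csum_neg of_nat_diff)
    moreover have "(if n \<le> b then h (a, b - n) else \<zero>) = \<ominus> csum f (int a) b"
      using f T0 by (auto simp: h_def)
    moreover have "\<ominus> csum f (int a - int m) (b + n) \<ominus> (\<ominus> csum f (int a) b) = f (a, b)"
      unfolding rec using fa csum_closed[OF f, of "int a - int m" "b + n"] by algebra
    ultimately show "f p = (h \<otimes>\<^bsub>PS\<^esub> (pmon \<one> m 0 \<ominus>\<^bsub>PS\<^esub> pmon \<one> 0 n)) p"
      using CI_gen_mult[OF h] by (simp add: p)
  qed
  then show "f \<in> CI" unfolding CI_eq using h by blast
next
  assume "f \<in> CI"
  then obtain h where h: "h \<in> carrier PS" "f = h \<otimes>\<^bsub>PS\<^esub> (pmon \<one> m 0 \<ominus>\<^bsub>PS\<^esub> pmon \<one> 0 n)"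
    unfolding CI_eq by blast
  let ?x = "pmon \<one> m 0 \<otimes>\<^bsub>PS\<^esub> h" and ?y = "pmon \<one> 0 n \<otimes>\<^bsub>PS\<^esub> h"
  have xy: "?x \<in> carrier PS" "?y \<in> carrier PS" using h by auto
  have "f \<oplus>\<^bsub>PS\<^esub> ?y = ?x"
  proof -
    have "f = ?x \<ominus>\<^bsub>PS\<^esub> ?y" using h by (simp add: PS.minus_eq PS.r_distr PS.r_minus PS.m_comm)
    then show ?thesis using xy by (simp add: PS.minus_eq PS.a_assoc PS.l_neg)
  qed
  have "csum f z b = \<zero>" if b: "b < n" for z b
  proof -
    have "csum ?x z b = csum h (z - int m) b"
    proof -
      have "col ?x b' z' = col h b' (z' - int m)" for b' z'
        using h by (auto simp: col_def pmon_mult PS_coeff nat_diff_distrib)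
      then have "csum ?x z b = (\<Oplus>q\<in>{..nat z}. col h (b + n * q) (z - int m - int (m * q)))"
        by (simp add: csum_def algebra_simps)
      also have "\<dots> = csum h (z - int m) b" using h by (intro csum_ext[symmetric]) auto
      finally show ?thesis .
    qed
    moreover have "csum ?y z b = csum h (z - int m) b"
    proof -
      have "col ?y b z = \<zero>" using h b by (simp add: col_def pmon_mult)
      then show ?thesis using csum_rec[OF xy(2), of z b] csum_y_mult[OF h(1), of n "z - int m" b] h by simp
    qed
    moreover have "csum f z b \<oplus> csum ?y z b = csum ?x z b"
      using csum_add[OF f xy(2), of z b] \<open>f \<oplus>\<^bsub>PS\<^esub> ?y = ?x\<close> by simp
    ultimately show ?thesis using f h(1) add.r_cancel_one[of "csum h (z - int m) b" "csum f z b"] by simp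
  qed
  moreover have "n - i < n" if "i \<in> {1..n}" for i using that n_pos by (auto simp: atLeastAtMost_iff)
  ultimately show "theta f = \<zero>\<^bsub>V\<^esub>" by (intro V_eqI) (auto simp: theta_coeff laurent_zero)
qed

section \<open>The curve ring as a quotient, computed through row vectors\<close>

lemma CR_cring: "cring CR"
  unfolding curve_ring_def using ideal.quotient_is_cring[OF CI_ideal PS_cring] .

sublocale CR: cring CR by (rule CR_cring)

lemma cl_hom: "cl \<in> ring_hom PS CR"
  using ideal.rcos_ring_hom[OF CI_ideal] unfolding curve_ring_def curve_class_def by simp

lemma cl_ops:
  "f \<in> carrier PS \<Longrightarrow> cl f \<in> carrier CR"
  "f \<in> carrier PS \<Longrightarrow> g \<in> carrier PS \<Longrightarrow> cl (f \<otimes>\<^bsub>PS\<^esub> g) = cl f \<otimes>\<^bsub>CR\<^esub> cl g"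
  "f \<in> carrier PS \<Longrightarrow> g \<in> carrier PS \<Longrightarrow> cl (f \<oplus>\<^bsub>PS\<^esub> g) = cl f \<oplus>\<^bsub>CR\<^esub> cl g"
  "cl \<one>\<^bsub>PS\<^esub> = \<one>\<^bsub>CR\<^esub>"
  using ring_hom_memE[OF cl_hom] by auto

lemma CR_carrier: "carrier CR = cl ` carrier PS"
  by (auto simp: curve_ring_def FactRing_def A_RCOSETS_def' curve_class_def image_iff)

text \<open>\<open>theta\<close> is additive with kernel the curve ideal, hence a complete invariant
  of classes. From here on computations in the curve ring are made on row vectors.\<close>

lemma cl_eq_iff:
  assumes f: "f \<in> carrier PS" and g: "g \<in> carrier PS"
  shows "cl f = cl g \<longleftrightarrow> theta f = theta g"
proof -
  have d: "f \<ominus>\<^bsub>PS\<^esub> g \<in> carrier PS" using f g by simp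
  have V: "theta f \<in> carrier V" "theta g \<in> carrier V" "theta (f \<ominus>\<^bsub>PS\<^esub> g) \<in> carrier V" using f g d by auto
  have "(f \<ominus>\<^bsub>PS\<^esub> g) \<oplus>\<^bsub>PS\<^esub> g = f" using f g by (simp add: PS.minus_eq PS.a_assoc PS.l_neg)
  then have sum: "theta (f \<ominus>\<^bsub>PS\<^esub> g) \<oplus>\<^bsub>V\<^esub> theta g = theta f" using theta_add[OF d g] by simp
  have "cl f = cl g \<longleftrightarrow> f \<ominus>\<^bsub>PS\<^esub> g \<in> CI"
    using PS.quotient_eq_iff_same_a_r_cos[OF CI_ideal f g] by (simp add: curve_class_def)
  also have "\<dots> \<longleftrightarrow> theta (f \<ominus>\<^bsub>PS\<^esub> g) = \<zero>\<^bsub>V\<^esub>" using theta_CI[OF d] by simp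
  also have "\<dots> \<longleftrightarrow> theta f = theta g"
    using sum V.M.add.r_cancel_one[OF V(2) V(3)] by metis
  finally show ?thesis .
qed

lemma cl_sect: "f \<in> carrier PS \<Longrightarrow> cl (sect (theta f)) = cl f"
  by (simp add: cl_eq_iff theta_sect)

definition curve_submodule :: "(nat \<Rightarrow> int \<Rightarrow> 'a) set \<Rightarrow> bool" where
  "curve_submodule W \<longleftrightarrow> K0_submodule W \<and> (\<forall>w\<in>W. shiftY w \<in> W)"

lemma curve_submoduleD:
  assumes "curve_submodule W"
  shows "K0_submodule W" "w \<in> W \<Longrightarrow> shiftY w \<in> W" "w \<in> W \<Longrightarrow> w \<in> Lam" "\<zero>\<^bsub>V\<^esub> \<in> W"
    "v \<in> W \<Longrightarrow> w \<in> W \<Longrightarrow> v \<oplus>\<^bsub>V\<^esub> w \<in> W" "a \<in> carrier K0 \<Longrightarrow> w \<in> W \<Longrightarrow> a \<odot>\<^bsub>V\<^esub> w \<in> W"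
  using assms unfolding curve_submodule_def K0_submodule_def by blast+

text \<open>Stability under R[[\<epsilon>]] and under Y gives, by Horner's scheme, stability under
  polynomials in y with coefficients in R[[x]]. This is enough, because every class has the
  representative \<open>sect\<close> of y-degree below n.\<close>

lemma theta_mult_closed:
  assumes W: "curve_submodule W" and f: "f \<in> carrier PS" and g: "g \<in> carrier PS" and gW: "theta g \<in> W"
  shows "theta (f \<otimes>\<^bsub>PS\<^esub> g) \<in> W"
proof -
  have poly: "theta (f \<otimes>\<^bsub>PS\<^esub> g) \<in> W" if "f \<in> carrier PS" "\<forall>a b. N \<le> b \<longrightarrow> f (a, b) = \<zero>" for f N
    using that
  proof (induction N arbitrary: f)
    case 0
    then have "f = \<zero>\<^bsub>PS\<^esub>" by (auto simp: fun_eq_iff PS_zero)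
    then have "theta (f \<otimes>\<^bsub>PS\<^esub> g) = \<zero>\<^bsub>V\<^esub>"
      using g theta_CI[OF PS.zero_closed] additive_subgroup.zero_closed[OF ideal.axioms(1)[OF CI_ideal]] by simp
    then show ?case using curve_submoduleD(4)[OF W] by simp
  next
    case (Suc N)
    define f' where "f' = (\<lambda>(a, b). f (a, Suc b))"
    have f': "f' \<in> carrier PS" using Suc.prems(1) by (auto simp: f'_def PS_carrier)
    have c0: "col f 0 \<in> carrier K0" using Suc.prems(1) by simp
    have yP: "var_y R \<in> carrier PS" by (simp add: var_y_eq)
    have "f = xseries (col f 0) \<oplus>\<^bsub>PS\<^esub> var_y R \<otimes>\<^bsub>PS\<^esub> f'"
    proof
      fix p
      show "f p = (xseries (col f 0) \<oplus>\<^bsub>PS\<^esub> var_y R \<otimes>\<^bsub>PS\<^esub> f') p"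
        using f' Suc.prems(1) PS_coeff[OF Suc.prems(1)]
        by (cases p; cases "snd p") (auto simp: PS_add xseries_def col_def var_y_eq pmon_mult f'_def PS_coeff)
    qed
    then have "f \<otimes>\<^bsub>PS\<^esub> g = xseries (col f 0) \<otimes>\<^bsub>PS\<^esub> g \<oplus>\<^bsub>PS\<^esub> var_y R \<otimes>\<^bsub>PS\<^esub> (f' \<otimes>\<^bsub>PS\<^esub> g)"
      using f' g c0 yP by (metis PS.l_distr PS.m_assoc PS.m_closed xseries_closed)
    then have "theta (f \<otimes>\<^bsub>PS\<^esub> g) = col f 0 \<odot>\<^bsub>V\<^esub> theta g \<oplus>\<^bsub>V\<^esub> shiftY (theta (f' \<otimes>\<^bsub>PS\<^esub> g))"
      using f' g c0 yP by (simp add: theta_add theta_xseries theta_y)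
    moreover have "theta (f' \<otimes>\<^bsub>PS\<^esub> g) \<in> W"
      using f' Suc.prems(2) by (intro Suc.IH) (auto simp: f'_def)
    ultimately show ?case using curve_submoduleD[OF W] gW c0 by simp
  qed
  have s: "sect (theta f) \<in> carrier PS" using f by simp
  have "cl (f \<otimes>\<^bsub>PS\<^esub> g) = cl (sect (theta f) \<otimes>\<^bsub>PS\<^esub> g)" using f g s by (simp add: cl_ops cl_sect)
  then have "theta (f \<otimes>\<^bsub>PS\<^esub> g) = theta (sect (theta f) \<otimes>\<^bsub>PS\<^esub> g)" using f g s cl_eq_iff by simp
  also have "\<dots> \<in> W" by (rule poly[of _ n]) (use s in \<open>auto simp: sect_def\<close>)
  finally show ?thesis .
qed

section \<open>Ideals of the curve ring and Y-stable submodules\<close>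

definition idl_of :: "(nat \<Rightarrow> int \<Rightarrow> 'a) set \<Rightarrow> (nat \<times> nat \<Rightarrow> 'a) set set" where
  "idl_of W = {cl f |f. f \<in> carrier PS \<and> theta f \<in> W}"

definition lat_of :: "(nat \<times> nat \<Rightarrow> 'a) set set \<Rightarrow> (nat \<Rightarrow> int \<Rightarrow> 'a) set" where
  "lat_of J = {theta f |f. f \<in> carrier PS \<and> cl f \<in> J}"

lemma cl_mem_idl_of: "f \<in> carrier PS \<Longrightarrow> cl f \<in> idl_of W \<longleftrightarrow> theta f \<in> W"
  unfolding idl_of_def using cl_eq_iff by auto

lemma theta_mem_lat_of: "f \<in> carrier PS \<Longrightarrow> theta f \<in> lat_of J \<longleftrightarrow> cl f \<in> J"
  unfolding lat_of_def using cl_eq_iff[of f] by (auto, metis)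

lemma lat_of_mem: "w \<in> Lam \<Longrightarrow> w \<in> lat_of J \<longleftrightarrow> cl (sect w) \<in> J"
  using theta_mem_lat_of[of "sect w" J] theta_sect[of w] by simp

lemma lat_of_Lam: "lat_of J \<subseteq> Lam"
  unfolding lat_of_def using theta_closed by blast

lemma idl_of_CR: "idl_of W \<subseteq> carrier CR"
  unfolding idl_of_def using cl_ops(1) by blast

lemma lat_of_idl_of:
  assumes "W \<subseteq> Lam" shows "lat_of (idl_of W) = W"
proof
  show "lat_of (idl_of W) \<subseteq> W" unfolding lat_of_def using cl_mem_idl_of by auto
  show "W \<subseteq> lat_of (idl_of W)"
  proof
    fix w assume "w \<in> W"
    then have "w \<in> Lam" "theta (sect w) \<in> W" using assms theta_sect by auto
    then show "w \<in> lat_of (idl_of W)" using lat_of_mem cl_mem_idl_of sect_closed by blast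
  qed
qed

lemma idl_of_lat_of:
  assumes "J \<subseteq> carrier CR" shows "idl_of (lat_of J) = J"
proof
  show "idl_of (lat_of J) \<subseteq> J" unfolding idl_of_def using theta_mem_lat_of by auto
  show "J \<subseteq> idl_of (lat_of J)"
    using assms theta_mem_lat_of unfolding CR_carrier idl_of_def by auto
qed

lemma idl_of_inj: "W \<subseteq> Lam \<Longrightarrow> W' \<subseteq> Lam \<Longrightarrow> idl_of W = idl_of W' \<Longrightarrow> W = W'"
  using lat_of_idl_of by metis

lemma idl_of_mono_iff: "W \<subseteq> Lam \<Longrightarrow> W' \<subseteq> Lam \<Longrightarrow> idl_of W \<subseteq> idl_of W' \<longleftrightarrow> W \<subseteq> W'"
proof
  assume "W \<subseteq> Lam" "W' \<subseteq> Lam" "idl_of W \<subseteq> idl_of W'"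
  then have "lat_of (idl_of W) \<subseteq> lat_of (idl_of W')" by (auto simp: lat_of_def)
  then show "W \<subseteq> W'" using lat_of_idl_of \<open>W \<subseteq> Lam\<close> \<open>W' \<subseteq> Lam\<close> by simp
qed (auto simp: idl_of_def)

lemma idl_of_ideal:
  assumes W: "curve_submodule W"
  shows "ideal (idl_of W) CR"
proof (rule idealI)
  note D = curve_submoduleD[OF W]
  show "ring CR" by (rule CR.ring_axioms)
  have mult: "x \<otimes>\<^bsub>CR\<^esub> a \<in> idl_of W" if ax: "a \<in> idl_of W" "x \<in> carrier CR" for a x
  proof -
    obtain f g where fg: "f \<in> carrier PS" "x = cl f" "g \<in> carrier PS" "theta g \<in> W" "a = cl g"
      using ax unfolding CR_carrier idl_of_def by auto
    have "x \<otimes>\<^bsub>CR\<^esub> a = cl (f \<otimes>\<^bsub>PS\<^esub> g)" using fg by (simp add: cl_ops)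
    then show ?thesis using theta_mult_closed[OF W fg(1,3,4)] fg cl_mem_idl_of by simp
  qed
  show "subgroup (idl_of W) (add_monoid CR)"
  proof (rule CR.add.subgroupI)
    show "idl_of W \<subseteq> carrier CR" by (rule idl_of_CR)
    have "theta \<zero>\<^bsub>PS\<^esub> = \<zero>\<^bsub>V\<^esub>"
      using theta_CI[OF PS.zero_closed] additive_subgroup.zero_closed[OF ideal.axioms(1)[OF CI_ideal]] by simp
    then have "cl \<zero>\<^bsub>PS\<^esub> \<in> idl_of W" using cl_mem_idl_of[OF PS.zero_closed] D(4) by simp
    then show "idl_of W \<noteq> {}" by blast
    show "\<ominus>\<^bsub>CR\<^esub> x \<in> idl_of W" if "x \<in> idl_of W" for x
    proof -
      have x: "x \<in> carrier CR" using that idl_of_CR by blast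
      then have "\<ominus>\<^bsub>CR\<^esub> x = (\<ominus>\<^bsub>CR\<^esub> \<one>\<^bsub>CR\<^esub>) \<otimes>\<^bsub>CR\<^esub> x" by (simp add: CR.l_minus)
      then show ?thesis using mult[OF that, of "\<ominus>\<^bsub>CR\<^esub> \<one>\<^bsub>CR\<^esub>"] by simp
    qed
    show "x \<oplus>\<^bsub>CR\<^esub> y \<in> idl_of W" if xy: "x \<in> idl_of W" "y \<in> idl_of W" for x y
    proof -
      obtain f g where fg: "f \<in> carrier PS" "theta f \<in> W" "x = cl f" "g \<in> carrier PS" "theta g \<in> W" "y = cl g"
        using xy unfolding idl_of_def by auto
      have "x \<oplus>\<^bsub>CR\<^esub> y = cl (f \<oplus>\<^bsub>PS\<^esub> g)" using fg by (simp add: cl_ops)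
      then show ?thesis using fg D(5) cl_mem_idl_of[of "f \<oplus>\<^bsub>PS\<^esub> g"] by (simp add: theta_add)
    qed
  qed
  show "x \<otimes>\<^bsub>CR\<^esub> a \<in> idl_of W" "a \<otimes>\<^bsub>CR\<^esub> x \<in> idl_of W" if "a \<in> idl_of W" "x \<in> carrier CR" for a x
    using mult[OF that] CR.m_comm[of a x] that(2) subsetD[OF idl_of_CR that(1)] by auto
qed

lemma lat_of_submodule:
  assumes J: "ideal J CR"
  shows "curve_submodule (lat_of J)"
  unfolding curve_submodule_def K0_submodule_def
proof (intro conjI ballI)
  interpret J: ideal J CR by (rule J)
  show "lat_of J \<subseteq> Lam" by (rule lat_of_Lam)
  have "theta \<zero>\<^bsub>PS\<^esub> = \<zero>\<^bsub>V\<^esub>"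
    using theta_CI[OF PS.zero_closed] additive_subgroup.zero_closed[OF ideal.axioms(1)[OF CI_ideal]] by simp
  moreover have "cl \<zero>\<^bsub>PS\<^esub> = \<zero>\<^bsub>CR\<^esub>" using ring_hom_zero[OF cl_hom PS.ring_axioms CR.ring_axioms] .
  ultimately show "\<zero>\<^bsub>V\<^esub> \<in> lat_of J" using theta_mem_lat_of[OF PS.zero_closed] J.zero_closed by metis
  show "v \<oplus>\<^bsub>V\<^esub> w \<in> lat_of J" if vw: "v \<in> lat_of J" "w \<in> lat_of J" for v w
  proof -
    obtain f g where fg: "f \<in> carrier PS" "cl f \<in> J" "v = theta f" "g \<in> carrier PS" "cl g \<in> J" "w = theta g"
      using vw unfolding lat_of_def by auto
    then have "v \<oplus>\<^bsub>V\<^esub> w = theta (f \<oplus>\<^bsub>PS\<^esub> g)" by (simp add: theta_add)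
    then show ?thesis using fg theta_mem_lat_of[of "f \<oplus>\<^bsub>PS\<^esub> g"] by (simp add: cl_ops J.a_closed)
  qed
  show "a \<odot>\<^bsub>V\<^esub> w \<in> lat_of J" if aw: "a \<in> carrier K0" "w \<in> lat_of J" for a w
  proof -
    obtain f where f: "f \<in> carrier PS" "cl f \<in> J" "w = theta f" using aw unfolding lat_of_def by auto
    then have "a \<odot>\<^bsub>V\<^esub> w = theta (xseries a \<otimes>\<^bsub>PS\<^esub> f)" using aw by (simp add: theta_xseries)
    then show ?thesis using f aw theta_mem_lat_of[of "xseries a \<otimes>\<^bsub>PS\<^esub> f"] by (simp add: cl_ops J.I_l_closed)
  qed
  show "shiftY w \<in> lat_of J" if w: "w \<in> lat_of J" for w
  proof -
    obtain f where f: "f \<in> carrier PS" "cl f \<in> J" "w = theta f" using w unfolding lat_of_def by auto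
    have y: "var_y R \<in> carrier PS" by (simp add: var_y_eq)
    have "shiftY w = theta (var_y R \<otimes>\<^bsub>PS\<^esub> f)" using f by (simp add: theta_y)
    then show ?thesis using f y theta_mem_lat_of[of "var_y R \<otimes>\<^bsub>PS\<^esub> f"] by (simp add: cl_ops J.I_l_closed)
  qed
qed

text \<open>Multiplication by y is right multiplication by Y on images, so the closing condition of
  a chain of ideals becomes a condition on lattices.\<close>

lemma y_coset:
  assumes "W \<subseteq> Lam"
  shows "cl (var_y R) <#\<^bsub>CR\<^esub> idl_of W = idl_of (shiftY ` W)"
proof -
  have y: "var_y R \<in> carrier PS" by (simp add: var_y_eq)
  have "cl (var_y R) <#\<^bsub>CR\<^esub> idl_of W = {cl (var_y R \<otimes>\<^bsub>PS\<^esub> f) |f. f \<in> carrier PS \<and> theta f \<in> W}"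
  proof (intro subset_antisym subsetI)
    fix c assume "c \<in> cl (var_y R) <#\<^bsub>CR\<^esub> idl_of W"
    then obtain f where f: "f \<in> carrier PS" "theta f \<in> W" "c = cl (var_y R) \<otimes>\<^bsub>CR\<^esub> cl f"
      unfolding l_coset_def idl_of_def by blast
    then have "c = cl (var_y R \<otimes>\<^bsub>PS\<^esub> f)" using cl_ops(2)[OF y f(1)] by simp
    then show "c \<in> {cl (var_y R \<otimes>\<^bsub>PS\<^esub> f) |f. f \<in> carrier PS \<and> theta f \<in> W}" using f by blast
  next
    fix c assume "c \<in> {cl (var_y R \<otimes>\<^bsub>PS\<^esub> f) |f. f \<in> carrier PS \<and> theta f \<in> W}"
    then obtain f where f: "f \<in> carrier PS" "theta f \<in> W" "c = cl (var_y R \<otimes>\<^bsub>PS\<^esub> f)" by blast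
    then have "c = cl (var_y R) \<otimes>\<^bsub>CR\<^esub> cl f" using cl_ops(2)[OF y f(1)] by simp
    then show "c \<in> cl (var_y R) <#\<^bsub>CR\<^esub> idl_of W" using f unfolding l_coset_def idl_of_def by blast
  qed
  also have "\<dots> = idl_of (shiftY ` W)"
  proof (intro subset_antisym subsetI)
    fix c assume "c \<in> {cl (var_y R \<otimes>\<^bsub>PS\<^esub> f) |f. f \<in> carrier PS \<and> theta f \<in> W}"
    then obtain f where f: "f \<in> carrier PS" "theta f \<in> W" "c = cl (var_y R \<otimes>\<^bsub>PS\<^esub> f)" by blast
    then have "theta (var_y R \<otimes>\<^bsub>PS\<^esub> f) \<in> shiftY ` W" by (simp add: theta_y)
    then show "c \<in> idl_of (shiftY ` W)" unfolding idl_of_def using f y by blast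
  next
    fix c assume "c \<in> idl_of (shiftY ` W)"
    then obtain g w where g: "g \<in> carrier PS" "c = cl g" "theta g = shiftY w" "w \<in> W" unfolding idl_of_def by auto
    then have w: "w \<in> Lam" using assms by blast
    have "theta (var_y R \<otimes>\<^bsub>PS\<^esub> sect w) = theta g" using g w by (simp add: theta_y theta_sect)
    then have "c = cl (var_y R \<otimes>\<^bsub>PS\<^esub> sect w)" using g w y cl_eq_iff[OF g(1), of "var_y R \<otimes>\<^bsub>PS\<^esub> sect w"] by simp
    moreover have "theta (sect w) \<in> W" using g w by (simp add: theta_sect)
    ultimately show "c \<in> {cl (var_y R \<otimes>\<^bsub>PS\<^esub> f) |f. f \<in> carrier PS \<and> theta f \<in> W}"
      using sect_closed[OF w] by blast
  qed
  finally show ?thesis .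
qed

end

section \<open>Ideals with projective quotient\<close>

context curve_setting
begin

text \<open>Linearity is over \<open>R\<close> only, with \<open>lmon c 0\<close> the constant c: in
  the applications the quotient by W is killed by a power of \<epsilon>, so that a splitting over
  R[[\<epsilon>]] cannot be expected. Such a map makes W a direct summand over
  \<open>R\<close>.\<close>

definition retraction :: "(nat \<Rightarrow> int \<Rightarrow> 'a) set \<Rightarrow> ((nat \<Rightarrow> int \<Rightarrow> 'a) \<Rightarrow> nat \<Rightarrow> int \<Rightarrow> 'a) \<Rightarrow> bool" where
  "retraction W P \<longleftrightarrow> (\<forall>w\<in>Lam. P w \<in> W) \<and> (\<forall>w\<in>W. P w = w) \<and>
     (\<forall>v\<in>Lam. \<forall>w\<in>Lam. P (v \<oplus>\<^bsub>V\<^esub> w) = P v \<oplus>\<^bsub>V\<^esub> P w) \<and>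
     (\<forall>c\<in>carrier R. \<forall>w\<in>Lam. P (lmon c 0 \<odot>\<^bsub>V\<^esub> w) = lmon c 0 \<odot>\<^bsub>V\<^esub> P w)"

lemma Lam_closed:
  "\<zero>\<^bsub>V\<^esub> \<in> Lam" "v \<in> Lam \<Longrightarrow> w \<in> Lam \<Longrightarrow> v \<oplus>\<^bsub>V\<^esub> w \<in> Lam" "a \<in> carrier K0 \<Longrightarrow> w \<in> Lam \<Longrightarrow> a \<odot>\<^bsub>V\<^esub> w \<in> Lam"
  using Lam_submodule unfolding K0_submodule_def by blast+

lemma sect_add:
  assumes "v \<in> Lam" "w \<in> Lam"
  shows "sect (v \<oplus>\<^bsub>V\<^esub> w) = sect v \<oplus>\<^bsub>PS\<^esub> sect w"
proof
  fix p
  show "sect (v \<oplus>\<^bsub>V\<^esub> w) p = (sect v \<oplus>\<^bsub>PS\<^esub> sect w) p"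
    by (cases p) (auto simp: sect_def PS_add laurent_add atLeastAtMost_iff)
qed

lemma sect_smult:
  assumes "c \<in> carrier R" "w \<in> Lam"
  shows "sect (lmon c 0 \<odot>\<^bsub>V\<^esub> w) = pmon c 0 0 \<otimes>\<^bsub>PS\<^esub> sect w"
proof
  fix p :: "nat \<times> nat"
  obtain a b where p: "p = (a, b)" by (cases p)
  have "(pmon c 0 0 \<otimes>\<^bsub>PS\<^esub> sect w) (a, b) = c \<otimes> sect w (a, b)"
    using pmon_mult[OF assms(1) sect_closed[OF assms(2)]] by simp
  moreover have "sect (lmon c 0 \<odot>\<^bsub>V\<^esub> w) (a, b) = c \<otimes> sect w (a, b)"
  proof (cases "b < n")
    case True
    then have "n - b \<in> {1..n}" by (auto simp: atLeastAtMost_iff)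
    then show ?thesis
      using True V_smult_lmon[OF Lam_VK[OF assms(2)] assms(1)] by (simp add: sect_def del: vec_smult)
  qed (use assms in \<open>simp add: sect_def\<close>)
  ultimately show "sect (lmon c 0 \<odot>\<^bsub>V\<^esub> w) p = (pmon c 0 0 \<otimes>\<^bsub>PS\<^esub> sect w) p" by (simp add: p)
qed

lemma pmon_add: "a \<in> carrier R \<Longrightarrow> b \<in> carrier R \<Longrightarrow> pmon (a \<oplus> b) i j = pmon a i j \<oplus>\<^bsub>PS\<^esub> pmon b i j"
  by (auto simp: pmon_def PS_add fun_eq_iff)

lemma lmon_add: "a \<in> carrier R \<Longrightarrow> b \<in> carrier R \<Longrightarrow> lmon (a \<oplus> b) k = lmon a k \<oplus>\<^bsub>K\<^esub> lmon b k"
  by (rule ext) (simp add: lmon_def laurent_add)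

lemma cl_pow: "f \<in> carrier PS \<Longrightarrow> cl (f [^]\<^bsub>PS\<^esub> (k::nat)) = cl f [^]\<^bsub>CR\<^esub> k"
  by (induction k) (simp_all add: cl_ops)

end

locale curve_ideal_setting = curve_setting +
  fixes J
  assumes J: "ideal J CR"
begin

abbreviation "W \<equiv> lat_of J"
abbreviation "Q \<equiv> curve_quotient_module m n R J"

text \<open>The quotient map on row vectors. As \<open>sect\<close> is additive and commutes with
  constants, it is an \<open>R\<close>-linear surjection from the integral vectors onto the
  quotient, with kernel W.\<close>

definition proj :: "(nat \<Rightarrow> int \<Rightarrow> 'a) \<Rightarrow> (nat \<times> nat \<Rightarrow> 'a) set set" where
  "proj w = J +>\<^bsub>CR\<^esub> cl (sect w)"

sublocale J: ideal J CR by (rule J)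

lemma W_sub: "curve_submodule W" by (rule lat_of_submodule[OF J])

lemma Q_simps:
  "carrier Q = carrier (CR Quot J)" "u \<oplus>\<^bsub>Q\<^esub> v = u \<oplus>\<^bsub>CR Quot J\<^esub> v" "\<zero>\<^bsub>Q\<^esub> = J"
  "c \<odot>\<^bsub>Q\<^esub> q = (J +>\<^bsub>CR\<^esub> cl (pmon c 0 0)) \<otimes>\<^bsub>CR Quot J\<^esub> q"
  by (simp_all add: curve_quotient_module_def Let_def FactRing_def const_series_eq)

lemma rho_ops:
  "x \<in> carrier CR \<Longrightarrow> J +>\<^bsub>CR\<^esub> x \<in> carrier (CR Quot J)"
  "x \<in> carrier CR \<Longrightarrow> y \<in> carrier CR \<Longrightarrow> J +>\<^bsub>CR\<^esub> (x \<otimes>\<^bsub>CR\<^esub> y) = (J +>\<^bsub>CR\<^esub> x) \<otimes>\<^bsub>CR Quot J\<^esub> (J +>\<^bsub>CR\<^esub> y)"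
  "x \<in> carrier CR \<Longrightarrow> y \<in> carrier CR \<Longrightarrow> J +>\<^bsub>CR\<^esub> (x \<oplus>\<^bsub>CR\<^esub> y) = (J +>\<^bsub>CR\<^esub> x) \<oplus>\<^bsub>CR Quot J\<^esub> (J +>\<^bsub>CR\<^esub> y)"
  "J +>\<^bsub>CR\<^esub> \<one>\<^bsub>CR\<^esub> = \<one>\<^bsub>CR Quot J\<^esub>"
  using ring_hom_memE[OF J.rcos_ring_hom] by auto

lemma Q_module: "module R Q"
proof -
  interpret F: cring "CR Quot J" by (rule J.quotient_is_cring[OF CR_cring])
  have c: "J +>\<^bsub>CR\<^esub> cl (pmon a 0 0) \<in> carrier (CR Quot J)" if "a \<in> carrier R" for a
    using that by (simp add: rho_ops cl_ops)
  show ?thesis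
  proof (rule moduleI)
    show "cring R" by (rule is_cring)
    have z: "\<zero>\<^bsub>CR Quot J\<^esub> = J" by (simp add: FactRing_def)
    show "abelian_group Q"
    proof (rule abelian_groupI)
      show "\<zero>\<^bsub>Q\<^esub> \<in> carrier Q" using F.zero_closed by (simp add: Q_simps z)
      show "\<zero>\<^bsub>Q\<^esub> \<oplus>\<^bsub>Q\<^esub> x = x" if "x \<in> carrier Q" for x using F.l_zero that by (simp add: Q_simps z)
      show "\<exists>y\<in>carrier Q. y \<oplus>\<^bsub>Q\<^esub> x = \<zero>\<^bsub>Q\<^esub>" if "x \<in> carrier Q" for x
        using F.add.l_inv_ex[of x] that by (simp add: Q_simps z)
      show "x \<oplus>\<^bsub>Q\<^esub> y = y \<oplus>\<^bsub>Q\<^esub> x" if "x \<in> carrier Q" "y \<in> carrier Q" for x y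
        using F.a_comm that by (simp add: Q_simps)
      show "x \<oplus>\<^bsub>Q\<^esub> y \<oplus>\<^bsub>Q\<^esub> z = x \<oplus>\<^bsub>Q\<^esub> (y \<oplus>\<^bsub>Q\<^esub> z)" if "x \<in> carrier Q" "y \<in> carrier Q" "z \<in> carrier Q" for x y z
        using F.a_assoc that by (simp add: Q_simps)
      show "x \<oplus>\<^bsub>Q\<^esub> y \<in> carrier Q" if "x \<in> carrier Q" "y \<in> carrier Q" for x y
        using F.a_closed that by (simp add: Q_simps)
    qed
    have cm: "J +>\<^bsub>CR\<^esub> cl (pmon (a \<otimes> b) 0 0) = (J +>\<^bsub>CR\<^esub> cl (pmon a 0 0)) \<otimes>\<^bsub>CR Quot J\<^esub> (J +>\<^bsub>CR\<^esub> cl (pmon b 0 0))"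
      if ab: "a \<in> carrier R" "b \<in> carrier R" for a b
      using ab pmon_mult_pmon[OF ab, of 0 0 0 0] by (simp add: rho_ops(2)[symmetric] cl_ops(1) cl_ops(2)[symmetric])
    have ca: "J +>\<^bsub>CR\<^esub> cl (pmon (a \<oplus> b) 0 0) = (J +>\<^bsub>CR\<^esub> cl (pmon a 0 0)) \<oplus>\<^bsub>CR Quot J\<^esub> (J +>\<^bsub>CR\<^esub> cl (pmon b 0 0))"
      if ab: "a \<in> carrier R" "b \<in> carrier R" for a b
      using ab by (simp add: pmon_add cl_ops rho_ops)
    show "a \<odot>\<^bsub>Q\<^esub> x \<in> carrier Q" if "a \<in> carrier R" "x \<in> carrier Q" for a x
      using that(2) c[OF that(1)] by (simp add: Q_simps)
    show "(a \<oplus> b) \<odot>\<^bsub>Q\<^esub> x = (a \<odot>\<^bsub>Q\<^esub> x) \<oplus>\<^bsub>Q\<^esub> (b \<odot>\<^bsub>Q\<^esub> x)" if "a \<in> carrier R" "b \<in> carrier R" "x \<in> carrier Q" for a b x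
      using F.l_distr[OF c[OF that(1)] c[OF that(2)]] that(3) by (simp add: Q_simps ca that(1,2))
    show "a \<odot>\<^bsub>Q\<^esub> (x \<oplus>\<^bsub>Q\<^esub> y) = (a \<odot>\<^bsub>Q\<^esub> x) \<oplus>\<^bsub>Q\<^esub> (a \<odot>\<^bsub>Q\<^esub> y)" if "a \<in> carrier R" "x \<in> carrier Q" "y \<in> carrier Q" for a x y
      using F.r_distr[OF _ _ c[OF that(1)]] that(2,3) by (simp add: Q_simps)
    show "(a \<otimes> b) \<odot>\<^bsub>Q\<^esub> x = a \<odot>\<^bsub>Q\<^esub> (b \<odot>\<^bsub>Q\<^esub> x)" if "a \<in> carrier R" "b \<in> carrier R" "x \<in> carrier Q" for a b x
      using F.m_assoc[OF c[OF that(1)] c[OF that(2)]] that(3) by (simp add: Q_simps cm that(1,2))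
    show "\<one> \<odot>\<^bsub>Q\<^esub> x = x" if "x \<in> carrier Q" for x
      using F.l_one that by (simp add: Q_simps pmon_one cl_ops rho_ops)
  qed
qed

lemma proj_closed: "w \<in> Lam \<Longrightarrow> proj w \<in> carrier Q"
  by (simp add: proj_def Q_simps rho_ops cl_ops)

lemma proj_add: "v \<in> Lam \<Longrightarrow> w \<in> Lam \<Longrightarrow> proj (v \<oplus>\<^bsub>V\<^esub> w) = proj v \<oplus>\<^bsub>Q\<^esub> proj w"
  by (simp add: proj_def Q_simps rho_ops cl_ops sect_add)

lemma proj_smult: "c \<in> carrier R \<Longrightarrow> w \<in> Lam \<Longrightarrow> proj (lmon c 0 \<odot>\<^bsub>V\<^esub> w) = c \<odot>\<^bsub>Q\<^esub> proj w"
  by (simp add: proj_def Q_simps rho_ops cl_ops sect_smult)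

lemma proj_zero_iff:
  assumes w: "w \<in> Lam" shows "proj w = \<zero>\<^bsub>Q\<^esub> \<longleftrightarrow> w \<in> W"
proof -
  have x: "cl (sect w) \<in> carrier CR" using w by (simp add: cl_ops)
  have "J +>\<^bsub>CR\<^esub> cl (sect w) = J \<longleftrightarrow> cl (sect w) \<in> J"
    using J.rcos_const_imp_mem[OF x] J.a_rcos_const by blast
  then show ?thesis using lat_of_mem[OF w] by (simp add: proj_def Q_simps)
qed

lemma proj_surj:
  assumes "q \<in> carrier Q"
  obtains w where "w \<in> Lam" "q = proj w"
proof -
  obtain f where f: "f \<in> carrier PS" "q = J +>\<^bsub>CR\<^esub> cl f"
    using assms by (auto simp: Q_simps FactRing_def A_RCOSETS_def' CR_carrier)
  then have "q = proj (theta f)" by (simp add: proj_def cl_sect)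
  then show ?thesis using that f theta_closed by blast
qed

text \<open>The images of the free generators in the quotient are lifted to integral vectors.
  Sending a class through the section into the free module, and from there to the lifts, gives an
  \<open>R\<close>-linear splitting of the quotient map; subtracting it from the identity projects
  onto W.\<close>

lemma retraction_exists:
  assumes "finite_projective R Q"
  shows "\<exists>P. retraction W P"
proof -
  interpret Q: module R Q by (rule Q_module)
  from conjunct2[OF assms[unfolded finite_projective_def]]
  obtain N p s where p: "p \<in> linear_maps R (free_module R N) Q"
    and s: "s \<in> linear_maps R Q (free_module R N)" and "\<forall>q\<in>carrier Q. p (s q) = q"
    by (elim exE bexE)
  then have ps: "p (s q) = q" if "q \<in> carrier Q" for q using that by blast
  let ?F = "free_module R N"
  have F: "?F = vec_mod {..<N} R" by (simp add: free_module_def vec_mod_def)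
  interpret F: module R ?F unfolding F by (rule vec_module)
  have pc: "p x \<in> carrier Q" if "x \<in> carrier ?F" for x using p that by (auto simp: linear_maps_def)
  have pa: "p (x \<oplus>\<^bsub>?F\<^esub> y) = p x \<oplus>\<^bsub>Q\<^esub> p y" if "x \<in> carrier ?F" "y \<in> carrier ?F" for x y using p that by (auto simp: linear_maps_def)
  have pm: "p (c \<odot>\<^bsub>?F\<^esub> x) = c \<odot>\<^bsub>Q\<^esub> p x" if "c \<in> carrier R" "x \<in> carrier ?F" for c x using p that by (auto simp: linear_maps_def)
  have sc: "s q \<in> carrier ?F" if "q \<in> carrier Q" for q using s that by (auto simp: linear_maps_def)
  have sa: "s (x \<oplus>\<^bsub>Q\<^esub> y) = s x \<oplus>\<^bsub>?F\<^esub> s y" if "x \<in> carrier Q" "y \<in> carrier Q" for x y using s that by (auto simp: linear_maps_def)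
  have sm: "s (c \<odot>\<^bsub>Q\<^esub> x) = c \<odot>\<^bsub>?F\<^esub> s x" if "c \<in> carrier R" "x \<in> carrier Q" for c x using s that by (auto simp: linear_maps_def)
  let ?e = "unit_row {..<N} R"
  have e: "?e j \<in> carrier ?F" for j by (simp add: F)
  have "\<exists>l. l \<in> Lam \<and> proj l = p (?e j)" for j using proj_surj[OF pc[OF e]] by metis
  then obtain l where l: "\<And>j. l j \<in> Lam" "\<And>j. proj (l j) = p (?e j)" by metis
  have lV: "l j \<in> VK" for j using Lam_VK[OF l(1)] .
  define comb where "comb x = lincomb {..<N} (\<lambda>j. lmon (x j) 0) l" for x
  have xR: "x j \<in> carrier R" if "x \<in> carrier ?F" "j \<in> {..<N}" for x j
    using that by (intro vec_mem[of x "{..<N}"]) (simp_all add: F)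
  have combL: "comb x \<in> Lam" if "x \<in> carrier ?F" for x
    unfolding comb_def by (rule lincomb_in_submodule[OF Lam_submodule]) (use l xR[OF that] in auto)
  have comb: "proj (comb x) = p x" if x: "x \<in> carrier ?F" for x
  proof -
    \<comment> \<open>The vector x cut down to the coordinates in \<open>S\<close>, so that the
      claim can be proved by adding one generator at a time.\<close>
    define r where "r S = (\<lambda>j\<in>{..<N}. if j \<in> S then x j else \<zero>)" for S
    have rc: "r S \<in> carrier ?F" for S using xR[OF x] by (auto simp: r_def F)
    have "proj (lincomb S (\<lambda>j. lmon (x j) 0) l) = p (r S) \<and> lincomb S (\<lambda>j. lmon (x j) 0) l \<in> Lam"
      if "finite S" "S \<subseteq> {..<N}" for S
      using that
    proof (induction S rule: finite_induct)
      case empty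
      have "r {} = \<zero>\<^bsub>?F\<^esub>" by (auto simp: r_def F vec_mod_def)
      then have "r {} \<oplus>\<^bsub>?F\<^esub> r {} = r {}" using F.M.l_zero F.M.zero_closed by simp
      then have "p (r {}) \<oplus>\<^bsub>Q\<^esub> p (r {}) = p (r {})" using pa rc by metis
      then have "p (r {}) = \<zero>\<^bsub>Q\<^esub>" using Q.M.add.l_cancel_one[OF pc[OF rc] pc[OF rc]] by simp
      then show ?case
        using proj_zero_iff[OF Lam_closed(1)] curve_submoduleD(4)[OF W_sub] Lam_closed(1) by (simp add: lincomb_empty)
    next
      case (insert j S)
      then have jN: "j \<in> {..<N}" by auto
      let ?L = "lincomb S (\<lambda>j. lmon (x j) 0) l"
      have "lincomb (insert j S) (\<lambda>j. lmon (x j) 0) l = lmon (x j) 0 \<odot>\<^bsub>V\<^esub> l j \<oplus>\<^bsub>V\<^esub> ?L"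
        by (rule lincomb_insert) (use insert lV xR[OF x] in auto)
      moreover have "r (insert j S) = x j \<odot>\<^bsub>?F\<^esub> ?e j \<oplus>\<^bsub>?F\<^esub> r S"
        unfolding F by (rule vec_eqI[where I = "{..<N}"])
          (use jN insert.hyps xR[OF x] in \<open>auto simp: r_def unit_row_def\<close>)
      moreover have "x j \<odot>\<^bsub>?F\<^esub> ?e j \<in> carrier ?F" using F.smult_closed[OF xR[OF x jN] e] .
      ultimately show ?case
        using insert jN l xR[OF x jN] rc Lam_closed e by (simp add: proj_add proj_smult pa pm)
    qed
    from this[of "{..<N}"] have "proj (comb x) = p (r {..<N})" by (simp add: comb_def)
    moreover have "r {..<N} = x"
      by (rule vec_eqI[where I = "{..<N}"]) (use x in \<open>auto simp: r_def F PiE_iff\<close>)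
    ultimately show ?thesis by simp
  qed
  have comb_lin: "comb (x \<oplus>\<^bsub>?F\<^esub> c \<odot>\<^bsub>?F\<^esub> y) = comb x \<oplus>\<^bsub>V\<^esub> lmon c 0 \<odot>\<^bsub>V\<^esub> comb y"
    if "x \<in> carrier ?F" "y \<in> carrier ?F" "c \<in> carrier R" for x y c
  proof -
    have "comb (x \<oplus>\<^bsub>?F\<^esub> c \<odot>\<^bsub>?F\<^esub> y) = lincomb {..<N} (\<lambda>j. lmon (x j) 0 \<oplus>\<^bsub>K\<^esub> lmon c 0 \<otimes>\<^bsub>K\<^esub> lmon (y j) 0) l"
      unfolding comb_def
    proof (rule lincomb_cong)
      fix j assume j: "j \<in> {..<N}"
      show "lmon ((x \<oplus>\<^bsub>?F\<^esub> c \<odot>\<^bsub>?F\<^esub> y) j) 0 = lmon (x j) 0 \<oplus>\<^bsub>K\<^esub> lmon c 0 \<otimes>\<^bsub>K\<^esub> lmon (y j) 0"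
        using j that xR[OF that(1) j] xR[OF that(2) j]
        by (simp add: F lmon_add lmon_mult_lmon)
      show "lmon (x j) 0 \<oplus>\<^bsub>K\<^esub> lmon c 0 \<otimes>\<^bsub>K\<^esub> lmon (y j) 0 \<in> carrier K"
        using j that xR[OF that(1) j] xR[OF that(2) j] by simp
    qed (rule lV)
    also have "\<dots> = comb x \<oplus>\<^bsub>V\<^esub> lmon c 0 \<odot>\<^bsub>V\<^esub> comb y"
      unfolding comb_def using that xR lV by (intro lincomb_shift) auto
    finally show ?thesis .
  qed
  have comb0: "comb \<zero>\<^bsub>?F\<^esub> = \<zero>\<^bsub>V\<^esub>"
    unfolding comb_def by (rule lincomb_zero) (use lV in \<open>auto simp: F lmon_def fun_eq_iff laurent_zero\<close>)
  have m1: "lmon (\<ominus> \<one>) 0 \<in> carrier K0" "lmon (\<ominus> \<one>) 0 \<in> carrier K" by auto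
  define P where "P w = w \<oplus>\<^bsub>V\<^esub> lmon (\<ominus> \<one>) 0 \<odot>\<^bsub>V\<^esub> comb (s (proj w))" for w
  have cs: "comb (s (proj w)) \<in> Lam" if "w \<in> Lam" for w using combL sc proj_closed that by blast
  have V: "w \<in> carrier V" if "w \<in> Lam" for w using Lam_VK[OF that] by simp
  have "retraction W P"
    unfolding retraction_def
  proof (intro conjI ballI)
    fix w assume w: "w \<in> Lam"
    have PL: "P w \<in> Lam" using w cs[OF w] m1 Lam_closed by (simp add: P_def)
    have "proj (P w) = proj w \<oplus>\<^bsub>Q\<^esub> (\<ominus> \<one>) \<odot>\<^bsub>Q\<^esub> proj w"
      using w cs[OF w] m1 Lam_closed comb[OF sc[OF proj_closed[OF w]]] ps[OF proj_closed[OF w]]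
      by (simp add: P_def proj_add proj_smult)
    also have "\<dots> = \<zero>\<^bsub>Q\<^esub>"
      using Q.smult_l_minus[OF one_closed proj_closed[OF w]] Q.smult_one[OF proj_closed[OF w]]
        Q.M.r_neg[OF proj_closed[OF w]] by simp
    finally show "P w \<in> W" using proj_zero_iff[OF PL] by simp
  next
    fix w assume w: "w \<in> W"
    then have wL: "w \<in> Lam" using curve_submoduleD[OF W_sub] by blast
    have "proj w = \<zero>\<^bsub>Q\<^esub>" using proj_zero_iff[OF wL] w by simp
    then have "s (proj w) = s (\<zero> \<odot>\<^bsub>Q\<^esub> proj w)" using Q.smult_l_null[OF proj_closed[OF wL]] by simp
    also have "\<dots> = \<zero>\<^bsub>?F\<^esub>" using sm[OF zero_closed proj_closed[OF wL]] F.smult_l_null[OF sc[OF proj_closed[OF wL]]] by simp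
    finally show "P w = w"
      using comb0 V.smult_r_null[OF m1(2)] V.M.r_zero[OF V[OF wL]] by (simp add: P_def)
  next
    fix v w assume vw: "v \<in> Lam" "w \<in> Lam"
    note c = V[OF vw(1)] V[OF vw(2)] V[OF cs[OF vw(1)]] V[OF cs[OF vw(2)]]
    have "comb (s (proj (v \<oplus>\<^bsub>V\<^esub> w))) = comb (s (proj v) \<oplus>\<^bsub>?F\<^esub> \<one> \<odot>\<^bsub>?F\<^esub> s (proj w))"
      using vw sc proj_closed by (simp add: proj_add sa)
    also have "\<dots> = comb (s (proj v)) \<oplus>\<^bsub>V\<^esub> comb (s (proj w))"
      using comb_lin[OF sc sc one_closed] vw proj_closed V.smult_one[OF c(4)] by (simp add: laurent_one)
    finally have eq: "comb (s (proj (v \<oplus>\<^bsub>V\<^esub> w))) = comb (s (proj v)) \<oplus>\<^bsub>V\<^esub> comb (s (proj w))" .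
    show "P (v \<oplus>\<^bsub>V\<^esub> w) = P v \<oplus>\<^bsub>V\<^esub> P w"
      unfolding P_def eq
      using c m1(2) V.smult_closed[OF m1(2)] V.smult_r_distr[OF m1(2) c(3,4)]
      by (simp add: V.M.a_ac del: vec_carrier)
  next
    fix c w assume cw: "c \<in> carrier R" "w \<in> Lam"
    have eq: "comb (s (proj (lmon c 0 \<odot>\<^bsub>V\<^esub> w))) = lmon c 0 \<odot>\<^bsub>V\<^esub> comb (s (proj w))"
    proof -
      have "s (proj (lmon c 0 \<odot>\<^bsub>V\<^esub> w)) = \<zero>\<^bsub>?F\<^esub> \<oplus>\<^bsub>?F\<^esub> c \<odot>\<^bsub>?F\<^esub> s (proj w)"
        using cw sm[OF cw(1) proj_closed[OF cw(2)]] F.M.l_zero[OF F.smult_closed[OF cw(1) sc[OF proj_closed[OF cw(2)]]]]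
        by (simp add: proj_smult)
      then have "comb (s (proj (lmon c 0 \<odot>\<^bsub>V\<^esub> w))) = \<zero>\<^bsub>V\<^esub> \<oplus>\<^bsub>V\<^esub> lmon c 0 \<odot>\<^bsub>V\<^esub> comb (s (proj w))"
        using comb_lin[OF F.M.zero_closed sc[OF proj_closed[OF cw(2)]] cw(1)] comb0 by simp
      then show ?thesis
        using V.M.l_zero[OF V.smult_closed[OF lmon_closed[OF cw(1)] V[OF cs[OF cw(2)]]]] by simp
    qed
    have cK: "lmon c 0 \<in> carrier K" using cw by simp
    note wV = V[OF cw(2)] V[OF cs[OF cw(2)]]
    show "P (lmon c 0 \<odot>\<^bsub>V\<^esub> w) = lmon c 0 \<odot>\<^bsub>V\<^esub> P w"
      unfolding P_def eq V.smult_r_distr[OF cK wV(1) V.smult_closed[OF m1(2) wV(2)]]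
      using V.smult_assoc1[OF m1(2) cK wV(2)] V.smult_assoc1[OF cK m1(2) wV(2)] K.m_comm[OF m1(2) cK] by simp
  qed
  then show ?thesis by blast
qed

end

section \<open>Truncation of vectors and multiplication by constants\<close>

context row_lattices
begin

text \<open>\<open>coeffs\<close> keeps the degrees 0 to k, so what remains is divisible by
  \<epsilon>^(k+1).\<close>

lemma trunc_split:
  assumes w: "w \<in> Lam"
  shows "\<exists>v\<in>Lam. w = from_coeffs k (coeffs k w) \<oplus>\<^bsub>V\<^esub> lmon \<one> (int k + 1) \<odot>\<^bsub>V\<^esub> v"
proof
  define v where "v = (\<lambda>i\<in>{1..n}. \<lambda>z. if z < 0 then \<zero> else w i (z + int k + 1))"
  show v: "v \<in> Lam" using Lam_coeff[OF w] by (auto simp: v_def K0_carrier_iff)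
  show "w = from_coeffs k (coeffs k w) \<oplus>\<^bsub>V\<^esub> lmon \<one> (int k + 1) \<odot>\<^bsub>V\<^esub> v"
  proof (rule V_eqI)
    fix i z assume i: "i \<in> {1..n}"
    have "(from_coeffs k (coeffs k w) \<oplus>\<^bsub>V\<^esub> lmon \<one> (int k + 1) \<odot>\<^bsub>V\<^esub> v) i z
        = from_coeffs k (coeffs k w) i z \<oplus> \<one> \<otimes> v i (z - (int k + 1))"
      using i V_smult_lmon[OF Lam_VK[OF v] one_closed i] by (simp add: laurent_add)
    moreover have "from_coeffs k (coeffs k w) i z = (if 0 \<le> z \<and> z \<le> int k then w i z else \<zero>)"
      using i by (auto simp: from_coeffs_def coeffs_def cidx_def atLeastAtMost_iff)
    moreover have "v i (z - (int k + 1)) = (if z \<le> int k then \<zero> else w i z)" using i by (simp add: v_def)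
    ultimately show "w i z = (from_coeffs k (coeffs k w) \<oplus>\<^bsub>V\<^esub> lmon \<one> (int k + 1) \<odot>\<^bsub>V\<^esub> v) i z"
      using Lam_neg[OF w i, of z] Lam_coeff[OF w i, of z] by auto
  qed (use w in \<open>auto simp: PiE_iff\<close>)
qed

lemma from_coeffs_add:
  assumes "x \<in> cidx k \<rightarrow>\<^sub>E carrier R" "y \<in> cidx k \<rightarrow>\<^sub>E carrier R"
  shows "from_coeffs k (x \<oplus>\<^bsub>vec_mod (cidx k) R\<^esub> y) = from_coeffs k x \<oplus>\<^bsub>V\<^esub> from_coeffs k y"
  by (rule V_eqI) (auto simp: from_coeffs_def laurent_add)

lemma from_coeffs_smult:
  assumes "c \<in> carrier R" "x \<in> cidx k \<rightarrow>\<^sub>E carrier R"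
  shows "from_coeffs k (c \<odot>\<^bsub>vec_mod (cidx k) R\<^esub> x) = lmon c 0 \<odot>\<^bsub>V\<^esub> from_coeffs k x"
proof (rule V_eqI)
  fix i z assume i: "i \<in> {1..n}"
  show "from_coeffs k (c \<odot>\<^bsub>vec_mod (cidx k) R\<^esub> x) i z = (lmon c 0 \<odot>\<^bsub>V\<^esub> from_coeffs k x) i z"
    unfolding V_smult_lmon[OF Lam_VK[OF from_coeffs_closed[OF assms(2)]] assms(1) i]
    using assms i by (simp add: from_coeffs_def)
qed (auto simp: from_coeffs_def)

lemma coeffs_add: "coeffs k (v \<oplus>\<^bsub>V\<^esub> w) = coeffs k v \<oplus>\<^bsub>vec_mod (cidx k) R\<^esub> coeffs k w"
  by (rule vec_eqI[where I = "cidx k"]) (auto simp: coeffs_def laurent_add dest: cidxD)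

lemma coeffs_smult:
  assumes "c \<in> carrier R" "w \<in> VK"
  shows "coeffs k (lmon c 0 \<odot>\<^bsub>V\<^esub> w) = c \<odot>\<^bsub>vec_mod (cidx k) R\<^esub> coeffs k w"
proof (rule vec_eqI[where I = "cidx k"])
  fix d assume d: "d \<in> cidx k"
  obtain i a where ia: "d = (i, a)" by (cases d)
  then have i: "i \<in> {1..n}" using d cidxD by blast
  show "coeffs k (lmon c 0 \<odot>\<^bsub>V\<^esub> w) d = (c \<odot>\<^bsub>vec_mod (cidx k) R\<^esub> coeffs k w) d"
    using V_smult_lmon[OF assms(2,1) i] d ia by (simp add: coeffs_def del: vec_smult(1)) (simp add: vec_mod_def)
qed (auto simp: coeffs_def)

lemma lmon_smult_lmon:
  assumes "w \<in> VK" "a \<in> carrier R" "b \<in> carrier R"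
  shows "lmon a k \<odot>\<^bsub>V\<^esub> (lmon b l \<odot>\<^bsub>V\<^esub> w) = lmon (a \<otimes> b) (k + l) \<odot>\<^bsub>V\<^esub> w"
  using assms V.smult_assoc1[of "lmon a k" "lmon b l" w] by (simp add: lmon_mult_lmon)

lemma deeper:
  assumes W: "K0_submodule W" and deep: "\<And>w. w \<in> Lam \<Longrightarrow> lmon \<one> (int k) \<odot>\<^bsub>V\<^esub> w \<in> W"
    and l: "int k \<le> l" and w: "w \<in> Lam"
  shows "lmon \<one> l \<odot>\<^bsub>V\<^esub> w \<in> W"
proof -
  have "lmon \<one> (l - int k) \<odot>\<^bsub>V\<^esub> w \<in> Lam" using Lam_submodule w l by (simp add: K0_submodule_def)
  from deep[OF this] show ?thesis using lmon_smult_lmon[OF Lam_VK[OF w] one_closed one_closed] by simp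
qed

end

section \<open>Finite codimension in terms of lattices\<close>

context curve_setting
begin

lemma xseries_lmon: "xseries (lmon c (int k)) = pmon c k 0"
  by (auto simp: xseries_def lmon_def pmon_def fun_eq_iff)

lemma theta_x_pow: "g \<in> carrier PS \<Longrightarrow> theta (pmon \<one> k 0 \<otimes>\<^bsub>PS\<^esub> g) = lmon \<one> (int k) \<odot>\<^bsub>V\<^esub> theta g"
  using theta_xseries[of "lmon \<one> (int k)" g] by (simp add: xseries_lmon)

text \<open>The power of \<epsilon> comes from the power of x in the ideal, since x acts as
  \<epsilon>; the retraction comes from projectivity of the quotient.\<close>

lemma finite_codim_idealD:
  assumes fc: "finite_codim_ideal m n R J"
  shows "curve_submodule (lat_of J)" "\<exists>P. retraction (lat_of J) P"
    "\<exists>k. \<forall>w\<in>Lam. lmon \<one> (int k) \<odot>\<^bsub>V\<^esub> w \<in> lat_of J"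
proof -
  interpret J: curve_ideal_setting R n m J
    by (intro curve_ideal_setting.intro curve_setting_axioms curve_ideal_setting_axioms.intro)
      (use fc in \<open>simp add: finite_codim_ideal_def\<close>)
  show "curve_submodule (lat_of J)" by (rule J.W_sub)
  show "\<exists>P. retraction (lat_of J) P" using fc by (intro J.retraction_exists) (simp add: finite_codim_ideal_def)
  obtain k :: nat where "cl (var_x R) [^]\<^bsub>CR\<^esub> k \<in> J" using fc by (auto simp: finite_codim_ideal_def)
  moreover have "var_x R \<in> carrier PS" by (simp add: var_x_def PS_carrier)
  ultimately have xk: "cl (pmon \<one> k 0) \<in> J" using cl_pow[of "var_x R" k] by (simp add: var_x_pow)
  have "lmon \<one> (int k) \<odot>\<^bsub>V\<^esub> w \<in> lat_of J" if w: "w \<in> Lam" for w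
  proof -
    have "lmon \<one> (int k) \<odot>\<^bsub>V\<^esub> w = theta (pmon \<one> k 0 \<otimes>\<^bsub>PS\<^esub> sect w)"
      using w by (simp add: theta_x_pow theta_sect)
    moreover have "cl (pmon \<one> k 0 \<otimes>\<^bsub>PS\<^esub> sect w) \<in> J"
      using w xk J.J.I_r_closed by (simp add: cl_ops)
    ultimately show ?thesis using w theta_mem_lat_of[of "pmon \<one> k 0 \<otimes>\<^bsub>PS\<^esub> sect w"] by simp
  qed
  then show "\<exists>k. \<forall>w\<in>Lam. lmon \<one> (int k) \<odot>\<^bsub>V\<^esub> w \<in> lat_of J" by blast
qed

text \<open>The complement T = 1 - P of the retraction kills W and so descends to the quotient.
  Cutting its values after degree k loses only elements of W, so the quotient is a direct summand of
  the free module on the coefficients up to degree k.\<close>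

lemma finite_projective_of_retraction:
  assumes W: "curve_submodule W" and P: "retraction W P"
    and deep: "\<And>w. w \<in> Lam \<Longrightarrow> lmon \<one> (int k) \<odot>\<^bsub>V\<^esub> w \<in> W"
  shows "finite_projective R (curve_quotient_module m n R (idl_of W))"
proof -
  interpret J: curve_ideal_setting R n m "idl_of W" 
    by (intro curve_ideal_setting.intro curve_setting_axioms curve_ideal_setting_axioms.intro idl_of_ideal[OF W])
  note D = curve_submoduleD[OF W]
  have WL: "W \<subseteq> Lam" using D(3) by blast
  have lat: "lat_of (idl_of W) = W" using lat_of_idl_of[OF WL] .
  let ?Q = "curve_quotient_module m n R (idl_of W)"
  interpret Q: module R ?Q by (rule J.Q_module)
  have PW: "P w \<in> W" if "w \<in> Lam" for w using P that unfolding retraction_def by blast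
  have PL: "P w \<in> Lam" if "w \<in> Lam" for w using PW[OF that] D(3) by blast
  have Pid: "P w = w" if "w \<in> W" for w using P that unfolding retraction_def by blast
  have Padd: "P (v \<oplus>\<^bsub>V\<^esub> w) = P v \<oplus>\<^bsub>V\<^esub> P w" if "v \<in> Lam" "w \<in> Lam" for v w
    using P that unfolding retraction_def by blast
  have Psm: "P (lmon c 0 \<odot>\<^bsub>V\<^esub> w) = lmon c 0 \<odot>\<^bsub>V\<^esub> P w" if "c \<in> carrier R" "w \<in> Lam" for c w
    using P that unfolding retraction_def by blast
  have m1: "lmon (\<ominus> \<one>) 0 \<in> carrier K" "lmon (\<ominus> \<one>) 0 \<in> carrier K0" by auto
  have VL: "w \<in> carrier V" if "w \<in> Lam" for w using Lam_VK[OF that] by simp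
  have neg: "w \<oplus>\<^bsub>V\<^esub> lmon (\<ominus> \<one>) 0 \<odot>\<^bsub>V\<^esub> w = \<zero>\<^bsub>V\<^esub>" if "w \<in> Lam" for w
  proof (rule V_eqI)
    fix i z assume i: "i \<in> {1..n}"
    show "(w \<oplus>\<^bsub>V\<^esub> lmon (\<ominus> \<one>) 0 \<odot>\<^bsub>V\<^esub> w) i z = \<zero>\<^bsub>V\<^esub> i z"
      using i V_smult_lmon[OF Lam_VK[OF that] a_inv_closed[OF one_closed] i] Lam_coeff[OF that i]
      by (simp add: laurent_add laurent_zero l_minus r_neg)
  qed simp_all
  define T where "T w = w \<oplus>\<^bsub>V\<^esub> lmon (\<ominus> \<one>) 0 \<odot>\<^bsub>V\<^esub> P w" for w
  have TL: "T w \<in> Lam" if "w \<in> Lam" for w using that PL m1 Lam_closed by (simp add: T_def)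
  have T0: "T w = \<zero>\<^bsub>V\<^esub>" if "w \<in> W" for w using that Pid neg D(3) by (simp add: T_def)
  have Tadd: "T (v \<oplus>\<^bsub>V\<^esub> w) = T v \<oplus>\<^bsub>V\<^esub> T w" if "v \<in> Lam" "w \<in> Lam" for v w
  proof -
    note c = VL[OF that(1)] VL[OF that(2)] VL[OF PL[OF that(1)]] VL[OF PL[OF that(2)]]
    show ?thesis unfolding T_def Padd[OF that]
      using c m1(1) V.smult_closed[OF m1(1)] V.smult_r_distr[OF m1(1) c(3,4)]
      by (simp add: V.M.a_ac del: vec_carrier)
  qed
  have Tsm: "T (lmon c 0 \<odot>\<^bsub>V\<^esub> w) = lmon c 0 \<odot>\<^bsub>V\<^esub> T w" if "c \<in> carrier R" "w \<in> Lam" for c w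
  proof -
    have cK: "lmon c 0 \<in> carrier K" using that by simp
    note wV = VL[OF that(2)] VL[OF PL[OF that(2)]]
    show ?thesis
      unfolding T_def Psm[OF that] V.smult_r_distr[OF cK wV(1) V.smult_closed[OF m1(1) wV(2)]]
      using V.smult_assoc1[OF m1(1) cK wV(2)] V.smult_assoc1[OF cK m1(1) wV(2)] K.m_comm[OF m1(1) cK] by simp
  qed
  have projT: "J.proj (T w) = J.proj w" if w: "w \<in> Lam" for w
  proof -
    have "J.proj (P w) = \<zero>\<^bsub>?Q\<^esub>" using J.proj_zero_iff[OF PL[OF w]] PW[OF w] lat by simp
    then have "J.proj (T w) = J.proj w \<oplus>\<^bsub>?Q\<^esub> (\<ominus> \<one>) \<odot>\<^bsub>?Q\<^esub> \<zero>\<^bsub>?Q\<^esub>"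
      using w PL m1 Lam_closed by (simp add: T_def J.proj_add J.proj_smult)
    then show ?thesis
      using Q.smult_r_null[OF a_inv_closed[OF one_closed]] Q.M.r_zero[OF J.proj_closed[OF w]] by simp
  qed
  have Tcong: "T v = T w" if vw: "v \<in> Lam" "w \<in> Lam" "J.proj v = J.proj w" for v w
  proof -
    have n1: "\<ominus> \<one> \<in> carrier R" by simp
    have mw: "lmon (\<ominus> \<one>) 0 \<odot>\<^bsub>V\<^esub> w \<in> Lam" by (rule Lam_closed(3)[OF m1(2) vw(2)])
    have dL: "v \<oplus>\<^bsub>V\<^esub> lmon (\<ominus> \<one>) 0 \<odot>\<^bsub>V\<^esub> w \<in> Lam" by (rule Lam_closed(2)[OF vw(1) mw])
    have "J.proj (v \<oplus>\<^bsub>V\<^esub> lmon (\<ominus> \<one>) 0 \<odot>\<^bsub>V\<^esub> w) = J.proj w \<oplus>\<^bsub>?Q\<^esub> (\<ominus> \<one>) \<odot>\<^bsub>?Q\<^esub> J.proj w"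
      using vw mw by (simp add: J.proj_add J.proj_smult)
    also have "\<dots> = \<zero>\<^bsub>?Q\<^esub>"
      using Q.smult_l_minus[OF one_closed J.proj_closed[OF vw(2)]] Q.smult_one[OF J.proj_closed[OF vw(2)]]
        Q.M.r_neg[OF J.proj_closed[OF vw(2)]] by simp
    finally have "v \<oplus>\<^bsub>V\<^esub> lmon (\<ominus> \<one>) 0 \<odot>\<^bsub>V\<^esub> w \<in> W" using J.proj_zero_iff[OF dL] lat by simp
    from T0[OF this] have e: "T v \<oplus>\<^bsub>V\<^esub> lmon (\<ominus> \<one>) 0 \<odot>\<^bsub>V\<^esub> T w = \<zero>\<^bsub>V\<^esub>"
      using Tadd[OF vw(1) mw] Tsm[OF n1 vw(2)] by simp
    have c: "T v \<in> carrier V" "T w \<in> carrier V" "lmon (\<ominus> \<one>) 0 \<odot>\<^bsub>V\<^esub> T w \<in> carrier V"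
      using VL TL vw V.smult_closed[OF m1(1)] by auto
    have "T w \<oplus>\<^bsub>V\<^esub> lmon (\<ominus> \<one>) 0 \<odot>\<^bsub>V\<^esub> T w = \<zero>\<^bsub>V\<^esub>" using neg[OF TL[OF vw(2)]] .
    with e show ?thesis by (intro V.M.add.r_cancel[OF _ c(1) c(2) c(3)]) simp
  qed
  let ?D = "cidx k" and ?N = "card (cidx k)"
  let ?F = "free_module R ?N"
  have F: "?F = vec_mod {..<?N} R" by (simp add: free_module_def vec_mod_def)
  \<comment> \<open>\<open>free_module\<close> is indexed by an initial segment of the natural
    numbers, so the pairs in \<open>cidx k\<close> are enumerated; \<open>S\<close> and
    \<open>S'\<close> are the resulting changes of index.\<close>
  obtain h where h: "bij_betw h {..<?N} ?D"
    using ex_bij_betw_nat_finite[OF finite_cidx[of k]] by (auto simp: atLeast0LessThan)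
  have hD: "h j \<in> ?D" if "j \<in> {..<?N}" for j using h that by (auto simp: bij_betw_def)
  define h' where "h' = inv_into {..<?N} h"
  have h'N: "h' d \<in> {..<?N}" "h (h' d) = d" if "d \<in> ?D" for d
    unfolding h'_def using bij_betwE[OF bij_betw_inv_into[OF h]] bij_betw_inv_into_right[OF h] that by blast+
  define S where "S y = (\<lambda>j\<in>{..<?N}. y (h j))" for y :: "nat \<times> int \<Rightarrow> 'a"
  define S' where "S' x = (\<lambda>d\<in>?D. x (h' d))" for x :: "nat \<Rightarrow> 'a"
  have Sc: "S y \<in> carrier ?F" if "y \<in> ?D \<rightarrow>\<^sub>E carrier R" for y
    using vec_mem[OF that] hD by (auto simp: S_def F)
  have S'c: "S' x \<in> ?D \<rightarrow>\<^sub>E carrier R" if "x \<in> carrier ?F" for x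
    using that vec_mem[of x "{..<?N}"] h'N by (auto simp: S'_def F)
  have S'S: "S' (S y) = y" if "y \<in> ?D \<rightarrow>\<^sub>E carrier R" for y
    by (rule vec_eqI[where I = ?D]) (use that h'N in \<open>auto simp: S_def S'_def PiE_iff\<close>)
  define p where "p x = J.proj (from_coeffs k (S' x))" for x
  \<comment> \<open>The chosen representative of q does not matter: by \<open>Tcong\<close>, T w
    depends only on the class of w.\<close>
  define s where "s q = S (coeffs k (T (SOME w. w \<in> Lam \<and> J.proj w = q)))" for q
  have s: "s (J.proj w) = S (coeffs k (T w))" if w: "w \<in> Lam" for w
  proof -
    define v where "v = (SOME v. v \<in> Lam \<and> J.proj v = J.proj w)"
    have "v \<in> Lam \<and> J.proj v = J.proj w"
      unfolding v_def by (rule someI[of "\<lambda>v. v \<in> Lam \<and> J.proj v = J.proj w"]) (rule conjI[OF w refl])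
    then have "T v = T w" using w by (intro Tcong) blast+
    then show ?thesis unfolding s_def v_def by (rule arg_cong)
  qed
  have "p \<in> linear_maps R ?F ?Q"
    unfolding linear_maps_def mem_Collect_eq
  proof (intro conjI ballI Pi_I)
    show "p x \<in> carrier ?Q" if "x \<in> carrier ?F" for x
      using S'c[OF that] by (simp add: p_def J.proj_closed)
    show "p (x \<oplus>\<^bsub>?F\<^esub> y) = p x \<oplus>\<^bsub>?Q\<^esub> p y" if "x \<in> carrier ?F" "y \<in> carrier ?F" for x y
    proof -
      have "S' (x \<oplus>\<^bsub>?F\<^esub> y) = S' x \<oplus>\<^bsub>vec_mod ?D R\<^esub> S' y"
        unfolding F by (rule vec_eqI[where I = ?D]) (use h'N in \<open>auto simp: S'_def\<close>)
      then show ?thesis using S'c[OF that(1)] S'c[OF that(2)] by (simp add: p_def from_coeffs_add J.proj_add)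
    qed
    show "p (c \<odot>\<^bsub>?F\<^esub> x) = c \<odot>\<^bsub>?Q\<^esub> p x" if "c \<in> carrier R" "x \<in> carrier ?F" for c x
    proof -
      have "S' (c \<odot>\<^bsub>?F\<^esub> x) = c \<odot>\<^bsub>vec_mod ?D R\<^esub> S' x"
        unfolding F by (rule vec_eqI[where I = ?D]) (use h'N in \<open>auto simp: S'_def\<close>)
      then show ?thesis using S'c[OF that(2)] that(1) by (simp add: p_def from_coeffs_smult J.proj_smult)
    qed
  qed
  moreover have "s \<in> linear_maps R ?Q ?F"
    unfolding linear_maps_def mem_Collect_eq
  proof (intro conjI ballI Pi_I)
    show "s q \<in> carrier ?F" if "q \<in> carrier ?Q" for q
    proof -
      note q = that
      obtain w where w: "w \<in> Lam" "q = J.proj w" using J.proj_surj[OF q] .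
      then show ?thesis using Sc[OF coeffs_closed[OF Lam_VK[OF TL[OF w(1)]]]] s by simp
    qed
    show "s (q \<oplus>\<^bsub>?Q\<^esub> q') = s q \<oplus>\<^bsub>?F\<^esub> s q'" if "q \<in> carrier ?Q" "q' \<in> carrier ?Q" for q q'
    proof -
      note q = that
      obtain w where w: "w \<in> Lam" "q = J.proj w" using J.proj_surj[OF q(1)] .
      obtain w' where w': "w' \<in> Lam" "q' = J.proj w'" using J.proj_surj[OF q(2)] .
      have "S (coeffs k (T w) \<oplus>\<^bsub>vec_mod ?D R\<^esub> coeffs k (T w')) = S (coeffs k (T w)) \<oplus>\<^bsub>?F\<^esub> S (coeffs k (T w'))"
        unfolding F by (rule vec_eqI[where I = "{..<?N}"]) (use hD in \<open>auto simp: S_def\<close>)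
      then show ?thesis
        using w w' s[OF w(1)] s[OF w'(1)] s[OF Lam_closed(2)[OF w(1) w'(1)]]
        by (simp add: J.proj_add Tadd coeffs_add)
    qed
    show "s (c \<odot>\<^bsub>?Q\<^esub> q) = c \<odot>\<^bsub>?F\<^esub> s q" if "c \<in> carrier R" "q \<in> carrier ?Q" for c q
    proof -
      note q = that
      obtain w where w: "w \<in> Lam" "q = J.proj w" using J.proj_surj[OF q(2)] .
      have c: "lmon c 0 \<odot>\<^bsub>V\<^esub> w \<in> Lam" using w that Lam_closed by simp
      have "S (c \<odot>\<^bsub>vec_mod ?D R\<^esub> coeffs k (T w)) = c \<odot>\<^bsub>?F\<^esub> S (coeffs k (T w))"
        unfolding F by (rule vec_eqI[where I = "{..<?N}"]) (use hD in \<open>auto simp: S_def\<close>)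
      then show ?thesis
        using w s[OF w(1)] s[OF c] that Lam_VK[OF TL[OF w(1)]]
        by (simp add: J.proj_smult[symmetric] Tsm coeffs_smult)
    qed
  qed
  moreover have "p (s q) = q" if "q \<in> carrier ?Q" for q
  proof -
    note q = that
    obtain w where w: "w \<in> Lam" "q = J.proj w" using J.proj_surj[OF q] .
    have "p (s q) = J.proj (from_coeffs k (coeffs k (T w)))"
      using w s[OF w(1)] S'S[OF coeffs_closed[OF Lam_VK[OF TL[OF w(1)]]]] by (simp add: p_def)
    also have "\<dots> = J.proj (T w)"
    proof -
      obtain v where v: "v \<in> Lam" "T w = from_coeffs k (coeffs k (T w)) \<oplus>\<^bsub>V\<^esub> lmon \<one> (int k + 1) \<odot>\<^bsub>V\<^esub> v"
        using trunc_split[OF TL[OF w(1)]] by blast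
      have evW: "lmon \<one> (int k + 1) \<odot>\<^bsub>V\<^esub> v \<in> W" by (rule deeper[OF D(1) deep]) (use v in auto)
      then have ev: "lmon \<one> (int k + 1) \<odot>\<^bsub>V\<^esub> v \<in> Lam" using D(3) by blast
      have fL: "from_coeffs k (coeffs k (T w)) \<in> Lam" using coeffs_closed[OF Lam_VK[OF TL[OF w(1)]]] by simp
      have "J.proj (T w) = J.proj (from_coeffs k (coeffs k (T w))) \<oplus>\<^bsub>?Q\<^esub> J.proj (lmon \<one> (int k + 1) \<odot>\<^bsub>V\<^esub> v)"
        using arg_cong[OF v(2), of J.proj] J.proj_add[OF fL ev] by metis
      also have "J.proj (lmon \<one> (int k + 1) \<odot>\<^bsub>V\<^esub> v) = \<zero>\<^bsub>?Q\<^esub>" using J.proj_zero_iff[OF ev] evW lat by simp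
      finally show ?thesis using Q.M.r_zero[OF J.proj_closed[OF fL]] by simp
    qed
    finally show ?thesis using projT w by simp
  qed
  ultimately show ?thesis unfolding finite_projective_def using J.Q_module by blast
qed

lemma finite_codim_idealI:
  assumes W: "curve_submodule W" and P: "retraction W P"
    and deep: "\<And>w. w \<in> Lam \<Longrightarrow> lmon \<one> (int k) \<odot>\<^bsub>V\<^esub> w \<in> W"
  shows "finite_codim_ideal m n R (idl_of W)"
  unfolding finite_codim_ideal_def
proof (intro conjI exI)
  show "ideal (idl_of W) CR" by (rule idl_of_ideal[OF W])
  show "finite_projective R (curve_quotient_module m n R (idl_of W))"
    by (rule finite_projective_of_retraction[OF W P deep])
  have xP: "var_x R \<in> carrier PS" "var_y R \<in> carrier PS" by (simp_all add: var_x_def var_y_def PS_carrier)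
  have xl: "cl (var_x R) [^]\<^bsub>CR\<^esub> l \<in> idl_of W" if "k \<le> l" for l
  proof -
    have "theta (pmon \<one> l 0) = theta (pmon \<one> l 0 \<otimes>\<^bsub>PS\<^esub> \<one>\<^bsub>PS\<^esub>)" by simp
    also have "\<dots> = lmon \<one> (int l) \<odot>\<^bsub>V\<^esub> theta \<one>\<^bsub>PS\<^esub>" by (rule theta_x_pow) simp
    also have "\<dots> \<in> W" by (rule deeper[OF curve_submoduleD(1)[OF W] deep]) (use that in auto)
    finally have "cl (pmon \<one> l 0) \<in> idl_of W" using cl_mem_idl_of by simp
    then show ?thesis using cl_pow[OF xP(1), of l] by (simp add: var_x_pow)
  qed
  have xy: "cl (var_x R) [^]\<^bsub>CR\<^esub> m = cl (var_y R) [^]\<^bsub>CR\<^esub> n"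
  proof -
    have "pmon \<one> m 0 \<ominus>\<^bsub>PS\<^esub> pmon \<one> 0 n \<in> CI"
      unfolding CI_eq using PS.l_one[of "pmon \<one> m 0 \<ominus>\<^bsub>PS\<^esub> pmon \<one> 0 n"] PS.one_closed by force
    then have "cl (pmon \<one> m 0) = cl (pmon \<one> 0 n)"
      using PS.quotient_eq_iff_same_a_r_cos[OF CI_ideal, of "pmon \<one> m 0" "pmon \<one> 0 n"] by (simp add: curve_class_def)
    then show ?thesis using cl_pow[OF xP(1), of m] cl_pow[OF xP(2), of n] by (simp add: var_x_pow var_y_pow)
  qed
  have cc: "cl (var_x R) \<in> carrier CR" "cl (var_y R) \<in> carrier CR" using xP by (simp_all add: cl_ops)
  \<comment> \<open>One exponent has to serve x and y. Since x^m = y^n, the power of y with exponent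
    n (m k) is the power of x with exponent m (m k), and both exponents of x are at least k.\<close>
  show "cl (var_x R) [^]\<^bsub>CR\<^esub> (n * (m * k)) \<in> idl_of W"
    using m_pos n_pos by (intro xl) simp
  have "cl (var_y R) [^]\<^bsub>CR\<^esub> (n * (m * k)) = cl (var_x R) [^]\<^bsub>CR\<^esub> (m * (m * k))"
    using cc by (simp add: CR.nat_pow_pow[symmetric] xy)
  then show "cl (var_y R) [^]\<^bsub>CR\<^esub> (n * (m * k)) \<in> idl_of W"
    using xl[of "m * (m * k)"] m_pos by simp
qed

end

section \<open>Row lattices of invertible matrices\<close>

context row_lattices
begin

sublocale M: Group.monoid "mat_monoid n K" by (rule K.mat_monoid_monoid)

abbreviation "mats \<equiv> {1..n} \<times> {1..n} \<rightarrow>\<^sub>E carrier K"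
abbreviation "mats0 \<equiv> {1..n} \<times> {1..n} \<rightarrow>\<^sub>E carrier K0"
abbreviation "minv g \<equiv> inv\<^bsub>mat_monoid n K\<^esub> g"

lemma GL_mats: "g \<in> GL \<Longrightarrow> g \<in> mats" "g \<in> GL \<Longrightarrow> minv g \<in> mats"
  using M.Units_closed[of g] M.Units_inv_closed[of g] by (simp_all add: mat_monoid_simps)

lemma GL_inv:
  "g \<in> GL \<Longrightarrow> mat_mult {1..n} K (minv g) g = scalar_mat {1..n} K \<one>\<^bsub>K\<^esub>"
  "g \<in> GL \<Longrightarrow> mat_mult {1..n} K g (minv g) = scalar_mat {1..n} K \<one>\<^bsub>K\<^esub>"
  using M.Units_l_inv[of g] M.Units_r_inv[of g] by (simp_all add: mat_monoid_simps)

lemma mats0_mats: "g \<in> mats0 \<Longrightarrow> g \<in> mats"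
  by (auto simp: PiE_iff)

lemma unit_row_Lam: "unit_row {1..n} K j \<in> Lam"
  using K0.one_closed K0.zero_closed by (auto simp: unit_row_def)

lemma rowmul_Lam:
  assumes "w \<in> Lam" "g \<in> mats0"
  shows "rowmul {1..n} K w g \<in> Lam"
  using K0.vec_mem[OF assms(1)] K0.mat_mem[OF assms(2)] by (auto simp: rowmul_def intro!: K0_finsum_closed)

lemma mats0I:
  assumes "g \<in> mats" "\<And>i. i \<in> {1..n} \<Longrightarrow> mat_row {1..n} g i \<in> Lam"
  shows "g \<in> mats0"
proof -
  have "g (i, j) \<in> carrier K0" if "i \<in> {1..n}" "j \<in> {1..n}" for i j
    using K0.vec_mem[OF assms(2)[OF that(1)] that(2)] that by simp
  then show ?thesis using assms(1) by (auto simp: PiE_iff)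
qed

lemma mats0_mult:
  assumes "g \<in> mats0" "h \<in> mats0"
  shows "mat_mult {1..n} K0 g h = mat_mult {1..n} K g h" "mat_mult {1..n} K g h \<in> mats0"
proof -
  show eq: "mat_mult {1..n} K0 g h = mat_mult {1..n} K g h"
    unfolding mat_mult_def
    by (rule restrict_ext) (use K0.mat_mem[OF assms(1)] K0.mat_mem[OF assms(2)] in \<open>auto intro!: K0_finsum\<close>)
  show "mat_mult {1..n} K g h \<in> mats0" using K0.mat_mult_closed[OF assms] eq by simp
qed

lemma rowlat_VK: "w \<in> rowlat g \<Longrightarrow> w \<in> VK" by (simp add: rowlat_def)

lemma rowmul_inv:
  assumes "g \<in> GL" "w \<in> VK"
  shows "rowmul {1..n} K (rowmul {1..n} K w g) (minv g) = w" "rowmul {1..n} K (rowmul {1..n} K w (minv g)) g = w"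
  using assms GL_mats[OF assms(1)] GL_inv[OF assms(1)] by (simp_all add: K.rowmul_assoc)

lemma inv_row_rowlat:
  assumes g: "g \<in> GL" and j: "j \<in> {1..n}"
  shows "mat_row {1..n} (minv g) j \<in> rowlat g"
proof -
  have "rowmul {1..n} K (mat_row {1..n} (minv g) j) g = mat_row {1..n} (scalar_mat {1..n} K \<one>\<^bsub>K\<^esub>) j"
    using K.mat_mult_row[OF j GL_mats(2)[OF g] GL_mats(1)[OF g]] GL_inv(1)[OF g] by simp
  also have "\<dots> = unit_row {1..n} K j"
    using K.mat_row_scalar[OF j K.one_closed] V.smult_one[of "unit_row {1..n} K j"] by simp
  finally show ?thesis using unit_row_Lam GL_mats(2)[OF g] j by (simp add: rowlat_def)
qed

text \<open>A matrix is integral exactly when it maps integral row vectors to integral ones. Applied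
  to g^-1 L g' and the vectors w g, this becomes a condition on lattices; conversely it is tested on
  the rows of g^-1. It is the dictionary between the Springer conditions and inclusions.\<close>

lemma integral_iff_rowlat:
  assumes g: "g \<in> GL" and g': "g' \<in> GL" and L: "L \<in> mats"
  shows "mat_mult {1..n} K (mat_mult {1..n} K (minv g) L) g' \<in> mats0 \<longleftrightarrow>
    (\<forall>w\<in>rowlat g. rowmul {1..n} K w L \<in> rowlat g')"
proof
  note m = GL_mats[OF g] GL_mats[OF g']
  let ?X = "mat_mult {1..n} K (mat_mult {1..n} K (minv g) L) g'"
  assume X: "?X \<in> mats0"
  show "\<forall>w\<in>rowlat g. rowmul {1..n} K w L \<in> rowlat g'"
  proof
    fix w assume "w \<in> rowlat g"
    then have w: "w \<in> VK" "rowmul {1..n} K w g \<in> Lam" by (simp_all add: rowlat_def)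
    have "rowmul {1..n} K (rowmul {1..n} K w g) ?X
        = rowmul {1..n} K (rowmul {1..n} K (rowmul {1..n} K (rowmul {1..n} K w g) (minv g)) L) g'"
      using w m L by (simp add: K.rowmul_assoc K.mat_mult_assoc)
    also have "\<dots> = rowmul {1..n} K (rowmul {1..n} K w L) g'" using rowmul_inv(1)[OF g w(1)] by simp
    finally have "rowmul {1..n} K (rowmul {1..n} K w L) g' \<in> Lam" using rowmul_Lam[OF w(2) X] by simp
    then show "rowmul {1..n} K w L \<in> rowlat g'" using w L by (simp add: rowlat_def)
  qed
next
  note m = GL_mats[OF g] GL_mats[OF g']
  assume H: "\<forall>w\<in>rowlat g. rowmul {1..n} K w L \<in> rowlat g'"
  show "mat_mult {1..n} K (mat_mult {1..n} K (minv g) L) g' \<in> mats0"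
  proof (rule mats0I)
    fix i assume i: "i \<in> {1..n}"
    have "mat_row {1..n} (mat_mult {1..n} K (mat_mult {1..n} K (minv g) L) g') i
        = rowmul {1..n} K (rowmul {1..n} K (mat_row {1..n} (minv g) i) L) g'"
      using m L i by (simp add: K.mat_mult_row)
    then show "mat_row {1..n} (mat_mult {1..n} K (mat_mult {1..n} K (minv g) L) g') i \<in> Lam"
      using H inv_row_rowlat[OF g i] by (simp add: rowlat_def)
  qed (use m L in simp)
qed

lemma integral_iff_rowlat_subset:
  assumes g: "g \<in> GL" and g': "g' \<in> GL"
  shows "mat_mult {1..n} K (minv g) g' \<in> mats0 \<longleftrightarrow> rowlat g \<subseteq> rowlat g'"
proof -
  have "(\<forall>w\<in>rowlat g. rowmul {1..n} K w (scalar_mat {1..n} K \<one>\<^bsub>K\<^esub>) \<in> rowlat g') \<longleftrightarrow> rowlat g \<subseteq> rowlat g'"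
    using K.rowmul_one[OF _ rowlat_VK] by (auto simp del: One_nat_def)
  then show ?thesis
    using integral_iff_rowlat[OF g g' K.scalar_mat_closed[OF K.one_closed]] GL_mats[OF g]
    by (simp add: K.mat_mult_one)
qed

lemma scalar_mat_K0: "scalar_mat {1..n} K0 \<one>\<^bsub>K\<^esub> = scalar_mat {1..n} K \<one>\<^bsub>K\<^esub>"
  unfolding scalar_mat_def K0_ops ..

text \<open>Inverses in the two matrix monoids agree, so invertibility over the integral ring can be
  checked as integrality of the matrix and of its inverse.\<close>

lemma Units_K0:
  "u \<in> Units (mat_monoid n K0) \<longleftrightarrow> u \<in> GL \<and> u \<in> mats0 \<and> minv u \<in> mats0"
proof
  assume "u \<in> Units (mat_monoid n K0)"
  then obtain v where v: "u \<in> mats0" "v \<in> mats0"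
    "mat_mult {1..n} K v u = scalar_mat {1..n} K \<one>\<^bsub>K\<^esub>" "mat_mult {1..n} K u v = scalar_mat {1..n} K \<one>\<^bsub>K\<^esub>"
    unfolding Units_def by (auto simp: mat_monoid_simps mats0_mult scalar_mat_K0)
  then have "u \<in> GL"
    unfolding Units_def using mats0_mats[OF v(1)] mats0_mats[OF v(2)] by (auto simp: mat_monoid_simps)
  moreover have "minv u = v"
    using M.inv_unique'[of u v] v mats0_mats[OF v(1)] mats0_mats[OF v(2)] by (simp add: mat_monoid_simps)
  ultimately show "u \<in> GL \<and> u \<in> mats0 \<and> minv u \<in> mats0" using v by simp
next
  assume "u \<in> GL \<and> u \<in> mats0 \<and> minv u \<in> mats0"
  then have u: "u \<in> GL" "u \<in> mats0" "minv u \<in> mats0" by auto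
  show "u \<in> Units (mat_monoid n K0)"
    unfolding Units_def using u GL_inv[OF u(1)]
    by (auto simp: mat_monoid_simps mats0_mult scalar_mat_K0 intro!: bexI[of _ "minv u"])
qed

lemma rowlat_mult_unit:
  assumes g: "g \<in> GL" and u: "u \<in> Units (mat_monoid n K0)"
  shows "rowlat (mat_mult {1..n} K g u) = rowlat g"
proof -
  have u': "u \<in> GL" "u \<in> mats0" "minv u \<in> mats0" using u by (simp_all add: Units_K0)
  note m = GL_mats[OF g] GL_mats[OF u'(1)]
  have "rowmul {1..n} K w (mat_mult {1..n} K g u) \<in> Lam \<longleftrightarrow> rowmul {1..n} K w g \<in> Lam" if w: "w \<in> VK" for w
  proof -
    have eq: "rowmul {1..n} K w (mat_mult {1..n} K g u) = rowmul {1..n} K (rowmul {1..n} K w g) u"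
      using w m by (simp add: K.rowmul_assoc)
    have "rowmul {1..n} K (rowmul {1..n} K (rowmul {1..n} K w g) u) (minv u) = rowmul {1..n} K w g"
      using w m by (intro rowmul_inv[OF u'(1)]) simp
    then show ?thesis using rowmul_Lam[OF _ u'(2)] rowmul_Lam[OF _ u'(3)] eq by metis
  qed
  then show ?thesis unfolding rowlat_def by blast
qed

text \<open>Take u = g^-1 g'. The two inclusions of lattices make u and its inverse g'^-1 g
  integral.\<close>

lemma rowlat_eq_imp:
  assumes g: "g \<in> GL" and g': "g' \<in> GL" and eq: "rowlat g = rowlat g'"
  obtains u where "u \<in> Units (mat_monoid n K0)" "g' = mat_mult {1..n} K g u"
proof
  note m = GL_mats[OF g] GL_mats[OF g']
  let ?u = "mat_mult {1..n} K (minv g) g'" and ?v = "mat_mult {1..n} K (minv g') g"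
  have uG: "?u \<in> GL" using M.Units_m_closed[OF M.Units_inv_Units[OF g] g'] by (simp add: mat_monoid_simps)
  have prod: "mat_mult {1..n} K (mat_mult {1..n} K (minv a) b) (mat_mult {1..n} K (minv b) a) = scalar_mat {1..n} K \<one>\<^bsub>K\<^esub>"
    if a: "a \<in> GL" and b: "b \<in> GL" for a b
  proof -
    note m = GL_mats[OF a] GL_mats[OF b]
    have "mat_mult {1..n} K b (mat_mult {1..n} K (minv b) a) = a"
      using m GL_inv[OF b] by (simp add: K.mat_mult_assoc[symmetric] K.mat_mult_one)
    then show ?thesis using m GL_inv[OF a] by (simp add: K.mat_mult_assoc)
  qed
  have uv: "minv ?u = ?v"
    using M.inv_unique'[of ?u ?v] prod[OF g g'] prod[OF g' g] m by (simp add: mat_monoid_simps)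
  show "?u \<in> Units (mat_monoid n K0)"
    using uG uv integral_iff_rowlat_subset[OF g g'] integral_iff_rowlat_subset[OF g' g] eq by (simp add: Units_K0)
  show "g' = mat_mult {1..n} K g ?u"
    using m GL_inv[OF g] by (simp add: K.mat_mult_assoc[symmetric] K.mat_mult_one)
qed

lemma rowlat_submodule:
  assumes g: "g \<in> GL" and L: "rowlat g \<subseteq> Lam"
  shows "K0_submodule (rowlat g)"
  unfolding K0_submodule_def
proof (intro conjI ballI)
  note m = GL_mats[OF g]
  note LD = Lam_submodule[unfolded K0_submodule_def]
  show "rowlat g \<subseteq> Lam" by (rule L)
  have z: "\<zero>\<^bsub>V\<^esub> \<in> VK" using V.M.zero_closed by simp
  have "rowmul {1..n} K (\<zero>\<^bsub>K\<^esub> \<odot>\<^bsub>V\<^esub> \<zero>\<^bsub>V\<^esub>) g = \<zero>\<^bsub>K\<^esub> \<odot>\<^bsub>V\<^esub> rowmul {1..n} K \<zero>\<^bsub>V\<^esub> g"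
    using m z by (intro K.rowmul_smult) auto
  then have "rowmul {1..n} K \<zero>\<^bsub>V\<^esub> g = \<zero>\<^bsub>V\<^esub>"
    using V.smult_l_null[of "\<zero>\<^bsub>V\<^esub>"] V.smult_l_null[of "rowmul {1..n} K \<zero>\<^bsub>V\<^esub> g"] z m by simp
  then show "\<zero>\<^bsub>V\<^esub> \<in> rowlat g" using LD z by (simp add: rowlat_def)
  show "v \<oplus>\<^bsub>V\<^esub> w \<in> rowlat g" if "v \<in> rowlat g" "w \<in> rowlat g" for v w
    using that m LD K.rowmul_add[of v "{1..n}" w g] V.M.a_closed[of v w] by (simp add: rowlat_def)
  show "a \<odot>\<^bsub>V\<^esub> w \<in> rowlat g" if "a \<in> carrier K0" "w \<in> rowlat g" for a w
    using that m LD K.rowmul_smult[of "{1..n}" a w g] V.smult_closed[of a w] by (simp add: rowlat_def)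
qed

text \<open>The finitely many entries of g have poles of bounded order, and one power of \<epsilon>
  clears them all.\<close>

lemma rowlat_deep:
  assumes g: "g \<in> GL"
  shows "\<exists>k. \<forall>w\<in>Lam. lmon \<one> (int k) \<odot>\<^bsub>V\<^esub> w \<in> rowlat g"
proof -
  note m = K.mat_mem[OF GL_mats(1)[OF g]]
  have "\<exists>k::nat. \<forall>p\<in>S. \<forall>z. z < - int k \<longrightarrow> g p z = \<zero>" if "finite S" "S \<subseteq> {1..n} \<times> {1..n}" for S
    using that
  proof (induction S rule: finite_induct)
    case (insert p S)
    then obtain k :: nat where k: "\<forall>p\<in>S. \<forall>z. z < - int k \<longrightarrow> g p z = \<zero>" by auto
    have "g p \<in> carrier K" using insert m by (cases p) auto
    then obtain N where N: "\<And>z. z < N \<Longrightarrow> g p z = \<zero>" by (rule laurent_bound) blast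
    show ?case by (rule exI[of _ "max k (nat (- N))"]) (use k N in auto)
  qed simp
  from this[of "{1..n} \<times> {1..n}"] obtain k :: nat where
    k: "\<forall>p\<in>{1..n} \<times> {1..n}. \<forall>z. z < - int k \<longrightarrow> g p z = \<zero>" by auto
  have gk: "lmon \<one> (int k) \<otimes>\<^bsub>K\<^esub> g (i, j) \<in> carrier K0" if "i \<in> {1..n}" "j \<in> {1..n}" for i j
  proof -
    have "lmon \<one> (int k) \<otimes>\<^bsub>K\<^esub> g (i, j) = (\<lambda>z. g (i, j) (z - int k))"
      using lmon_mult[OF one_closed m[OF that]] m[OF that] by simp
    then show ?thesis using k that m[OF that] by (auto simp: K0_carrier_iff)
  qed
  have "lmon \<one> (int k) \<odot>\<^bsub>V\<^esub> w \<in> rowlat g" if w: "w \<in> Lam" for w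
  proof -
    have wV: "w \<in> VK" by (rule Lam_VK[OF w])
    have kK: "lmon \<one> (int k) \<in> carrier K" by simp
    have ewV: "lmon \<one> (int k) \<odot>\<^bsub>V\<^esub> w \<in> VK" using V.smult_closed[OF kK, of w] wV by simp
    have "rowmul {1..n} K (lmon \<one> (int k) \<odot>\<^bsub>V\<^esub> w) g \<in> Lam"
    proof -
      have "(\<Oplus>\<^bsub>K\<^esub>i\<in>{1..n}. (lmon \<one> (int k) \<odot>\<^bsub>V\<^esub> w) i \<otimes>\<^bsub>K\<^esub> g (i, j)) \<in> carrier K0" if j: "j \<in> {1..n}" for j
      proof (rule K0_finsum_closed)
        fix i assume i: "i \<in> {1..n}"
        have "(lmon \<one> (int k) \<odot>\<^bsub>V\<^esub> w) i \<otimes>\<^bsub>K\<^esub> g (i, j) = w i \<otimes>\<^bsub>K\<^esub> (lmon \<one> (int k) \<otimes>\<^bsub>K\<^esub> g (i, j))"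
          using i K.vec_mem[OF wV i] m[OF i j] kK by (simp add: K.m_ac)
        then show "(lmon \<one> (int k) \<odot>\<^bsub>V\<^esub> w) i \<otimes>\<^bsub>K\<^esub> g (i, j) \<in> carrier K0"
          using K0_mult_closed[OF K0.vec_mem[OF w i] gk[OF i j]] by simp
      qed
      then show ?thesis by (auto simp: rowmul_def)
    qed
    then show ?thesis using ewV by (simp add: rowlat_def)
  qed
  then show ?thesis by blast
qed

end

section \<open>Row lattices as ideals, and the inverse of Y\<close>

context curve_setting
begin

text \<open>In the coordinates w g the lattice consists of the integral vectors, so dropping all
  negative powers of \<epsilon> there projects onto it.\<close>

lemma rowlat_retraction:
  assumes g: "g \<in> GL" and L: "rowlat g \<subseteq> Lam"
  shows "\<exists>P. retraction (rowlat g) P"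
proof -
  note m = GL_mats[OF g]
  define pl where "pl y = (\<lambda>i\<in>{1..n}. \<lambda>z. if z < 0 then \<zero> else y i z)" for y :: "nat \<Rightarrow> int \<Rightarrow> 'a"
  have plL: "pl y \<in> Lam" if "y \<in> VK" for y
    using VK_coeff[OF that] by (auto simp: pl_def K0_carrier_iff)
  have pl_id: "pl y = y" if "y \<in> Lam" for y
    by (rule V_eqI) (use that Lam_neg[OF that] in \<open>auto simp: pl_def PiE_iff\<close>)
  have pl_add: "pl (x \<oplus>\<^bsub>V\<^esub> y) = pl x \<oplus>\<^bsub>V\<^esub> pl y" for x y
    by (rule V_eqI) (auto simp: pl_def laurent_add)
  have pl_sm: "pl (lmon c 0 \<odot>\<^bsub>V\<^esub> y) = lmon c 0 \<odot>\<^bsub>V\<^esub> pl y" if "c \<in> carrier R" "y \<in> VK" for c y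
  proof (rule V_eqI)
    fix i z assume i: "i \<in> {1..n}"
    show "pl (lmon c 0 \<odot>\<^bsub>V\<^esub> y) i z = (lmon c 0 \<odot>\<^bsub>V\<^esub> pl y) i z"
      unfolding V_smult_lmon[OF Lam_VK[OF plL[OF that(2)]] that(1) i]
      using i V_smult_lmon[OF that(2,1) i, of 0] that(1) by (simp add: pl_def del: vec_smult)
  qed (auto simp: pl_def)
  define P where "P w = rowmul {1..n} K (pl (rowmul {1..n} K w g)) (minv g)" for w
  have gV: "rowmul {1..n} K w g \<in> VK" if "w \<in> Lam" for w using Lam_VK[OF that] m by simp
  have "retraction (rowlat g) P"
    unfolding retraction_def
  proof (intro conjI ballI)
    show "P w \<in> rowlat g" if "w \<in> Lam" for w
      using rowmul_inv(2)[OF g Lam_VK[OF plL[OF gV[OF that]]]] plL[OF gV[OF that]] Lam_VK m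
      by (simp add: P_def rowlat_def)
    show "P w = w" if "w \<in> rowlat g" for w
      using that pl_id rowmul_inv(1)[OF g rowlat_VK[OF that]] by (simp add: P_def rowlat_def)
    show "P (v \<oplus>\<^bsub>V\<^esub> w) = P v \<oplus>\<^bsub>V\<^esub> P w" if "v \<in> Lam" "w \<in> Lam" for v w
      using K.rowmul_add[OF Lam_VK[OF that(1)] Lam_VK[OF that(2)] m(1)]
        K.rowmul_add[OF Lam_VK[OF plL[OF gV[OF that(1)]]] Lam_VK[OF plL[OF gV[OF that(2)]]] m(2)]
      by (simp add: P_def pl_add)
    show "P (lmon c 0 \<odot>\<^bsub>V\<^esub> w) = lmon c 0 \<odot>\<^bsub>V\<^esub> P w" if "c \<in> carrier R" "w \<in> Lam" for c w
      using K.rowmul_smult[OF _ lmon_closed[OF that(1)] Lam_VK[OF that(2)] m(1)]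
        K.rowmul_smult[OF _ lmon_closed[OF that(1)] Lam_VK[OF plL[OF gV[OF that(2)]]] m(2)]
        pl_sm[OF that(1) gV[OF that(2)]]
      by (simp add: P_def)
  qed
  then show ?thesis by blast
qed

lemma rowlat_finite_codim:
  assumes g: "g \<in> GL" and sub: "curve_submodule (rowlat g)"
  shows "finite_codim_ideal m n R (idl_of (rowlat g))"
proof -
  have L: "rowlat g \<subseteq> Lam" using curve_submoduleD(3)[OF sub] by blast
  obtain P where P: "retraction (rowlat g) P" using rowlat_retraction[OF g L] by blast
  obtain k where k: "\<forall>w\<in>Lam. lmon \<one> (int k) \<odot>\<^bsub>V\<^esub> w \<in> rowlat g" using rowlat_deep[OF g] by blast
  show ?thesis by (rule finite_codim_idealI[OF sub P, of k]) (use k in blast)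
qed

text \<open>The inverse of Y over the Laurent ring, where the corner entry becomes \<epsilon>^(-m).
  It serves to write the image of a row lattice under Y as a row lattice.\<close>

definition Yinv :: "nat \<times> nat \<Rightarrow> int \<Rightarrow> 'a" where
  "Yinv = (\<lambda>(i, j)\<in>{1..n} \<times> {1..n}. if i < n \<and> j = i + 1 then \<one>\<^bsub>K\<^esub>
     else if i = n \<and> j = 1 then lmon \<one> (- int m) else \<zero>\<^bsub>K\<^esub>)"

lemma Yinv_mats: "Yinv \<in> mats"
  by (auto simp: Yinv_def)

lemma shiftYinv:
  assumes w: "w \<in> VK" and j: "j \<in> {1..n}"
  shows "rowmul {1..n} K w Yinv j = (if j = 1 then lmon \<one> (- int m) \<otimes>\<^bsub>K\<^esub> w n else w (j - 1))"
proof -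
  note wm = K.vec_mem[OF w]
  let ?i = "if j = 1 then n else j - 1"
  have i: "?i \<in> {1..n}" using j n_pos by (auto simp: atLeastAtMost_iff)
  have "(\<Oplus>\<^bsub>K\<^esub>i\<in>{1..n}. w i \<otimes>\<^bsub>K\<^esub> Yinv (i, j)) = w ?i \<otimes>\<^bsub>K\<^esub> Yinv (?i, j)"
    by (rule K.finsum_single)
      (use j i wm in \<open>auto simp: Yinv_def atLeastAtMost_iff\<close>)
  moreover have "Yinv (?i, j) = (if j = 1 then lmon \<one> (- int m) else \<one>\<^bsub>K\<^esub>)"
    using i j by (auto simp: Yinv_def atLeastAtMost_iff)
  ultimately show ?thesis
    using i j wm[OF i] by (auto simp: rowmul_def K.m_comm)
qed

lemma eps_m_inv: "lmon \<one> (int m) \<otimes>\<^bsub>K\<^esub> (lmon \<one> (- int m) \<otimes>\<^bsub>K\<^esub> a) = a"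
  "lmon \<one> (- int m) \<otimes>\<^bsub>K\<^esub> (lmon \<one> (int m) \<otimes>\<^bsub>K\<^esub> a) = a" if "a \<in> carrier K"
  using that by (simp_all add: K.m_assoc[symmetric] lmon_mult_lmon laurent_one[symmetric])

lemma Y_inverse:
  assumes "w \<in> VK"
  shows "rowmul {1..n} K (shiftY w) Yinv = w" "shiftY (rowmul {1..n} K w Yinv) = w"
proof -
  note wm = K.vec_mem[OF assms]
  have n1: "1 \<in> {1..n}" "n \<in> {1..n}" using n_pos by (auto simp: atLeastAtMost_iff)
  have sV: "shiftY w \<in> VK" "rowmul {1..n} K w Yinv \<in> VK" using assms Yinv_mats by auto
  show "rowmul {1..n} K (shiftY w) Yinv = w"
  proof (rule vec_eqI[where I = "{1..n}"])
    fix j assume j: "j \<in> {1..n}"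
    show "rowmul {1..n} K (shiftY w) Yinv j = w j"
    proof (cases "j = 1")
      case True
      then show ?thesis using shiftYinv[OF sV(1) j] shiftY[OF assms n1(2)] eps_m_inv[OF wm[OF n1(1)]] by simp
    next
      case False
      then have "j - 1 \<in> {1..n}" "j - 1 < n" "j - 1 + 1 = j" using j by (auto simp: atLeastAtMost_iff)
      then show ?thesis using False shiftYinv[OF sV(1) j] shiftY[OF assms, of "j - 1"] by simp
    qed
  qed (use assms in \<open>auto simp: PiE_iff\<close>)
  show "shiftY (rowmul {1..n} K w Yinv) = w"
  proof (rule vec_eqI[where I = "{1..n}"])
    fix i assume i: "i \<in> {1..n}"
    show "shiftY (rowmul {1..n} K w Yinv) i = w i"
    proof (cases "i < n")
      case True
      then have "i + 1 \<in> {1..n}" "i + 1 \<noteq> 1" "i + 1 - 1 = i" using i by (auto simp: atLeastAtMost_iff)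
      then show ?thesis using True shiftY[OF sV(2) i] shiftYinv[OF assms, of "i + 1"] by simp
    next
      case False
      then have "i = n" using i by (auto simp: atLeastAtMost_iff)
      then show ?thesis using shiftY[OF sV(2) i] shiftYinv[OF assms n1(1)] eps_m_inv[OF wm[OF n1(2)]] by simp
    qed
  qed (use assms in \<open>auto simp: PiE_iff\<close>)
qed

lemma Yinv_GL: "Yinv \<in> GL"
proof -
  have "mat_mult {1..n} K Y Yinv = scalar_mat {1..n} K \<one>\<^bsub>K\<^esub>"
  proof (rule K.mat_eqI[where I = "{1..n}"])
    fix i assume i: "i \<in> {1..n}"
    have "rowmul {1..n} K (shiftY (unit_row {1..n} K i)) Yinv = unit_row {1..n} K i" by (rule Y_inverse) simp
    then show "mat_row {1..n} (mat_mult {1..n} K Y Yinv) i = mat_row {1..n} (scalar_mat {1..n} K \<one>\<^bsub>K\<^esub>) i"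
      using i Y_closed Yinv_mats K.rowmul_unit_row[OF _ i Y_closed] V.smult_one[of "unit_row {1..n} K i"]
      by (simp add: K.mat_mult_row K.mat_row_scalar)
  qed simp_all
  moreover have "mat_mult {1..n} K Yinv Y = scalar_mat {1..n} K \<one>\<^bsub>K\<^esub>"
  proof (rule K.mat_eqI[where I = "{1..n}"])
    fix i assume i: "i \<in> {1..n}"
    have "shiftY (rowmul {1..n} K (unit_row {1..n} K i) Yinv) = unit_row {1..n} K i" by (rule Y_inverse) simp
    then show "mat_row {1..n} (mat_mult {1..n} K Yinv Y) i = mat_row {1..n} (scalar_mat {1..n} K \<one>\<^bsub>K\<^esub>) i"
      using i Y_closed Yinv_mats K.rowmul_unit_row[OF _ i Yinv_mats] V.smult_one[of "unit_row {1..n} K i"]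
      by (simp add: K.mat_mult_row K.mat_row_scalar)
  qed simp_all
  ultimately show ?thesis unfolding Units_def using Y_closed Yinv_mats by (auto simp: mat_monoid_simps)
qed

text \<open>If w = v Y, then w Y^-1 g = v g. So the closing lattice of a chain is again given by an
  invertible matrix, and what is known of row lattices applies to it.\<close>

lemma rowlat_Yinv:
  assumes g: "g \<in> GL"
  shows "mat_mult {1..n} K Yinv g \<in> GL" "rowlat (mat_mult {1..n} K Yinv g) = shiftY ` rowlat g"
proof -
  show "mat_mult {1..n} K Yinv g \<in> GL" using M.Units_m_closed[OF Yinv_GL g] by (simp add: mat_monoid_simps)
  have eq: "rowmul {1..n} K w (mat_mult {1..n} K Yinv g) = rowmul {1..n} K (rowmul {1..n} K w Yinv) g" if "w \<in> VK" for w
    using that GL_mats[OF g] Yinv_mats by (simp add: K.rowmul_assoc)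
  show "rowlat (mat_mult {1..n} K Yinv g) = shiftY ` rowlat g"
  proof (intro subset_antisym subsetI)
    fix w assume w: "w \<in> rowlat (mat_mult {1..n} K Yinv g)"
    then have wV: "w \<in> VK" by (rule rowlat_VK)
    have "rowmul {1..n} K w Yinv \<in> rowlat g" using w eq[OF wV] wV Yinv_mats by (simp add: rowlat_def)
    then show "w \<in> shiftY ` rowlat g" using Y_inverse(2)[OF wV] by (metis image_eqI)
  next
    fix w assume "w \<in> shiftY ` rowlat g"
    then obtain v where v: "v \<in> rowlat g" "w = shiftY v" by blast
    have vV: "v \<in> VK" by (rule rowlat_VK[OF v(1)])
    have wV: "w \<in> VK" using v vV by simp
    have "rowmul {1..n} K w (mat_mult {1..n} K Yinv g) = rowmul {1..n} K v g"
      unfolding eq[OF wV] using Y_inverse(1)[OF vV] v by simp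
    then show "w \<in> rowlat (mat_mult {1..n} K Yinv g)" using v wV by (simp add: rowlat_def)
  qed
qed

end

section \<open>Points of the Springer fibre as chains of ideals\<close>

locale springer_setting = curve_setting +
  fixes r :: nat
  assumes r_pos: "r > 0"
begin

abbreviation "GG \<equiv> gauge_group n r K"

text \<open>The value at i = r is the image of the lattice 0 under Y and closes the chain, in
  accordance with J^r = y J^0.\<close>

definition lat :: "(nat \<Rightarrow> nat \<times> nat \<Rightarrow> int \<Rightarrow> 'a) \<Rightarrow> nat \<Rightarrow> (nat \<Rightarrow> int \<Rightarrow> 'a) set" where
  "lat g i = (if i < r then rowlat (g i) else shiftY ` rowlat (g 0))"

definition chain :: "(nat \<Rightarrow> nat \<times> nat \<Rightarrow> int \<Rightarrow> 'a) \<Rightarrow> nat \<Rightarrow> (nat \<times> nat \<Rightarrow> 'a) set set" where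
  "chain g = (\<lambda>i\<in>{..r}. idl_of (lat g i))"

definition integral_at :: "(nat \<Rightarrow> nat \<times> nat \<Rightarrow> int \<Rightarrow> 'a) \<Rightarrow> bool" where
  "integral_at g \<longleftrightarrow> rep_action n r K (inv\<^bsub>GG\<^esub> g) (spr_vector m n r R) \<in> rep_space n r K0"

lemma gauge_carrier: "carrier (gauge_group n r A) = {..<r} \<rightarrow>\<^sub>E Units (mat_monoid n A)"
  by (simp add: gauge_group_def units_of_carrier)

lemma gauge_mult: "g \<otimes>\<^bsub>GG\<^esub> h = (\<lambda>i\<in>{..<r}. mat_mult {1..n} K (g i) (h i))"
  by (simp add: gauge_group_def units_of_mult mat_monoid_simps)

lemma gauge_GL: "g \<in> carrier GG \<Longrightarrow> i < r \<Longrightarrow> g i \<in> GL"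
  unfolding gauge_carrier using PiE_mem[of g "{..<r}" "\<lambda>_. GL" i] by simp

lemma gauge_inv:
  assumes "g \<in> carrier GG"
  shows "inv\<^bsub>GG\<^esub> g = (\<lambda>i\<in>{..<r}. minv (g i))"
proof -
  have "inv\<^bsub>GG\<^esub> g = (\<lambda>i\<in>{..<r}. inv\<^bsub>units_of (mat_monoid n K)\<^esub> (g i))"
    unfolding gauge_group_def
  proof (rule inv_product_group)
    show "g \<in> ({..<r} \<rightarrow>\<^sub>E carrier (units_of (mat_monoid n K)))"
      using assms unfolding gauge_carrier units_of_carrier .
  qed (rule M.units_group)
  also have "\<dots> = (\<lambda>i\<in>{..<r}. minv (g i))"
    by (rule restrict_ext, rule M.units_of_inv, rule gauge_GL[OF assms]) simp
  finally show ?thesis .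
qed

lemma gr_class_eq:
  "gr_class n r R g = (\<lambda>u. \<lambda>i\<in>{..<r}. mat_mult {1..n} K (g i) (u i)) ` ({..<r} \<rightarrow>\<^sub>E Units (mat_monoid n K0))"
  by (auto simp: gr_class_def l_coset_def gauge_mult gauge_carrier)

lemma gr_class_subset:
  assumes g: "g \<in> carrier GG" and g': "g' \<in> carrier GG" and eq: "\<And>i. i < r \<Longrightarrow> rowlat (g i) = rowlat (g' i)"
  shows "gr_class n r R g' \<subseteq> gr_class n r R g"
proof
  interpret M0: Group.monoid "mat_monoid n K0" by (rule K0.mat_monoid_monoid)
  fix x assume "x \<in> gr_class n r R g'"
  then obtain v where v: "v \<in> {..<r} \<rightarrow>\<^sub>E Units (mat_monoid n K0)" "x = (\<lambda>i\<in>{..<r}. mat_mult {1..n} K (g' i) (v i))"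
    unfolding gr_class_eq by blast
  have "\<exists>u. u \<in> Units (mat_monoid n K0) \<and> g' i = mat_mult {1..n} K (g i) u" if "i < r" for i
    using rowlat_eq_imp[OF gauge_GL[OF g that] gauge_GL[OF g' that] eq[OF that]] by metis
  then obtain u where u: "\<And>i. i < r \<Longrightarrow> u i \<in> Units (mat_monoid n K0)"
    "\<And>i. i < r \<Longrightarrow> g' i = mat_mult {1..n} K (g i) (u i)" by metis
  define t where "t = (\<lambda>i\<in>{..<r}. mat_mult {1..n} K (u i) (v i))"
  have vU: "v i \<in> Units (mat_monoid n K0)" if "i < r" for i using v(1) that by auto
  have m0: "u i \<in> mats0" "v i \<in> mats0" if "i < r" for i using u(1)[OF that] vU[OF that] by (simp_all add: Units_K0)
  have "mat_mult {1..n} K (u i) (v i) \<in> Units (mat_monoid n K0)" if "i < r" for i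
    using M0.Units_m_closed[OF u(1)[OF that] vU[OF that]] mats0_mult(1)[OF m0[OF that]] by (simp add: mat_monoid_simps)
  then have "t \<in> {..<r} \<rightarrow>\<^sub>E Units (mat_monoid n K0)" by (auto simp: t_def)
  moreover have "x = (\<lambda>i\<in>{..<r}. mat_mult {1..n} K (g i) (t i))"
    unfolding v(2)
    by (rule restrict_ext) (use u(2) m0 mats0_mats GL_mats(1)[OF gauge_GL[OF g]] in \<open>simp add: t_def K.mat_mult_assoc\<close>)
  ultimately show "x \<in> gr_class n r R g" unfolding gr_class_eq by blast
qed

lemma gr_class_self:
  assumes g: "g \<in> carrier GG"
  shows "g \<in> gr_class n r R g"
proof -
  have one: "scalar_mat {1..n} K \<one>\<^bsub>K\<^esub> \<in> Units (mat_monoid n K0)"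
    using monoid.Units_one_closed[OF K0.mat_monoid_monoid[of n]] by (simp add: mat_monoid_simps scalar_mat_K0)
  have "g = (\<lambda>i\<in>{..<r}. mat_mult {1..n} K (g i) (scalar_mat {1..n} K \<one>\<^bsub>K\<^esub>))"
    by (rule vec_eqI[where I = "{..<r}"])
      (use g GL_mats(1)[OF gauge_GL[OF g]] in \<open>auto simp: K.mat_mult_one gauge_carrier PiE_iff\<close>)
  then have "g = (\<lambda>i\<in>{..<r}. mat_mult {1..n} K (g i) ((\<lambda>i\<in>{..<r}. scalar_mat {1..n} K \<one>\<^bsub>K\<^esub>) i))"
    by (simp cong: restrict_cong)
  then show ?thesis unfolding gr_class_eq using one by (intro image_eqI) auto
qed

lemma gr_class_memD:
  assumes g: "g \<in> carrier GG" and x: "x \<in> gr_class n r R g"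
  shows "x \<in> carrier GG" "i < r \<Longrightarrow> rowlat (x i) = rowlat (g i)"
proof -
  obtain u where u: "u \<in> {..<r} \<rightarrow>\<^sub>E Units (mat_monoid n K0)" "x = (\<lambda>i\<in>{..<r}. mat_mult {1..n} K (g i) (u i))"
    using x unfolding gr_class_eq by blast
  have uU: "u i \<in> Units (mat_monoid n K0)" if "i < r" for i using u(1) that by auto
  have "mat_mult {1..n} K (g i) (u i) \<in> GL" if "i < r" for i
    using M.Units_m_closed[OF gauge_GL[OF g that], of "u i"] uU[OF that] by (simp add: mat_monoid_simps Units_K0)
  then show "x \<in> carrier GG" by (auto simp: u(2) gauge_carrier)
  show "rowlat (x i) = rowlat (g i)" if "i < r"
    using rowlat_mult_unit[OF gauge_GL[OF g that] uU[OF that]] that by (simp add: u(2))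
qed

text \<open>Makes the passage from classes to chains well defined and injective: right
  multiplication by integral invertible matrices is exactly the ambiguity that the lattices
  leave.\<close>

lemma gr_class_eq_iff:
  assumes g: "g \<in> carrier GG" and g': "g' \<in> carrier GG"
  shows "gr_class n r R g = gr_class n r R g' \<longleftrightarrow> (\<forall>i<r. rowlat (g i) = rowlat (g' i))"
proof
  assume "gr_class n r R g = gr_class n r R g'"
  then have "g \<in> gr_class n r R g'" using gr_class_self[OF g] by simp
  then show "\<forall>i<r. rowlat (g i) = rowlat (g' i)" using gr_class_memD[OF g'] by blast
next
  assume "\<forall>i<r. rowlat (g i) = rowlat (g' i)"
  then show "gr_class n r R g = gr_class n r R g'"
    using gr_class_subset[OF g g'] gr_class_subset[OF g' g] by blast
qed

text \<open>Acting by the inverse of g puts the i-th matrix into the form g_(i+1)^-1 X_i g_i with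
  cyclic index, so that \<open>integral_iff_rowlat\<close> compares lattice i+1 with lattice i. The
  vector becomes the first column of g_0^-1; its integrality is that of the first entries of the
  lattice, because the rows of g_0^-1 generate it.\<close>

lemma integral_at_iff:
  assumes g: "g \<in> carrier GG"
  shows "integral_at g \<longleftrightarrow> (\<forall>w\<in>rowlat (g 0). w 1 \<in> carrier K0) \<and>
    (\<forall>i. Suc i < r \<longrightarrow> rowlat (g (Suc i)) \<subseteq> rowlat (g i)) \<and>
    (\<forall>w\<in>rowlat (g 0). shiftY w \<in> rowlat (g (r - 1)))"
proof -
  note GL = gauge_GL[OF g]
  define L where "L i = (if i = r - 1 then Y else scalar_mat {1..n} K \<one>\<^bsub>K\<^esub>)" for i
  have L: "L i \<in> mats" for i using Y_closed by (simp add: L_def)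
  have n1: "1 \<in> {1..n}" using n_pos by (auto simp: atLeastAtMost_iff)
  note m0 = GL_mats(2)[OF GL[OF r_pos]]
  have vec: "mat_vec n K (minv (g 0)) (basis_vec n K 1) = (\<lambda>i\<in>{1..n}. minv (g 0) (i, 1))"
  proof (unfold mat_vec_def, rule restrict_ext)
    fix i assume i: "i \<in> {1..n}"
    have "(\<Oplus>\<^bsub>K\<^esub>k\<in>{1..n}. minv (g 0) (i, k) \<otimes>\<^bsub>K\<^esub> basis_vec n K 1 k) = minv (g 0) (i, 1) \<otimes>\<^bsub>K\<^esub> basis_vec n K 1 1"
      by (rule K.finsum_single) (use n1 K.mat_mem[OF m0 i] in \<open>auto simp: basis_vec_def\<close>)
    then show "(\<Oplus>\<^bsub>K\<^esub>k\<in>{1..n}. minv (g 0) (i, k) \<otimes>\<^bsub>K\<^esub> basis_vec n K 1 k) = minv (g 0) (i, 1)"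
      using n1 K.mat_mem[OF m0 i n1] by (simp add: basis_vec_def)
  qed
  have act: "rep_action n r K (inv\<^bsub>GG\<^esub> g) (spr_vector m n r R) =
    (\<lambda>i\<in>{1..n}. minv (g 0) (i, 1),
     \<lambda>i\<in>{..<r}. mat_mult {1..n} K (mat_mult {1..n} K (minv (g (Suc i mod r))) (L i)) (g i))"
    unfolding rep_action_def spr_vector_def gauge_inv[OF g] prod.case
    using r_pos M.Units_inv_inv[OF GL]
    by (auto simp: vec L_def mat_monoid_simps intro!: restrict_ext)
  have i1: "(\<lambda>i\<in>{1..n}. minv (g 0) (i, 1)) \<in> {1..n} \<rightarrow>\<^sub>E carrier K0 \<longleftrightarrow> (\<forall>w\<in>rowlat (g 0). w 1 \<in> carrier K0)"
  proof
    assume A: "(\<lambda>i\<in>{1..n}. minv (g 0) (i, 1)) \<in> {1..n} \<rightarrow>\<^sub>E carrier K0"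
    show "\<forall>w\<in>rowlat (g 0). w 1 \<in> carrier K0"
    proof
      fix w assume w: "w \<in> rowlat (g 0)"
      have "w 1 = rowmul {1..n} K (rowmul {1..n} K w (g 0)) (minv (g 0)) 1"
        using rowmul_inv(1)[OF GL[OF r_pos] rowlat_VK[OF w]] by simp
      also have "\<dots> = (\<Oplus>\<^bsub>K\<^esub>i\<in>{1..n}. rowmul {1..n} K w (g 0) i \<otimes>\<^bsub>K\<^esub> minv (g 0) (i, 1))"
        using n1 by (subst rowmul_def) simp
      also have "\<dots> \<in> carrier K0"
      proof (rule K0_finsum_closed)
        fix i assume i: "i \<in> {1..n}"
        have "rowmul {1..n} K w (g 0) i \<in> carrier K0" using w i by (intro K0.vec_mem[OF _ i]) (simp add: rowlat_def)
        moreover have "minv (g 0) (i, 1) \<in> carrier K0" using K0.vec_mem[OF A i] i by simp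
        ultimately show "rowmul {1..n} K w (g 0) i \<otimes>\<^bsub>K\<^esub> minv (g 0) (i, 1) \<in> carrier K0" by (rule K0_mult_closed)
      qed
      finally show "w 1 \<in> carrier K0" .
    qed
  next
    assume A: "\<forall>w\<in>rowlat (g 0). w 1 \<in> carrier K0"
    have "minv (g 0) (i, 1) \<in> carrier K0" if i: "i \<in> {1..n}" for i
      using A inv_row_rowlat[OF GL[OF r_pos] i] n1 by (metis mat_row_apply)
    then show "(\<lambda>i\<in>{1..n}. minv (g 0) (i, 1)) \<in> {1..n} \<rightarrow>\<^sub>E carrier K0" by auto
  qed
  have i2: "(\<lambda>i\<in>{..<r}. mat_mult {1..n} K (mat_mult {1..n} K (minv (g (Suc i mod r))) (L i)) (g i))
       \<in> {..<r} \<rightarrow>\<^sub>E mats0 \<longleftrightarrow> (\<forall>i<r. \<forall>w\<in>rowlat (g (Suc i mod r)). rowmul {1..n} K w (L i) \<in> rowlat (g i))"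
  proof -
    have "(\<lambda>i\<in>{..<r}. mat_mult {1..n} K (mat_mult {1..n} K (minv (g (Suc i mod r))) (L i)) (g i)) \<in> {..<r} \<rightarrow>\<^sub>E mats0 \<longleftrightarrow>
      (\<forall>i<r. mat_mult {1..n} K (mat_mult {1..n} K (minv (g (Suc i mod r))) (L i)) (g i) \<in> mats0)"
      by (simp only: restrict_PiE_iff) auto
    also have "\<dots> \<longleftrightarrow> (\<forall>i<r. \<forall>w\<in>rowlat (g (Suc i mod r)). rowmul {1..n} K w (L i) \<in> rowlat (g i))"
      using integral_iff_rowlat[OF GL GL L] r_pos by simp
    finally show ?thesis .
  qed
  have i3: "(\<forall>i<r. \<forall>w\<in>rowlat (g (Suc i mod r)). rowmul {1..n} K w (L i) \<in> rowlat (g i)) \<longleftrightarrow>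
    (\<forall>i. Suc i < r \<longrightarrow> rowlat (g (Suc i)) \<subseteq> rowlat (g i)) \<and> (\<forall>w\<in>rowlat (g 0). shiftY w \<in> rowlat (g (r - 1)))"
  proof -
    have a: "(\<forall>w\<in>rowlat (g (Suc i mod r)). rowmul {1..n} K w (L i) \<in> rowlat (g i)) \<longleftrightarrow> rowlat (g (Suc i)) \<subseteq> rowlat (g i)"
      if "Suc i < r" for i
      using that K.rowmul_one[OF _ rowlat_VK] by (auto simp: L_def)
    have b: "(\<forall>w\<in>rowlat (g (Suc (r - 1) mod r)). rowmul {1..n} K w (L (r - 1)) \<in> rowlat (g (r - 1))) \<longleftrightarrow>
        (\<forall>w\<in>rowlat (g 0). shiftY w \<in> rowlat (g (r - 1)))"
      using r_pos by (simp add: L_def)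
    \<comment> \<open>The successor index wraps around to 0 only for i = r - 1, which is also the
      place where the matrix is Y instead of the identity.\<close>
    have c: "i < r \<longleftrightarrow> Suc i < r \<or> i = r - 1" for i using r_pos by auto
    show ?thesis
    proof (intro iffI conjI allI impI)
      assume H: "\<forall>i<r. \<forall>w\<in>rowlat (g (Suc i mod r)). rowmul {1..n} K w (L i) \<in> rowlat (g i)"
      show "rowlat (g (Suc i)) \<subseteq> rowlat (g i)" if "Suc i < r" for i using a[OF that] H Suc_lessD[OF that] by blast
      have "r - 1 < r" using r_pos by simp
      then show "\<forall>w\<in>rowlat (g 0). shiftY w \<in> rowlat (g (r - 1))" using b H by blast
    next
      fix i
      assume H: "(\<forall>i. Suc i < r \<longrightarrow> rowlat (g (Suc i)) \<subseteq> rowlat (g i)) \<and> (\<forall>w\<in>rowlat (g 0). shiftY w \<in> rowlat (g (r - 1)))"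
        and "i < r"
      then consider "Suc i < r" | "i = r - 1" using c[of i] by blast
      then show "\<forall>w\<in>rowlat (g (Suc i mod r)). rowmul {1..n} K w (L i) \<in> rowlat (g i)"
      proof cases
        case 1
        then show ?thesis using a[OF 1] H by blast
      next
        case 2
        then show ?thesis using b H by blast
      qed
    qed
  qed
  show ?thesis
    unfolding integral_at_def act rep_space_def mem_Times_iff fst_conv snd_conv mat_monoid_simps(1) i1 i2 i3 by blast
qed

lemma spr_points_eq: "spr_points m n r R = {gr_class n r R g |g. g \<in> carrier GG \<and> integral_at g}"
  by (simp add: spr_points_def integral_at_def)

text \<open>Since the rows \<open>b\<^sub>1, b\<^sub>1 Y, \<dots>\<close> exhaust the coordinates, integrality of the first entry of all
  vectors of a \<open>Y\<close>-stable lattice makes the whole lattice integral.\<close>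

lemma integral_at_lat:
  assumes g: "g \<in> carrier GG" and int: "integral_at g"
  shows "i \<le> r \<Longrightarrow> curve_submodule (lat g i)" "i < r \<Longrightarrow> lat g (Suc i) \<subseteq> lat g i"
proof -
  note GL = gauge_GL[OF g]
  have c1: "w 1 \<in> carrier K0" if "w \<in> rowlat (g 0)" for w using int that integral_at_iff[OF g] by blast
  have c2: "rowlat (g (Suc i)) \<subseteq> rowlat (g i)" if "Suc i < r" for i using int that integral_at_iff[OF g] by blast
  have c3: "shiftY w \<in> rowlat (g (r - 1))" if "w \<in> rowlat (g 0)" for w using int that integral_at_iff[OF g] by blast
  have sub: "rowlat (g j) \<subseteq> rowlat (g i)" if "i \<le> j" "j < r" for i j
    using that
  proof (induction j)
    case (Suc j)
    then show ?case using c2[of j] by (cases "i = Suc j") auto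
  qed simp
  have Y0: "shiftY w \<in> rowlat (g 0)" if "w \<in> rowlat (g 0)" for w
    using c3[OF that] sub[of 0 "r - 1"] r_pos by auto
  have L0: "rowlat (g 0) \<subseteq> Lam"
  proof
    fix w assume w: "w \<in> rowlat (g 0)"
    have "\<forall>w\<in>rowlat (g 0). w (Suc t) \<in> carrier K0" if "Suc t \<le> n" for t
      using that
    proof (induction t)
      case 0
      then show ?case using c1 by (simp add: One_nat_def)
    next
      case (Suc t)
      show ?case
      proof
        fix w assume w: "w \<in> rowlat (g 0)"
        have "shiftY w (Suc t) = w (Suc (Suc t))"
          using shiftY[OF rowlat_VK[OF w], of "Suc t"] Suc.prems by (auto simp: atLeastAtMost_iff One_nat_def)
        then show "w (Suc (Suc t)) \<in> carrier K0" using Suc Y0[OF w] by (metis Suc_leD)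
      qed
    qed
    then have "w i \<in> carrier K0" if "i \<in> {1..n}" for i
      using w that by (cases i) (auto simp: atLeastAtMost_iff)
    then show "w \<in> Lam" using rowlat_VK[OF w] by (auto simp: PiE_iff)
  qed
  have subm: "curve_submodule (rowlat (g i))" if "i < r" for i
    unfolding curve_submodule_def
  proof
    have "rowlat (g i) \<subseteq> Lam" using sub[of 0 i] that L0 by auto
    then show "K0_submodule (rowlat (g i))" by (rule rowlat_submodule[OF GL[OF that]])
    \<comment> \<open>The lattice W_i lies in W_0, whose image under Y lies in W_(r-1) and hence in
      W_i.\<close>
    have "i \<le> r - 1" "r - 1 < r" using that by auto
    then show "\<forall>w\<in>rowlat (g i). shiftY w \<in> rowlat (g i)"
      using c3 sub[of 0 i] sub[of i "r - 1"] that by blast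
  qed
  have last: "shiftY ` rowlat (g 0) \<subseteq> rowlat (g (r - 1))" using c3 by blast
  show "curve_submodule (lat g i)" if "i \<le> r"
  proof (cases "i < r")
    case True
    then show ?thesis using subm by (simp add: lat_def)
  next
    case False
    have eq: "shiftY ` rowlat (g 0) = rowlat (mat_mult {1..n} K Yinv (g 0))" using rowlat_Yinv[OF GL[OF r_pos]] by simp
    have "shiftY ` rowlat (g 0) \<subseteq> Lam" using Y0 L0 by blast
    then have "K0_submodule (shiftY ` rowlat (g 0))"
      unfolding eq by (intro rowlat_submodule rowlat_Yinv GL r_pos)
    then show ?thesis using False Y0 by (auto simp: lat_def curve_submodule_def)
  qed
  show "lat g (Suc i) \<subseteq> lat g i" if "i < r"
  proof (cases "Suc i < r")
    case True
    then show ?thesis using c2 by (simp add: lat_def)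
  next
    case False
    then have "i = r - 1" "\<not> Suc i < r" using that by auto
    then show ?thesis using last r_pos by (simp add: lat_def)
  qed
qed

lemma lat_rowlat:
  assumes "g \<in> carrier GG"
  obtains h where "h \<in> GL" "lat g i = rowlat h"
proof (cases "i < r")
  case True
  then show ?thesis using that[of "g i"] gauge_GL[OF assms] by (simp add: lat_def)
next
  case False
  then show ?thesis using that rowlat_Yinv[OF gauge_GL[OF assms r_pos]] by (simp add: lat_def)
qed

lemma chain_point:
  assumes g: "g \<in> carrier GG" and int: "integral_at g"
  shows "chain g \<in> cphilb_points m n r R"
  unfolding cphilb_points_def mem_Collect_eq
proof (intro conjI allI impI)
  show "chain g \<in> extensional {..r}" by (simp add: chain_def)
  show "finite_codim_ideal m n R (chain g i)" if "i \<le> r" for i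
  proof -
    obtain h where h: "h \<in> GL" "lat g i = rowlat h" using lat_rowlat[OF g] .
    then show ?thesis using rowlat_finite_codim[OF h(1)] integral_at_lat(1)[OF g int that] that by (simp add: chain_def)
  qed
  show "chain g (Suc i) \<subseteq> chain g i" if "i < r" for i
    using integral_at_lat(2)[OF g int that] that by (auto simp: chain_def idl_of_def)
  have "rowlat (g 0) \<subseteq> Lam"
    using curve_submoduleD(3)[OF integral_at_lat(1)[OF g int, of 0]] r_pos by (auto simp: lat_def)
  then show "chain g r = cl (var_y R) <#\<^bsub>CR\<^esub> chain g 0"
    using r_pos y_coset by (simp add: chain_def lat_def)
qed

lemma chain_inj:
  assumes g: "g \<in> carrier GG" "integral_at g" and g': "g' \<in> carrier GG" "integral_at g'"
    and eq: "chain g = chain g'"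
  shows "gr_class n r R g = gr_class n r R g'"
  unfolding gr_class_eq_iff[OF g(1) g'(1)]
proof (intro allI impI)
  fix i assume i: "i < r"
  have "rowlat (g i) \<subseteq> Lam" "rowlat (g' i) \<subseteq> Lam"
    using curve_submoduleD(3)[OF integral_at_lat(1)[OF g, of i]] curve_submoduleD(3)[OF integral_at_lat(1)[OF g', of i]] i
    by (auto simp: lat_def)
  moreover have "idl_of (rowlat (g i)) = idl_of (rowlat (g' i))"
    using fun_cong[OF eq, of i] i by (simp add: chain_def lat_def)
  ultimately show "rowlat (g i) = rowlat (g' i)" by (rule idl_of_inj)
qed

lemma chain_cong:
  assumes "\<And>i. i < r \<Longrightarrow> rowlat (g i) = rowlat (g' i)"
  shows "chain g = chain g'"
  using assms r_pos by (auto simp: chain_def lat_def intro!: restrict_ext)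

text \<open>That the lattices of the ideals have bases is a hypothesis here, to be supplied after
  localization. It is made for i < r, since J_r is determined by J_0 through the closing condition.
  The condition on the vector b_1 holds because lattices of ideals consist of integral
  vectors.\<close>

lemma chain_surj:
  assumes Jext: "J \<in> extensional {..r}" and Jid: "\<And>i. i \<le> r \<Longrightarrow> ideal (J i) CR"
    and sub: "\<And>i. i < r \<Longrightarrow> J (Suc i) \<subseteq> J i" and Jr: "J r = cl (var_y R) <#\<^bsub>CR\<^esub> J 0"
    and h: "\<And>i. i < r \<Longrightarrow> h i \<in> GL" "\<And>i. i < r \<Longrightarrow> lat_of (J i) = rowlat (h i)"
  shows "\<exists>g\<in>carrier GG. integral_at g \<and> chain g = J"
proof -
  define g where "g = (\<lambda>i\<in>{..<r}. h i)"
  have g: "g \<in> carrier GG" using h by (auto simp: g_def gauge_carrier)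
  have gi: "rowlat (g i) = lat_of (J i)" if "i < r" for i using h(2) that by (simp add: g_def)
  have JC: "J i \<subseteq> carrier CR" if "i \<le> r" for i
    by (rule additive_subgroup.a_subset[OF ideal.axioms(1)[OF Jid[OF that]]])
  have idl: "idl_of (rowlat (g i)) = J i" if "i < r" for i
    using gi[OF that] idl_of_lat_of[OF JC, of i] that by simp
  have L: "rowlat (g i) \<subseteq> Lam" if "i < r" for i using gi[OF that] lat_of_Lam by simp
  have Jr': "J r = idl_of (shiftY ` rowlat (g 0))" using Jr idl[OF r_pos] y_coset[OF L[OF r_pos]] by simp
  have cs: "chain g = J"
  proof (rule vec_eqI[where I = "{..r}"])
    fix i assume "i \<in> {..r}"
    then show "chain g i = J i" using idl Jr' by (cases "i < r") (auto simp: chain_def lat_def)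
  qed (use Jext in \<open>auto simp: chain_def\<close>)
  have "integral_at g"
    unfolding integral_at_iff[OF g]
  proof (intro conjI ballI allI impI)
    have n1: "1 \<in> {1..n}" using n_pos by (auto simp: atLeastAtMost_iff)
    show "w 1 \<in> carrier K0" if "w \<in> rowlat (g 0)" for w
      using L[OF r_pos] that K0.vec_mem[OF _ n1] by blast
    show "rowlat (g (Suc i)) \<subseteq> rowlat (g i)" if "Suc i < r" for i
      using sub[of i] that gi by (auto simp: lat_of_def)
    have W0: "curve_submodule (rowlat (g 0))"
      using lat_of_submodule[OF Jid, of 0] gi[OF r_pos] by simp
    have "idl_of (shiftY ` rowlat (g 0)) \<subseteq> idl_of (rowlat (g (r - 1)))"
      using sub[of "r - 1"] r_pos idl[of "r - 1"] Jr' by simp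
    moreover have "shiftY ` rowlat (g 0) \<subseteq> Lam" using curve_submoduleD[OF W0] by blast
    ultimately have "shiftY ` rowlat (g 0) \<subseteq> rowlat (g (r - 1))"
      using idl_of_mono_iff L[of "r - 1"] r_pos by simp
    then show "shiftY w \<in> rowlat (g (r - 1))" if "w \<in> rowlat (g 0)" for w using that by blast
  qed
  then show ?thesis using g cs by blast
qed

end

section \<open>Base change\<close>

locale base_change = A: springer_setting R n m r + B: springer_setting S n m r
  for R :: "('a, 'b) ring_scheme" and S :: "('a, 'c) ring_scheme" and n m r +
  fixes \<phi> :: "'a \<Rightarrow> 'a"
  assumes hom: "\<phi> \<in> ring_hom R S"
begin

abbreviation "N \<equiv> {1..n}"

definition vmap :: "(nat \<Rightarrow> int \<Rightarrow> 'a) \<Rightarrow> nat \<Rightarrow> int \<Rightarrow> 'a" where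
  "vmap w = (\<lambda>i\<in>N. \<phi> \<circ> w i)"

definition mmap :: "(nat \<times> nat \<Rightarrow> int \<Rightarrow> 'a) \<Rightarrow> nat \<times> nat \<Rightarrow> int \<Rightarrow> 'a" where
  "mmap g = (\<lambda>p\<in>N \<times> N. \<phi> \<circ> g p)"

sublocale h: ring_hom_cring R S \<phi>
  by (intro ring_hom_cring.intro ring_hom_cring_axioms.intro A.is_cring B.is_cring hom)

lemma kmap_closed: "f \<in> carrier A.K \<Longrightarrow> \<phi> \<circ> f \<in> carrier B.K"
proof -
  assume f: "f \<in> carrier A.K"
  then obtain M where "\<And>k. k < M \<Longrightarrow> f k = \<zero>\<^bsub>R\<^esub>" by (rule A.laurent_bound) blast
  then show ?thesis using f by (intro B.laurent_carrierI[where N = M]) auto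
qed

lemma kmap_closed0: "f \<in> carrier A.K0 \<Longrightarrow> \<phi> \<circ> f \<in> carrier B.K0"
  by (auto simp: A.K0_carrier_iff B.K0_carrier_iff)

lemma kmap_mult:
  assumes f: "f \<in> carrier A.K" and g: "g \<in> carrier A.K"
  shows "\<phi> \<circ> (f \<otimes>\<^bsub>A.K\<^esub> g) = (\<phi> \<circ> f) \<otimes>\<^bsub>B.K\<^esub> (\<phi> \<circ> g)"
proof
  fix k
  obtain M where M: "\<And>k. k < M \<Longrightarrow> f k = \<zero>\<^bsub>R\<^esub>" "\<And>k. k < M \<Longrightarrow> g k = \<zero>\<^bsub>R\<^esub>"
    using A.laurent_common_bound[OF f g] by metis
  have "(f \<otimes>\<^bsub>A.K\<^esub> g) k = (\<Oplus>\<^bsub>R\<^esub>i\<in>{M..k-M}. f i \<otimes>\<^bsub>R\<^esub> g (k - i))"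
    by (rule A.laurent_mult_box[OF f g]) (use M in auto)
  moreover have "((\<phi> \<circ> f) \<otimes>\<^bsub>B.K\<^esub> (\<phi> \<circ> g)) k = (\<Oplus>\<^bsub>S\<^esub>i\<in>{M..k-M}. (\<phi> \<circ> f) i \<otimes>\<^bsub>S\<^esub> (\<phi> \<circ> g) (k - i))"
    by (rule B.laurent_mult_box[OF kmap_closed[OF f] kmap_closed[OF g]]) (use M in auto)
  moreover have "\<phi> (\<Oplus>\<^bsub>R\<^esub>i\<in>{M..k-M}. f i \<otimes>\<^bsub>R\<^esub> g (k - i)) = (\<Oplus>\<^bsub>S\<^esub>i\<in>{M..k-M}. \<phi> (f i \<otimes>\<^bsub>R\<^esub> g (k - i)))"
    using h.hom_finsum[of "\<lambda>i. f i \<otimes>\<^bsub>R\<^esub> g (k - i)" "{M..k-M}"] f g by (simp add: o_def Pi_def)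
  moreover have "\<dots> = (\<Oplus>\<^bsub>S\<^esub>i\<in>{M..k-M}. (\<phi> \<circ> f) i \<otimes>\<^bsub>S\<^esub> (\<phi> \<circ> g) (k - i))"
    using f g by (intro B.finsum_cong') auto
  ultimately show "(\<phi> \<circ> (f \<otimes>\<^bsub>A.K\<^esub> g)) k = ((\<phi> \<circ> f) \<otimes>\<^bsub>B.K\<^esub> (\<phi> \<circ> g)) k" by simp
qed

lemma kmap_lmon: "c \<in> carrier R \<Longrightarrow> \<phi> \<circ> A.lmon c k = B.lmon (\<phi> c) k"
  by (auto simp: A.lmon_def B.lmon_def)

lemma kmap_zero: "\<phi> \<circ> \<zero>\<^bsub>A.K\<^esub> = \<zero>\<^bsub>B.K\<^esub>"
  by (auto simp: A.laurent_zero B.laurent_zero)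

lemma kmap_one: "\<phi> \<circ> \<one>\<^bsub>A.K\<^esub> = \<one>\<^bsub>B.K\<^esub>"
  by (simp add: A.laurent_one B.laurent_one kmap_lmon)

lemma kmap_add: "f \<in> carrier A.K \<Longrightarrow> g \<in> carrier A.K \<Longrightarrow> \<phi> \<circ> (f \<oplus>\<^bsub>A.K\<^esub> g) = (\<phi> \<circ> f) \<oplus>\<^bsub>B.K\<^esub> (\<phi> \<circ> g)"
  by (rule ext) (simp add: A.laurent_add B.laurent_add)

sublocale k: ring_hom_cring A.K B.K "\<lambda>f. \<phi> \<circ> f"
  by (intro ring_hom_cring.intro ring_hom_cring_axioms.intro A.laurent_cring B.laurent_cring ring_hom_memI
      kmap_closed kmap_mult kmap_add kmap_one)

lemma vmap_closed: "w \<in> A.VK \<Longrightarrow> vmap w \<in> B.VK"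
  using A.K.vec_mem[of w N] kmap_closed by (auto simp: vmap_def)

lemma vmap_Lam: "w \<in> A.Lam \<Longrightarrow> vmap w \<in> B.Lam"
  using A.K0.vec_mem[of w N] kmap_closed0 by (auto simp: vmap_def)

lemma vmap_apply: "i \<in> N \<Longrightarrow> vmap w i = \<phi> \<circ> w i"
  by (simp add: vmap_def)

lemma vmap_ext [simp]: "vmap w \<in> extensional N"
  by (simp add: vmap_def)

lemma mmap_closed: "g \<in> A.mats \<Longrightarrow> mmap g \<in> B.mats"
  using A.K.mat_mem[of g N] kmap_closed by (auto simp: mmap_def)

lemma mmap_closed0: "g \<in> A.mats0 \<Longrightarrow> mmap g \<in> B.mats0"
  using A.K0.mat_mem[of g N] kmap_closed0 by (auto simp: mmap_def)

lemma vmap_add: "v \<in> A.VK \<Longrightarrow> w \<in> A.VK \<Longrightarrow> vmap (v \<oplus>\<^bsub>A.V\<^esub> w) = vmap v \<oplus>\<^bsub>B.V\<^esub> vmap w"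
  by (rule vec_eqI[where I = N]) (auto simp: vmap_apply A.K.vec_mem[of _ N] kmap_add)

lemma vmap_smult: "a \<in> carrier A.K \<Longrightarrow> w \<in> A.VK \<Longrightarrow> vmap (a \<odot>\<^bsub>A.V\<^esub> w) = (\<phi> \<circ> a) \<odot>\<^bsub>B.V\<^esub> vmap w"
  by (rule vec_eqI[where I = N]) (auto simp: vmap_apply A.K.vec_mem[of _ N] kmap_mult)

lemma kmap_sum_prod:
  assumes "\<And>i. i \<in> I \<Longrightarrow> f i \<in> carrier A.K" "\<And>i. i \<in> I \<Longrightarrow> g i \<in> carrier A.K"
  shows "\<phi> \<circ> (\<Oplus>\<^bsub>A.K\<^esub>i\<in>I. f i \<otimes>\<^bsub>A.K\<^esub> g i) = (\<Oplus>\<^bsub>B.K\<^esub>i\<in>I. (\<phi> \<circ> f i) \<otimes>\<^bsub>B.K\<^esub> (\<phi> \<circ> g i))"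
proof -
  have "\<phi> \<circ> (\<Oplus>\<^bsub>A.K\<^esub>i\<in>I. f i \<otimes>\<^bsub>A.K\<^esub> g i) = (\<Oplus>\<^bsub>B.K\<^esub>i\<in>I. \<phi> \<circ> (f i \<otimes>\<^bsub>A.K\<^esub> g i))"
    using k.hom_finsum[of "\<lambda>i. f i \<otimes>\<^bsub>A.K\<^esub> g i" I] assms by (simp add: Pi_def o_def[of "\<lambda>f. \<phi> \<circ> f"])
  also have "\<dots> = (\<Oplus>\<^bsub>B.K\<^esub>i\<in>I. (\<phi> \<circ> f i) \<otimes>\<^bsub>B.K\<^esub> (\<phi> \<circ> g i))"
    using assms kmap_mult kmap_closed by (intro B.K.finsum_cong') auto
  finally show ?thesis .
qed

lemma vmap_rowmul:
  assumes w: "w \<in> A.VK" and g: "g \<in> A.mats"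
  shows "vmap (rowmul N A.K w g) = rowmul N B.K (vmap w) (mmap g)"
proof (rule vec_eqI[where I = N])
  fix j assume j: "j \<in> N"
  have "\<phi> \<circ> (\<Oplus>\<^bsub>A.K\<^esub>i\<in>N. w i \<otimes>\<^bsub>A.K\<^esub> g (i, j)) = (\<Oplus>\<^bsub>B.K\<^esub>i\<in>N. (\<phi> \<circ> w i) \<otimes>\<^bsub>B.K\<^esub> (\<phi> \<circ> g (i, j)))"
    using A.K.vec_mem[OF w] A.K.mat_mem[OF g _ j] by (intro kmap_sum_prod) auto
  also have "\<dots> = (\<Oplus>\<^bsub>B.K\<^esub>i\<in>N. vmap w i \<otimes>\<^bsub>B.K\<^esub> mmap g (i, j))"
    using A.K.vec_mem[OF w] A.K.mat_mem[OF g _ j] j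
    by (intro B.K.finsum_cong') (auto simp: vmap_apply mmap_def kmap_closed)
  finally show "vmap (rowmul N A.K w g) j = rowmul N B.K (vmap w) (mmap g) j"
    using j by (simp add: vmap_apply rowmul_def)
qed simp_all

lemma mat_row_mmap: "i \<in> N \<Longrightarrow> mat_row N (mmap g) i = vmap (mat_row N g i)"
  by (rule vec_eqI[where I = N]) (auto simp: vmap_apply mmap_def)

lemma mmap_mult:
  assumes g: "g \<in> A.mats" and h: "h \<in> A.mats"
  shows "mmap (mat_mult N A.K g h) = mat_mult N B.K (mmap g) (mmap h)"
proof (rule A.K.mat_eqI[where I = N])
  fix i assume i: "i \<in> N"
  have "mat_row N (mmap (mat_mult N A.K g h)) i = vmap (rowmul N A.K (mat_row N g i) h)"
    using i g h by (simp add: mat_row_mmap A.K.mat_mult_row)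
  also have "\<dots> = rowmul N B.K (vmap (mat_row N g i)) (mmap h)"
    using i g h by (intro vmap_rowmul) auto
  also have "\<dots> = mat_row N (mat_mult N B.K (mmap g) (mmap h)) i"
    using i mmap_closed[OF g] mmap_closed[OF h] by (simp add: mat_row_mmap B.K.mat_mult_row)
  finally show "mat_row N (mmap (mat_mult N A.K g h)) i = mat_row N (mat_mult N B.K (mmap g) (mmap h)) i" .
qed (simp_all add: mmap_def)

lemma mmap_one: "mmap (scalar_mat N A.K \<one>\<^bsub>A.K\<^esub>) = scalar_mat N B.K \<one>\<^bsub>B.K\<^esub>"
  by (rule vec_eqI[where I = "N \<times> N"]) (auto simp: mmap_def scalar_mat_def kmap_one kmap_zero)

lemma mmap_GL:
  assumes g: "g \<in> A.GL"
  shows "mmap g \<in> B.GL" "B.minv (mmap g) = mmap (A.minv g)"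
proof -
  note m = A.GL_mats[OF g]
  have 1: "mat_mult N B.K (mmap (A.minv g)) (mmap g) = scalar_mat N B.K \<one>\<^bsub>B.K\<^esub>"
    "mat_mult N B.K (mmap g) (mmap (A.minv g)) = scalar_mat N B.K \<one>\<^bsub>B.K\<^esub>"
    using mmap_mult[OF m(2) m(1)] mmap_mult[OF m(1) m(2)] A.GL_inv[OF g] mmap_one by simp_all
  then show "mmap g \<in> B.GL" unfolding Units_def using mmap_closed[OF m(1)] mmap_closed[OF m(2)]
    by (auto simp: mat_monoid_simps)
  show "B.minv (mmap g) = mmap (A.minv g)"
    using B.M.inv_unique'[of "mmap g" "mmap (A.minv g)"] 1 mmap_closed[OF m(1)] mmap_closed[OF m(2)]
    by (simp add: mat_monoid_simps)
qed

lemma mmap_Y: "mmap A.Y = B.Y"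
  by (rule vec_eqI[where I = "N \<times> N"])
    (auto simp: mmap_def Y_matrix_def A.eps_pow B.eps_pow kmap_lmon kmap_one kmap_zero)

lemma mmap_Yinv: "mmap A.Yinv = B.Yinv"
  by (rule vec_eqI[where I = "N \<times> N"])
    (auto simp: mmap_def A.Yinv_def B.Yinv_def kmap_lmon kmap_one kmap_zero)

lemma vmap_shiftY: "w \<in> A.VK \<Longrightarrow> vmap (A.shiftY w) = B.shiftY (vmap w)"
  using vmap_rowmul[OF _ A.Y_closed] by (simp add: mmap_Y)

lemma PS_map: "f \<in> carrier A.PS \<Longrightarrow> \<phi> \<circ> f \<in> carrier B.PS"
  by (auto simp: A.PS_carrier B.PS_carrier)

text \<open>Each coefficient of \<open>theta\<close> is a finite sum of coefficients of the series,
  so it commutes with any ring homomorphism; no continuity is involved.\<close>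

lemma theta_map:
  assumes f: "f \<in> carrier A.PS"
  shows "B.theta (\<phi> \<circ> f) = vmap (A.theta f)"
proof (rule B.V_eqI)
  fix i z assume i: "i \<in> N"
  have "\<phi> (A.csum f z b) = B.csum (\<phi> \<circ> f) z b" for b
  proof -
    have "\<phi> (A.csum f z b) = (\<Oplus>\<^bsub>S\<^esub>q\<in>{..nat z}. \<phi> (A.col f (b + n * q) (z - int (m * q))))"
      unfolding A.csum_def using h.hom_finsum[of "\<lambda>q. A.col f (b + n * q) (z - int (m * q))" "{..nat z}"] f
      by (simp add: A.col_coeff Pi_def o_def)
    also have "\<dots> = B.csum (\<phi> \<circ> f) z b"
      unfolding B.csum_def using f by (intro B.finsum_cong') (auto simp: A.col_coeff A.col_def B.col_def A.PS_coeff)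
    finally show ?thesis .
  qed
  then show "B.theta (\<phi> \<circ> f) i z = vmap (A.theta f) i z"
    using i by (simp add: B.theta_coeff vmap_apply A.theta_coeff)
qed simp_all

text \<open>All members of the union in \<open>curve_ring_map\<close> coincide: representatives of a
  class share their \<open>theta\<close>, and \<open>theta\<close> commutes with \<phi>.\<close>

lemma curve_ring_map_cl:
  assumes f: "f \<in> carrier A.PS"
  shows "curve_ring_map m n S \<phi> (A.cl f) = B.cl (\<phi> \<circ> f)"
proof -
  interpret CI: ideal A.CI A.PS by (rule A.CI_ideal)
  have "B.cl (\<phi> \<circ> f') = B.cl (\<phi> \<circ> f)" if "f' \<in> A.cl f" for f'
  proof -
    have f': "f' \<in> carrier A.PS"
      using that A.PS.a_r_coset_subset_G[OF CI.a_subset f] by (auto simp: curve_class_def)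
    have "A.cl f' = A.cl f"
      using CI.a_repr_independence'[OF _ f, of f'] that by (simp add: curve_class_def)
    then have "A.theta f' = A.theta f" using A.cl_eq_iff[OF f' f] by simp
    then show ?thesis using B.cl_eq_iff[OF PS_map[OF f'] PS_map[OF f]] theta_map[OF f'] theta_map[OF f] by simp
  qed
  moreover have "f \<in> A.cl f" using CI.a_rcos_self[OF f] by (simp add: curve_class_def)
  ultimately show ?thesis unfolding curve_ring_map_def by (intro SUP_eq_const) blast+
qed

section \<open>Pullback of ideals and of their lattices\<close>

definition bc_ideal :: "(nat \<times> nat \<Rightarrow> 'a) set set \<Rightarrow> (nat \<times> nat \<Rightarrow> 'a) set set" where
  "bc_ideal J = Idl\<^bsub>B.CR\<^esub> (curve_ring_map m n S \<phi> ` J)"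

lemma bc_image:
  "curve_ring_map m n S \<phi> ` A.idl_of W = {B.cl (\<phi> \<circ> f) |f. f \<in> carrier A.PS \<and> A.theta f \<in> W}"
  unfolding A.idl_of_def using curve_ring_map_cl by (auto simp: image_def)

text \<open>The third and fourth claims form a universal property: the pulled back lattice is the
  smallest Y-stable submodule that contains the images. Later comparisons of lattices over S rest on
  it.\<close>

lemma bc_ideal_props:
  assumes W: "W \<subseteq> A.Lam"
  defines "J \<equiv> bc_ideal (A.idl_of W)"
  shows "ideal J B.CR" "B.curve_submodule (B.lat_of J)" "w \<in> W \<Longrightarrow> vmap w \<in> B.lat_of J"
    "B.curve_submodule W' \<Longrightarrow> (\<And>w. w \<in> W \<Longrightarrow> vmap w \<in> W') \<Longrightarrow> B.lat_of J \<subseteq> W'"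
    "J = B.idl_of (B.lat_of J)"
proof -
  let ?G = "{B.cl (\<phi> \<circ> f) |f. f \<in> carrier A.PS \<and> A.theta f \<in> W}"
  have G: "?G \<subseteq> carrier B.CR" using B.cl_ops(1) PS_map by blast
  have J: "J = Idl\<^bsub>B.CR\<^esub> ?G" by (simp add: J_def bc_ideal_def bc_image)
  show id: "ideal J B.CR" unfolding J by (rule B.CR.genideal_ideal[OF G])
  show "B.curve_submodule (B.lat_of J)" by (rule B.lat_of_submodule[OF id])
  show "vmap w \<in> B.lat_of J" if "w \<in> W"
  proof -
    have w: "w \<in> A.Lam" using that W by blast
    have s: "A.sect w \<in> carrier A.PS" "A.theta (A.sect w) = w" using w A.theta_sect by auto
    have "B.cl (\<phi> \<circ> A.sect w) \<in> ?G" by (intro CollectI exI[of _ "A.sect w"]) (use s that in simp)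
    then have "B.cl (\<phi> \<circ> A.sect w) \<in> J" unfolding J by (rule subsetD[OF B.CR.genideal_self[OF G]])
    then show ?thesis using B.theta_mem_lat_of[OF PS_map[OF s(1)]] theta_map[OF s(1)] s(2) by simp
  qed
  show "B.lat_of J \<subseteq> W'" if W': "B.curve_submodule W'" "\<And>w. w \<in> W \<Longrightarrow> vmap w \<in> W'"
  proof -
    have "?G \<subseteq> B.idl_of W'"
    proof
      fix c assume "c \<in> ?G"
      then obtain f where f: "f \<in> carrier A.PS" "A.theta f \<in> W" "c = B.cl (\<phi> \<circ> f)" by blast
      then show "c \<in> B.idl_of W'" using B.cl_mem_idl_of[OF PS_map[OF f(1)]] theta_map[OF f(1)] W'(2) by simp
    qed
    then have "J \<subseteq> B.idl_of W'" unfolding J by (rule B.CR.genideal_minimal[OF B.idl_of_ideal[OF W'(1)]])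
    then have "B.lat_of J \<subseteq> B.lat_of (B.idl_of W')" by (auto simp: B.lat_of_def)
    moreover have "W' \<subseteq> B.Lam" using B.curve_submoduleD(3)[OF W'(1)] by blast
    ultimately show ?thesis using B.lat_of_idl_of by blast
  qed
  have "J \<subseteq> carrier B.CR" by (rule additive_subgroup.a_subset[OF ideal.axioms(1)[OF id]])
  then show "J = B.idl_of (B.lat_of J)" using B.idl_of_lat_of by simp
qed

text \<open>The rows of the inverse matrix are a basis of the row lattice, and they are defined over \<open>R\<close>.\<close>

lemma rowlat_map_generated:
  assumes g: "g \<in> A.GL" and W': "B.K0_submodule W'" "\<And>w. w \<in> A.rowlat g \<Longrightarrow> vmap w \<in> W'"
  shows "B.rowlat (mmap g) \<subseteq> W'"
proof
  fix w assume w: "w \<in> B.rowlat (mmap g)"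
  define y where "y = rowmul N B.K w (mmap g)"
  have y: "y \<in> B.Lam" using w by (simp add: y_def B.rowlat_def)
  note m = A.GL_mats[OF g]
  have "w = rowmul N B.K y (mmap (A.minv g))"
    using B.rowmul_inv(1)[OF mmap_GL(1)[OF g] B.rowlat_VK[OF w]] by (simp add: y_def mmap_GL(2)[OF g])
  also have "\<dots> = B.lincomb N y (\<lambda>j. vmap (mat_row N (A.minv g) j))"
    unfolding B.lincomb_def
  proof (subst rowmul_def, rule restrict_ext, rule B.K.finsum_cong')
    fix i j assume i: "i \<in> N" and j: "j \<in> N"
    show "y j \<otimes>\<^bsub>B.K\<^esub> mmap (A.minv g) (j, i) = y j \<otimes>\<^bsub>B.K\<^esub> vmap (mat_row N (A.minv g) j) i"
      using i j by (simp add: vmap_apply mmap_def)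
  next
    fix i assume i: "i \<in> N"
    show "(\<lambda>j. y j \<otimes>\<^bsub>B.K\<^esub> vmap (mat_row N (A.minv g) j) i) \<in> N \<rightarrow> carrier B.K"
      using i B.K.vec_mem[OF B.Lam_VK[OF y]] B.K.vec_mem[OF vmap_closed[OF A.K.mat_row_closed[OF m(2)]]] by auto
  qed simp
  also have "\<dots> \<in> W'"
    by (rule B.lincomb_in_submodule[OF W'(1)]) (use B.K0.vec_mem[OF y] W'(2) A.inv_row_rowlat[OF g] in auto)
  finally show "w \<in> W'" .
qed

lemma rowlat_map:
  assumes g: "g \<in> A.GL" and w: "w \<in> A.rowlat g"
  shows "vmap w \<in> B.rowlat (mmap g)"
proof -
  have "vmap (rowmul N A.K w g) \<in> B.Lam" by (rule vmap_Lam) (use w in \<open>simp add: A.rowlat_def\<close>)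
  then show ?thesis
    using vmap_closed[OF A.rowlat_VK[OF w]] vmap_rowmul[OF A.rowlat_VK[OF w] A.GL_mats(1)[OF g]]
    by (simp add: B.rowlat_def)
qed

text \<open>A vector of the lattice over S need not come from R, so the inclusion cannot be
  transported vector by vector. It is encoded as integrality of g^-1 L g', which passes to S entry
  by entry.\<close>

lemma rowlat_map_stable:
  assumes g: "g \<in> A.GL" and g': "g' \<in> A.GL" and L: "L \<in> A.mats"
    and st: "\<And>w. w \<in> A.rowlat g \<Longrightarrow> rowmul N A.K w L \<in> A.rowlat g'" and w: "w \<in> B.rowlat (mmap g)"
  shows "rowmul N B.K w (mmap L) \<in> B.rowlat (mmap g')"
proof -
  note m = A.GL_mats[OF g] A.GL_mats[OF g']
  have "mat_mult N A.K (mat_mult N A.K (A.minv g) L) g' \<in> A.mats0"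
    using A.integral_iff_rowlat[OF g g' L] st by blast
  from mmap_closed0[OF this]
  have "mat_mult N B.K (mat_mult N B.K (B.minv (mmap g)) (mmap L)) (mmap g') \<in> B.mats0"
    using m L mmap_GL(2)[OF g] by (simp add: mmap_mult)
  then show ?thesis using B.integral_iff_rowlat[OF mmap_GL(1)[OF g] mmap_GL(1)[OF g'] mmap_closed[OF L]] w by blast
qed

definition gmap :: "(nat \<Rightarrow> nat \<times> nat \<Rightarrow> int \<Rightarrow> 'a) \<Rightarrow> nat \<Rightarrow> nat \<times> nat \<Rightarrow> int \<Rightarrow> 'a" where
  "gmap g = (\<lambda>i\<in>{..<r}. mmap (g i))"

text \<open>The last claim compares the lattice of the mapped matrices with the one generated by the
  image of the ideal. The rows of the inverse matrix generate the former and lie in the latter; the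
  latter is minimal and its generators lie in the former.\<close>

lemma gmap_point:
  assumes g: "g \<in> carrier A.GG" and int: "A.integral_at g"
  shows "gmap g \<in> carrier B.GG" "B.integral_at (gmap g)"
    "i \<le> r \<Longrightarrow> B.lat (gmap g) i = B.lat_of (bc_ideal (A.idl_of (A.lat g i)))"
proof -
  note GL = A.gauge_GL[OF g]
  note D = A.integral_at_iff[OF g, THEN iffD1, OF int]
  note sub = A.integral_at_lat[OF g int]
  show gG: "gmap g \<in> carrier B.GG" using mmap_GL(1)[OF GL] by (auto simp: B.gauge_carrier gmap_def)
  have L: "A.rowlat (g i) \<subseteq> A.Lam" if "i < r" for i
    using A.curve_submoduleD(3)[OF sub(1)[of i]] that by (auto simp: A.lat_def)
  have LB: "B.rowlat (mmap (g i)) \<subseteq> B.Lam" if "i < r" for i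
    by (rule rowlat_map_generated[OF GL[OF that] B.Lam_submodule]) (use L[OF that] vmap_Lam in blast)
  have n1: "1 \<in> N" using A.n_pos by (auto simp: atLeastAtMost_iff)
  show intB: "B.integral_at (gmap g)"
    unfolding B.integral_at_iff[OF gG]
  proof (intro conjI ballI allI impI)
    show "w 1 \<in> carrier B.K0" if "w \<in> B.rowlat (gmap g 0)" for w
      using that LB[OF A.r_pos] A.r_pos B.K0.vec_mem[OF _ n1] by (auto simp: gmap_def)
    show "B.rowlat (gmap g (Suc i)) \<subseteq> B.rowlat (gmap g i)" if i: "Suc i < r" for i
    proof
      fix w assume w: "w \<in> B.rowlat (gmap g (Suc i))"
      have "rowmul N B.K w (mmap (scalar_mat N A.K \<one>\<^bsub>A.K\<^esub>)) \<in> B.rowlat (mmap (g i))"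
        using w i D GL A.K.rowmul_one[OF _ A.rowlat_VK]
        by (intro rowlat_map_stable[of "g (Suc i)"]) (auto simp: gmap_def)
      then show "w \<in> B.rowlat (gmap g i)"
        using i B.K.rowmul_one[OF _ B.rowlat_VK[OF w]] by (simp add: gmap_def mmap_one)
    qed
    show "B.shiftY w \<in> B.rowlat (gmap g (r - 1))" if w: "w \<in> B.rowlat (gmap g 0)" for w
    proof -
      have "rowmul N B.K w (mmap A.Y) \<in> B.rowlat (mmap (g (r - 1)))"
        using w D GL A.r_pos A.Y_closed by (intro rowlat_map_stable[of "g 0"]) (auto simp: gmap_def)
      then show ?thesis using A.r_pos by (simp add: gmap_def mmap_Y)
    qed
  qed
  show "B.lat (gmap g) i = B.lat_of (bc_ideal (A.idl_of (A.lat g i)))" if i: "i \<le> r"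
  proof -
    obtain h where h: "h \<in> A.GL" "A.lat g i = A.rowlat h" "B.lat (gmap g) i = B.rowlat (mmap h)"
    proof (cases "i < r")
      case True
      then show ?thesis using that[of "g i"] GL by (simp add: A.lat_def B.lat_def gmap_def)
    next
      case False
      \<comment> \<open>For i = r the lattice is described by Y^-1 g_0, which is mapped to the
        corresponding matrix over S.\<close>
      let ?h = "mat_mult N A.K A.Yinv (g 0)"
      have e: "mmap ?h = mat_mult N B.K B.Yinv (mmap (g 0))"
        using mmap_mult[OF A.Yinv_mats A.GL_mats(1)[OF GL[OF A.r_pos]]] by (simp add: mmap_Yinv)
      have "B.lat (gmap g) i = B.rowlat (mmap ?h)"
        unfolding e B.rowlat_Yinv(2)[OF mmap_GL(1)[OF GL[OF A.r_pos]]] using False A.r_pos by (simp add: B.lat_def gmap_def)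
      then show ?thesis
        using that[of ?h] False A.rowlat_Yinv[OF GL[OF A.r_pos]] by (simp add: A.lat_def)
    qed
    have WL: "A.rowlat h \<subseteq> A.Lam" using A.curve_submoduleD(3)[OF sub(1)[OF i]] h(2) by blast
    note bc = bc_ideal_props[OF WL]
    have "B.rowlat (mmap h) \<subseteq> B.lat_of (bc_ideal (A.idl_of (A.rowlat h)))"
      by (rule rowlat_map_generated[OF h(1) B.curve_submoduleD(1)[OF bc(2)]]) (rule bc(3))
    moreover have "B.lat_of (bc_ideal (A.idl_of (A.rowlat h))) \<subseteq> B.rowlat (mmap h)"
      by (rule bc(4)) (use B.integral_at_lat(1)[OF gG intB i] h(3) rowlat_map[OF h(1)] in simp_all)
    ultimately show ?thesis using h by simp
  qed
qed

lemma chain_gmap: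
  assumes g: "g \<in> carrier A.GG" and int: "A.integral_at g"
  shows "B.chain (gmap g) = cphilb_map m n r S \<phi> (A.chain g)"
  unfolding cphilb_map_def B.chain_def
proof (rule restrict_ext)
  fix i assume i: "i \<in> {..r}"
  have "A.lat g i \<subseteq> A.Lam" using A.curve_submoduleD(3)[OF A.integral_at_lat(1)[OF g int]] i by blast
  from bc_ideal_props(5)[OF this]
  show "B.idl_of (B.lat (gmap g) i) = Idl\<^bsub>B.CR\<^esub> (curve_ring_map m n S \<phi> ` A.chain g i)"
    using i gmap_point(3)[OF g int, of i] by (simp add: A.chain_def bc_ideal_def)
qed

text \<open>By \<open>gmap_point\<close> the lattices of a mapped tuple depend only on the lattices
  of the original one. So all representatives give the same class, and the union in
  \<open>gr_map\<close> is a union of equal sets.\<close>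

lemma gr_map_class:
  assumes g: "g \<in> carrier A.GG" and int: "A.integral_at g"
  shows "gr_map n r S \<phi> (gr_class n r R g) = gr_class n r S (gmap g)"
proof -
  have cls: "gr_class n r S (gmap x) = gr_class n r S (gmap g)" if x: "x \<in> gr_class n r R g" for x
  proof -
    note xD = A.gr_class_memD[OF g x]
    have intx: "A.integral_at x"
      using int xD(2) A.r_pos unfolding A.integral_at_iff[OF g] A.integral_at_iff[OF xD(1)] by simp
    have "A.lat x i = A.lat g i" for i using xD(2) A.r_pos by (simp add: A.lat_def)
    then have "B.rowlat (gmap x i) = B.rowlat (gmap g i)" if "i < r" for i
      using gmap_point(3)[OF g int, of i] gmap_point(3)[OF xD(1) intx, of i] that by (simp add: B.lat_def)
    then show ?thesis
      using B.gr_class_eq_iff[OF gmap_point(1)[OF xD(1) intx] gmap_point(1)[OF g int]] by simp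
  qed
  have "gr_map n r S \<phi> (gr_class n r R g) = (\<Union>x\<in>gr_class n r R g. gr_class n r S (gmap x))"
    by (simp add: gr_map_def gmap_def mmap_def)
  also have "\<dots> = gr_class n r S (gmap g)"
    using A.gr_class_self[OF g] cls by (intro SUP_eq_const) blast+
  finally show ?thesis .
qed

end

section \<open>A projector onto a complement of \<open>\<epsilon>W\<close>\<close>

text \<open>An endomorphism of truncated coefficient vectors is recorded by its matrix, because a
  matrix can be carried along \<phi> whereas a map on vectors over R cannot.\<close>

lemma (in cring) linear_map_rowmul:
  assumes I: "finite I" and F: "\<And>x. x \<in> I \<rightarrow>\<^sub>E carrier R \<Longrightarrow> F x \<in> I \<rightarrow>\<^sub>E carrier R"
    and add: "\<And>x y. x \<in> I \<rightarrow>\<^sub>E carrier R \<Longrightarrow> y \<in> I \<rightarrow>\<^sub>E carrier R \<Longrightarrow>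
      F (x \<oplus>\<^bsub>vec_mod I R\<^esub> y) = F x \<oplus>\<^bsub>vec_mod I R\<^esub> F y"
    and sm: "\<And>c x. c \<in> carrier R \<Longrightarrow> x \<in> I \<rightarrow>\<^sub>E carrier R \<Longrightarrow> F (c \<odot>\<^bsub>vec_mod I R\<^esub> x) = c \<odot>\<^bsub>vec_mod I R\<^esub> F x"
    and x: "x \<in> I \<rightarrow>\<^sub>E carrier R"
  shows "F x = rowmul I R x (\<lambda>(d, e)\<in>I \<times> I. F (unit_row I R d) e)"
proof -
  interpret D: module R "vec_mod I R" by (rule vec_module)
  define E where "E = (\<lambda>(d, e)\<in>I \<times> I. F (unit_row I R d) e)"
  have FE: "F (unit_row I R d) e \<in> carrier R" if "e \<in> I" for d e
    using vec_mem[OF F[OF unit_row_closed] that] .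
  define y where "y S = (\<lambda>d\<in>I. if d \<in> S then x d else \<zero>)" for S
  have y: "y S \<in> I \<rightarrow>\<^sub>E carrier R" for S using vec_mem[OF x] by (auto simp: y_def)
  have "\<forall>e\<in>I. F (y S) e = (\<Oplus>d\<in>S. x d \<otimes> F (unit_row I R d) e)" if "finite S" "S \<subseteq> I" for S
    using that
  proof (induction S rule: finite_induct)
    case empty
    have "y {} = \<zero>\<^bsub>vec_mod I R\<^esub>" by (auto simp: y_def vec_mod_def)
    then have "y {} = \<zero> \<odot>\<^bsub>vec_mod I R\<^esub> y {}" using D.smult_l_null[of "y {}"] y by simp
    then have "F (y {}) = \<zero> \<odot>\<^bsub>vec_mod I R\<^esub> F (y {})" using sm[OF zero_closed y] by metis
    then have "F (y {}) = \<zero>\<^bsub>vec_mod I R\<^esub>" using D.smult_l_null[of "F (y {})"] F[OF y] by simp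
    then show ?case by simp
  next
    case (insert d S)
    have d: "d \<in> I" "x d \<in> carrier R" using insert vec_mem[OF x] by auto
    have xu: "x d \<odot>\<^bsub>vec_mod I R\<^esub> unit_row I R d \<in> I \<rightarrow>\<^sub>E carrier R"
      using D.smult_closed[OF d(2), of "unit_row I R d"] by simp
    have "y (insert d S) = x d \<odot>\<^bsub>vec_mod I R\<^esub> unit_row I R d \<oplus>\<^bsub>vec_mod I R\<^esub> y S"
      by (rule vec_eqI[where I = I]) (use insert.hyps d vec_mem[OF x] in \<open>auto simp: y_def unit_row_def\<close>)
    then have "F (y (insert d S)) = x d \<odot>\<^bsub>vec_mod I R\<^esub> F (unit_row I R d) \<oplus>\<^bsub>vec_mod I R\<^esub> F (y S)"
      using add[OF xu y] sm[OF d(2) unit_row_closed] by simp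
    moreover have "(\<Oplus>d\<in>insert d S. x d \<otimes> F (unit_row I R d) e) = x d \<otimes> F (unit_row I R d) e \<oplus> (\<Oplus>d\<in>S. x d \<otimes> F (unit_row I R d) e)"
      if "e \<in> I" for e
      using insert vec_mem[OF x] FE[OF that] by (intro finsum_insert) auto
    ultimately show ?case using insert by simp
  qed
  from this[OF I order.refl] have "F (y I) e = (\<Oplus>d\<in>I. x d \<otimes> F (unit_row I R d) e)" if "e \<in> I" for e using that by blast
  moreover have "y I = x" by (rule vec_eqI[where I = I]) (use x in \<open>auto simp: y_def PiE_iff\<close>)
  moreover have "rowmul I R x E e = (\<Oplus>d\<in>I. x d \<otimes> F (unit_row I R d) e)" if e: "e \<in> I" for e
    using e vec_mem[OF x] FE[OF e] by (simp add: rowmul_def) (auto simp: E_def intro!: finsum_cong')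
  ultimately show ?thesis unfolding E_def[symmetric]
    by (intro vec_eqI[where I = I]) (use F[OF x] in \<open>auto simp: PiE_iff\<close>)
qed

context curve_setting
begin

text \<open>What truncation removes is \<epsilon>^(k+1) times an integral vector, and that lies in
  W.\<close>

lemma from_coeffs_coeffs_in:
  assumes W: "K0_submodule W" and deep: "\<And>w. w \<in> Lam \<Longrightarrow> lmon \<one> (int k) \<odot>\<^bsub>V\<^esub> w \<in> W" and w: "w \<in> W"
  shows "from_coeffs k (coeffs k w) \<in> W"
proof -
  have wL: "w \<in> Lam" using W w by (auto simp: K0_submodule_def)
  obtain v where v: "v \<in> Lam" "w = from_coeffs k (coeffs k w) \<oplus>\<^bsub>V\<^esub> lmon \<one> (int k + 1) \<odot>\<^bsub>V\<^esub> v"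
    using trunc_split[OF wL] by blast
  have ev: "lmon \<one> (int k + 1) \<odot>\<^bsub>V\<^esub> v \<in> W" by (rule deeper[OF W deep]) (use v in auto)
  have evV: "lmon \<one> (int k + 1) \<odot>\<^bsub>V\<^esub> v \<in> VK" using V.smult_closed[of "lmon \<one> (int k + 1)" v] Lam_VK[OF v(1)] by simp
  have m1: "lmon (\<ominus> \<one>) 0 \<in> carrier K0" by simp
  have "from_coeffs k (coeffs k w) = w \<oplus>\<^bsub>V\<^esub> lmon (\<ominus> \<one>) 0 \<odot>\<^bsub>V\<^esub> (lmon \<one> (int k + 1) \<odot>\<^bsub>V\<^esub> v)"
  proof (rule V_eqI)
    fix i z assume i: "i \<in> {1..n}"
    have c: "from_coeffs k (coeffs k w) i z \<in> carrier R" "(lmon \<one> (int k + 1) \<odot>\<^bsub>V\<^esub> v) i z \<in> carrier R"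
      using Lam_coeff[OF from_coeffs_closed[OF coeffs_closed[OF Lam_VK[OF wL]]] i] VK_coeff[OF evV i] by auto
    have "w i z = from_coeffs k (coeffs k w) i z \<oplus> (lmon \<one> (int k + 1) \<odot>\<^bsub>V\<^esub> v) i z"
      using arg_cong[OF v(2), of "\<lambda>x. x i z"] i by (simp add: laurent_add del: vec_smult)
    moreover have "(lmon (\<ominus> \<one>) 0 \<odot>\<^bsub>V\<^esub> (lmon \<one> (int k + 1) \<odot>\<^bsub>V\<^esub> v)) i z = (\<ominus> \<one>) \<otimes> (lmon \<one> (int k + 1) \<odot>\<^bsub>V\<^esub> v) i z"
      using V_smult_lmon[OF evV _ i, of "\<ominus> \<one>" 0] by (simp del: vec_smult)
    moreover have "(a \<oplus> b) \<oplus> (\<ominus> \<one>) \<otimes> b = a" if "a \<in> carrier R" "b \<in> carrier R" for a b using that by algebra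
    ultimately show "from_coeffs k (coeffs k w) i z = (w \<oplus>\<^bsub>V\<^esub> lmon (\<ominus> \<one>) 0 \<odot>\<^bsub>V\<^esub> (lmon \<one> (int k + 1) \<odot>\<^bsub>V\<^esub> v)) i z"
      using i c by (simp add: laurent_add del: vec_smult)
  qed (auto simp: from_coeffs_def)
  then show ?thesis using W w ev m1 by (simp add: K0_submodule_def)
qed

lemma split_lattice_exists:
  assumes W: "K0_submodule W" and P: "retraction W P"
    and deep: "\<And>w. w \<in> Lam \<Longrightarrow> lmon \<one> (int k) \<odot>\<^bsub>V\<^esub> w \<in> W"
  shows "\<exists>E. split_lattice R n W k E"
proof -
  have WL: "w \<in> Lam" if "w \<in> W" for w using W that unfolding K0_submodule_def by blast
  have Wa: "v \<oplus>\<^bsub>V\<^esub> w \<in> W" if "v \<in> W" "w \<in> W" for v w using W that unfolding K0_submodule_def by blast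
  have Wm: "a \<odot>\<^bsub>V\<^esub> w \<in> W" if "a \<in> carrier K0" "w \<in> W" for a w using W that unfolding K0_submodule_def by blast
  have PW: "P w \<in> W" if "w \<in> Lam" for w using P that unfolding retraction_def by blast
  have PL: "P w \<in> Lam" if "w \<in> Lam" for w using WL[OF PW[OF that]] .
  have Pid: "P w = w" if "w \<in> W" for w using P that unfolding retraction_def by blast
  have Padd: "P (v \<oplus>\<^bsub>V\<^esub> w) = P v \<oplus>\<^bsub>V\<^esub> P w" if "v \<in> Lam" "w \<in> Lam" for v w
    using P that unfolding retraction_def by blast
  have Psm: "P (lmon c 0 \<odot>\<^bsub>V\<^esub> w) = lmon c 0 \<odot>\<^bsub>V\<^esub> P w" if "c \<in> carrier R" "w \<in> Lam" for c w
    using P that unfolding retraction_def by blast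
  have VL: "w \<in> carrier V" if "w \<in> Lam" for w using Lam_VK[OF that] by simp
  \<comment> \<open>Division by \<epsilon> that discards the constant coefficient; an
    \<open>R\<close>-linear left inverse of multiplication by \<epsilon>.\<close>
  define dn where "dn w = (\<lambda>i\<in>{1..n}. \<lambda>z. if z < 0 then \<zero> else w i (z + 1))" for w :: "nat \<Rightarrow> int \<Rightarrow> 'a"
  have dnL: "dn w \<in> Lam" if "w \<in> Lam" for w
    using Lam_coeff[OF that] by (auto simp: dn_def K0_carrier_iff)
  have dn_add: "dn (v \<oplus>\<^bsub>V\<^esub> w) = dn v \<oplus>\<^bsub>V\<^esub> dn w" for v w
    by (rule V_eqI) (auto simp: dn_def laurent_add)
  have dn_sm: "dn (lmon c 0 \<odot>\<^bsub>V\<^esub> w) = lmon c 0 \<odot>\<^bsub>V\<^esub> dn w" if "c \<in> carrier R" "w \<in> Lam" for c w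
  proof (rule V_eqI)
    fix i z assume i: "i \<in> {1..n}"
    show "dn (lmon c 0 \<odot>\<^bsub>V\<^esub> w) i z = (lmon c 0 \<odot>\<^bsub>V\<^esub> dn w) i z"
      unfolding V_smult_lmon[OF Lam_VK[OF dnL[OF that(2)]] that(1) i]
      using i V_smult_lmon[OF Lam_VK[OF that(2)] that(1) i, of 0] that(1) by (simp add: dn_def del: vec_smult)
  qed (auto simp: dn_def)
  have dn_eps: "dn (lmon \<one> 1 \<odot>\<^bsub>V\<^esub> w) = w" if "w \<in> Lam" for w
  proof (rule V_eqI)
    fix i z assume i: "i \<in> {1..n}"
    show "dn (lmon \<one> 1 \<odot>\<^bsub>V\<^esub> w) i z = w i z"
      using i V_smult_lmon[OF Lam_VK[OF that] one_closed i, of 1] Lam_coeff[OF that i] Lam_neg[OF that i]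
      by (simp add: dn_def del: vec_smult)
  qed (use that in \<open>auto simp: dn_def PiE_iff\<close>)
  have e: "lmon (\<ominus> \<one>) 1 \<in> carrier K" "lmon (\<ominus> \<one>) 1 \<in> carrier K0" "lmon \<one> 1 \<in> carrier K" "lmon \<one> 1 \<in> carrier K0" by auto
  have cancel: "lmon \<one> 1 \<odot>\<^bsub>V\<^esub> w \<oplus>\<^bsub>V\<^esub> lmon (\<ominus> \<one>) 1 \<odot>\<^bsub>V\<^esub> w = \<zero>\<^bsub>V\<^esub>" if "w \<in> Lam" for w
  proof (rule V_eqI)
    fix i z assume i: "i \<in> {1..n}"
    show "(lmon \<one> 1 \<odot>\<^bsub>V\<^esub> w \<oplus>\<^bsub>V\<^esub> lmon (\<ominus> \<one>) 1 \<odot>\<^bsub>V\<^esub> w) i z = \<zero>\<^bsub>V\<^esub> i z"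
      using i V_smult_lmon[OF Lam_VK[OF that] one_closed i, of 1] V_smult_lmon[OF Lam_VK[OF that] a_inv_closed[OF one_closed] i, of 1]
        Lam_coeff[OF that i]
      by (simp add: laurent_add laurent_zero l_minus r_neg del: vec_smult)
  qed simp_all
  \<comment> \<open>On W this is w - \<epsilon> P (dn w), and for w = \<epsilon> v with v in W the
    two terms cancel. F depends on w only through P w, and its correction term lies in \<epsilon>W,
    which F kills; hence F is idempotent.\<close>
  define F where "F w = P w \<oplus>\<^bsub>V\<^esub> lmon (\<ominus> \<one>) 1 \<odot>\<^bsub>V\<^esub> P (dn (P w))" for w
  have FW: "F w \<in> W" if "w \<in> Lam" for w
    unfolding F_def by (intro Wa Wm PW dnL PL that e)
  have FL: "F w \<in> Lam" if "w \<in> Lam" for w using WL[OF FW[OF that]] .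
  have Fadd: "F (v \<oplus>\<^bsub>V\<^esub> w) = F v \<oplus>\<^bsub>V\<^esub> F w" if vw: "v \<in> Lam" "w \<in> Lam" for v w
  proof -
    note d = dnL[OF PL[OF vw(1)]] dnL[OF PL[OF vw(2)]]
    note c = VL[OF PL[OF vw(1)]] VL[OF PL[OF vw(2)]] VL[OF PL[OF d(1)]] VL[OF PL[OF d(2)]]
    show ?thesis unfolding F_def Padd[OF vw] dn_add Padd[OF d]
      using c V.smult_closed[OF e(1)] V.smult_r_distr[OF e(1) c(3,4)]
      by (simp add: V.M.a_ac del: vec_carrier)
  qed
  have Fsm: "F (lmon c 0 \<odot>\<^bsub>V\<^esub> w) = lmon c 0 \<odot>\<^bsub>V\<^esub> F w" if cw: "c \<in> carrier R" "w \<in> Lam" for c w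
  proof -
    have cK: "lmon c 0 \<in> carrier K" using cw by simp
    note d = dnL[OF PL[OF cw(2)]]
    note wV = VL[OF PL[OF cw(2)]] VL[OF PL[OF d]]
    show ?thesis
      unfolding F_def Psm[OF cw] dn_sm[OF cw(1) PL[OF cw(2)]] Psm[OF cw(1) d]
        V.smult_r_distr[OF cK wV(1) V.smult_closed[OF e(1) wV(2)]]
      using V.smult_assoc1[OF e(1) cK wV(2)] V.smult_assoc1[OF cK e(1) wV(2)] K.m_comm[OF e(1) cK] by simp
  qed
  have F_eps: "F (lmon \<one> 1 \<odot>\<^bsub>V\<^esub> w) = \<zero>\<^bsub>V\<^esub>" if "w \<in> W" for w
    using Pid[OF Wm[OF e(4) that]] dn_eps[OF WL[OF that]] Pid[OF that] cancel[OF WL[OF that]] by (simp add: F_def)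
  \<comment> \<open>\<epsilon>^(k+1) v is \<epsilon> times the element \<epsilon>^k v of W. So F
    factors through the coefficients of degree at most k and is described by a finite
    matrix.\<close>
  have F_deep: "F (lmon \<one> (int k + 1) \<odot>\<^bsub>V\<^esub> v) = \<zero>\<^bsub>V\<^esub>" if "v \<in> Lam" for v
    using F_eps[OF deep[OF that]] lmon_smult_lmon[OF Lam_VK[OF that] one_closed one_closed, of 1 "int k"]
    by (simp add: add.commute)
  have F_id: "F (F w) = F w" if w: "w \<in> Lam" for w
  proof -
    let ?p = "P w" and ?q = "P (dn (P w))"
    have pq: "?p \<in> W" "?q \<in> W" using PW dnL PL w by auto
    have q: "lmon (\<ominus> \<one>) 1 \<odot>\<^bsub>V\<^esub> ?q = lmon (\<ominus> \<one>) 0 \<odot>\<^bsub>V\<^esub> (lmon \<one> 1 \<odot>\<^bsub>V\<^esub> ?q)"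
      using lmon_smult_lmon[OF Lam_VK[OF WL[OF pq(2)]], of "\<ominus> \<one>" \<one> 0 1] by simp
    have eqL: "lmon \<one> 1 \<odot>\<^bsub>V\<^esub> ?q \<in> Lam" "lmon (\<ominus> \<one>) 1 \<odot>\<^bsub>V\<^esub> ?q \<in> Lam" using WL[OF Wm[OF e(4) pq(2)]] WL[OF Wm[OF e(2) pq(2)]] by auto
    have n1: "\<ominus> \<one> \<in> carrier R" by simp
    have "F (lmon (\<ominus> \<one>) 1 \<odot>\<^bsub>V\<^esub> ?q) = \<zero>\<^bsub>V\<^esub>"
      unfolding q Fsm[OF n1 eqL(1)] F_eps[OF pq(2)] using V.smult_r_null by simp
    then have "F (F w) = F ?p \<oplus>\<^bsub>V\<^esub> \<zero>\<^bsub>V\<^esub>"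
      using Fadd[OF WL[OF pq(1)] eqL(2)] by (simp add: F_def[of w])
    also have "\<dots> = F ?p" using V.M.r_zero[OF VL[OF FL[OF WL[OF pq(1)]]]] .
    also have "\<dots> = F w" using Pid[OF pq(1)] by (simp add: F_def)
    finally show ?thesis .
  qed
  let ?D = "cidx k"
  define f where "f x = coeffs k (F (from_coeffs k x))" for x
  define E where "E = (\<lambda>(d, e)\<in>?D \<times> ?D. f (unit_row ?D R d) e)"
  have fc: "f x \<in> ?D \<rightarrow>\<^sub>E carrier R" if "x \<in> ?D \<rightarrow>\<^sub>E carrier R" for x
    unfolding f_def using coeffs_closed[OF Lam_VK[OF FL[OF from_coeffs_closed[OF that]]]] .
  have f_row: "f x = rowmul ?D R x E" if "x \<in> ?D \<rightarrow>\<^sub>E carrier R" for x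
    unfolding E_def
  proof (rule linear_map_rowmul[OF finite_cidx fc])
    show "f (x \<oplus>\<^bsub>vec_mod ?D R\<^esub> y) = f x \<oplus>\<^bsub>vec_mod ?D R\<^esub> f y" if "x \<in> ?D \<rightarrow>\<^sub>E carrier R" "y \<in> ?D \<rightarrow>\<^sub>E carrier R" for x y
      using that by (simp add: f_def from_coeffs_add Fadd coeffs_add)
    show "f (c \<odot>\<^bsub>vec_mod ?D R\<^esub> x) = c \<odot>\<^bsub>vec_mod ?D R\<^esub> f x" if "c \<in> carrier R" "x \<in> ?D \<rightarrow>\<^sub>E carrier R" for c x
      using that Lam_VK[OF FL[OF from_coeffs_closed[OF that(2)]]] by (simp add: f_def from_coeffs_smult Fsm coeffs_smult)
  qed (use that in auto)
  have F_row: "coeffs k (F w) = rowmul ?D R (coeffs k w) E" if w: "w \<in> Lam" for w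
  proof -
    obtain v where v: "v \<in> Lam" "w = from_coeffs k (coeffs k w) \<oplus>\<^bsub>V\<^esub> lmon \<one> (int k + 1) \<odot>\<^bsub>V\<^esub> v"
      using trunc_split[OF w] by blast
    have x: "coeffs k w \<in> ?D \<rightarrow>\<^sub>E carrier R" using w Lam_VK by simp
    have ev: "lmon \<one> (int k + 1) \<odot>\<^bsub>V\<^esub> v \<in> Lam" using v Lam_closed by simp
    have "F w = F (from_coeffs k (coeffs k w)) \<oplus>\<^bsub>V\<^esub> \<zero>\<^bsub>V\<^esub>"
      using arg_cong[OF v(2), of F] Fadd[OF from_coeffs_closed[OF x] ev] F_deep[OF v(1)] by metis
    then have "F w = F (from_coeffs k (coeffs k w))"
      using V.M.r_zero[OF VL[OF FL[OF from_coeffs_closed[OF x]]]] by simp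
    then show ?thesis using f_row[OF x] by (simp add: f_def)
  qed
  have Ec: "E \<in> ?D \<times> ?D \<rightarrow>\<^sub>E carrier R"
    using vec_mem[OF fc[OF unit_row_closed]] by (auto simp: E_def)
  have u: "from_coeffs k (unit_row ?D R d) \<in> Lam" for d by simp
  have row: "mat_row ?D E d = coeffs k (F (from_coeffs k (unit_row ?D R d)))" if d: "d \<in> ?D" for d
    by (rule vec_eqI[where I = ?D]) (use d in \<open>auto simp: E_def f_def coeffs_def\<close>)
  have "split_lattice R n W k E"
  proof (intro split_lattice.intro row_lattices_axioms split_lattice_axioms.intro)
    show "K0_submodule W" by (rule W)
    show "lmon \<one> (int k) \<odot>\<^bsub>V\<^esub> w \<in> W" if "w \<in> Lam" for w using deep[OF that] .
    show "E \<in> ?D \<times> ?D \<rightarrow>\<^sub>E carrier R" by (rule Ec)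
    show "mat_mult ?D R E E = E"
    proof (rule mat_eqI[where I = ?D])
      fix d assume d: "d \<in> ?D"
      have "mat_row ?D (mat_mult ?D R E E) d = rowmul ?D R (coeffs k (F (from_coeffs k (unit_row ?D R d)))) E"
        using mat_mult_row[OF d Ec Ec] row[OF d] by simp
      also have "\<dots> = coeffs k (F (F (from_coeffs k (unit_row ?D R d))))" using F_row[OF FL[OF u]] by simp
      finally show "mat_row ?D (mat_mult ?D R E E) d = mat_row ?D E d" using F_id[OF u] row[OF d] by simp
    qed (use Ec in \<open>auto simp: PiE_iff\<close>)
    show "from_coeffs k (mat_row ?D E d) \<in> W" if "d \<in> ?D" for d
      unfolding row[OF that] by (rule from_coeffs_coeffs_in[OF W deep FW[OF u]])
    show "\<exists>w'\<in>W. w = from_coeffs k (rowmul ?D R (coeffs k w) E) \<oplus>\<^bsub>V\<^esub> lmon \<one> 1 \<odot>\<^bsub>V\<^esub> w'" if w: "w \<in> W" for w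
    proof -
      obtain v where v: "v \<in> Lam" "F w = from_coeffs k (coeffs k (F w)) \<oplus>\<^bsub>V\<^esub> lmon \<one> (int k + 1) \<odot>\<^bsub>V\<^esub> v"
        using trunc_split[OF FL[OF WL[OF w]]] by blast
      \<comment> \<open>F w differs from its truncation by \<epsilon>^(k+1) v, which is \<epsilon>
        times the element \<epsilon>^k v of W. The truncation error thus joins the remainder, and
        the truncated matrix E is as good as F.\<close>
      let ?a = "from_coeffs k (rowmul ?D R (coeffs k w) E)" and ?q = "P (dn w)" and ?v = "lmon \<one> (int k) \<odot>\<^bsub>V\<^esub> v"
      have q: "?q \<in> W" using PW dnL WL w by blast
      have vW: "?v \<in> W" using deep[OF v(1)] .
      have aV: "?a \<in> carrier V"
        using VL[OF from_coeffs_closed[OF rowmul_closed[OF coeffs_closed[OF Lam_VK[OF WL[OF w]]] Ec]]] .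
      note c = aV VL[OF WL[OF q]] VL[OF WL[OF vW]]
      have "lmon \<one> (int k + 1) \<odot>\<^bsub>V\<^esub> v = lmon \<one> 1 \<odot>\<^bsub>V\<^esub> ?v"
        using lmon_smult_lmon[OF Lam_VK[OF v(1)] one_closed one_closed, of 1 "int k"] by (simp add: add.commute)
      then have Fw: "F w = ?a \<oplus>\<^bsub>V\<^esub> lmon \<one> 1 \<odot>\<^bsub>V\<^esub> ?v" using v(2) F_row[OF WL[OF w]] by simp
      have Fw': "F w = w \<oplus>\<^bsub>V\<^esub> lmon (\<ominus> \<one>) 1 \<odot>\<^bsub>V\<^esub> ?q" using Pid[OF w] by (simp add: F_def)
      have wV: "w \<in> carrier V" using VL[OF WL[OF w]] .
      have sc: "lmon \<one> 1 \<odot>\<^bsub>V\<^esub> ?q \<in> carrier V" "lmon (\<ominus> \<one>) 1 \<odot>\<^bsub>V\<^esub> ?q \<in> carrier V" "lmon \<one> 1 \<odot>\<^bsub>V\<^esub> ?v \<in> carrier V"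
        using V.smult_closed[OF e(3) c(2)] V.smult_closed[OF e(1) c(2)] V.smult_closed[OF e(3) c(3)] by auto
      have "w = w \<oplus>\<^bsub>V\<^esub> (lmon \<one> 1 \<odot>\<^bsub>V\<^esub> ?q \<oplus>\<^bsub>V\<^esub> lmon (\<ominus> \<one>) 1 \<odot>\<^bsub>V\<^esub> ?q)"
        using cancel[OF WL[OF q]] V.M.r_zero[OF wV] by simp
      also have "\<dots> = (w \<oplus>\<^bsub>V\<^esub> lmon (\<ominus> \<one>) 1 \<odot>\<^bsub>V\<^esub> ?q) \<oplus>\<^bsub>V\<^esub> lmon \<one> 1 \<odot>\<^bsub>V\<^esub> ?q"
        using wV sc by (simp add: V.M.a_ac del: vec_carrier)
      also have "\<dots> = ?a \<oplus>\<^bsub>V\<^esub> lmon \<one> 1 \<odot>\<^bsub>V\<^esub> ?v \<oplus>\<^bsub>V\<^esub> lmon \<one> 1 \<odot>\<^bsub>V\<^esub> ?q" using Fw Fw' by simp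
      also have "\<dots> = ?a \<oplus>\<^bsub>V\<^esub> lmon \<one> 1 \<odot>\<^bsub>V\<^esub> (?v \<oplus>\<^bsub>V\<^esub> ?q)"
        using V.smult_r_distr[OF e(3) c(3) c(2)] V.M.a_assoc[OF aV sc(3) sc(1)] by simp
      finally show ?thesis using Wa[OF vW q] by blast
    qed
    show "rowmul ?D R (coeffs k (lmon \<one> 1 \<odot>\<^bsub>V\<^esub> w)) E = \<zero>\<^bsub>vec_mod ?D R\<^esub>" if w: "w \<in> W" for w
    proof -
      have "coeffs k \<zero>\<^bsub>V\<^esub> = \<zero>\<^bsub>vec_mod ?D R\<^esub>"
        by (rule vec_eqI[where I = ?D]) (auto simp: coeffs_def laurent_zero dest: cidxD)
      then show ?thesis using F_row[OF WL[OF Wm[OF e(4) w]]] F_eps[OF w] by simp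
    qed
  qed
  then show ?thesis by blast
qed

end

section \<open>Base change of the projector\<close>

context base_change
begin

definition xmap :: "'i set \<Rightarrow> ('i \<Rightarrow> 'a) \<Rightarrow> 'i \<Rightarrow> 'a" where
  "xmap I x = (\<lambda>d\<in>I. \<phi> (x d))"

lemma xmap_apply: "d \<in> I \<Longrightarrow> xmap I x d = \<phi> (x d)"
  by (simp add: xmap_def)

lemma xmap_closed: "x \<in> I \<rightarrow>\<^sub>E carrier R \<Longrightarrow> xmap I x \<in> I \<rightarrow>\<^sub>E carrier S"
  by (auto simp: xmap_def)

lemma xmap_rowmul:
  assumes x: "x \<in> I \<rightarrow>\<^sub>E carrier R" and E: "E \<in> I \<times> I \<rightarrow>\<^sub>E carrier R"
  shows "xmap I (rowmul I R x E) = rowmul I S (xmap I x) (xmap (I \<times> I) E)"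
proof (rule vec_eqI[where I = I])
  fix e assume e: "e \<in> I"
  note mem = A.vec_mem[OF x] A.mat_mem[OF E _ e]
  have "\<phi> (\<Oplus>\<^bsub>R\<^esub>d\<in>I. x d \<otimes>\<^bsub>R\<^esub> E (d, e)) = (\<Oplus>\<^bsub>S\<^esub>d\<in>I. \<phi> (x d \<otimes>\<^bsub>R\<^esub> E (d, e)))"
    using h.hom_finsum[of "\<lambda>d. x d \<otimes>\<^bsub>R\<^esub> E (d, e)" I] mem by (simp add: o_def Pi_def)
  also have "\<dots> = (\<Oplus>\<^bsub>S\<^esub>d\<in>I. xmap I x d \<otimes>\<^bsub>S\<^esub> xmap (I \<times> I) E (d, e))"
    using mem e by (intro B.finsum_cong') (auto simp: xmap_def)
  finally show "xmap I (rowmul I R x E) e = rowmul I S (xmap I x) (xmap (I \<times> I) E) e"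
    using xmap_apply[OF e, of "rowmul I R x E"] e by (simp add: rowmul_def)
qed (auto simp: xmap_def)

lemma xmap_mat_row: "i \<in> I \<Longrightarrow> mat_row I (xmap (I \<times> I) E) i = xmap I (mat_row I E i)"
  by (rule vec_eqI[where I = I]) (auto simp: xmap_def)

lemma xmap_mat_mult:
  assumes E: "E \<in> I \<times> I \<rightarrow>\<^sub>E carrier R" and F: "F \<in> I \<times> I \<rightarrow>\<^sub>E carrier R"
  shows "xmap (I \<times> I) (mat_mult I R E F) = mat_mult I S (xmap (I \<times> I) E) (xmap (I \<times> I) F)"
proof (rule A.mat_eqI[where I = I])
  fix i assume i: "i \<in> I"
  have "mat_row I (xmap (I \<times> I) (mat_mult I R E F)) i = xmap I (rowmul I R (mat_row I E i) F)"
    using i E F by (simp add: xmap_mat_row A.mat_mult_row)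
  also have "\<dots> = rowmul I S (xmap I (mat_row I E i)) (xmap (I \<times> I) F)"
    using i E F by (intro xmap_rowmul) auto
  also have "\<dots> = mat_row I (mat_mult I S (xmap (I \<times> I) E) (xmap (I \<times> I) F)) i"
    using i xmap_closed[OF E] xmap_closed[OF F] by (simp add: xmap_mat_row B.mat_mult_row)
  finally show "mat_row I (xmap (I \<times> I) (mat_mult I R E F)) i = mat_row I (mat_mult I S (xmap (I \<times> I) E) (xmap (I \<times> I) F)) i" .
qed (simp_all add: xmap_def)

lemma xmap_scalar: "xmap (I \<times> I) (scalar_mat I R c) = scalar_mat I S (\<phi> c)"
  by (rule vec_eqI[where I = "I \<times> I"]) (auto simp: xmap_def scalar_mat_def)

lemma xmap_split_rows:
  assumes E: "E \<in> I \<times> I \<rightarrow>\<^sub>E carrier R"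
  shows "xmap (I \<times> I) (A.split_rows I E T J) = B.split_rows I (xmap (I \<times> I) E) T J"
proof (rule vec_eqI[where I = "I \<times> I"])
  fix p assume pI: "p \<in> I \<times> I"
  obtain i j where pe: "p = (i, j)" by (cases p)
  then have p: "p = (i, j)" "i \<in> I" "j \<in> I" using pI by simp_all
  have u: "\<phi> (unit_row I R i j) = unit_row I S i j" "unit_row I R i j \<in> carrier R" using p by (simp_all add: unit_row_def)
  have Em: "E (i, j) \<in> carrier R" using A.mat_mem[OF E p(2,3)] .
  show "xmap (I \<times> I) (A.split_rows I E T J) p = B.split_rows I (xmap (I \<times> I) E) T J p"
    using u Em p by (simp add: xmap_apply A.split_rows_def B.split_rows_def A.minus_eq B.minus_eq)
qed (auto simp: xmap_def A.split_rows_def B.split_rows_def)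

lemma vmap_from_coeffs: "vmap (A.from_coeffs k x) = B.from_coeffs k (xmap (A.cidx k) x)"
  by (rule B.V_eqI) (auto simp: vmap_apply A.from_coeffs_def B.from_coeffs_def xmap_def)

lemma coeffs_vmap: "B.coeffs k (vmap w) = xmap (A.cidx k) (A.coeffs k w)"
proof (rule vec_eqI[where I = "A.cidx k"])
  fix d assume d: "d \<in> A.cidx k"
  obtain i a where "d = (i, a)" by (cases d)
  then show "B.coeffs k (vmap w) d = xmap (A.cidx k) (A.coeffs k w) d"
    using d A.cidxD(1)[of i a k] by (auto simp: A.coeffs_def B.coeffs_def xmap_def vmap_apply)
qed (auto simp: B.coeffs_def xmap_def)

text \<open>An upper bound for the pulled back lattice on which linear identities can be checked by
  induction. The scalars are constants of S only, because the truncated matrix is linear over S but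
  not over S[[\<epsilon>]]; higher degrees enter through \<open>deep\<close>.\<close>

inductive_set span_map :: "(nat \<Rightarrow> int \<Rightarrow> 'a) set \<Rightarrow> nat \<Rightarrow> (nat \<Rightarrow> int \<Rightarrow> 'a) set"
  for W :: "(nat \<Rightarrow> int \<Rightarrow> 'a) set" and k :: nat where
  gen: "w \<in> W \<Longrightarrow> vmap w \<in> span_map W k"
| deep: "v \<in> B.Lam \<Longrightarrow> B.lmon \<one>\<^bsub>S\<^esub> (int k + 1) \<odot>\<^bsub>B.V\<^esub> v \<in> span_map W k"
| add: "v \<in> span_map W k \<Longrightarrow> w \<in> span_map W k \<Longrightarrow> v \<oplus>\<^bsub>B.V\<^esub> w \<in> span_map W k"
| smult: "c \<in> carrier S \<Longrightarrow> w \<in> span_map W k \<Longrightarrow> B.lmon c 0 \<odot>\<^bsub>B.V\<^esub> w \<in> span_map W k"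

lemma span_map_Lam:
  assumes W: "W \<subseteq> A.Lam" and w: "w \<in> span_map W k"
  shows "w \<in> B.Lam"
  using w
proof induction
  case (gen w)
  show ?case by (rule vmap_Lam) (use gen W in blast)
next
  case (deep v)
  show ?case by (rule B.Lam_closed(3)) (use deep in auto)
next
  case (add v w)
  show ?case by (rule B.Lam_closed(2)[OF add.IH])
next
  case (smult c w)
  show ?case by (rule B.Lam_closed(3)[OF _ smult.IH]) (use smult.hyps in auto)
qed

text \<open>A power series splits into its terms of degree at most k and a multiple of
  \<epsilon>^(k+1). A term a_s \<epsilon>^s acts on the image of w as the constant a_s on the image
  of \<epsilon>^s w, which comes from W again; the rest falls under \<open>deep\<close>.\<close>

lemma span_map_K0:
  assumes W: "A.K0_submodule W" and a: "a \<in> carrier B.K0" and w: "w \<in> span_map W k"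
  shows "a \<odot>\<^bsub>B.V\<^esub> w \<in> span_map W k"
proof -
  have WL: "W \<subseteq> A.Lam" using W by (simp add: A.K0_submodule_def)
  have VB: "w \<in> B.VK" if "w \<in> span_map W k" for w using B.Lam_VK[OF span_map_Lam[OF WL that]] .
  have aK: "a \<in> carrier B.K" using a by simp
  show ?thesis using w
  proof induction
    case (gen w)
    have wV: "w \<in> A.VK" using A.Lam_VK WL gen by blast
    \<comment> \<open>Induction on the number \<open>t\<close> of degrees below k + 1 that may still
      occur in the scalar. For t = 0 the scalar is divisible by \<epsilon>^(k+1); in the step its
      lowest possible term, of degree k - t, is removed.\<close>
    have claim: "a \<odot>\<^bsub>B.V\<^esub> vmap w \<in> span_map W k"
      if "t \<le> k + 1" "a \<in> carrier B.K0" "\<And>z. z < int (k + 1) - int t \<Longrightarrow> a z = \<zero>\<^bsub>S\<^esub>" for t a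
      using that
    proof (induction t arbitrary: a)
      case 0
      define a' where "a' = (\<lambda>z. a (z + (int k + 1)))"
      have aS: "a z \<in> carrier S" for z using 0(2) by (simp add: B.K0_carrier_iff)
      have a'0: "a' \<in> carrier B.K0" unfolding B.K0_carrier_iff a'_def using aS 0(3) by simp
      have "a = B.lmon \<one>\<^bsub>S\<^esub> (int k + 1) \<otimes>\<^bsub>B.K\<^esub> a'"
      proof
        fix z
        show "a z = (B.lmon \<one>\<^bsub>S\<^esub> (int k + 1) \<otimes>\<^bsub>B.K\<^esub> a') z"
          unfolding B.lmon_mult[OF B.one_closed B.K0_closed[OF a'0]] using aS[of z] by (simp add: a'_def)
      qed
      then have "a \<odot>\<^bsub>B.V\<^esub> vmap w = B.lmon \<one>\<^bsub>S\<^esub> (int k + 1) \<odot>\<^bsub>B.V\<^esub> (a' \<odot>\<^bsub>B.V\<^esub> vmap w)"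
        using B.V.smult_assoc1[of "B.lmon \<one>\<^bsub>S\<^esub> (int k + 1)" a' "vmap w"] a'0 vmap_closed[OF wV] by simp
      moreover have "a' \<odot>\<^bsub>B.V\<^esub> vmap w \<in> B.Lam"
        using B.Lam_closed(3)[OF a'0] vmap_Lam gen WL by blast
      ultimately show ?case using span_map.deep by simp
    next
      case (Suc t)
      define s where "s = k - t"
      have s: "int s = int (k + 1) - int (Suc t)" using Suc.prems(1) by (simp add: s_def)
      have as: "a (int s) \<in> carrier S" using Suc.prems(2) by (simp add: B.K0_carrier_iff)
      define a' where "a' = (\<lambda>z. if z = int s then \<zero>\<^bsub>S\<^esub> else a z)"
      have a'0: "a' \<in> carrier B.K0" using Suc.prems(2) by (auto simp: a'_def B.K0_carrier_iff)
      have "a' \<odot>\<^bsub>B.V\<^esub> vmap w \<in> span_map W k"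
      proof (rule Suc.IH)
        show "a' z = \<zero>\<^bsub>S\<^esub>" if "z < int (k + 1) - int t" for z
          using Suc.prems(3)[of z] that s by (auto simp: a'_def)
      qed (use Suc.prems(1) a'0 in auto)
      moreover have "B.lmon (a (int s)) (int s) \<odot>\<^bsub>B.V\<^esub> vmap w \<in> span_map W k"
      proof -
        have "A.lmon \<one>\<^bsub>R\<^esub> (int s) \<odot>\<^bsub>A.V\<^esub> w \<in> W" using W gen by (simp add: A.K0_submodule_def)
        then have "B.lmon (a (int s)) 0 \<odot>\<^bsub>B.V\<^esub> vmap (A.lmon \<one>\<^bsub>R\<^esub> (int s) \<odot>\<^bsub>A.V\<^esub> w) \<in> span_map W k"
          by (intro span_map.intros as)
        then show ?thesis
          using vmap_smult[of "A.lmon \<one>\<^bsub>R\<^esub> (int s)" w] wV B.lmon_smult_lmon[OF vmap_closed[OF wV] as B.one_closed, of 0 "int s"] as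
          by (simp add: kmap_lmon)
      qed
      moreover have "a \<odot>\<^bsub>B.V\<^esub> vmap w = B.lmon (a (int s)) (int s) \<odot>\<^bsub>B.V\<^esub> vmap w \<oplus>\<^bsub>B.V\<^esub> a' \<odot>\<^bsub>B.V\<^esub> vmap w"
      proof -
        have "a = B.lmon (a (int s)) (int s) \<oplus>\<^bsub>B.K\<^esub> a'"
          by (rule ext) (use Suc.prems(2) in \<open>auto simp: B.laurent_add B.lmon_def a'_def B.K0_carrier_iff\<close>)
        then show ?thesis
          using B.V.smult_l_distr[of "B.lmon (a (int s)) (int s)" a' "vmap w"] as a'0 vmap_closed[OF wV] by simp
      qed
      ultimately show ?case by (simp add: span_map.add)
    qed
    show ?case by (rule claim[of "k + 1"]) (use a in \<open>auto simp: B.K0_carrier_iff\<close>)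
  next
    case (deep v)
    have v: "v \<in> carrier B.V" using B.Lam_VK[OF deep] by simp
    have eK: "B.lmon \<one>\<^bsub>S\<^esub> (int k + 1) \<in> carrier B.K" by simp
    have "a \<odot>\<^bsub>B.V\<^esub> (B.lmon \<one>\<^bsub>S\<^esub> (int k + 1) \<odot>\<^bsub>B.V\<^esub> v) = B.lmon \<one>\<^bsub>S\<^esub> (int k + 1) \<odot>\<^bsub>B.V\<^esub> (a \<odot>\<^bsub>B.V\<^esub> v)"
      using B.V.smult_assoc1[OF aK eK v] B.V.smult_assoc1[OF eK aK v] B.K.m_comm[OF aK eK] by simp
    then show ?case using span_map.deep[OF B.Lam_closed(3)[OF a deep]] by simp
  next
    case (add v w)
    then show ?case
      using B.V.smult_r_distr[OF aK, of v w] VB by (simp add: span_map.add)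
  next
    case (smult c w)
    have w: "w \<in> carrier B.V" using VB[OF smult.hyps(2)] by simp
    have cK: "B.lmon c 0 \<in> carrier B.K" using smult.hyps by simp
    have "a \<odot>\<^bsub>B.V\<^esub> (B.lmon c 0 \<odot>\<^bsub>B.V\<^esub> w) = B.lmon c 0 \<odot>\<^bsub>B.V\<^esub> (a \<odot>\<^bsub>B.V\<^esub> w)"
      using B.V.smult_assoc1[OF aK cK w] B.V.smult_assoc1[OF cK aK w] B.K.m_comm[OF aK cK] by simp
    then show ?case using span_map.smult[OF smult.hyps(1) smult.IH] by simp
  qed
qed

lemma span_map_submodule:
  assumes W: "A.curve_submodule W"
  shows "B.curve_submodule (span_map W k)"
  unfolding B.curve_submodule_def B.K0_submodule_def
proof (intro conjI ballI)
  note D = A.curve_submoduleD[OF W]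
  have WL: "W \<subseteq> A.Lam" using D(3) by blast
  have VB: "w \<in> B.VK" if "w \<in> span_map W k" for w using B.Lam_VK[OF span_map_Lam[OF WL that]] .
  show "span_map W k \<subseteq> B.Lam" using span_map_Lam[OF WL] by blast
  have "B.lmon \<one>\<^bsub>S\<^esub> (int k + 1) \<odot>\<^bsub>B.V\<^esub> \<zero>\<^bsub>B.V\<^esub> \<in> span_map W k" by (rule span_map.deep[OF B.Lam_closed(1)])
  then show "\<zero>\<^bsub>B.V\<^esub> \<in> span_map W k" using B.V.smult_r_null[of "B.lmon \<one>\<^bsub>S\<^esub> (int k + 1)"] by simp
  show "v \<oplus>\<^bsub>B.V\<^esub> w \<in> span_map W k" if "v \<in> span_map W k" "w \<in> span_map W k" for v w using that by (rule span_map.add)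
  show "a \<odot>\<^bsub>B.V\<^esub> w \<in> span_map W k" if "a \<in> carrier B.K0" "w \<in> span_map W k" for a w
    using span_map_K0[OF D(1) that] .
  show "B.shiftY w \<in> span_map W k" if "w \<in> span_map W k" for w
    using that
  proof induction
    case (gen w)
    have "w \<in> A.VK" using A.Lam_VK WL gen by blast
    then have "B.shiftY (vmap w) = vmap (A.shiftY w)" using vmap_shiftY by simp
    then show ?case using span_map.gen[OF D(2)[OF gen]] by simp
  next
    case (deep v)
    have v: "v \<in> B.VK" using B.Lam_VK[OF deep] .
    have "B.shiftY v \<in> B.Lam"
      using deep B.shiftY[OF v] B.K0.vec_mem[OF deep] B.n_pos v
      by (intro PiE_I) (auto simp: atLeastAtMost_iff rowmul_def)
    then show ?case
      using B.K.rowmul_smult[OF _ B.lmon_closed[OF B.one_closed] v B.Y_closed, of "int k + 1"] span_map.deep by simp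
  next
    case (add v w)
    then show ?case using B.K.rowmul_add[OF VB VB B.Y_closed] span_map.add by simp
  next
    case (smult c w)
    then show ?case
      using B.K.rowmul_smult[OF _ B.lmon_closed VB B.Y_closed, of c w 0] span_map.smult by simp
  qed
qed

text \<open>The conditions on E that range over the lattice are checked on \<open>span_map\<close>,
  which contains the pulled back lattice. They are additive and linear over S, hold on images by
  applying \<phi>, and hold on multiples of \<epsilon>^(k+1) because these have no coefficients in
  the truncated range.\<close>

lemma split_lattice_map:
  assumes W: "A.curve_submodule W" and split: "split_lattice R n W k E"
  shows "split_lattice S n (B.lat_of (bc_ideal (A.idl_of W))) k (xmap (A.cidx k \<times> A.cidx k) E)"
proof -
  interpret s: split_lattice R n W k E by (rule split)
  note D = A.curve_submoduleD[OF W]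
  have WL: "W \<subseteq> A.Lam" using D(3) by blast
  define U where "U = B.lat_of (bc_ideal (A.idl_of W))"
  note bc = bc_ideal_props[OF WL, folded U_def]
  note UD = B.curve_submoduleD[OF bc(2)]
  let ?D = "A.cidx k" and ?E = "xmap (A.cidx k \<times> A.cidx k) E"
  have E: "?E \<in> ?D \<times> ?D \<rightarrow>\<^sub>E carrier S" by (rule xmap_closed[OF s.E])
  have sub: "U \<subseteq> span_map W k" by (rule bc(4)[OF span_map_submodule[OF W]]) (rule span_map.gen)
  have deep: "B.lmon \<one>\<^bsub>S\<^esub> (int k) \<odot>\<^bsub>B.V\<^esub> w \<in> U" if w: "w \<in> B.Lam" for w
  proof -
    \<comment> \<open>The vectors \<epsilon>^k e_j are images of vectors of W, and over
      S[[\<epsilon>]] they generate \<epsilon>^k times all integral vectors.\<close>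
    have gen: "B.lmon \<one>\<^bsub>S\<^esub> (int k) \<odot>\<^bsub>B.V\<^esub> unit_row N B.K j \<in> U" for j
    proof -
      have "vmap (A.lmon \<one>\<^bsub>R\<^esub> (int k) \<odot>\<^bsub>A.V\<^esub> unit_row N A.K j) \<in> U" by (rule bc(3)[OF s.W_deep[OF A.unit_row_Lam]])
      moreover have "vmap (unit_row N A.K j) = unit_row N B.K j"
        by (rule vec_eqI[where I = N]) (auto simp: vmap_apply unit_row_def kmap_one kmap_zero)
      ultimately show ?thesis
        using vmap_smult[OF A.lmon_closed[OF A.one_closed] A.K.unit_row_closed, of "int k" j] by (simp add: kmap_lmon)
    qed
    have kK: "B.lmon \<one>\<^bsub>S\<^esub> (int k) \<in> carrier B.K" by simp
    have "B.lincomb N w (\<lambda>j. B.lmon \<one>\<^bsub>S\<^esub> (int k) \<odot>\<^bsub>B.V\<^esub> unit_row N B.K j) \<in> U"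
      by (rule B.lincomb_in_submodule[OF UD(1)]) (use B.K0.vec_mem[OF w] gen in auto)
    moreover have "B.lincomb N w (\<lambda>j. B.lmon \<one>\<^bsub>S\<^esub> (int k) \<odot>\<^bsub>B.V\<^esub> unit_row N B.K j) = B.lmon \<one>\<^bsub>S\<^esub> (int k) \<odot>\<^bsub>B.V\<^esub> w"
    proof (rule vec_eqI[where I = N])
      fix i assume i: "i \<in> N"
      note wK = B.K.vec_mem[OF B.Lam_VK[OF w]]
      have "(\<Oplus>\<^bsub>B.K\<^esub>j\<in>N. w j \<otimes>\<^bsub>B.K\<^esub> (B.lmon \<one>\<^bsub>S\<^esub> (int k) \<odot>\<^bsub>B.V\<^esub> unit_row N B.K j) i)
          = w i \<otimes>\<^bsub>B.K\<^esub> (B.lmon \<one>\<^bsub>S\<^esub> (int k) \<odot>\<^bsub>B.V\<^esub> unit_row N B.K i) i"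
        by (rule B.K.finsum_single) (use i wK kK in \<open>auto simp: unit_row_def\<close>)
      then show "B.lincomb N w (\<lambda>j. B.lmon \<one>\<^bsub>S\<^esub> (int k) \<odot>\<^bsub>B.V\<^esub> unit_row N B.K j) i = (B.lmon \<one>\<^bsub>S\<^esub> (int k) \<odot>\<^bsub>B.V\<^esub> w) i"
        using i wK[OF i] kK by (simp add: B.lincomb_def unit_row_def B.K.m_comm)
    qed (auto simp: B.lincomb_def)
    ultimately show ?thesis by simp
  qed
  have e: "B.lmon \<one>\<^bsub>S\<^esub> 1 \<in> carrier B.K" "B.lmon \<one>\<^bsub>S\<^esub> 1 \<in> carrier B.K0" by auto
  have VB: "w \<in> B.VK" if "w \<in> span_map W k" for w using B.Lam_VK[OF span_map_Lam[OF WL that]] .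
  have UV: "w \<in> carrier B.V" if "w \<in> U" for w using B.Lam_VK[OF UD(3)[OF that]] by simp
  have Dz: "B.coeffs k (B.lmon \<one>\<^bsub>S\<^esub> l \<odot>\<^bsub>B.V\<^esub> v) = \<zero>\<^bsub>vec_mod ?D S\<^esub>" if v: "v \<in> B.Lam" and l: "l > int k" for v l
  proof (rule vec_eqI[where I = ?D])
    fix d assume d: "d \<in> ?D"
    obtain i a where ia: "d = (i, a)" by (cases d)
    then have i: "i \<in> N" and al: "a \<le> int k" using d A.cidxD by blast+
    show "B.coeffs k (B.lmon \<one>\<^bsub>S\<^esub> l \<odot>\<^bsub>B.V\<^esub> v) d = \<zero>\<^bsub>vec_mod ?D S\<^esub> d"
      using B.V_smult_lmon[OF B.Lam_VK[OF v] B.one_closed i, of l a] B.Lam_neg[OF v i, of "a - l"] al l d ia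
      by (simp add: B.coeffs_def del: vec_smult)
  qed (auto simp: B.coeffs_def)
  interpret DS: module S "vec_mod ?D S" by (rule B.vec_module)
  have zE: "rowmul ?D S \<zero>\<^bsub>vec_mod ?D S\<^esub> ?E = \<zero>\<^bsub>vec_mod ?D S\<^esub>"
  proof (rule vec_eqI[where I = ?D])
    fix d assume d: "d \<in> ?D"
    have "(\<Oplus>\<^bsub>S\<^esub>c\<in>?D. \<zero>\<^bsub>vec_mod ?D S\<^esub> c \<otimes>\<^bsub>S\<^esub> ?E (c, d)) = (\<Oplus>\<^bsub>S\<^esub>c\<in>?D. \<zero>\<^bsub>S\<^esub>)"
      using B.mat_mem[OF E _ d] by (intro B.finsum_cong') auto
    then show "rowmul ?D S \<zero>\<^bsub>vec_mod ?D S\<^esub> ?E d = \<zero>\<^bsub>vec_mod ?D S\<^esub> d" using d by (simp add: rowmul_def)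
  qed simp_all
  have cc: "B.coeffs k w \<in> ?D \<rightarrow>\<^sub>E carrier S" if "w \<in> B.VK" for w using B.coeffs_closed[OF that, of k] by simp
  have fcc: "B.from_coeffs k x \<in> B.Lam" if "x \<in> ?D \<rightarrow>\<^sub>E carrier S" for x
    using B.from_coeffs_closed[of x k] that by simp
  have fz: "B.from_coeffs k \<zero>\<^bsub>vec_mod ?D S\<^esub> = \<zero>\<^bsub>B.V\<^esub>"
    by (rule B.V_eqI) (auto simp: B.from_coeffs_def B.laurent_zero)
  \<comment> \<open>The remainder is found in the pulled back lattice itself and not merely in the
    span, as \<open>split_lattice\<close> demands for that lattice.\<close>
  have split2: "\<exists>w'\<in>U. w = B.from_coeffs k (rowmul ?D S (B.coeffs k w) ?E) \<oplus>\<^bsub>B.V\<^esub> B.lmon \<one>\<^bsub>S\<^esub> 1 \<odot>\<^bsub>B.V\<^esub> w'"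
    if "w \<in> span_map W k" for w
    using that
  proof induction
    case (gen w)
    have wV: "w \<in> A.VK" using A.Lam_VK WL gen by blast
    obtain w' where w': "w' \<in> W" "w = A.from_coeffs k (rowmul ?D R (A.coeffs k w) E) \<oplus>\<^bsub>A.V\<^esub> A.lmon \<one>\<^bsub>R\<^esub> 1 \<odot>\<^bsub>A.V\<^esub> w'"
      using s.E_split[OF gen] by blast
    have w'V: "w' \<in> A.VK" using A.Lam_VK WL w'(1) by blast
    have ewV: "A.lmon \<one>\<^bsub>R\<^esub> 1 \<odot>\<^bsub>A.V\<^esub> w' \<in> A.VK" using A.V.smult_closed[of "A.lmon \<one>\<^bsub>R\<^esub> 1" w'] w'V by simp
    have fV: "A.from_coeffs k (rowmul ?D R (A.coeffs k w) E) \<in> A.VK"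
      using A.Lam_VK[OF A.from_coeffs_closed[OF A.rowmul_closed[OF A.coeffs_closed[OF wV] s.E]]] .
    have "vmap w = vmap (A.from_coeffs k (rowmul ?D R (A.coeffs k w) E)) \<oplus>\<^bsub>B.V\<^esub> vmap (A.lmon \<one>\<^bsub>R\<^esub> 1 \<odot>\<^bsub>A.V\<^esub> w')"
      using arg_cong[OF w'(2), of vmap] vmap_add[OF fV ewV] by metis
    also have "vmap (A.lmon \<one>\<^bsub>R\<^esub> 1 \<odot>\<^bsub>A.V\<^esub> w') = B.lmon \<one>\<^bsub>S\<^esub> 1 \<odot>\<^bsub>B.V\<^esub> vmap w'"
      using vmap_smult[OF A.lmon_closed[OF A.one_closed] w'V] by (simp add: kmap_lmon)
    also have "vmap (A.from_coeffs k (rowmul ?D R (A.coeffs k w) E)) = B.from_coeffs k (rowmul ?D S (B.coeffs k (vmap w)) ?E)"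
      using xmap_rowmul[OF A.coeffs_closed[OF wV] s.E] by (simp add: vmap_from_coeffs coeffs_vmap)
    finally show ?case using bc(3)[OF w'(1)] by blast
  next
    case (deep v)
    let ?v = "B.lmon \<one>\<^bsub>S\<^esub> (int k) \<odot>\<^bsub>B.V\<^esub> v"
    have eq: "B.lmon \<one>\<^bsub>S\<^esub> (int k + 1) \<odot>\<^bsub>B.V\<^esub> v = B.lmon \<one>\<^bsub>S\<^esub> 1 \<odot>\<^bsub>B.V\<^esub> ?v"
      using B.lmon_smult_lmon[OF B.Lam_VK[OF deep] B.one_closed B.one_closed, of 1 "int k"] by (simp add: add.commute)
    have vU: "?v \<in> U" using deep by (rule \<open>\<And>w. w \<in> B.Lam \<Longrightarrow> B.lmon \<one>\<^bsub>S\<^esub> (int k) \<odot>\<^bsub>B.V\<^esub> w \<in> U\<close>)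
    have "B.from_coeffs k (rowmul ?D S (B.coeffs k (B.lmon \<one>\<^bsub>S\<^esub> (int k + 1) \<odot>\<^bsub>B.V\<^esub> v)) ?E) = \<zero>\<^bsub>B.V\<^esub>"
      using Dz[OF deep, of "int k + 1"] zE fz by simp
    then have "B.lmon \<one>\<^bsub>S\<^esub> (int k + 1) \<odot>\<^bsub>B.V\<^esub> v =
      B.from_coeffs k (rowmul ?D S (B.coeffs k (B.lmon \<one>\<^bsub>S\<^esub> (int k + 1) \<odot>\<^bsub>B.V\<^esub> v)) ?E) \<oplus>\<^bsub>B.V\<^esub> B.lmon \<one>\<^bsub>S\<^esub> 1 \<odot>\<^bsub>B.V\<^esub> ?v"
      using eq B.V.M.l_zero[OF B.V.smult_closed[OF e(1) UV[OF vU]]] by simp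
    then show ?case using vU by blast
  next
    case (add v w)
    obtain v' where v': "v' \<in> U" "v = B.from_coeffs k (rowmul ?D S (B.coeffs k v) ?E) \<oplus>\<^bsub>B.V\<^esub> B.lmon \<one>\<^bsub>S\<^esub> 1 \<odot>\<^bsub>B.V\<^esub> v'"
      using add.IH(1) by blast
    obtain w' where w': "w' \<in> U" "w = B.from_coeffs k (rowmul ?D S (B.coeffs k w) ?E) \<oplus>\<^bsub>B.V\<^esub> B.lmon \<one>\<^bsub>S\<^esub> 1 \<odot>\<^bsub>B.V\<^esub> w'"
      using add.IH(2) by blast
    note vV = VB[OF add.hyps(1)] and wV = VB[OF add.hyps(2)]
    let ?a = "B.from_coeffs k (rowmul ?D S (B.coeffs k v) ?E)" and ?b = "B.from_coeffs k (rowmul ?D S (B.coeffs k w) ?E)"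
    have rc: "rowmul ?D S (B.coeffs k v) ?E \<in> ?D \<rightarrow>\<^sub>E carrier S" "rowmul ?D S (B.coeffs k w) ?E \<in> ?D \<rightarrow>\<^sub>E carrier S"
      using cc[OF vV] cc[OF wV] E by simp_all
    have ab: "?a \<in> carrier B.V" "?b \<in> carrier B.V" using B.Lam_VK[OF fcc[OF rc(1)]] B.Lam_VK[OF fcc[OF rc(2)]] by simp_all
    have "B.from_coeffs k (rowmul ?D S (B.coeffs k (v \<oplus>\<^bsub>B.V\<^esub> w)) ?E) = ?a \<oplus>\<^bsub>B.V\<^esub> ?b"
      using B.coeffs_add[of k v w] B.rowmul_add[OF cc[OF vV] cc[OF wV] E] B.from_coeffs_add[of _ k] rc
      by simp
    moreover have "v \<oplus>\<^bsub>B.V\<^esub> w = (?a \<oplus>\<^bsub>B.V\<^esub> ?b) \<oplus>\<^bsub>B.V\<^esub> B.lmon \<one>\<^bsub>S\<^esub> 1 \<odot>\<^bsub>B.V\<^esub> (v' \<oplus>\<^bsub>B.V\<^esub> w')"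
    proof -
      have c: "B.lmon \<one>\<^bsub>S\<^esub> 1 \<odot>\<^bsub>B.V\<^esub> v' \<in> carrier B.V" "B.lmon \<one>\<^bsub>S\<^esub> 1 \<odot>\<^bsub>B.V\<^esub> w' \<in> carrier B.V"
        using B.V.smult_closed[OF e(1)] UV v'(1) w'(1) by auto
      have "(?a \<oplus>\<^bsub>B.V\<^esub> B.lmon \<one>\<^bsub>S\<^esub> 1 \<odot>\<^bsub>B.V\<^esub> v') \<oplus>\<^bsub>B.V\<^esub> (?b \<oplus>\<^bsub>B.V\<^esub> B.lmon \<one>\<^bsub>S\<^esub> 1 \<odot>\<^bsub>B.V\<^esub> w')
          = (?a \<oplus>\<^bsub>B.V\<^esub> ?b) \<oplus>\<^bsub>B.V\<^esub> (B.lmon \<one>\<^bsub>S\<^esub> 1 \<odot>\<^bsub>B.V\<^esub> v' \<oplus>\<^bsub>B.V\<^esub> B.lmon \<one>\<^bsub>S\<^esub> 1 \<odot>\<^bsub>B.V\<^esub> w')"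
        using ab c by (simp add: B.V.M.a_ac del: vec_carrier)
      then show ?thesis
        using v'(2) w'(2) B.V.smult_r_distr[OF e(1) UV[OF v'(1)] UV[OF w'(1)]] by simp
    qed
    ultimately show ?case using UD(5)[OF v'(1) w'(1)] by metis
  next
    case (smult c w)
    obtain w' where w': "w' \<in> U" "w = B.from_coeffs k (rowmul ?D S (B.coeffs k w) ?E) \<oplus>\<^bsub>B.V\<^esub> B.lmon \<one>\<^bsub>S\<^esub> 1 \<odot>\<^bsub>B.V\<^esub> w'"
      using smult.IH by blast
    note wV = VB[OF smult.hyps(2)]
    let ?b = "B.from_coeffs k (rowmul ?D S (B.coeffs k w) ?E)"
    have cK: "B.lmon c 0 \<in> carrier B.K" "B.lmon c 0 \<in> carrier B.K0" using smult.hyps by auto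
    have rc: "rowmul ?D S (B.coeffs k w) ?E \<in> ?D \<rightarrow>\<^sub>E carrier S" using cc[OF wV] E by simp
    have b: "?b \<in> carrier B.V" using B.Lam_VK[OF fcc[OF rc]] by simp
    have "B.from_coeffs k (rowmul ?D S (B.coeffs k (B.lmon c 0 \<odot>\<^bsub>B.V\<^esub> w)) ?E) = B.lmon c 0 \<odot>\<^bsub>B.V\<^esub> ?b"
      using B.coeffs_smult[OF smult.hyps(1) wV, of k] B.rowmul_smult[OF _ smult.hyps(1) cc[OF wV] E]
        B.from_coeffs_smult[OF smult.hyps(1), of _ k] rc A.finite_cidx[of k]
      by simp
    moreover have "B.lmon c 0 \<odot>\<^bsub>B.V\<^esub> w = B.lmon c 0 \<odot>\<^bsub>B.V\<^esub> ?b \<oplus>\<^bsub>B.V\<^esub> B.lmon \<one>\<^bsub>S\<^esub> 1 \<odot>\<^bsub>B.V\<^esub> (B.lmon c 0 \<odot>\<^bsub>B.V\<^esub> w')"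
    proof -
      have "B.lmon c 0 \<odot>\<^bsub>B.V\<^esub> (B.lmon \<one>\<^bsub>S\<^esub> 1 \<odot>\<^bsub>B.V\<^esub> w') = B.lmon \<one>\<^bsub>S\<^esub> 1 \<odot>\<^bsub>B.V\<^esub> (B.lmon c 0 \<odot>\<^bsub>B.V\<^esub> w')"
        using B.V.smult_assoc1[OF cK(1) e(1) UV[OF w'(1)]] B.V.smult_assoc1[OF e(1) cK(1) UV[OF w'(1)]]
          B.K.m_comm[OF cK(1) e(1)] by simp
      then show ?thesis
        using arg_cong[OF w'(2), of "\<lambda>x. B.lmon c 0 \<odot>\<^bsub>B.V\<^esub> x"]
          B.V.smult_r_distr[OF cK(1) b B.V.smult_closed[OF e(1) UV[OF w'(1)]]] by simp
    qed
    ultimately show ?case using UD(6)[OF cK(2) w'(1)] by metis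
  qed
  have eps2: "rowmul ?D S (B.coeffs k (B.lmon \<one>\<^bsub>S\<^esub> 1 \<odot>\<^bsub>B.V\<^esub> w)) ?E = \<zero>\<^bsub>vec_mod ?D S\<^esub>"
    if "w \<in> span_map W k" for w
    using that
  proof induction
    case (gen w)
    have wV: "w \<in> A.VK" using A.Lam_VK WL gen by blast
    have ewV: "A.lmon \<one>\<^bsub>R\<^esub> 1 \<odot>\<^bsub>A.V\<^esub> w \<in> A.VK" using A.V.smult_closed[of "A.lmon \<one>\<^bsub>R\<^esub> 1" w] wV by simp
    have "B.lmon \<one>\<^bsub>S\<^esub> 1 \<odot>\<^bsub>B.V\<^esub> vmap w = vmap (A.lmon \<one>\<^bsub>R\<^esub> 1 \<odot>\<^bsub>A.V\<^esub> w)"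
      using vmap_smult[OF A.lmon_closed[OF A.one_closed] wV] by (simp add: kmap_lmon)
    then have "rowmul ?D S (B.coeffs k (B.lmon \<one>\<^bsub>S\<^esub> 1 \<odot>\<^bsub>B.V\<^esub> vmap w)) ?E = xmap ?D (rowmul ?D R (A.coeffs k (A.lmon \<one>\<^bsub>R\<^esub> 1 \<odot>\<^bsub>A.V\<^esub> w)) E)"
      using xmap_rowmul[OF A.coeffs_closed[OF ewV] s.E] by (simp add: coeffs_vmap)
    also have "\<dots> = xmap ?D \<zero>\<^bsub>vec_mod ?D R\<^esub>" using s.E_eps[OF gen] by simp
    also have "\<dots> = \<zero>\<^bsub>vec_mod ?D S\<^esub>" by (rule vec_eqI[where I = ?D]) (auto simp: xmap_def)
    finally show ?case .
  next
    case (deep v)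
    have "B.lmon \<one>\<^bsub>S\<^esub> 1 \<odot>\<^bsub>B.V\<^esub> (B.lmon \<one>\<^bsub>S\<^esub> (int k + 1) \<odot>\<^bsub>B.V\<^esub> v) = B.lmon \<one>\<^bsub>S\<^esub> (int k + 2) \<odot>\<^bsub>B.V\<^esub> v"
      using B.lmon_smult_lmon[OF B.Lam_VK[OF deep] B.one_closed B.one_closed, of 1 "int k + 1"] by (simp add: algebra_simps)
    then show ?case using Dz[OF deep, of "int k + 2"] zE by simp
  next
    case (add v w)
    note vV = VB[OF add.hyps(1)] and wV = VB[OF add.hyps(2)]
    have c: "B.lmon \<one>\<^bsub>S\<^esub> 1 \<odot>\<^bsub>B.V\<^esub> v \<in> B.VK" "B.lmon \<one>\<^bsub>S\<^esub> 1 \<odot>\<^bsub>B.V\<^esub> w \<in> B.VK"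
      using B.V.smult_closed[OF e(1), of v] B.V.smult_closed[OF e(1), of w] vV wV by simp_all
    have "B.coeffs k (B.lmon \<one>\<^bsub>S\<^esub> 1 \<odot>\<^bsub>B.V\<^esub> (v \<oplus>\<^bsub>B.V\<^esub> w)) =
      B.coeffs k (B.lmon \<one>\<^bsub>S\<^esub> 1 \<odot>\<^bsub>B.V\<^esub> v) \<oplus>\<^bsub>vec_mod ?D S\<^esub> B.coeffs k (B.lmon \<one>\<^bsub>S\<^esub> 1 \<odot>\<^bsub>B.V\<^esub> w)"
      using B.V.smult_r_distr[OF e(1), of v w] vV wV B.coeffs_add[of k] by simp
    then show ?case
      using B.rowmul_add[OF cc[OF c(1)] cc[OF c(2)] E] add.IH DS.M.l_zero[OF DS.M.zero_closed] by simp
  next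
    case (smult c w)
    note wV = VB[OF smult.hyps(2)]
    have cK: "B.lmon c 0 \<in> carrier B.K" using smult.hyps by simp
    have ew: "B.lmon \<one>\<^bsub>S\<^esub> 1 \<odot>\<^bsub>B.V\<^esub> w \<in> B.VK" using B.V.smult_closed[OF e(1), of w] wV by simp
    have "B.lmon \<one>\<^bsub>S\<^esub> 1 \<odot>\<^bsub>B.V\<^esub> (B.lmon c 0 \<odot>\<^bsub>B.V\<^esub> w) = B.lmon c 0 \<odot>\<^bsub>B.V\<^esub> (B.lmon \<one>\<^bsub>S\<^esub> 1 \<odot>\<^bsub>B.V\<^esub> w)"
      using B.V.smult_assoc1[OF cK e(1), of w] B.V.smult_assoc1[OF e(1) cK, of w] B.K.m_comm[OF cK e(1)] wV by simp
    then have "B.coeffs k (B.lmon \<one>\<^bsub>S\<^esub> 1 \<odot>\<^bsub>B.V\<^esub> (B.lmon c 0 \<odot>\<^bsub>B.V\<^esub> w)) = c \<odot>\<^bsub>vec_mod ?D S\<^esub> B.coeffs k (B.lmon \<one>\<^bsub>S\<^esub> 1 \<odot>\<^bsub>B.V\<^esub> w)"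
      using B.coeffs_smult[OF smult.hyps(1) ew, of k] by simp
    then show ?case
      using B.rowmul_smult[OF _ smult.hyps(1) cc[OF ew] E] smult.IH DS.smult_r_null[OF smult.hyps(1)] A.finite_cidx[of k] by simp
  qed
  show ?thesis
    unfolding U_def[symmetric]
  proof (intro split_lattice.intro B.row_lattices_axioms split_lattice_axioms.intro)
    show "B.K0_submodule U" by (rule UD(1))
    show "B.lmon \<one>\<^bsub>S\<^esub> (int k) \<odot>\<^bsub>B.V\<^esub> w \<in> U" if "w \<in> B.Lam" for w using deep[OF that] .
    show "?E \<in> ?D \<times> ?D \<rightarrow>\<^sub>E carrier S" by (rule E)
    show "mat_mult ?D S ?E ?E = ?E" using xmap_mat_mult[OF s.E s.E] s.E_idem by simp
    show "B.from_coeffs k (mat_row ?D ?E d) \<in> U" if "d \<in> ?D" for d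
      using bc(3)[OF s.E_row[OF that]] vmap_from_coeffs[of k "mat_row ?D E d"] xmap_mat_row[OF that] by simp
    show "\<exists>w'\<in>U. w = B.from_coeffs k (rowmul ?D S (B.coeffs k w) ?E) \<oplus>\<^bsub>B.V\<^esub> B.lmon \<one>\<^bsub>S\<^esub> 1 \<odot>\<^bsub>B.V\<^esub> w'" if "w \<in> U" for w
      using split2 sub that by blast
    show "rowmul ?D S (B.coeffs k (B.lmon \<one>\<^bsub>S\<^esub> 1 \<odot>\<^bsub>B.V\<^esub> w)) ?E = \<zero>\<^bsub>vec_mod ?D S\<^esub>" if "w \<in> U" for w
      using eps2 sub that by blast
  qed
qed

text \<open>Here the finite data found over R meet the localization: the matrix identities pass to
  S, where the image of \<open>f\<close> is a unit, and the \<epsilon>-adic approximation is carried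
  out there.\<close>

lemma rowlat_of_split:
  assumes W: "A.curve_submodule W" and split: "split_lattice R n W k E"
    and J: "J \<subseteq> A.cidx k" and Z: "Z \<in> A.cidx k \<times> A.cidx k \<rightarrow>\<^sub>E carrier R" and f: "f \<in> carrier R" "\<phi> f \<in> Units S"
    and MZ: "mat_mult (A.cidx k) R (A.split_rows (A.cidx k) E (A.cidx k) J) Z = scalar_mat (A.cidx k) R f"
    and ZM: "mat_mult (A.cidx k) R Z (A.split_rows (A.cidx k) E (A.cidx k) J) = scalar_mat (A.cidx k) R f"
    and char0: "\<And>t::nat. t > 0 \<Longrightarrow> add_pow S t \<one>\<^bsub>S\<^esub> \<in> Units S"
  shows "\<exists>g\<in>B.GL. B.lat_of (bc_ideal (A.idl_of W)) = B.rowlat g"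
proof -
  interpret s: split_lattice R n W k E by (rule split)
  let ?D = "A.cidx k"
  note M = A.split_rows_closed[OF s.E, of ?D J]
  interpret b: split_lattice_basis S n "B.lat_of (bc_ideal (A.idl_of W))" k "xmap (?D \<times> ?D) E" J "xmap (?D \<times> ?D) Z" "\<phi> f"
  proof (intro split_lattice_basis.intro split_lattice_map[OF W split] split_lattice_basis_axioms.intro)
    show "mat_mult ?D S (B.split_rows ?D (xmap (?D \<times> ?D) E) ?D J) (xmap (?D \<times> ?D) Z) = scalar_mat ?D S (\<phi> f)"
      using xmap_mat_mult[OF M Z] xmap_split_rows[OF s.E] MZ xmap_scalar[of ?D f] by simp
    show "mat_mult ?D S (xmap (?D \<times> ?D) Z) (B.split_rows ?D (xmap (?D \<times> ?D) E) ?D J) = scalar_mat ?D S (\<phi> f)"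
      using xmap_mat_mult[OF Z M] xmap_split_rows[OF s.E] ZM xmap_scalar[of ?D f] by simp
  qed (use J xmap_closed[OF Z] f in auto)
  show ?thesis by (rule b.lattice_is_rowlat[OF char0])
qed

end

section \<open>The isomorphism\<close>

context base_change
begin

text \<open>Two minimality arguments. The image under Y of the pulled back lattice is a Y-stable
  submodule containing the images of the shifted lattice. Conversely, the vectors that Y sends into
  the pullback of the shifted lattice form a Y-stable submodule containing the images of W.\<close>

lemma bc_y_coset:
  assumes W: "A.curve_submodule W"
  shows "bc_ideal (A.idl_of (A.shiftY ` W)) = B.cl (var_y S) <#\<^bsub>B.CR\<^esub> bc_ideal (A.idl_of W)"
proof -
  note D = A.curve_submoduleD[OF W]
  have WL: "W \<subseteq> A.Lam" using D(3) by blast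
  have sL: "A.shiftY ` W \<subseteq> A.Lam" using D(2,3) by blast
  define U where "U = B.lat_of (bc_ideal (A.idl_of W))"
  define Ur where "Ur = B.lat_of (bc_ideal (A.idl_of (A.shiftY ` W)))"
  note bc = bc_ideal_props[OF WL, folded U_def] and bcr = bc_ideal_props[OF sL, folded Ur_def]
  note UD = B.curve_submoduleD[OF bc(2)] and UrD = B.curve_submoduleD[OF bcr(2)]
  have UL: "U \<subseteq> B.Lam" using UD(3) by blast
  have lin: "B.shiftY (v \<oplus>\<^bsub>B.V\<^esub> w) = B.shiftY v \<oplus>\<^bsub>B.V\<^esub> B.shiftY w" if "v \<in> B.Lam" "w \<in> B.Lam" for v w
    using B.K.rowmul_add[OF B.Lam_VK[OF that(1)] B.Lam_VK[OF that(2)] B.Y_closed] .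
  have sm: "B.shiftY (a \<odot>\<^bsub>B.V\<^esub> w) = a \<odot>\<^bsub>B.V\<^esub> B.shiftY w" if "a \<in> carrier B.K0" "w \<in> B.Lam" for a w
    using B.K.rowmul_smult[OF _ B.K0_closed[OF that(1)] B.Lam_VK[OF that(2)] B.Y_closed] by simp
  have zero: "B.shiftY \<zero>\<^bsub>B.V\<^esub> = \<zero>\<^bsub>B.V\<^esub>"
  proof -
    have z: "\<zero>\<^bsub>B.V\<^esub> \<in> carrier B.V" "B.shiftY \<zero>\<^bsub>B.V\<^esub> \<in> carrier B.V"
      using B.V.M.zero_closed B.shiftY_closed[of "\<zero>\<^bsub>B.V\<^esub>"] by auto
    have k0: "\<zero>\<^bsub>B.K\<^esub> \<in> carrier B.K0" using B.K0.zero_closed by simp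
    show ?thesis using sm[OF k0 B.Lam_closed(1)] B.V.smult_l_null[OF z(1)] B.V.smult_l_null[OF z(2)] by simp
  qed
  have "B.curve_submodule (B.shiftY ` U)"
    unfolding B.curve_submodule_def B.K0_submodule_def
  proof (intro conjI ballI)
    show "B.shiftY ` U \<subseteq> B.Lam" using UD(2,3) by blast
    show "\<zero>\<^bsub>B.V\<^esub> \<in> B.shiftY ` U" using UD(4) zero by (metis image_eqI)
    show "v \<oplus>\<^bsub>B.V\<^esub> w \<in> B.shiftY ` U" if vw: "v \<in> B.shiftY ` U" "w \<in> B.shiftY ` U" for v w
    proof -
      obtain v' w' where v': "v' \<in> U" "v = B.shiftY v'" "w' \<in> U" "w = B.shiftY w'" using vw by blast
      then show ?thesis using lin[OF UD(3) UD(3), of v' w'] UD(5)[of v' w'] by (metis image_eqI)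
    qed
    show "a \<odot>\<^bsub>B.V\<^esub> w \<in> B.shiftY ` U" if aw: "a \<in> carrier B.K0" "w \<in> B.shiftY ` U" for a w
    proof -
      obtain w' where w': "w' \<in> U" "w = B.shiftY w'" using aw by blast
      then show ?thesis using sm[OF aw(1) UD(3), of w'] UD(6)[OF aw(1), of w'] by (metis image_eqI)
    qed
    show "B.shiftY w \<in> B.shiftY ` U" if "w \<in> B.shiftY ` U" for w using that UD(2) by blast
  qed
  moreover have "vmap w \<in> B.shiftY ` U" if w: "w \<in> A.shiftY ` W" for w
  proof -
    obtain w' where w': "w' \<in> W" "w = A.shiftY w'" using w by blast
    then show ?thesis using vmap_shiftY[OF A.Lam_VK[OF D(3)[OF w'(1)]]] bc(3)[OF w'(1)] by simp
  qed
  ultimately have 1: "Ur \<subseteq> B.shiftY ` U" by (rule bcr(4))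
  have "B.curve_submodule {u \<in> B.Lam. B.shiftY u \<in> Ur}"
    unfolding B.curve_submodule_def B.K0_submodule_def
  proof (intro conjI ballI)
    show "\<zero>\<^bsub>B.V\<^esub> \<in> {u \<in> B.Lam. B.shiftY u \<in> Ur}" using UrD(4) zero B.Lam_closed(1) by simp
    show "v \<oplus>\<^bsub>B.V\<^esub> w \<in> {u \<in> B.Lam. B.shiftY u \<in> Ur}" if "v \<in> {u \<in> B.Lam. B.shiftY u \<in> Ur}" "w \<in> {u \<in> B.Lam. B.shiftY u \<in> Ur}" for v w
      using that lin[of v w] B.Lam_closed(2)[of v w] UrD(5)[of "B.shiftY v" "B.shiftY w"] by simp
    show "a \<odot>\<^bsub>B.V\<^esub> w \<in> {u \<in> B.Lam. B.shiftY u \<in> Ur}" if "a \<in> carrier B.K0" "w \<in> {u \<in> B.Lam. B.shiftY u \<in> Ur}" for a w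
      using that sm[of a w] B.Lam_closed(3)[of a w] UrD(6)[of a "B.shiftY w"] by simp
    show "B.shiftY w \<in> {u \<in> B.Lam. B.shiftY u \<in> Ur}" if "w \<in> {u \<in> B.Lam. B.shiftY u \<in> Ur}" for w
      using that UrD(2)[of "B.shiftY w"] UrD(3)[of "B.shiftY w"] by simp
  qed auto
  moreover have "vmap w \<in> {u \<in> B.Lam. B.shiftY u \<in> Ur}" if w: "w \<in> W" for w
    using vmap_shiftY[OF A.Lam_VK[OF D(3)[OF w]]] bcr(3)[of "A.shiftY w"] w vmap_Lam[OF D(3)[OF w]] by simp
  ultimately have "U \<subseteq> {u \<in> B.Lam. B.shiftY u \<in> Ur}" by (rule bc(4))
  with 1 have "Ur = B.shiftY ` U" by blast
  then show ?thesis using bc(5) bcr(5) B.y_coset[OF UL] by simp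
qed

end

lemma springer_settingI:
  assumes "cring R" "m > 0" "n > 0" "r > 0"
  shows "springer_setting R n m r"
  using assms
  by (intro springer_setting.intro curve_setting.intro row_lattices.intro coeff_ring.intro
      curve_setting_axioms.intro springer_setting_axioms.intro)

lemma complex_algebra_cring: "complex_algebra R \<Longrightarrow> cring R"
  by (simp add: algebra_def)

text \<open>The scalar 1/t provides the inverse. This is what allows the rank of a lattice to be
  read off from a trace.\<close>

lemma complex_algebra_char0:
  assumes S: "complex_algebra S" and t: "(t::nat) > 0"
  shows "add_pow S t \<one>\<^bsub>S\<^esub> \<in> Units S"
proof -
  interpret S: algebra "ring_of_type_algebra :: complex ring" S by (rule S)
  have ops: "carrier (ring_of_type_algebra :: complex ring) = UNIV"
    "a \<otimes>\<^bsub>ring_of_type_algebra\<^esub> b = a * b" "a \<oplus>\<^bsub>ring_of_type_algebra\<^esub> b = a + b"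
    "\<one>\<^bsub>ring_of_type_algebra\<^esub> = (1 :: complex)" for a b :: complex
    by (simp_all add: ring_of_type_algebra_def)
  have one: "\<one>\<^bsub>S\<^esub> \<in> carrier S" by simp
  have cl: "c \<odot>\<^bsub>S\<^esub> \<one>\<^bsub>S\<^esub> \<in> carrier S" for c using S.smult_closed[of c "\<one>\<^bsub>S\<^esub>"] by (simp add: ops)
  have mult: "(a \<odot>\<^bsub>S\<^esub> \<one>\<^bsub>S\<^esub>) \<otimes>\<^bsub>S\<^esub> (b \<odot>\<^bsub>S\<^esub> \<one>\<^bsub>S\<^esub>) = (a * b) \<odot>\<^bsub>S\<^esub> \<one>\<^bsub>S\<^esub>" for a b :: complex
    using S.smult_assoc2[of a "\<one>\<^bsub>S\<^esub>" "b \<odot>\<^bsub>S\<^esub> \<one>\<^bsub>S\<^esub>"] S.smult_assoc1[of a b "\<one>\<^bsub>S\<^esub>"] cl by (simp add: ops)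
  have pow: "add_pow S s \<one>\<^bsub>S\<^esub> = of_nat s \<odot>\<^bsub>S\<^esub> \<one>\<^bsub>S\<^esub>" if "s > 0" for s :: nat
    using that
  proof (induction s)
    case (Suc s)
    show ?case
    proof (cases "s = 0")
      case True
      then show ?thesis using S.smult_one[OF one] by (simp add: ops add_pow_def)
    next
      case False
      then have "add_pow S (Suc s) \<one>\<^bsub>S\<^esub> = of_nat s \<odot>\<^bsub>S\<^esub> \<one>\<^bsub>S\<^esub> \<oplus>\<^bsub>S\<^esub> 1 \<odot>\<^bsub>S\<^esub> \<one>\<^bsub>S\<^esub>"
        using Suc.IH S.smult_one[OF one] by (simp add: ops add_pow_def)
      also have "\<dots> = of_nat (Suc s) \<odot>\<^bsub>S\<^esub> \<one>\<^bsub>S\<^esub>"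
        using S.smult_l_distr[of "of_nat s" 1 "\<one>\<^bsub>S\<^esub>"] by (simp add: ops add.commute)
      finally show ?thesis .
    qed
  qed simp
  have "(of_nat t \<odot>\<^bsub>S\<^esub> \<one>\<^bsub>S\<^esub>) \<otimes>\<^bsub>S\<^esub> ((1 / of_nat t) \<odot>\<^bsub>S\<^esub> \<one>\<^bsub>S\<^esub>) = \<one>\<^bsub>S\<^esub>"
    "((1 / of_nat t) \<odot>\<^bsub>S\<^esub> \<one>\<^bsub>S\<^esub>) \<otimes>\<^bsub>S\<^esub> (of_nat t \<odot>\<^bsub>S\<^esub> \<one>\<^bsub>S\<^esub>) = \<one>\<^bsub>S\<^esub>"
    using S.smult_one[OF one] t by (simp_all add: mult ops)
  then show ?thesis unfolding pow[OF t] Units_def using cl by blast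
qed

text \<open>A representative of the class is chosen arbitrarily; \<open>chain_some\<close> shows
  that the choice does not matter.\<close>

definition spr_to_cphilb ::
    "nat \<Rightarrow> nat \<Rightarrow> nat \<Rightarrow> (complex, 'u) module \<Rightarrow> (nat \<Rightarrow> nat \<times> nat \<Rightarrow> int \<Rightarrow> 'u) set \<Rightarrow> nat \<Rightarrow> (nat \<times> nat \<Rightarrow> 'u) set set" where
  "spr_to_cphilb m n r R c = springer_setting.chain R n m r (SOME g. g \<in> c)"

lemma (in springer_setting) chain_some:
  assumes "g \<in> carrier GG"
  shows "chain (SOME h. h \<in> gr_class n r R g) = chain g"
proof -
  have "(SOME h. h \<in> gr_class n r R g) \<in> gr_class n r R g"
    by (rule someI[of "\<lambda>h. h \<in> gr_class n r R g", OF gr_class_self[OF assms]])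
  from gr_class_memD(2)[OF assms this] show ?thesis by (rule chain_cong)
qed

lemma base_changeI:
  assumes "complex_algebra R" "complex_algebra S" "\<phi> \<in> algebra_hom R S" "m > 0" "n > 0" "r > 0"
  shows "base_change R S n m r \<phi>"
  using assms springer_settingI[OF complex_algebra_cring]
  by (intro base_change.intro base_change_axioms.intro) (auto simp: algebra_hom_def)

theorem proposition8p9:
  fixes m n r :: nat
  assumes "m > 0" and "n > 0" and "coprime m n" and "r > 0"
  shows "isomorphic_spaces
           (Spr m n r :: ('u, (nat \<Rightarrow> nat \<times> nat \<Rightarrow> int \<Rightarrow> 'u) set) points_functor)
           (CPHilb m n r :: ('u, nat \<Rightarrow> (nat \<times> nat \<Rightarrow> 'u) set set) points_functor)"
  unfolding isomorphic_spaces_def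
proof (intro exI conjI)
  note pos = assms(1,2,4)
  let ?F = "Spr m n r :: ('u, (nat \<Rightarrow> nat \<times> nat \<Rightarrow> int \<Rightarrow> 'u) set) points_functor"
  let ?G = "CPHilb m n r :: ('u, nat \<Rightarrow> (nat \<times> nat \<Rightarrow> 'u) set set) points_functor"
  let ?Phi = "spr_to_cphilb m n r :: (complex, 'u) module \<Rightarrow> _"
  show "natural_transformation ?F ?G ?Phi"
    unfolding natural_transformation_def
  proof (intro conjI allI impI ballI)
    fix R :: "(complex, 'u) module" assume R: "complex_algebra R"
    interpret springer_setting R n m r by (rule springer_settingI[OF complex_algebra_cring[OF R] pos])
    show "?Phi R \<in> pts ?F R \<rightarrow> pts ?G R"
    proof
      fix c assume "c \<in> pts ?F R"
      then obtain g where g: "g \<in> carrier GG" "integral_at g" "c = gr_class n r R g"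
        by (auto simp: Spr_def spr_points_eq)
      then show "?Phi R c \<in> pts ?G R"
        using chain_point[OF g(1,2)] chain_some[OF g(1)] by (simp add: CPHilb_def spr_to_cphilb_def)
    qed
  next
    fix R S :: "(complex, 'u) module" and \<phi> c
    assume H: "complex_algebra R \<and> complex_algebra S \<and> \<phi> \<in> algebra_hom R S" and c: "c \<in> pts ?F R"
    interpret base_change R S n m r \<phi> using H pos by (intro base_changeI) auto
    obtain g where g: "g \<in> carrier A.GG" "A.integral_at g" "c = gr_class n r R g"
      using c by (auto simp: Spr_def A.spr_points_eq)
    show "?Phi S (pts_map ?F R S \<phi> c) = pts_map ?G R S \<phi> (?Phi R c)"
      using gr_map_class[OF g(1,2)] chain_gmap[OF g(1,2)] A.chain_some[OF g(1)]
        B.chain_some[OF gmap_point(1)[OF g(1,2)]] g(3)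
      by (simp add: Spr_def CPHilb_def spr_to_cphilb_def)
  qed
  show "locally_injective ?F ?Phi"
    unfolding locally_injective_def
  proof (intro allI impI ballI)
    fix R :: "(complex, 'u) module" and x y
    assume R: "complex_algebra R" and xy: "x \<in> pts ?F R" "y \<in> pts ?F R" "?Phi R x = ?Phi R y"
    interpret springer_setting R n m r by (rule springer_settingI[OF complex_algebra_cring[OF R] pos])
    obtain g where g: "g \<in> carrier GG" "integral_at g" "x = gr_class n r R g"
      using xy(1) by (auto simp: Spr_def spr_points_eq)
    obtain g' where g': "g' \<in> carrier GG" "integral_at g'" "y = gr_class n r R g'"
      using xy(2) by (auto simp: Spr_def spr_points_eq)
    have "chain g = chain g'"
      using xy(3) chain_some[OF g(1)] chain_some[OF g'(1)] g(3) g'(3) by (simp add: spr_to_cphilb_def)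
    then have "x = y" using chain_inj[OF g(1,2) g'(1,2)] g(3) g'(3) by simp
    \<comment> \<open>The map is injective on points before any localization, so the trivial cover
      by \<open>\<one>\<close> is enough.\<close>
    then show "zariski_locally R (\<lambda>S \<phi>. pts_map ?F R S \<phi> x = pts_map ?F R S \<phi> y)"
      unfolding zariski_locally_def using genideal_one by (intro exI[of _ "{\<one>\<^bsub>R\<^esub>}"]) simp
  qed
  show "locally_surjective ?F ?G ?Phi"
    unfolding locally_surjective_def
  proof (intro allI impI ballI)
    fix R :: "(complex, 'u) module" and J
    assume R: "complex_algebra R" and "J \<in> pts ?G R"
    then have J: "J \<in> cphilb_points m n r R" by (simp add: CPHilb_def)
    interpret A: springer_setting R n m r by (rule springer_settingI[OF complex_algebra_cring[OF R] pos])
    have fc: "finite_codim_ideal m n R (J i)" if "i \<le> r" for i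
      using J that unfolding cphilb_points_def by blast
    have Jsub: "J (Suc i) \<subseteq> J i" if "i < r" for i using J that unfolding cphilb_points_def by blast
    have Jr: "J r = A.cl (var_y R) <#\<^bsub>A.CR\<^esub> J 0" using J unfolding cphilb_points_def by blast
    have JC: "J i \<subseteq> carrier A.CR" if "i \<le> r" for i
      by (rule additive_subgroup.a_subset[OF ideal.axioms(1)]) (use fc[OF that] in \<open>simp add: finite_codim_ideal_def\<close>)
    have "\<exists>k E. split_lattice R n (A.lat_of (J i)) k E" if i: "i \<le> r" for i
    proof -
      note D = A.finite_codim_idealD[OF fc[OF i]]
      obtain P where P: "A.retraction (A.lat_of (J i)) P" using D(2) by blast
      obtain k where k: "\<forall>w\<in>A.Lam. A.lmon \<one>\<^bsub>R\<^esub> (int k) \<odot>\<^bsub>A.V\<^esub> w \<in> A.lat_of (J i)" using D(3) by blast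
      have "\<exists>E. split_lattice R n (A.lat_of (J i)) k E"
        by (rule A.split_lattice_exists[OF A.curve_submoduleD(1)[OF D(1)] P]) (use k in blast)
      then show ?thesis by blast
    qed
    then obtain k E where split: "\<And>i. i \<le> r \<Longrightarrow> split_lattice R n (A.lat_of (J i)) (k i) (E i)" by metis
    \<comment> \<open>The element f is a multiple of a scalar f0 that comes with a selection of rows
      for the i-th ideal. The cofactor c makes the property stable under multiplication, so that a
      product serves several ideals at once; where f is inverted, f0 is a unit as well.\<close>
    define good where "good i f \<longleftrightarrow> (\<exists>I Z f0 c. I \<subseteq> A.cidx (k i) \<and> Z \<in> A.cidx (k i) \<times> A.cidx (k i) \<rightarrow>\<^sub>E carrier R \<and>
      f0 \<in> carrier R \<and> c \<in> carrier R \<and> f = f0 \<otimes>\<^bsub>R\<^esub> c \<and>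
      mat_mult (A.cidx (k i)) R (A.split_rows (A.cidx (k i)) (E i) (A.cidx (k i)) I) Z = scalar_mat (A.cidx (k i)) R f0 \<and>
      mat_mult (A.cidx (k i)) R Z (A.split_rows (A.cidx (k i)) (E i) (A.cidx (k i)) I) = scalar_mat (A.cidx (k i)) R f0)" for i f
    have good_mult: "good i (f \<otimes>\<^bsub>R\<^esub> g)" if gf: "good i f" "g \<in> carrier R" for i f g
    proof -
      obtain I Z f0 c where *: "I \<subseteq> A.cidx (k i)" "Z \<in> A.cidx (k i) \<times> A.cidx (k i) \<rightarrow>\<^sub>E carrier R"
        "f0 \<in> carrier R" "c \<in> carrier R" "f = f0 \<otimes>\<^bsub>R\<^esub> c"
        "mat_mult (A.cidx (k i)) R (A.split_rows (A.cidx (k i)) (E i) (A.cidx (k i)) I) Z = scalar_mat (A.cidx (k i)) R f0"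
        "mat_mult (A.cidx (k i)) R Z (A.split_rows (A.cidx (k i)) (E i) (A.cidx (k i)) I) = scalar_mat (A.cidx (k i)) R f0"
        using gf(1) unfolding good_def by (elim exE conjE)
      have "f \<otimes>\<^bsub>R\<^esub> g = f0 \<otimes>\<^bsub>R\<^esub> (c \<otimes>\<^bsub>R\<^esub> g)" using * gf(2) by (simp add: A.m_assoc)
      then show ?thesis unfolding good_def using * gf(2) A.m_closed by blast
    qed
    have good_prime: "\<exists>f\<in>carrier R - p. good i f" if p: "primeideal p R" and i: "i \<le> r" for p i
    proof -
      interpret s: split_lattice R n "A.lat_of (J i)" "k i" "E i" by (rule split[OF i])
      obtain I Z f where *: "I \<subseteq> A.cidx (k i)" "Z \<in> A.cidx (k i) \<times> A.cidx (k i) \<rightarrow>\<^sub>E carrier R" "f \<in> carrier R - p"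
        "mat_mult (A.cidx (k i)) R (A.split_rows (A.cidx (k i)) (E i) (A.cidx (k i)) I) Z = scalar_mat (A.cidx (k i)) R f"
        "mat_mult (A.cidx (k i)) R Z (A.split_rows (A.cidx (k i)) (E i) (A.cidx (k i)) I) = scalar_mat (A.cidx (k i)) R f"
        using A.split_rows_invertible[OF A.finite_cidx s.E p] by metis
      have "good i f" unfolding good_def
        by (rule exI[of _ I], rule exI[of _ Z], rule exI[of _ f], rule exI[of _ "\<one>\<^bsub>R\<^esub>"]) (use * in auto)
      then show ?thesis using *(3) by blast
    qed
    \<comment> \<open>Only i < r is asked for, as J_r is recovered from J_0 by multiplication with
      y.\<close>
    define T where "T = {f \<in> carrier R. \<forall>i<r. good i f}"
    have TR: "T \<subseteq> carrier R" by (auto simp: T_def)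
    \<comment> \<open>Otherwise a maximal ideal contains \<open>T\<close>. Being prime, it misses a
      good element for each of the ideals, hence also their product; but this product belongs to
      \<open>T\<close>.\<close>
    have one: "\<one>\<^bsub>R\<^esub> \<in> Idl\<^bsub>R\<^esub> T"
    proof (rule ccontr)
      assume "\<one>\<^bsub>R\<^esub> \<notin> Idl\<^bsub>R\<^esub> T"
      then obtain p where p: "maximalideal p R" "Idl\<^bsub>R\<^esub> T \<subseteq> p"
        using A.exists_maximal_ideal[OF A.genideal_ideal[OF TR]] by metis
      have pp: "primeideal p R" by (rule A.maximalideal_prime[OF p(1)])
      interpret p: primeideal p R by (rule pp)
      have "\<exists>f\<in>carrier R - p. \<forall>i<t. good i f" if "t \<le> r" for t
        using that
      proof (induction t)
        case 0
        have "\<one>\<^bsub>R\<^esub> \<notin> p" using p.I_notcarr p.one_imp_carrier by blast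
        then show ?case by auto
      next
        case (Suc t)
        then obtain f where f: "f \<in> carrier R - p" "\<forall>i<t. good i f" by auto
        obtain g where g: "g \<in> carrier R - p" "good t g" using good_prime[OF pp, of t] Suc.prems by auto
        have "f \<otimes>\<^bsub>R\<^esub> g \<in> carrier R - p" using f g p.I_prime by blast
        moreover have "good i (f \<otimes>\<^bsub>R\<^esub> g)" if "i < Suc t" for i
        proof (cases "i < t")
          case True
          then show ?thesis using good_mult[of i f g] f g by auto
        next
          case False
          then have "i = t" using that by simp
          then show ?thesis using good_mult[of t g f] f g A.m_comm[of f g] by auto
        qed
        ultimately show ?case by blast
      qed
      then obtain f where f: "f \<in> carrier R - p" "\<forall>i<r. good i f" by blast
      then have "f \<in> T" by (simp add: T_def)
      then have "f \<in> p" using p(2) A.genideal_self[OF TR] by blast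
      then show False using f(1) by simp
    qed
    obtain F where F: "finite F" "F \<subseteq> T" "\<one>\<^bsub>R\<^esub> \<in> Idl\<^bsub>R\<^esub> F" using A.finite_subset_genideal[OF TR one] by metis
    have FR: "F \<subseteq> carrier R" using F(2) TR by blast
    have IdlF: "Idl\<^bsub>R\<^esub> F = carrier R" using ideal.one_imp_carrier[OF A.genideal_ideal[OF FR] F(3)] .
    show "zariski_locally R (\<lambda>S \<phi>. pts_map ?G R S \<phi> J \<in> ?Phi S ` pts ?F S)"
      unfolding zariski_locally_def
    proof (intro exI[of _ F] conjI ballI allI impI)
      fix f S \<phi> assume f: "f \<in> F" and loc: "is_localization R f S \<phi>"
      have S: "complex_algebra S" and hom: "\<phi> \<in> algebra_hom R S" and unit: "\<phi> f \<in> Units S"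
        using loc unfolding is_localization_def by blast+
      interpret base_change R S n m r \<phi> by (rule base_changeI[OF R S hom pos])
      let ?J = "cphilb_map m n r S \<phi> J"
      have bcJ: "?J i = bc_ideal (J i)" if "i \<le> r" for i using that by (simp add: cphilb_map_def bc_ideal_def)
      have lat: "A.curve_submodule (A.lat_of (J i))" "A.idl_of (A.lat_of (J i)) = J i" if "i \<le> r" for i
        using A.finite_codim_idealD(1)[OF fc[OF that]] A.idl_of_lat_of[OF JC[OF that]] by auto
      have latL: "A.lat_of (J i) \<subseteq> A.Lam" for i by (rule A.lat_of_Lam)
      have "\<exists>g\<in>B.GL. B.lat_of (?J i) = B.rowlat g" if i: "i < r" for i
      proof -
        have "good i f" using f F(2) i unfolding T_def by blast
        then obtain I Z f0 c where *: "I \<subseteq> A.cidx (k i)" "Z \<in> A.cidx (k i) \<times> A.cidx (k i) \<rightarrow>\<^sub>E carrier R"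
          "f0 \<in> carrier R" "c \<in> carrier R" "f = f0 \<otimes>\<^bsub>R\<^esub> c"
          "mat_mult (A.cidx (k i)) R (A.split_rows (A.cidx (k i)) (E i) (A.cidx (k i)) I) Z = scalar_mat (A.cidx (k i)) R f0"
          "mat_mult (A.cidx (k i)) R Z (A.split_rows (A.cidx (k i)) (E i) (A.cidx (k i)) I) = scalar_mat (A.cidx (k i)) R f0"
          unfolding good_def by (elim exE conjE)
        have "\<phi> f0 \<otimes>\<^bsub>S\<^esub> \<phi> c \<in> Units S" using unit * by simp
        then have u: "\<phi> f0 \<in> Units S" using B.unit_factor[of "\<phi> f0" "\<phi> c"] * by simp
        have "\<exists>g\<in>B.GL. B.lat_of (bc_ideal (A.idl_of (A.lat_of (J i)))) = B.rowlat g"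
          using rowlat_of_split[OF lat(1) split *(1,2,3) u *(6,7) complex_algebra_char0[OF S]] i by simp
        then show ?thesis using lat(2)[of i] bcJ[of i] i by simp
      qed
      then obtain h where h: "\<And>i. i < r \<Longrightarrow> h i \<in> B.GL" "\<And>i. i < r \<Longrightarrow> B.lat_of (?J i) = B.rowlat (h i)" by metis
      have "\<exists>g\<in>carrier B.GG. B.integral_at g \<and> B.chain g = ?J"
      proof (rule B.chain_surj[OF _ _ _ _ h])
        show "?J \<in> extensional {..r}" by (simp add: cphilb_map_def)
        show "ideal (?J i) B.CR" if "i \<le> r" for i
          using bc_ideal_props(1)[OF latL, of i] lat(2)[OF that] bcJ[OF that] by simp
        show "?J (Suc i) \<subseteq> ?J i" if i: "i < r" for i
        proof -
          have "curve_ring_map m n S \<phi> ` J i \<subseteq> carrier B.CR"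
            using bc_image[of "A.lat_of (J i)"] lat(2)[of i] i B.cl_ops(1) PS_map by auto
          then have "bc_ideal (J (Suc i)) \<subseteq> bc_ideal (J i)"
            unfolding bc_ideal_def using Jsub[OF i] by (intro B.CR.subset_Idl_subset image_mono)
          then show ?thesis using bcJ[of "Suc i"] bcJ[of i] i by simp
        qed
        have "J r = A.idl_of (A.shiftY ` A.lat_of (J 0))"
          using Jr A.y_coset[OF latL, of 0] lat(2)[of 0] by simp
        then show "?J r = B.cl (var_y S) <#\<^bsub>B.CR\<^esub> ?J 0"
          using bc_y_coset[OF lat(1), of 0] lat(2)[of 0] bcJ[of r] bcJ[of 0] by simp
      qed
      then obtain g where g: "g \<in> carrier B.GG" "B.integral_at g" "B.chain g = ?J" by blast
      have "gr_class n r S g \<in> pts ?F S" using g(1,2) by (auto simp: Spr_def B.spr_points_eq)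
      moreover have "?Phi S (gr_class n r S g) = ?J"
        using B.chain_some[OF g(1)] g(3) by (simp add: spr_to_cphilb_def)
      ultimately have "?J \<in> ?Phi S ` pts ?F S" by (metis image_eqI)
      then show "pts_map ?G R S \<phi> J \<in> ?Phi S ` pts ?F S" by (simp add: CPHilb_def)
    qed (use F(1) FR IdlF in auto)
  qed
qed

end
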